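(* Let $E$ be a UMD Banach space and let $A$ be a sectorial operator in $E$ having bounded imaginary powers with power angle $\phi<\pi$. Then $A$ is $T$-sectorial of angle $\theta$ for any $\theta\in[0,\pi-\phi)$.
   Context: Banach spaces are complex; $\mathcal{D}(\cdot)$ denotes the domain and $\rho(\cdot)$ the resolvent set of an operator. UMD means unconditionality of martingale differences (equivalently, the Hilbert transform is bounded on $L^p(\mathbb{R};E)$ for $1<p<\infty$). Sectorial operators. For $\theta\in[0,\pi)$ let $\Lambda_\theta=\{z\in\mathbb{C}\mid |\arg z|\le\theta\}\cup\{0\}$. For $K\ge 1$, $\mathcal{P}_K(\theta)$ is the class of closed densely defined linear operators $A$ in $E$ such that $\Lambda_\theta\subset\rho(-A)$ and $(1+|z|)\|(A+z)^{-1}\|\le K$ for all $z\in\Lambda_\theta$. Set $\mathcal{P}(\theta)=\bigcup_{K\ge1}\mathcal{P}_K(\theta)$; its elements are called sectorial operators of angle $\theta$. A sectorial operator is an element of $\mathcal{P}(\theta)$ for some $\theta\in[0,\pi)$. Bounded imaginary powers. For a sectorial operator $A$ and $t\in\mathbb{R}$, the imaginary power $A^{it}$ is defined as the closure of the operator $\frac{\sin(i\pi t)}{i\pi t}\int_0^\infty\lambda^{it}(A+\lambda)^{-2}A\,d\lambda$ on $\mathcal{D}(A)$ (with $A^0=I$). The operator $A$ has bounded imaginary powers if there exist $\varepsilon,\delta>0$ such that $A^{it}\in\mathcal{L}(E)$ and $\|A^{it}\|\le\delta$ for all $t\in[-\varepsilon,\varepsilon]$. In that case $A^{it}\in\mathcal{L}(E)$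 for all $t\in\mathbb{R}$ and there are $M\ge1$, $\phi\ge0$ with $\|A^{it}\|\le Me^{\phi|t|}$ for all $t\in\mathbb{R}$; one then says that $A$ has bounded imaginary powers with power angle $\phi$. $T$-sectorial operators. For $\theta\in[0,\pi)$, $\mathcal{T}(\theta)$ is the class of those $A\in\mathcal{P}(\theta)$ with the following property: for some fixed $p\in(1,\infty)$ and for every $\psi\in[-\theta,\theta]$ there is a constant $C_A^{p,\psi}>0$ (depending only on $A,p,\psi$) such that for every $n\in\mathbb{N}$, $r\in[\frac1e,1]$ and $x_0,\dots,x_n\in E$ there exist $a_0,\dots,a_n\in L^\infty(0,2\pi)$ with $\|a_k\|_\infty\le1$ (allowed to depend on $A,n,\psi,r,x_0,\dots,x_n$) satisfying $$\Big\|\sum_{k=0}^n e^{ikt}(I+re^{-k+i\psi}A)^{-1}x_k\Big\|_{L^p(0,2\pi;E)}\le C_A^{p,\psi}\Big\|\sum_{k=0}^n a_k(t)x_k\Big\|_{L^p(0,2\pi;E)},$$ the norms being taken in the variable $t$. The elements of $\mathcal{T}(\theta)$ are called $T$-sectorial operators of angle $\theta$. *)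

theory Defs
  imports "HOL-Probability.Probability"
begin

section \<open>Complex Banach spaces\<close>

class complex_banach = banach +
  fixes scaleC :: "complex \<Rightarrow> 'a \<Rightarrow> 'a" (infixr "*\<^sub>C" 75)
  assumes scaleC_add_right: "c *\<^sub>C (x + y) = c *\<^sub>C x + c *\<^sub>C y"
    and scaleC_add_left: "(c + d) *\<^sub>C x = c *\<^sub>C x + d *\<^sub>C x"
    and scaleC_scaleC: "c *\<^sub>C (d *\<^sub>C x) = (c * d) *\<^sub>C x"
    and scaleC_of_real: "complex_of_real r *\<^sub>C x = r *\<^sub>R x"
    and norm_scaleC: "norm (c *\<^sub>C x) = cmod c * norm x"

instantiation complex :: complex_banach
begin

definition scaleC_complex :: "complex \<Rightarrow> complex \<Rightarrow> complex" where
  "scaleC_complex c x = c * x"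

instance
  by standard (simp_all add: scaleC_complex_def algebra_simps norm_mult scaleR_conv_of_real)

end

section \<open>The UMD property\<close>

text \<open>
  The library's Bochner integral is restricted to second countable (separable) value spaces.
  The following is the same definition (see \<open>has_bochner_integral\<close>) for an arbitrary Banach
  space; the approximating simple functions force \<open>f\<close> to be strongly measurable.
\<close>

definition has_Bochner_integral :: "'w measure \<Rightarrow> ('w \<Rightarrow> 'a::banach) \<Rightarrow> 'a \<Rightarrow> bool" where
  "has_Bochner_integral M f I \<longleftrightarrow>
     f \<in> borel_measurable M \<and>
     (\<exists>s. (\<forall>i. Bochner_Integration.simple_bochner_integrable M (s i)) \<and>
          (\<lambda>i. \<integral>\<^sup>+w. ennreal (norm (f w - s i w)) \<partial>M) \<longlonglongrightarrow> 0 \<and>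
          (\<lambda>i. Bochner_Integration.simple_bochner_integral M (s i)) \<longlonglongrightarrow> I)"

definition Lp_norm :: "'w measure \<Rightarrow> real \<Rightarrow> ('w \<Rightarrow> 'a::real_normed_vector) \<Rightarrow> real" where
  "Lp_norm M p f = (\<integral>w. norm (f w) powr p \<partial>M) powr (1 / p)"

text \<open>
  \<open>Lp_martingale M p N F f\<close>: on the probability space \<open>M\<close>, the functions \<open>f 0, \<dots>, f N\<close> form a
  martingale in \<open>L\<^sup>p(M; E)\<close> with respect to the filtration \<open>F 0 \<subseteq> \<dots> \<subseteq> F N\<close>. Adaptedness is
  expressed by Bochner integrability over the restriction of \<open>M\<close> to \<open>F n\<close> (on a probability
  space \<open>L\<^sup>p\<close> is contained in \<open>L\<^sup>1\<close>), and \<open>E(f (n+1) | F n) = f n\<close> by the defining property of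
  the conditional expectation.
\<close>

definition Lp_martingale ::
    "'w measure \<Rightarrow> real \<Rightarrow> nat \<Rightarrow> (nat \<Rightarrow> 'w measure) \<Rightarrow> (nat \<Rightarrow> 'w \<Rightarrow> 'a::banach) \<Rightarrow> bool" where
  "Lp_martingale M p N F f \<longleftrightarrow>
     prob_space M \<and>
     (\<forall>n\<le>N. subalgebra M (F n)) \<and>
     (\<forall>n<N. sets (F n) \<subseteq> sets (F (Suc n))) \<and>
     (\<forall>n\<le>N. (\<exists>I. has_Bochner_integral (restr_to_subalg M (F n)) (f n) I) \<and>
             integrable M (\<lambda>w. norm (f n w) powr p)) \<and>
     (\<forall>n<N. \<forall>B\<in>sets (F n).
        has_Bochner_integral M (\<lambda>w. indicator B w *\<^sub>R (f (Suc n) w - f n w)) 0)"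

text \<open>
  A type cannot be quantified over inside a definition, so the probability spaces are carried by
  sets of real numbers. This is no restriction: the inequality depends only on the joint law of
  \<open>f 0, \<dots>, f N\<close>, and these functions are almost surely separably valued, so every such law is
  realised on the unit interval.
\<close>

definition UMD :: "'a::banach itself \<Rightarrow> bool" where
  "UMD _ \<longleftrightarrow>
     (\<forall>p>1. \<exists>C\<ge>0. \<forall>(M :: real measure) N F (f :: nat \<Rightarrow> real \<Rightarrow> 'a) (\<epsilon> :: nat \<Rightarrow> real).
        Lp_martingale M p N F f \<longrightarrow> (\<forall>n. \<epsilon> n \<in> {-1, 1}) \<longrightarrow>
        Lp_norm M p (\<lambda>w. \<Sum>n<N. \<epsilon> n *\<^sub>R (f (Suc n) w - f n w))
          \<le> C * Lp_norm M p (\<lambda>w. \<Sum>n<N. f (Suc n) w - f n w))"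

section \<open>Unbounded operators\<close>

text \<open>An operator in \<open>E\<close> is represented by its graph, its domain being \<open>Domain A\<close>.\<close>

type_synonym 'a operator = "('a \<times> 'a) set"

definition linear_operator :: "'a::complex_banach operator \<Rightarrow> bool" where
  "linear_operator A \<longleftrightarrow>
     single_valued A \<and> (0, 0) \<in> A \<and>
     (\<forall>x y u v. (x, u) \<in> A \<longrightarrow> (y, v) \<in> A \<longrightarrow> (x + y, u + v) \<in> A) \<and>
     (\<forall>c x u. (x, u) \<in> A \<longrightarrow> (c *\<^sub>C x, c *\<^sub>C u) \<in> A)"

definition op_app :: "'a operator \<Rightarrow> 'a \<Rightarrow> 'a" where
  "op_app A x = (THE y. (x, y) \<in> A)"

definition op_scale :: "complex \<Rightarrow> 'a::complex_banach operator \<Rightarrow> 'a operator" where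
  "op_scale c A = {(x, c *\<^sub>C y) |x y. (x, y) \<in> A}"

text \<open>\<open>op_shift A z\<close> is \<open>A + z I\<close>, with domain \<open>Domain A\<close>.\<close>

definition op_shift :: "'a::complex_banach operator \<Rightarrow> complex \<Rightarrow> 'a operator" where
  "op_shift A z = {(x, y + z *\<^sub>C x) |x y. (x, y) \<in> A}"

text \<open>Membership in \<open>\<L>(E)\<close>; in particular the domain is the whole space.\<close>

definition bounded_operator :: "'a::complex_banach operator \<Rightarrow> bool" where
  "bounded_operator T \<longleftrightarrow>
     (\<exists>f. bounded_linear f \<and> (\<forall>c x. f (c *\<^sub>C x) = c *\<^sub>C f x) \<and> T = {(x, f x) |x. True})"

text \<open>Only meaningful on \<open>\<L>(E)\<close>.\<close>

definition op_norm :: "'a::complex_banach operator \<Rightarrow> real" where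
  "op_norm T = onorm (op_app T)"

definition resolvent_set :: "'a::complex_banach operator \<Rightarrow> complex set" where
  "resolvent_set A = {z. bounded_operator ((op_shift A (- z))\<inverse>)}"

section \<open>Sectorial operators\<close>

definition sector :: "real \<Rightarrow> complex set" where
  "sector \<theta> = {z. \<bar>Arg z\<bar> \<le> \<theta>} \<union> {0}"

definition sectorial_class_const :: "real \<Rightarrow> real \<Rightarrow> 'a::complex_banach operator set" where
  "sectorial_class_const K \<theta> =
     {A. linear_operator A \<and> closed A \<and> closure (Domain A) = UNIV \<and>
         sector \<theta> \<subseteq> resolvent_set (op_scale (- 1) A) \<and>
         (\<forall>z\<in>sector \<theta>. (1 + cmod z) * op_norm ((op_shift A z)\<inverse>) \<le> K)}"

definition sectorial_class :: "real \<Rightarrow> 'a::complex_banach operator set" where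
  "sectorial_class \<theta> = (\<Union>K\<in>{1..}. sectorial_class_const K \<theta>)"

definition sectorial :: "'a::complex_banach operator \<Rightarrow> bool" where
  "sectorial A \<longleftrightarrow> (\<exists>\<theta>\<in>{0..<pi}. A \<in> sectorial_class \<theta>)"

section \<open>Bounded imaginary powers\<close>

text \<open>
  \<open>imag_power A t\<close> is \<open>A\<^sup>i\<^sup>t\<close>; the closure of an operator is the closure of its graph. The integral
  is the Henstock-Kurzweil one; for sectorial \<open>A\<close> the integrand is continuous and its norm is
  dominated by a multiple of \<open>(1 + l) ^ (-2)\<close>.
\<close>

definition imag_power :: "'a::complex_banach operator \<Rightarrow> real \<Rightarrow> 'a operator" where
  "imag_power A t =
     (if t = 0 then Id
      else closure
        {(x, (sin (\<i> * pi * t) / (\<i> * pi * t)) *\<^sub>C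
             integral {0<..} (\<lambda>l::real. (of_real l powr (\<i> * t)) *\<^sub>C
               (op_app ((op_shift A (of_real l))\<inverse>) ^^ 2) (op_app A x))) |x. x \<in> Domain A})"

definition bounded_imaginary_powers :: "'a::complex_banach operator \<Rightarrow> bool" where
  "bounded_imaginary_powers A \<longleftrightarrow>
     (\<exists>\<epsilon>>0. \<exists>\<delta>>0. \<forall>t\<in>{-\<epsilon>..\<epsilon>}. bounded_operator (imag_power A t) \<and> op_norm (imag_power A t) \<le> \<delta>)"

definition bounded_imaginary_powers_angle :: "'a::complex_banach operator \<Rightarrow> real \<Rightarrow> bool" where
  "bounded_imaginary_powers_angle A \<phi> \<longleftrightarrow>
     bounded_imaginary_powers A \<and> \<phi> \<ge> 0 \<and>
     (\<exists>M\<ge>1. \<forall>t. bounded_operator (imag_power A t) \<and>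
                 op_norm (imag_power A t) \<le> M * exp (\<phi> * \<bar>t\<bar>))"

section \<open>T-sectorial operators\<close>

definition T_sectorial_class :: "real \<Rightarrow> 'a::complex_banach operator set" where
  "T_sectorial_class \<theta> =
     {A \<in> sectorial_class \<theta>.
       \<exists>p>1. \<forall>\<psi>\<in>{-\<theta>..\<theta>}. \<exists>C>0.
         \<forall>(n::nat). \<forall>r\<in>{exp (- 1)..1}. \<forall>x :: nat \<Rightarrow> 'a.
           \<exists>a :: nat \<Rightarrow> real \<Rightarrow> complex.
             (\<forall>k\<le>n. a k \<in> borel_measurable (lebesgue_on {0<..<2 * pi}) \<and>
                    (AE t in lebesgue_on {0<..<2 * pi}. cmod (a k t) \<le> 1)) \<and>
             Lp_norm (lebesgue_on {0<..<2 * pi}) p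
               (\<lambda>t. \<Sum>k\<le>n. exp (\<i> * of_nat k * of_real t) *\<^sub>C
                  op_app ((op_shift (op_scale (of_real r * exp (- of_nat k + \<i> * of_real \<psi>)) A) 1)\<inverse>) (x k))
             \<le> C * Lp_norm (lebesgue_on {0<..<2 * pi}) p (\<lambda>t. \<Sum>k\<le>n. a k t *\<^sub>C x k)}"

end

theory Submission
  imports Defs
begin

text \<open>
  Take \<open>p = 2\<close> and \<open>a\<^sub>k(t) = e\<^sup>i\<^sup>k\<^sup>t\<close>, and write \<open>T(u) = e\<^sup>u (e\<^sup>u + A)\<^sup>-\<^sup>1\<close>, so that
  \<open>T(k - ln r) = (I + r e\<^sup>-\<^sup>k A)\<^sup>-\<^sup>1\<close>. Mellin inversion gives the principal value formula
  \<open>x - 2 T(u) x = (1 / \<pi>\<i>) PV\<integral> e\<^sup>-\<^sup>i\<^sup>t\<^sup>u (\<pi> / sinh (\<pi> t)) A\<^sup>i\<^sup>t x dt\<close>, hence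
  (for \<open>r = 1\<close>) \<open>\<Sum> e\<^sup>i\<^sup>k\<^sup>\<tau> T(k) x\<^sub>k\<close> is a singular integral of \<open>A\<^sup>i\<^sup>t f(\<tau> - t)\<close> with \<open>f(\<tau>) = \<Sum> e\<^sup>i\<^sup>k\<^sup>\<tau> x\<^sub>k\<close>.
  Transference with the group \<open>A\<^sup>i\<^sup>t\<close> reduces its singular part to a truncated Hilbert transform,
  which UMD bounds: the transform is an average over translations and dilations of a shift of Haar
  coefficients (two martingale transforms). The angle comes for free: as long as the power angle of
  \<open>e\<^sup>i\<^sup>\<psi> A\<close> stays below \<open>\<pi>\<close>, the same formula bounds its resolvent uniformly, so \<open>A\<close> may be rotated
  in small steps up to any angle below \<open>\<pi> - \<phi>\<close>.
\<close>

section \<open>Dyadic martingales and UMD\<close>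

text \<open>Sectoriality may give resolvents on the positive half-line only, and A^it comes with
  nothing but a norm bound, so neither a contour nor the group law is available at the start. Both
  are extracted from one integral over the half-line, \<open>mellin A t y\<close>, which for y = A x
  equals A^it x times the scalar \<open>mellin_id t\<close>. The group law results from comparing
  the composition of two such integrals with the same composition for the identity operator on the
  complex numbers: the kernel that appears is the same for both operators, and it never has to be
  integrated. Two facts fix the shape of the transference. The group grows like exp (\<phi> |t|),
  and the kernel \<pi> / sinh (\<pi> t) beats this growth exactly because \<phi> < \<pi>. The
  principal value must be controlled on the truncations [2^-n, n] uniformly in n; the averaged Haar
  shift has there, up to errors integrable uniformly in n, the kernel 1 / (8 t) on [2^-n, 2], whence
  the factor 8 in the comparison, and beyond 2 absolute values suffice.\<close>

lemma sum_split_mult: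
  fixes f :: "nat \<Rightarrow> 'b::comm_monoid_add"
  shows "(\<Sum>x<m * k. f x) = (\<Sum>y<m. \<Sum>z<k. f (y * k + z))"
proof -
  have "(\<Sum>x<m * k. f x) = (\<Sum>y<m. sum f {y * k..<y * k + k})"
    by (rule sum.nat_group [symmetric])
  also have "\<dots> = (\<Sum>y<m. \<Sum>z<k. f (y * k + z))"
    using sum.shift_bounds_nat_ivl[of f 0 "y * k" k for y]
    by (rule_tac sum.cong[OF refl]) (simp add: lessThan_atLeast0 add.commute)
  finally show ?thesis .
qed

text \<open>The i-th Rademacher function on the points x < 2^n, digit 0 being the finest. A
  coefficient of level i may depend on the coarser digits only, that is on
  \<open>x div 2 ^ Suc i\<close>.\<close>

definition bit_sign :: "nat \<Rightarrow> nat \<Rightarrow> real" where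
  "bit_sign i x = (- 1) ^ (x div 2 ^ i)"

lemma bit_sign_cases: "bit_sign i x \<in> {-1, 1}"
  by (cases "even (x div 2 ^ i)") (auto simp: bit_sign_def)

lemma bit_sign_mult_self [simp]: "bit_sign i x * bit_sign i x = 1"
  using bit_sign_cases[of i x] by auto

lemma bit_sign_block:
  assumes "z < 2 ^ i"
  shows "bit_sign i (y * 2 ^ i + z) = (- 1) ^ y"
proof -
  have "(y * 2 ^ i + z) div 2 ^ i = y" using assms by simp
  then show ?thesis by (simp add: bit_sign_def)
qed

text \<open>Flipping digit i changes the sign and leaves \<open>x div 2 ^ Suc i\<close> alone, so
  the points cancel in pairs. This is the martingale property of the dyadic differences.\<close>

lemma sum_bit_sign_eq_0:
  fixes \<phi> :: "nat \<Rightarrow> 'a::real_vector"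
  assumes "i < n"
  shows "(\<Sum>x<2 ^ n. bit_sign i x *\<^sub>R \<phi> (x div 2 ^ Suc i)) = 0"
proof -
  have n: "2 ^ n = 2 ^ (n - Suc i) * (2 * 2 ^ i :: nat)"
    using assms by (metis Suc_leI le_add_diff_inverse2 power_Suc power_add)
  have inner: "(\<Sum>z<2 * 2 ^ i. bit_sign i (y * (2 * 2 ^ i) + z) *\<^sub>R \<phi> ((y * (2 * 2 ^ i) + z) div 2 ^ Suc i)) = 0"
    for y
  proof -
    have "(\<Sum>z<2 * 2 ^ i. bit_sign i (y * (2 * 2 ^ i) + z) *\<^sub>R \<phi> ((y * (2 * 2 ^ i) + z) div 2 ^ Suc i))
      = (\<Sum>z<2 * 2 ^ i. bit_sign i (y * (2 * 2 ^ i) + z) *\<^sub>R \<phi> y)"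
      by (intro sum.cong refl arg_cong2[where f=scaleR] arg_cong[where f=\<phi>]) auto
    also have "\<dots> = (\<Sum>e<2. \<Sum>z<2 ^ i. bit_sign i ((2 * y + e) * 2 ^ i + z) *\<^sub>R \<phi> y)"
      by (subst sum_split_mult) (simp add: algebra_simps)
    also have "\<dots> = (\<Sum>e<2. \<Sum>z<(2::nat) ^ i. (- 1) ^ (2 * y + e) *\<^sub>R \<phi> y)"
      by (intro sum.cong refl) (subst bit_sign_block, auto)
    also have "\<dots> = 0" by (simp add: numeral_2_eq_2 sum_negf)
    finally show ?thesis .
  qed
  show ?thesis unfolding n by (subst sum_split_mult) (simp only: inner sum.neutral_const)
qed

text \<open>On a finite space a measurable function is already simple, so the constant sequence
  approximates it.\<close>

lemma finite_has_Bochner_integral: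
  fixes f :: "'w \<Rightarrow> 'a::banach"
  assumes fin: "finite (space M)" and f: "f \<in> borel_measurable M" and M: "emeasure M (space M) < \<infinity>"
  shows "has_Bochner_integral M f (Bochner_Integration.simple_bochner_integral M f)"
proof -
  have "simple_function M f"
    unfolding simple_function_def using fin f by (auto intro: measurable_sets)
  moreover have "emeasure M {y \<in> space M. f y \<noteq> 0} \<le> emeasure M (space M)"
    by (intro emeasure_mono) auto
  ultimately have "Bochner_Integration.simple_bochner_integrable M f"
    using M by (auto intro!: Bochner_Integration.simple_bochner_integrable.intros simp: top_unique)
  then show ?thesis
    unfolding has_Bochner_integral_def using f by (intro conjI exI[of _ "\<lambda>i. f"]) auto
qed

lemma simple_bochner_integral_uniform_count_measure:
  fixes f :: "'w \<Rightarrow> 'a::banach"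
  assumes fin: "finite \<Omega>"
  shows "Bochner_Integration.simple_bochner_integral (uniform_count_measure \<Omega>) f = (1 / card \<Omega>) *\<^sub>R (\<Sum>x\<in>\<Omega>. f x)"
proof -
  have "Bochner_Integration.simple_bochner_integral (uniform_count_measure \<Omega>) f
     = (\<Sum>y\<in>f ` \<Omega>. (1 / card \<Omega>) *\<^sub>R (\<Sum>x\<in>{x\<in>\<Omega>. f x = y}. f x))"
    unfolding Bochner_Integration.simple_bochner_integral_def space_uniform_count_measure
  proof (intro sum.cong refl)
    fix y
    have "(\<Sum>x\<in>{x\<in>\<Omega>. f x = y}. f x) = (\<Sum>x\<in>{x\<in>\<Omega>. f x = y}. y)"
      by (intro sum.cong) auto
    then show "measure (uniform_count_measure \<Omega>) {x \<in> \<Omega>. f x = y} *\<^sub>R y = (1 / card \<Omega>) *\<^sub>R (\<Sum>x\<in>{x\<in>\<Omega>. f x = y}. f x)"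
      using fin by (subst measure_uniform_count_measure) (auto simp: sum_constant_scaleR)
  qed
  also have "\<dots> = (1 / card \<Omega>) *\<^sub>R (\<Sum>x\<in>\<Omega>. f x)"
    by (simp only: scaleR_sum_right [symmetric] sum.image_gen[OF fin, of f f, symmetric])
  finally show ?thesis .
qed

text \<open>The case p = 2 is applied to Walsh-Paley martingales: 2^n equally likely points, each
  difference being a sign times a function of the coarser digits. Sums of squares take the place of
  norms, hence the constant C^2.\<close>

lemma UMD_dyadic:
  assumes "UMD TYPE('a::banach)"
  obtains C where "C \<ge> 0" "\<And>n (a :: nat \<Rightarrow> nat \<Rightarrow> 'a) \<epsilon>. (\<And>i. \<epsilon> i \<in> {-1, 1}) \<Longrightarrow>
     (\<Sum>x<2 ^ n. (norm (\<Sum>i<n. (\<epsilon> i * bit_sign i x) *\<^sub>R a i (x div 2 ^ Suc i)))\<^sup>2)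
      \<le> C\<^sup>2 * (\<Sum>x<2 ^ n. (norm (\<Sum>i<n. bit_sign i x *\<^sub>R a i (x div 2 ^ Suc i)))\<^sup>2)"
proof -
  have "(2::real) > 1" by simp
  from assms[unfolded UMD_def, THEN spec, THEN mp, OF this]
  obtain C where C0: "C \<ge> 0" and C': "\<forall>(M :: real measure) N F (f :: nat \<Rightarrow> real \<Rightarrow> 'a) (\<epsilon> :: nat \<Rightarrow> real).
        Lp_martingale M 2 N F f \<longrightarrow> (\<forall>n. \<epsilon> n \<in> {-1, 1}) \<longrightarrow>
        Lp_norm M 2 (\<lambda>w. \<Sum>n<N. \<epsilon> n *\<^sub>R (f (Suc n) w - f n w))
          \<le> C * Lp_norm M 2 (\<lambda>w. \<Sum>n<N. f (Suc n) w - f n w)"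
    by (elim exE conjE)
  note C = C'[rule_format]
  have "(\<Sum>x<2 ^ n. (norm (\<Sum>i<n. (\<epsilon> i * bit_sign i x) *\<^sub>R a i (x div 2 ^ Suc i)))\<^sup>2)
      \<le> C\<^sup>2 * (\<Sum>x<2 ^ n. (norm (\<Sum>i<n. bit_sign i x *\<^sub>R a i (x div 2 ^ Suc i)))\<^sup>2)"
    if \<epsilon>: "\<And>i. \<epsilon> i \<in> {-1, 1}" for n and a :: "nat \<Rightarrow> nat \<Rightarrow> 'a" and \<epsilon>
  proof -
    \<comment> \<open>The points are embedded in the real line because \<open>UMD\<close> quantifies
      over measures on the reals; \<open>idx\<close> recovers the integer.\<close>
    define \<Omega> :: "real set" where "\<Omega> = real ` {..<2 ^ n}"
    define idx :: "real \<Rightarrow> nat" where "idx w = nat \<lfloor>w\<rfloor>" for w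
    define M where "M = uniform_count_measure \<Omega>"
    \<comment> \<open>\<open>B j\<close> keeps the j leading digits. The filtration must run from
      coarse to fine while digits are numbered from the fine end, so step j reveals digit n - Suc
      j.\<close>
    define B where "B j w = idx w div 2 ^ (n - j)" for j w
    define F where "F j = vimage_algebra \<Omega> (B j) (count_space UNIV)" for j
    define d where "d j x = bit_sign (n - Suc j) x *\<^sub>R a (n - Suc j) (x div 2 ^ (n - j))" for j x
    define f where "f j w = (\<Sum>k<j. d k (idx w))" for j w
    have fin: "finite \<Omega>" and card: "card \<Omega> = 2 ^ n"
      by (auto simp: \<Omega>_def card_image inj_on_def)
    have sp: "space M = \<Omega>" and se: "sets M = Pow \<Omega>"
      by (auto simp: M_def space_uniform_count_measure sets_uniform_count_measure)
    have emM: "emeasure M \<Omega> = 1"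
      unfolding M_def using fin card by (subst emeasure_uniform_count_measure) auto
    have prob: "prob_space M"
      by (rule prob_spaceI) (simp add: sp emM)
    have sF: "sets (F j) = {B j -` A \<inter> \<Omega> | A. A \<in> UNIV}" and spF: "space (F j) = \<Omega>" for j
      by (auto simp: F_def sets_vimage_algebra2)
    have sub: "subalgebra M (F j)" for j
      by (auto simp: subalgebra_def sp se sF spF)
    have Bdiv: "B j w = B k w div 2 ^ (k - j)" if "j \<le> k" "k \<le> n" for j k w
    proof -
      have "n - j = (n - k) + (k - j)" using that by simp
      then show ?thesis by (simp add: B_def power_add div_mult2_eq)
    qed
    have mono: "sets (F j) \<subseteq> sets (F (Suc j))" if "j < n" for j
    proof
      fix X assume "X \<in> sets (F j)"
      then obtain A where X: "X = B j -` A \<inter> \<Omega>" by (auto simp: sF)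
      have "X = B (Suc j) -` {m. m div 2 \<in> A} \<inter> \<Omega>"
        using Bdiv[of j "Suc j"] that by (auto simp: X)
      then show "X \<in> sets (F (Suc j))" unfolding sF by blast
    qed
    have dB: "d k (idx w) = (- 1) ^ (B j w div 2 ^ (j - Suc k)) *\<^sub>R a (n - Suc k) (B j w div 2 ^ (j - k))"
      if "k < j" "j \<le> n" for k j w
    proof -
      have "n - k = (n - j) + (j - k)" "n - Suc k = (n - j) + (j - Suc k)" using that by simp_all
      then show ?thesis unfolding d_def bit_sign_def B_def by (simp add: power_add div_mult2_eq)
    qed
    have fB: "f j w = (\<Sum>k<j. (- 1) ^ (B j w div 2 ^ (j - Suc k)) *\<^sub>R a (n - Suc k) (B j w div 2 ^ (j - k)))"
      if "j \<le> n" for j w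
      unfolding f_def using that by (intro sum.cong refl dB) auto
    have meas: "f j \<in> borel_measurable (restr_to_subalg M (F j))" if j: "j \<le> n" for j
    proof (rule measurableI)
      fix X
      have "f j -` X \<inter> \<Omega> = B j -` {m. (\<Sum>k<j. (- 1) ^ (m div 2 ^ (j - Suc k)) *\<^sub>R a (n - Suc k) (m div 2 ^ (j - k))) \<in> X} \<inter> \<Omega>"
        using fB[OF j] by auto
      then show "f j -` X \<inter> space (restr_to_subalg M (F j)) \<in> sets (restr_to_subalg M (F j))"
        using sub[of j] unfolding sets_restr_to_subalg[OF sub] space_restr_to_subalg sp sF by blast
    qed auto
    have mart: "Lp_martingale M 2 n F f"
      unfolding Lp_martingale_def
    proof (intro conjI allI impI ballI)
      show "prob_space M" by fact
      show "subalgebra M (F j)" for j by (rule sub)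
      show "sets (F j) \<subseteq> sets (F (Suc j))" if "j < n" for j using that by (rule mono)
      show "\<exists>I. has_Bochner_integral (restr_to_subalg M (F j)) (f j) I" if "j \<le> n" for j
      proof (rule exI, rule finite_has_Bochner_integral)
        have "\<Omega> \<in> sets (F j)" using sets.top[of "F j"] by (simp add: spF)
        then show "emeasure (restr_to_subalg M (F j)) (space (restr_to_subalg M (F j))) < \<infinity>"
          using emM by (simp add: emeasure_restr_to_subalg[OF sub] space_restr_to_subalg sp)
      qed (use fin meas[OF that] in \<open>auto simp: space_restr_to_subalg sp\<close>)
      show "integrable M (\<lambda>w. norm (f j w) powr 2)" for j
        unfolding M_def using fin by (simp add: uniform_count_measure_def integrable_point_measure_finite)
      fix j X assume j: "j < n" and X: "X \<in> sets (F j)"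
      then obtain A where XA: "X = B j -` A \<inter> \<Omega>" by (auto simp: sF)
      let ?g = "\<lambda>w. indicator X w *\<^sub>R (f (Suc j) w - f j w)"
      have "has_Bochner_integral M ?g (Bochner_Integration.simple_bochner_integral M ?g)"
        using fin emM by (intro finite_has_Bochner_integral) (auto simp: sp se measurable_def)
      moreover have "(\<Sum>w\<in>\<Omega>. ?g w) = 0"
      proof -
        have "(\<Sum>w\<in>\<Omega>. ?g w) = (\<Sum>x<2 ^ n. ?g (real x))"
          unfolding \<Omega>_def by (subst sum.reindex) (auto simp: inj_on_def)
        also have "\<dots> = (\<Sum>x<2 ^ n. bit_sign (n - Suc j) x *\<^sub>R
            (\<lambda>m. indicator A m *\<^sub>R a (n - Suc j) m) (x div 2 ^ Suc (n - Suc j)))"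
          using j by (intro sum.cong refl)
            (auto simp: f_def d_def XA \<Omega>_def B_def idx_def indicator_def Suc_diff_Suc)
        also have "\<dots> = 0" using j by (intro sum_bit_sign_eq_0) auto
        finally show ?thesis .
      qed
      ultimately show "has_Bochner_integral M ?g 0"
        unfolding M_def using fin by (simp add: simple_bochner_integral_uniform_count_measure)
    qed
    have Lp: "Lp_norm M 2 g = sqrt ((\<Sum>x<2 ^ n. (norm (g (real x)))\<^sup>2) / 2 ^ n)" for g :: "real \<Rightarrow> 'a"
    proof -
      have "integral\<^sup>L M (\<lambda>w. norm (g w) powr 2) = (\<Sum>w\<in>\<Omega>. norm (g w) powr 2) / card \<Omega>"
        unfolding M_def using fin by (simp add: integral_uniform_count_measure)
      also have "(\<Sum>w\<in>\<Omega>. norm (g w) powr 2) = (\<Sum>x<2 ^ n. norm (g (real x)) powr 2)"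
        unfolding \<Omega>_def by (subst sum.reindex) (auto simp: inj_on_def)
      finally show ?thesis
        by (simp add: Lp_norm_def card powr_half_sqrt sum_nonneg)
    qed
    have rev: "(\<Sum>j<n. G (n - Suc j)) = (\<Sum>i<n. G i)" for G :: "nat \<Rightarrow> 'a"
      by (rule sum.nat_diff_reindex)
    have "Lp_norm M 2 (\<lambda>w. \<Sum>j<n. \<epsilon> (n - Suc j) *\<^sub>R (f (Suc j) w - f j w))
          \<le> C * Lp_norm M 2 (\<lambda>w. \<Sum>j<n. f (Suc j) w - f j w)"
      using \<epsilon> by (intro C[OF mart])
    moreover have "(\<Sum>j<n. \<epsilon> (n - Suc j) *\<^sub>R (f (Suc j) (real x) - f j (real x)))
       = (\<Sum>i<n. (\<epsilon> i * bit_sign i x) *\<^sub>R a i (x div 2 ^ Suc i))" for x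
      unfolding rev[of "\<lambda>i. (\<epsilon> i * bit_sign i x) *\<^sub>R a i (x div 2 ^ Suc i)", symmetric]
      by (intro sum.cong refl) (auto simp: f_def d_def idx_def Suc_diff_Suc)
    moreover have "(\<Sum>j<n. (f (Suc j) (real x) - f j (real x)))
       = (\<Sum>i<n. (bit_sign i x) *\<^sub>R a i (x div 2 ^ Suc i))" for x
      unfolding rev[of "\<lambda>i. (bit_sign i x) *\<^sub>R a i (x div 2 ^ Suc i)", symmetric]
      by (intro sum.cong refl) (auto simp: f_def d_def idx_def Suc_diff_Suc)
    ultimately have "sqrt ((\<Sum>x<2 ^ n. (norm (\<Sum>i<n. (\<epsilon> i * bit_sign i x) *\<^sub>R a i (x div 2 ^ Suc i)))\<^sup>2) / 2 ^ n)
       \<le> C * sqrt ((\<Sum>x<2 ^ n. (norm (\<Sum>i<n. (bit_sign i x) *\<^sub>R a i (x div 2 ^ Suc i)))\<^sup>2) / 2 ^ n)"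
      by (simp only: Lp)
    also have "\<dots> = sqrt (C\<^sup>2 * ((\<Sum>x<2 ^ n. (norm (\<Sum>i<n. (bit_sign i x) *\<^sub>R a i (x div 2 ^ Suc i)))\<^sup>2) / 2 ^ n))"
      using C0 by (simp add: real_sqrt_mult real_sqrt_divide)
    finally show ?thesis by (simp add: field_simps)
  qed
  with C0 show ?thesis by (rule that)
qed

section \<open>Haar expansion and Haar shift\<close>

definition block_avg :: "(nat \<Rightarrow> 'a::real_vector) \<Rightarrow> nat \<Rightarrow> nat \<Rightarrow> 'a" where
  "block_avg g i y = (1 / 2 ^ i) *\<^sub>R (\<Sum>z<2 ^ i. g (y * 2 ^ i + z))"

definition haar_coef :: "(nat \<Rightarrow> 'a::real_vector) \<Rightarrow> nat \<Rightarrow> nat \<Rightarrow> 'a" where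
  "haar_coef g i y = (1 / 2) *\<^sub>R (block_avg g i (2 * y) - block_avg g i (2 * y + 1))"

text \<open>Petermichl's dyadic shift up to normalisation:
  \<open>bit_sign (Suc k) x * bit_sign k x\<close> is the Haar function of the left half of a block
  of length 2^(k+2) minus that of its right half, so the coefficient of a block is passed on to its
  two halves with opposite signs.\<close>

definition haar_shift :: "nat \<Rightarrow> (nat \<Rightarrow> 'a::real_vector) \<Rightarrow> nat \<Rightarrow> 'a" where
  "haar_shift n g x = (\<Sum>k<n - 1. (bit_sign (Suc k) x * bit_sign k x) *\<^sub>R haar_coef g (Suc k) (x div 2 ^ Suc (Suc k)))"

lemma block_avg_Suc: "block_avg g (Suc i) y = (1 / 2) *\<^sub>R (block_avg g i (2 * y) + block_avg g i (2 * y + 1))"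
proof -
  have "(\<Sum>z<2 ^ Suc i. g (y * 2 ^ Suc i + z)) = (\<Sum>e<2. \<Sum>z<2 ^ i. g (y * 2 ^ Suc i + (e * 2 ^ i + z)))"
    by (simp only: power_Suc sum_split_mult)
  also have "\<dots> = (\<Sum>z<2 ^ i. g (2 * y * 2 ^ i + z)) + (\<Sum>z<2 ^ i. g ((2 * y + 1) * 2 ^ i + z))"
    by (simp add: numeral_2_eq_2 algebra_simps)
  finally show ?thesis by (simp add: block_avg_def scaleR_right_distrib)
qed

text \<open>Each Haar term is the difference of the averages over two nested blocks around x, so the
  sum telescopes.\<close>

lemma haar_expansion:
  assumes "x < 2 ^ n"
  shows "(\<Sum>i<n. bit_sign i x *\<^sub>R haar_coef g i (x div 2 ^ Suc i)) = g x - block_avg g n 0"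
proof -
  have step: "bit_sign i x *\<^sub>R haar_coef g i (x div 2 ^ Suc i)
     = block_avg g i (x div 2 ^ i) - block_avg g (Suc i) (x div 2 ^ Suc i)" for i
  proof -
    define m where "m = x div 2 ^ i"
    have d: "x div 2 ^ Suc i = m div 2" by (simp add: m_def div_mult2_eq[symmetric] mult.commute)
    have half: "u - (1 / 2) *\<^sub>R (u + v) = (1 / 2) *\<^sub>R (u - v)" for u v :: 'a
      by (simp add: algebra_simps) (metis scaleR_half_double add.commute scaleR_add_right)
    show ?thesis
    proof (cases "even m")
      case True
      then obtain j where j: "m = 2 * j" by (elim evenE)
      then show ?thesis unfolding d bit_sign_def m_def[symmetric]
        by (simp add: block_avg_Suc haar_coef_def half)
    next
      case False
      then obtain j where j: "m = 2 * j + 1" by (elim oddE)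
      have "- ((1 / 2) *\<^sub>R (u - v)) = v - (1 / 2) *\<^sub>R (u + v)" for u v :: 'a
        using half[of v u] by (simp add: algebra_simps)
      with j show ?thesis unfolding d bit_sign_def m_def[symmetric]
        by (simp add: block_avg_Suc haar_coef_def)
    qed
  qed
  have "(\<Sum>i<n. bit_sign i x *\<^sub>R haar_coef g i (x div 2 ^ Suc i))
      = (\<Sum>i<n. block_avg g i (x div 2 ^ i) - block_avg g (Suc i) (x div 2 ^ Suc i))"
    by (simp only: step)
  also have "\<dots> = block_avg g 0 (x div 2 ^ 0) - block_avg g n (x div 2 ^ n)"
    by (rule sum_lessThan_telescope')
  finally show ?thesis using assms by (simp add: block_avg_def)
qed

lemma square_sum_le:
  fixes f :: "'i \<Rightarrow> real"
  shows "(\<Sum>x\<in>A. f x)\<^sup>2 \<le> real (card A) * (\<Sum>x\<in>A. (f x)\<^sup>2)"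
  using Cauchy_Schwarz_ineq_sum[of "\<lambda>_. 1" f A] by simp

lemma norm_sum_square_le:
  fixes f :: "'i \<Rightarrow> 'a::real_normed_vector"
  shows "(norm (\<Sum>x\<in>A. f x))\<^sup>2 \<le> real (card A) * (\<Sum>x\<in>A. (norm (f x))\<^sup>2)"
  by (rule order_trans[OF _ square_sum_le]) (intro power_mono norm_sum norm_ge_zero)

lemma norm_add_square_le:
  fixes u v :: "'a::real_normed_vector"
  shows "(norm (u + v))\<^sup>2 \<le> 2 * (norm u)\<^sup>2 + 2 * (norm v)\<^sup>2"
proof -
  have "(norm (u + v))\<^sup>2 \<le> (norm u + norm v)\<^sup>2" by (intro power_mono norm_triangle_ineq) auto
  also have "\<dots> \<le> 2 * (norm u)\<^sup>2 + 2 * (norm v)\<^sup>2"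
    using zero_le_power2[of "norm u - norm v"] by (simp add: power2_eq_square algebra_simps)
  finally show ?thesis .
qed

text \<open>By \<open>haar_expansion\<close> the inner sum is g minus its mean. The mean has at most
  the square norm of g by Cauchy-Schwarz, and squaring a difference costs a factor 2, which makes
  4.\<close>

lemma sum_square_haar_expansion_le:
  fixes g :: "nat \<Rightarrow> 'a::real_normed_vector"
  shows "(\<Sum>x<2 ^ n. (norm (\<Sum>i<n. bit_sign i x *\<^sub>R haar_coef g i (x div 2 ^ Suc i)))\<^sup>2)
    \<le> 4 * (\<Sum>x<2 ^ n. (norm (g x))\<^sup>2)"
proof -
  let ?G = "\<Sum>x<2 ^ n. (norm (g x))\<^sup>2"
  have avg: "(norm (block_avg g n 0))\<^sup>2 \<le> ?G / 2 ^ n"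
  proof -
    have "(norm (block_avg g n 0))\<^sup>2 = (norm (\<Sum>z<2 ^ n. g z))\<^sup>2 / (2 ^ n)\<^sup>2"
      by (simp add: block_avg_def power_divide)
    also have "\<dots> \<le> (2 ^ n * ?G) / (2 ^ n)\<^sup>2"
      using norm_sum_square_le[of g "{..<2 ^ n}"] by (intro divide_right_mono) auto
    finally show ?thesis by (simp add: power2_eq_square)
  qed
  have "(\<Sum>x<2 ^ n. (norm (\<Sum>i<n. bit_sign i x *\<^sub>R haar_coef g i (x div 2 ^ Suc i)))\<^sup>2)
     \<le> (\<Sum>x<(2::nat) ^ n. 2 * (norm (g x))\<^sup>2 + 2 * (?G / 2 ^ n))"
  proof (intro sum_mono)
    fix x assume "x \<in> {..<(2::nat) ^ n}"
    then have "(norm (\<Sum>i<n. bit_sign i x *\<^sub>R haar_coef g i (x div 2 ^ Suc i)))\<^sup>2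
        = (norm (g x + - block_avg g n 0))\<^sup>2"
      by (subst haar_expansion) auto
    also have "\<dots> \<le> 2 * (norm (g x))\<^sup>2 + 2 * (norm (- block_avg g n 0))\<^sup>2"
      by (rule norm_add_square_le)
    finally show "(norm (\<Sum>i<n. bit_sign i x *\<^sub>R haar_coef g i (x div 2 ^ Suc i)))\<^sup>2
       \<le> 2 * (norm (g x))\<^sup>2 + 2 * (?G / 2 ^ n)" using avg by simp
  qed
  also have "\<dots> = 4 * ?G" by (simp add: sum.distrib sum_distrib_left [symmetric])
  finally show ?thesis .
qed

abbreviation bitxor :: "nat \<Rightarrow> nat \<Rightarrow> nat" where
  "bitxor \<equiv> semiring_bit_operations_class.xor"

lemma bit_sign_xor: "bit_sign k (bitxor w x) = bit_sign k w * bit_sign k x"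
proof -
  have "bit_sign k y = (if bit y k then -1 else 1)" for y
    by (auto simp: bit_sign_def bit_iff_odd)
  then show ?thesis by (auto simp: bit_xor_iff)
qed

lemma xor_less_power:
  fixes w x :: nat
  assumes "w < 2 ^ n" "x < 2 ^ n"
  shows "bitxor w x < 2 ^ n"
  using assms by (metis take_bit_nat_eq_self_iff take_bit_xor)

text \<open>The shift is a martingale whose difference of level k carries a coefficient of level k +
  1. A first transform with the signs \<open>bit_sign k w\<close>, averaged over w, decouples the
  signs from the point x at which the coefficients are taken. For fixed w a second transform removes
  the signs and leaves the Haar expansion of g. Two uses of UMD and the factor 4 give 4 C^4.\<close>

lemma haar_shift_bounded:
  assumes "UMD TYPE('a::banach)"
  obtains D where "D \<ge> 0" "\<And>n (g :: nat \<Rightarrow> 'a).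
     (\<Sum>x<2 ^ n. (norm (haar_shift n g x))\<^sup>2) \<le> D * (\<Sum>x<2 ^ n. (norm (g x))\<^sup>2)"
proof -
  obtain C where C0: "C \<ge> 0" and C: "\<And>n (a :: nat \<Rightarrow> nat \<Rightarrow> 'a) \<epsilon>. (\<And>i. \<epsilon> i \<in> {-1, 1}) \<Longrightarrow>
     (\<Sum>x<2 ^ n. (norm (\<Sum>i<n. (\<epsilon> i * bit_sign i x) *\<^sub>R a i (x div 2 ^ Suc i)))\<^sup>2)
      \<le> C\<^sup>2 * (\<Sum>x<2 ^ n. (norm (\<Sum>i<n. bit_sign i x *\<^sub>R a i (x div 2 ^ Suc i)))\<^sup>2)"
    using UMD_dyadic[OF assms] by blast
  have "(\<Sum>x<2 ^ n. (norm (haar_shift n g x))\<^sup>2) \<le> (4 * C ^ 4) * (\<Sum>x<2 ^ n. (norm (g x))\<^sup>2)"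
    for n and g :: "nat \<Rightarrow> 'a"
  proof -
    let ?G = "\<Sum>x<2 ^ n. (norm (g x))\<^sup>2"
    \<comment> \<open>\<open>b\<close> is \<open>c\<close> written as a function of the coarser
      digits. The value 0 at the top level lets the sum run over all levels below n.\<close>
    define b where "b k m = (if Suc k < n then (- 1) ^ m *\<^sub>R haar_coef g (Suc k) (m div 2) else 0)" for k m
    define c where "c k x = (if Suc k < n then bit_sign (Suc k) x *\<^sub>R haar_coef g (Suc k) (x div 2 ^ Suc (Suc k)) else 0)" for k x
    have bc: "b k (x div 2 ^ Suc k) = c k x" for k x
      by (auto simp: b_def c_def bit_sign_def div_mult2_eq[symmetric] mult.commute)
    have shift: "haar_shift n g x = (\<Sum>k<n. bit_sign k x *\<^sub>R c k x)" for x
    proof -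
      have "(\<Sum>k<n. bit_sign k x *\<^sub>R c k x) = (\<Sum>k<n - 1. bit_sign k x *\<^sub>R c k x)"
        by (rule sum.mono_neutral_right) (auto simp: c_def)
      also have "\<dots> = haar_shift n g x"
        unfolding haar_shift_def by (intro sum.cong) (auto simp: c_def mult.commute)
      finally show ?thesis by simp
    qed
    have signs: "bit_sign k w \<in> {-1, 1}" for k w by (rule bit_sign_cases)
    \<comment> \<open>The sign of w is put both into the coefficients and into the transform. On the
      left it squares to 1; on the right it turns the sign of x into that of
      \<open>bitxor w x\<close>.\<close>
    have first: "(\<Sum>x<2 ^ n. (norm (haar_shift n g x))\<^sup>2)
       \<le> C\<^sup>2 * (\<Sum>x<2 ^ n. (norm (\<Sum>k<n. bit_sign k (bitxor w x) *\<^sub>R c k x))\<^sup>2)" for w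
      using C[where n = n and \<epsilon> = "\<lambda>k. bit_sign k w" and a = "\<lambda>k m. bit_sign k w *\<^sub>R b k m", OF signs]
      by (simp add: shift bc mult.commute mult.left_commute bit_sign_xor del: power_Suc flip: mult.assoc)
    have second: "(\<Sum>x<2 ^ n. (norm (\<Sum>k<n. bit_sign k w *\<^sub>R c k x))\<^sup>2) \<le> C\<^sup>2 * (4 * ?G)" for w
    proof -
      \<comment> \<open>For fixed w the factor \<open>bit_sign (Suc k) x\<close> inside
        \<open>c\<close> makes the sum a Haar expansion whose level k + 1 carries the sign of digit
        k of w. Level 0 receives a free sign \<sigma>.\<close>
      define \<epsilon> where "\<epsilon> \<sigma> i = (case i of 0 \<Rightarrow> \<sigma> | Suc k \<Rightarrow> bit_sign k w)" for \<sigma> :: real and i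
      define v where "v \<sigma> x = (\<Sum>i<n. (\<epsilon> \<sigma> i * bit_sign i x) *\<^sub>R haar_coef g i (x div 2 ^ Suc i))" for \<sigma> x
      have \<epsilon>: "\<epsilon> \<sigma> i \<in> {-1, 1}" if "\<sigma> \<in> {-1, 1}" for \<sigma> i
        using that signs by (auto simp: \<epsilon>_def split: nat.split)
      have v: "(\<Sum>x<2 ^ n. (norm (v \<sigma> x))\<^sup>2) \<le> C\<^sup>2 * (4 * ?G)" if "\<sigma> \<in> {-1, 1}" for \<sigma>
      proof -
        have "(\<Sum>x<2 ^ n. (norm (v \<sigma> x))\<^sup>2)
          \<le> C\<^sup>2 * (\<Sum>x<2 ^ n. (norm (\<Sum>i<n. bit_sign i x *\<^sub>R haar_coef g i (x div 2 ^ Suc i)))\<^sup>2)"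
          unfolding v_def using \<epsilon>[OF that] by (rule C)
        also have "\<dots> \<le> C\<^sup>2 * (4 * ?G)"
          by (intro mult_left_mono sum_square_haar_expansion_le) auto
        finally show ?thesis .
      qed
      \<comment> \<open>Level 0 of the Haar expansion is absent from the shift; averaging over
        \<sigma> = 1 and \<sigma> = -1 removes it.\<close>
      have avg: "(\<Sum>k<n. bit_sign k w *\<^sub>R c k x) = (1 / 2) *\<^sub>R (v 1 x + v (-1) x)" for x
      proof (cases n)
        case (Suc m)
        have "v \<sigma> x = (\<sigma> * bit_sign 0 x) *\<^sub>R haar_coef g 0 (x div 2) + (\<Sum>k<m. bit_sign k w *\<^sub>R c k x)" for \<sigma>
          unfolding v_def Suc sum.lessThan_Suc_shift
          by (intro arg_cong2[where f="(+)"] sum.cong refl) (auto simp: \<epsilon>_def c_def Suc)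
        moreover have "c m x = 0" by (simp add: c_def Suc)
        ultimately show ?thesis
          unfolding Suc sum.lessThan_Suc by (simp add: scaleR_right_distrib scaleR_left_distrib[symmetric])
      qed (simp add: v_def)
      have "(\<Sum>x<2 ^ n. (norm (\<Sum>k<n. bit_sign k w *\<^sub>R c k x))\<^sup>2)
        \<le> (\<Sum>x<2 ^ n. (1 / 2) * (norm (v 1 x))\<^sup>2 + (1 / 2) * (norm (v (-1) x))\<^sup>2)"
      proof (intro sum_mono)
        fix x
        have "(norm ((1 / 2) *\<^sub>R (v 1 x + v (-1) x)))\<^sup>2 = (1 / 4) * (norm (v 1 x + v (-1) x))\<^sup>2"
          by (simp add: power_mult_distrib power2_eq_square)
        then show "(norm (\<Sum>k<n. bit_sign k w *\<^sub>R c k x))\<^sup>2 \<le> (1 / 2) * (norm (v 1 x))\<^sup>2 + (1 / 2) * (norm (v (-1) x))\<^sup>2"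
          unfolding avg using norm_add_square_le[of "v 1 x" "v (-1) x"] by linarith
      qed
      also have "\<dots> \<le> C\<^sup>2 * (4 * ?G)"
        using v[of 1] v[of "-1"] by (simp add: sum.distrib sum_divide_distrib [symmetric])
      finally show ?thesis .
    qed
    have "2 ^ n * (\<Sum>x<2 ^ n. (norm (haar_shift n g x))\<^sup>2)
       = (\<Sum>w<(2::nat) ^ n. \<Sum>x<2 ^ n. (norm (haar_shift n g x))\<^sup>2)" by simp
    also have "\<dots> \<le> (\<Sum>w<2 ^ n. C\<^sup>2 * (\<Sum>x<2 ^ n. (norm (\<Sum>k<n. bit_sign k (bitxor w x) *\<^sub>R c k x))\<^sup>2))"
      by (intro sum_mono first)
    also have "\<dots> = C\<^sup>2 * (\<Sum>x<2 ^ n. \<Sum>w<2 ^ n. (norm (\<Sum>k<n. bit_sign k (bitxor w x) *\<^sub>R c k x))\<^sup>2)"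
      by (subst sum.swap) (simp add: sum_distrib_left)
    \<comment> \<open>For fixed x the map from w to \<open>bitxor w x\<close> permutes the points,
      so x disappears from the signs.\<close>
    also have "\<dots> = C\<^sup>2 * (\<Sum>x<2 ^ n. \<Sum>w<2 ^ n. (norm (\<Sum>k<n. bit_sign k w *\<^sub>R c k x))\<^sup>2)"
    proof (rule arg_cong[where f="\<lambda>u. C\<^sup>2 * u"], rule sum.cong[OF refl])
      fix x assume "x \<in> {..<(2::nat) ^ n}"
      then show "(\<Sum>w<2 ^ n. (norm (\<Sum>k<n. bit_sign k (bitxor w x) *\<^sub>R c k x))\<^sup>2)
         = (\<Sum>w<2 ^ n. (norm (\<Sum>k<n. bit_sign k w *\<^sub>R c k x))\<^sup>2)"
        by (intro sum.reindex_bij_witness[of _ "\<lambda>w. bitxor w x" "\<lambda>w. bitxor w x"])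
           (auto simp: xor.assoc xor_less_power)
    qed
    also have "\<dots> = C\<^sup>2 * (\<Sum>w<2 ^ n. \<Sum>x<2 ^ n. (norm (\<Sum>k<n. bit_sign k w *\<^sub>R c k x))\<^sup>2)"
      by (subst sum.swap) (rule refl)
    also have "\<dots> \<le> C\<^sup>2 * (\<Sum>w<(2::nat) ^ n. C\<^sup>2 * (4 * ?G))"
      by (intro mult_left_mono sum_mono second) auto
    also have "\<dots> = 2 ^ n * ((4 * C ^ 4) * ?G)" by (simp add: power2_eq_square power4_eq_xxxx)
    finally show ?thesis by simp
  qed
  then show ?thesis by (intro that[of "4 * C ^ 4"]) auto
qed

text \<open>The differences z - x are distributed symmetrically over the square, so the argument may
  be reflected in the second sum.\<close>

lemma sum_antisym:
  fixes G :: "int \<Rightarrow> 'a::ab_group_add"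
  shows "(\<Sum>x<q. \<Sum>z<q. G (c + (int z - int x))) - (\<Sum>x<q. \<Sum>z<q. G (- c + (int z - int x)))
    = (\<Sum>x<q. \<Sum>z<q. G (c + (int z - int x)) - G (- (c + (int z - int x))))"
proof -
  have "(\<Sum>x<q. \<Sum>z<q. G (- c + (int z - int x))) = (\<Sum>x<q. \<Sum>z<q. G (- c + (int x - int z)))"
    by (rule sum.swap)
  then show ?thesis by (simp add: sum_subtractf algebra_simps)
qed

text \<open>Averaging the Haar shift over all translates of the dyadic grid gives a convolution, whose
  kernel is the correlation of the sign pattern \<open>+--+\<close> with \<open>++--\<close> at each scale.\<close>

lemma haar_shift_average:
  fixes G :: "int \<Rightarrow> 'a::real_vector"
  shows "(1 / 2 ^ n) *\<^sub>R (\<Sum>x<2 ^ n. haar_shift n (\<lambda>z. G (int z - int x)) x)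
    = (\<Sum>k<n - 1. (1 / (16 * (2 ^ k)\<^sup>2)) *\<^sub>R (\<Sum>x<2 ^ k. \<Sum>z<2 ^ k.
         3 *\<^sub>R (G (2 ^ k + (int z - int x)) - G (- (2 ^ k + (int z - int x))))
         - (G (3 * 2 ^ k + (int z - int x)) - G (- (3 * 2 ^ k + (int z - int x))))))"
proof -
  have "(1 / 2 ^ n) *\<^sub>R (\<Sum>x<2 ^ n. (bit_sign (Suc k) x * bit_sign k x) *\<^sub>R
          haar_coef (\<lambda>z. G (int z - int x)) (Suc k) (x div 2 ^ Suc (Suc k)))
      = (1 / (16 * (2 ^ k)\<^sup>2)) *\<^sub>R (\<Sum>x<2 ^ k. \<Sum>z<2 ^ k.
         3 *\<^sub>R (G (2 ^ k + (int z - int x)) - G (- (2 ^ k + (int z - int x))))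
         - (G (3 * 2 ^ k + (int z - int x)) - G (- (3 * 2 ^ k + (int z - int x)))))"
    if k: "k < n - 1" for k
  proof -
    define q :: nat where "q = 2 ^ k"
    define V where "V c = (\<Sum>x<q. \<Sum>z<q. G (c + (int z - int x)))" for c
    define L :: nat where "L = 2 ^ (n - Suc (Suc k))"
    have L: "(2::nat) ^ n = L * (4 * q)"
    proof -
      have "n = (n - Suc (Suc k)) + (k + 2)" using k by simp
      then have "(2::nat) ^ n = 2 ^ (n - Suc (Suc k)) * 2 ^ (k + 2)" by (metis power_add)
      then show ?thesis by (simp add: L_def q_def)
    qed
    have sum4: "(\<Sum>b<4. f b) = f 0 + f 1 + f 2 + f 3" for f :: "nat \<Rightarrow> 'a"
      by (simp add: eval_nat_numeral)
    have coef: "haar_coef (\<lambda>z. G (int z - int x)) (Suc k) y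
       = (1 / (4 * q)) *\<^sub>R (\<Sum>b<4. (if b < 2 then 1 else - 1 :: real) *\<^sub>R (\<Sum>z<q. G (int (y * (4 * q) + (b * q + z)) - int x)))"
      for x y
    proof -
      have "(\<Sum>z<2 * q. f z) = (\<Sum>z<q. f z) + (\<Sum>z<q. f (q + z))" for f :: "nat \<Rightarrow> 'a"
        by (subst sum_split_mult) (simp add: numeral_2_eq_2)
      moreover have r: "(2::real) ^ k = real q" by (simp add: q_def)
      ultimately show ?thesis
        unfolding haar_coef_def block_avg_def power_Suc r q_def[symmetric] sum4
        by (simp add: scaleR_right_distrib scaleR_right_diff_distrib algebra_simps)
    qed
    have sgn: "bit_sign (Suc k) (y * (4 * q) + (a * q + x)) * bit_sign k (y * (4 * q) + (a * q + x))
       = (- 1) ^ a * (- 1) ^ (a div 2)" and quot: "(y * (4 * q) + (a * q + x)) div 2 ^ Suc (Suc k) = y"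
      if "x < q" "a < 4" for x y a
    proof -
      have "a * q + x < a * q + q" using that by simp
      also have "\<dots> = (a + 1) * q" by simp
      also have "\<dots> \<le> 4 * q" using that by (intro mult_right_mono) auto
      finally show "(y * (4 * q) + (a * q + x)) div 2 ^ Suc (Suc k) = y"
        by (simp add: q_def)
      have "a mod 2 * q \<le> 1 * q" by (intro mult_right_mono) auto
      then have m: "(a mod 2) * q + x < 2 ^ Suc k"
        using that(1) unfolding power_Suc q_def[symmetric] by linarith
      have "a * q = (a div 2) * (2 * q) + (a mod 2) * q"
        by (metis add_mult_distrib div_mult_mod_eq mult.assoc)
      then have e1: "y * (4 * q) + (a * q + x) = (2 * y + a div 2) * 2 ^ Suc k + ((a mod 2) * q + x)"
        and e2: "y * (4 * q) + (a * q + x) = (4 * y + a) * 2 ^ k + x"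
        by (simp_all add: q_def algebra_simps)
      have "bit_sign (Suc k) (y * (4 * q) + (a * q + x)) = (- 1) ^ (2 * y + a div 2)"
        unfolding e1 by (rule bit_sign_block[OF m])
      moreover have "bit_sign k (y * (4 * q) + (a * q + x)) = (- 1) ^ (4 * y + a)"
        unfolding e2 using that by (intro bit_sign_block) (simp add: q_def)
      ultimately show "bit_sign (Suc k) (y * (4 * q) + (a * q + x)) * bit_sign k (y * (4 * q) + (a * q + x))
       = (- 1) ^ a * (- 1) ^ (a div 2)"
        by (simp add: power_add power_mult)
    qed
    have "(\<Sum>x<2 ^ n. (bit_sign (Suc k) x * bit_sign k x) *\<^sub>R
          haar_coef (\<lambda>z. G (int z - int x)) (Suc k) (x div 2 ^ Suc (Suc k)))
      = (\<Sum>y<L. \<Sum>a<4. \<Sum>x<q. (bit_sign (Suc k) (y * (4 * q) + (a * q + x)) * bit_sign k (y * (4 * q) + (a * q + x))) *\<^sub>R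
          haar_coef (\<lambda>z. G (int z - int (y * (4 * q) + (a * q + x)))) (Suc k) ((y * (4 * q) + (a * q + x)) div 2 ^ Suc (Suc k)))"
      unfolding L by (simp only: sum_split_mult)
    also have "\<dots> = (\<Sum>y<L. \<Sum>a<4. \<Sum>x<q. ((- 1) ^ a * (- 1) ^ (a div 2)) *\<^sub>R (1 / (4 * q)) *\<^sub>R
          (\<Sum>b<4. (if b < 2 then 1 else - 1 :: real) *\<^sub>R (\<Sum>z<q. G ((int b - int a) * q + (int z - int x)))))"
    proof (intro sum.cong refl)
      fix y a x assume "a \<in> {..<(4::nat)}" "x \<in> {..<q}"
      then show "(bit_sign (Suc k) (y * (4 * q) + (a * q + x)) * bit_sign k (y * (4 * q) + (a * q + x))) *\<^sub>R
          haar_coef (\<lambda>z. G (int z - int (y * (4 * q) + (a * q + x)))) (Suc k) ((y * (4 * q) + (a * q + x)) div 2 ^ Suc (Suc k))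
        = ((- 1) ^ a * (- 1) ^ (a div 2)) *\<^sub>R (1 / (4 * q)) *\<^sub>R
          (\<Sum>b<4. (if b < 2 then 1 else - 1 :: real) *\<^sub>R (\<Sum>z<q. G ((int b - int a) * q + (int z - int x))))"
        by (simp only: sgn quot coef lessThan_iff) (simp add: algebra_simps)
    qed
    also have "\<dots> = L *\<^sub>R (1 / (4 * q)) *\<^sub>R (\<Sum>a<4. ((- 1) ^ a * (- 1) ^ (a div 2)) *\<^sub>R
          (\<Sum>b<4. (if b < 2 then 1 else - 1 :: real) *\<^sub>R V ((int b - int a) * q)))"
    proof -
      have "(\<Sum>x<q. \<Sum>b<4. (if b < 2 then 1 else - 1 :: real) *\<^sub>R (\<Sum>z<q. G ((int b - int a) * q + (int z - int x))))
        = (\<Sum>b<4. (if b < 2 then 1 else - 1 :: real) *\<^sub>R V ((int b - int a) * q))" for a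
        unfolding V_def scaleR_sum_right by (rule sum.swap)
      then show ?thesis
        by (simp add: scaleR_sum_right[symmetric] sum_constant_scaleR scaleR_left_commute mult.commute)
           (simp add: scaleR_sum_right mult_ac)
    qed
    \<comment> \<open>Of the lags b - a of the two sign patterns the even ones cancel; lags 1 and -1
      carry the weights 3 and -3, lags 3 and -3 the weights -1 and 1.\<close>
    also have "(\<Sum>a<4. ((- 1) ^ a * (- 1) ^ (a div 2)) *\<^sub>R
          (\<Sum>b<4. (if b < 2 then 1 else - 1 :: real) *\<^sub>R V ((int b - int a) * q)))
        = 3 *\<^sub>R (V q - V (- q)) - (V (3 * q) - V (- (3 * q)))"
    proof -
      have three: "3 *\<^sub>R u = u + u + u" for u :: 'a
        by (simp add: scaleR_left_distrib[of 1 2, simplified] scaleR_2 add.assoc)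
      show ?thesis unfolding sum4 three by (simp add: algebra_simps)
    qed
    also have "3 *\<^sub>R (V q - V (- q)) - (V (3 * q) - V (- (3 * q))) = (\<Sum>x<q. \<Sum>z<q.
         3 *\<^sub>R (G (q + (int z - int x)) - G (- (q + (int z - int x))))
         - (G (3 * q + (int z - int x)) - G (- (3 * q + (int z - int x)))))"
      unfolding V_def sum_antisym by (simp only: sum_subtractf scaleR_sum_right scaleR_right_diff_distrib)
    finally have "(\<Sum>x<2 ^ n. (bit_sign (Suc k) x * bit_sign k x) *\<^sub>R
          haar_coef (\<lambda>z. G (int z - int x)) (Suc k) (x div 2 ^ Suc (Suc k)))
      = L *\<^sub>R (1 / (4 * q)) *\<^sub>R (\<Sum>x<q. \<Sum>z<q.
         3 *\<^sub>R (G (q + (int z - int x)) - G (- (q + (int z - int x))))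
         - (G (3 * q + (int z - int x)) - G (- (3 * q + (int z - int x)))))" .
    moreover have "real (2 ^ n) = real (L * (4 * q))" by (simp only: L)
    then have "(2::real) ^ n = real L * (4 * 2 ^ k)" by (simp add: q_def)
    moreover have "L > 0" by (simp add: L_def)
    ultimately show ?thesis
      by (simp add: q_def power2_eq_square field_simps)
  qed
  then show ?thesis
    unfolding haar_shift_def scaleR_sum_right
    by (subst sum.swap) (simp add: scaleR_sum_right)
qed

section \<open>The truncated Hilbert transform\<close>

definition odd_part :: "(real \<Rightarrow> 'a::real_vector) \<Rightarrow> real \<Rightarrow> real \<Rightarrow> 'a" where
  "odd_part g \<tau> t = g (\<tau> + t) - g (\<tau> - t)"

text \<open>The right-hand side of \<open>haar_shift_average\<close> for the samples of g on the
  grid of mesh \<delta> through \<tau>.\<close>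

definition dyadic_conv :: "nat \<Rightarrow> real \<Rightarrow> (real \<Rightarrow> 'a::real_vector) \<Rightarrow> real \<Rightarrow> 'a" where
  "dyadic_conv n \<delta> g \<tau> = (\<Sum>k<n - 1. (1 / (16 * (2 ^ k)\<^sup>2)) *\<^sub>R (\<Sum>x<2 ^ k. \<Sum>z<2 ^ k.
     3 *\<^sub>R odd_part g \<tau> ((2 ^ k + (real z - real x)) * \<delta>) - odd_part g \<tau> ((3 * 2 ^ k + (real z - real x)) * \<delta>)))"

lemma dyadic_conv_eq_average:
  "dyadic_conv n \<delta> g \<tau> = (1 / 2 ^ n) *\<^sub>R (\<Sum>x<2 ^ n. haar_shift n (\<lambda>z. g (\<tau> - real x * \<delta> + real z * \<delta>)) x)"
proof -
  have "(1 / 2 ^ n) *\<^sub>R (\<Sum>x<2 ^ n. haar_shift n (\<lambda>z. (\<lambda>m. g (\<tau> + of_int m * \<delta>)) (int z - int x)) x) = dyadic_conv n \<delta> g \<tau>"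
    using haar_shift_average[of n "\<lambda>m. g (\<tau> + of_int m * \<delta>)"]
    by (simp add: dyadic_conv_def odd_part_def algebra_simps)
  then show ?thesis by (simp add: algebra_simps)
qed

lemma integral_mono_interval:
  fixes f :: "real \<Rightarrow> real"
  assumes "continuous_on UNIV f" "\<And>t. f t \<ge> 0" "c \<le> a" "b \<le> d"
  shows "integral {a..b} f \<le> integral {c..d} f"
  using assms by (intro integral_subset_le) (auto intro!: integrable_continuous_real intro: continuous_on_subset)

lemma continuous_on_haar_shift:
  fixes g :: "real \<Rightarrow> nat \<Rightarrow> 'a::real_normed_vector"
  assumes "\<And>z. continuous_on S (\<lambda>\<tau>. g \<tau> z)"
  shows "continuous_on S (\<lambda>\<tau>. haar_shift n (g \<tau>) x)"
  unfolding haar_shift_def haar_coef_def block_avg_def by (intro continuous_intros assms)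

text \<open>Integration over \<tau> shifts each of the 2^n translated grids to a common starting
  point \<beta>. For fixed \<beta> the sum over x is the full discrete norm of the Haar shift, to
  which \<open>haar_shift_bounded\<close> applies. Samples are taken up to 2^n \<delta> away, hence
  the larger interval.\<close>

lemma dyadic_conv_bounded:
  assumes "UMD TYPE('a::banach)"
  obtains D where "D \<ge> 0" "\<And>n \<delta> (g :: real \<Rightarrow> 'a) a b.
     continuous_on UNIV g \<Longrightarrow> \<delta> \<ge> 0 \<Longrightarrow>
     integral {a..b} (\<lambda>\<tau>. (norm (dyadic_conv n \<delta> g \<tau>))\<^sup>2)
       \<le> D * integral {a - 2 ^ n * \<delta>..b + 2 ^ n * \<delta>} (\<lambda>\<tau>. (norm (g \<tau>))\<^sup>2)"
proof -
  obtain D where D0: "D \<ge> 0" and D: "\<And>n (g :: nat \<Rightarrow> 'a).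
     (\<Sum>x<2 ^ n. (norm (haar_shift n g x))\<^sup>2) \<le> D * (\<Sum>x<2 ^ n. (norm (g x))\<^sup>2)"
    using haar_shift_bounded[OF assms] by blast
  have "integral {a..b} (\<lambda>\<tau>. (norm (dyadic_conv n \<delta> g \<tau>))\<^sup>2)
       \<le> D * integral {a - 2 ^ n * \<delta>..b + 2 ^ n * \<delta>} (\<lambda>\<tau>. (norm (g \<tau>))\<^sup>2)"
    if g: "continuous_on UNIV g" and \<delta>: "\<delta> \<ge> 0" for n \<delta> and g :: "real \<Rightarrow> 'a" and a b
  proof -
    let ?N = "(2::nat) ^ n"
    let ?c = "a - 2 ^ n * \<delta>" and ?d = "b + 2 ^ n * \<delta>"
    define s where "s x \<beta> = (norm (haar_shift n (\<lambda>z. g (\<beta> + real z * \<delta>)) x))\<^sup>2" for x \<beta>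
    have gc: "continuous_on S (\<lambda>\<beta>. g (h \<beta>))" if "continuous_on S h" for h and S :: "real set"
      using continuous_on_compose2[OF g that] by auto
    have s_cont: "continuous_on S (s x)" for S x
      unfolding s_def by (intro continuous_intros continuous_on_haar_shift gc)
    have s_cont': "continuous_on S (\<lambda>\<beta>. s x (\<beta> - c))" for S x c
      by (rule continuous_on_compose2[OF s_cont[of UNIV]]) (auto intro!: continuous_intros)
    have xN: "0 \<le> real x * \<delta>" "real x * \<delta> \<le> 2 ^ n * \<delta>" if "x < ?N" for x
      using that \<delta> by (auto intro!: mult_right_mono simp: less_imp_le of_nat_less_numeral_power_cancel_iff)
    have pt: "(norm (dyadic_conv n \<delta> g \<tau>))\<^sup>2 \<le> (1 / 2 ^ n) * (\<Sum>x<?N. s x (\<tau> - real x * \<delta>))" for \<tau>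
    proof -
      have "(norm (dyadic_conv n \<delta> g \<tau>))\<^sup>2
         = (1 / 2 ^ n)\<^sup>2 * (norm (\<Sum>x<?N. haar_shift n (\<lambda>z. g (\<tau> - real x * \<delta> + real z * \<delta>)) x))\<^sup>2"
        unfolding dyadic_conv_eq_average by (simp add: power_mult_distrib power_divide)
      also have "\<dots> \<le> (1 / 2 ^ n)\<^sup>2 * (real ?N * (\<Sum>x<?N. s x (\<tau> - real x * \<delta>)))"
        unfolding s_def using norm_sum_square_le[of _ "{..<?N}"] by (intro mult_left_mono) auto
      also have "\<dots> = (1 / 2 ^ n) * (\<Sum>x<?N. s x (\<tau> - real x * \<delta>))"
        by (simp add: power2_eq_square)
      finally show ?thesis .
    qed
    have cont: "continuous_on S (\<lambda>\<tau>. (norm (dyadic_conv n \<delta> g \<tau>))\<^sup>2)" for S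
      unfolding dyadic_conv_eq_average
      by (intro continuous_intros continuous_on_haar_shift gc)
    have "integral {a..b} (\<lambda>\<tau>. (norm (dyadic_conv n \<delta> g \<tau>))\<^sup>2)
       \<le> integral {a..b} (\<lambda>\<tau>. (1 / 2 ^ n) * (\<Sum>x<?N. s x (\<tau> - real x * \<delta>)))"
      by (intro integral_le integrable_continuous_real cont pt continuous_intros s_cont')
    also have "\<dots> = (1 / 2 ^ n) * (\<Sum>x<?N. integral {a..b} (\<lambda>\<tau>. s x (\<tau> - real x * \<delta>)))"
      by (subst integral_mult_right, subst integral_sum)
         (auto intro!: integrable_continuous_real s_cont')
    also have "\<dots> = (1 / 2 ^ n) * (\<Sum>x<?N. integral {a - real x * \<delta>..b - real x * \<delta>} (s x))"
      using integral_shift_real_ivl[of "a - c" "- c" "b - c" "s x" for x c, symmetric] by simp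
    also have "\<dots> \<le> (1 / 2 ^ n) * (\<Sum>x<?N. integral {?c..b} (s x))"
      using xN by (intro mult_left_mono sum_mono integral_mono_interval s_cont) (auto simp: s_def)
    also have "\<dots> = (1 / 2 ^ n) * integral {?c..b} (\<lambda>\<beta>. \<Sum>x<?N. s x \<beta>)"
      by (subst integral_sum) (auto intro!: integrable_continuous_real s_cont)
    also have "\<dots> \<le> (1 / 2 ^ n) * integral {?c..b} (\<lambda>\<beta>. D * (\<Sum>z<?N. (norm (g (\<beta> + real z * \<delta>)))\<^sup>2))"
      unfolding s_def
      by (intro mult_left_mono integral_le integrable_continuous_real continuous_intros gc D
            continuous_on_haar_shift) auto
    also have "\<dots> = (1 / 2 ^ n) * (D * (\<Sum>z<?N. integral {?c..b} (\<lambda>\<beta>. (norm (g (\<beta> + real z * \<delta>)))\<^sup>2)))"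
      by (subst integral_mult_right, subst integral_sum)
         (auto intro!: integrable_continuous_real continuous_intros gc)
    also have "\<dots> = (1 / 2 ^ n) * (D * (\<Sum>z<?N. integral {?c + real z * \<delta>..b + real z * \<delta>} (\<lambda>\<beta>. (norm (g \<beta>))\<^sup>2)))"
      using integral_shift_real_ivl[of "u + c" c "v + c" "\<lambda>\<beta>. (norm (g \<beta>))\<^sup>2" for u v c] by simp
    also have "\<dots> \<le> (1 / 2 ^ n) * (D * (\<Sum>z<?N. integral {?c..?d} (\<lambda>\<beta>. (norm (g \<beta>))\<^sup>2)))"
      using xN D0 by (intro mult_left_mono sum_mono integral_mono_interval continuous_intros gc) auto
    also have "\<dots> = D * integral {?c..?d} (\<lambda>\<beta>. (norm (g \<beta>))\<^sup>2)" by simp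
    finally show ?thesis .
  qed
  with D0 show ?thesis by (rule that)
qed

text \<open>The integral of w (f - s)^2 is a nonnegative quadratic polynomial in s; if the mass of w
  is positive, its minimum gives the claim.\<close>

lemma integral_Cauchy_Schwarz_weighted:
  fixes w f :: "real \<Rightarrow> real"
  assumes w: "continuous_on {a..b} w" "\<And>t. t \<in> {a..b} \<Longrightarrow> w t \<ge> 0" and f: "continuous_on {a..b} f"
  shows "(integral {a..b} (\<lambda>t. w t * f t))\<^sup>2 \<le> integral {a..b} w * integral {a..b} (\<lambda>t. w t * (f t)\<^sup>2)"
proof -
  let ?W = "integral {a..b} w" and ?F = "integral {a..b} (\<lambda>t. w t * f t)"
  let ?S = "integral {a..b} (\<lambda>t. w t * (f t)\<^sup>2)"
  have W0: "?W \<ge> 0" using w by (intro integral_nonneg integrable_continuous_real) auto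
  have quad: "?S - 2 * s * ?F + s\<^sup>2 * ?W \<ge> 0" for s
  proof -
    have "0 \<le> integral {a..b} (\<lambda>t. w t * (f t - s)\<^sup>2)"
      using w by (intro integral_nonneg integrable_continuous_real continuous_intros f) auto
    also have "\<dots> = integral {a..b} (\<lambda>t. w t * (f t)\<^sup>2 - (2 * s) * (w t * f t) + s\<^sup>2 * w t)"
      by (simp add: power2_eq_square algebra_simps)
    also have "\<dots> = ?S - 2 * s * ?F + s\<^sup>2 * ?W"
      using w(1) f
      by (subst integral_add integral_diff integral_mult_right;
           (intro integrable_continuous_real continuous_intros)?; simp?)+
    finally show ?thesis .
  qed
  show ?thesis
  proof (cases "?W = 0")
    case True
    have "?F = 0"
    proof (rule ccontr)
      assume "?F \<noteq> 0"
      \<comment> \<open>For mass 0 the polynomial is affine in s, and this choice of s makes it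
        -1.\<close>
      then show False using quad[of "(?S + 1) / (2 * ?F)"] True by simp
    qed
    with True show ?thesis by simp
  next
    case False
    then show ?thesis using quad[of "?F / ?W"] W0
      by (simp add: power2_eq_square field_simps)
  qed
qed


section \<open>The kernel of the averaged Haar shift\<close>

definition octave :: "real \<Rightarrow> real \<Rightarrow> real" where
  "octave y m = (if m < y \<and> y \<le> 2 * m then 1 else 0)"

text \<open>Lags and weights are those of \<open>haar_shift_average\<close> at block length q. Their
  total mass (3 - 1) / 16 is the 1 / 8 that survives in the limit.\<close>

definition corr :: "nat \<Rightarrow> (real \<Rightarrow> real) \<Rightarrow> real" where
  "corr q F = (1 / (16 * (real q)\<^sup>2)) * (\<Sum>x<q. \<Sum>z<q. 3 * F (real q + (real z - real x)) - F (3 * real q + (real z - real x)))"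

text \<open>A lag m dilated by some r in [1, 2] passes through y exactly when
  \<open>octave y m\<close> is 1, up to an endpoint. So this is the kernel of
  \<open>averaged_conv\<close> without its factor 1 / t, at distance y in units of 2^-n.\<close>

definition dyadic_kernel :: "nat \<Rightarrow> real \<Rightarrow> real" where
  "dyadic_kernel n y = (\<Sum>k<n - 1. corr (2 ^ k) (octave y))"

definition step_fun :: "real \<Rightarrow> real \<Rightarrow> real" where
  "step_fun y m = (if y \<le> m then 1 else 0)"

lemma corr_diff: "corr q (\<lambda>m. F m - G m) = corr q F - corr q G"
proof -
  have "(\<Sum>x<q. \<Sum>z<q. 3 * (F (a x z) - G (a x z)) - (F (b x z) - G (b x z)))
    = (\<Sum>x<q. \<Sum>z<q. 3 * F (a x z) - F (b x z)) - (\<Sum>x<q. \<Sum>z<q. 3 * G (a x z) - G (b x z))" for a b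
    unfolding sum_subtractf[symmetric] by (intro sum.cong refl) simp
  then show ?thesis by (simp add: corr_def diff_divide_distrib)
qed

lemma corr_cong:
  assumes "\<And>m. m > 0 \<Longrightarrow> F m = G m"
  shows "corr q F = corr q G"
  unfolding corr_def
  by (intro arg_cong2[where f="(*)"] refl sum.cong arg_cong2[where f="(-)"] assms) auto

lemma corr_const: "q > 0 \<Longrightarrow> corr q (\<lambda>_. 1) = 1 / 8"
  by (simp add: corr_def power2_eq_square)

lemma count_close_le_2:
  assumes "\<And>z z' :: nat. P z \<Longrightarrow> P z' \<Longrightarrow> z \<le> z' + 1"
  shows "(\<Sum>z<q. if P z then 1 else 0 :: real) \<le> 2"
proof -
  let ?S = "{z. z < q \<and> P z}"
  have "(\<Sum>z<q. if P z then 1 else 0 :: real) = real (card ?S)"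
    by (simp add: sum.If_cases Int_def)
  also have "card ?S \<le> 2"
  proof (cases "?S = {}")
    case True
    then show ?thesis by (simp only: card.empty)
  next
    case False
    have "Min ?S \<in> ?S" using False by (intro Min_in) auto
    then have "z \<in> {Min ?S, Min ?S + 1}" if "z \<in> ?S" for z
    proof -
      have "Min ?S \<le> z" using that by (intro Min_le) auto
      moreover have "z \<le> Min ?S + 1" using assms[of z "Min ?S"] \<open>Min ?S \<in> ?S\<close> that by blast
      ultimately show ?thesis by auto
    qed
    then have "?S \<subseteq> {Min ?S, Min ?S + 1}" by blast
    then have "card ?S \<le> card {Min ?S, Min ?S + 1}" by (intro card_mono) auto
    then show ?thesis by simp
  qed
  finally show ?thesis by simp
qed

text \<open>If the lags scaled exactly, the two correlations would agree. Doubling q splits every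
  pair (x, z) into four, whose lags are perturbed by at most 1, and this changes the step only when
  the doubled lag is within 1 of y. For fixed x that concerns at most two z, hence 2 q of the q^2
  pairs; the weights 3 and 1 then give 8 q / (16 q^2) = 1 / (2 q).\<close>

lemma corr_refine:
  assumes q: "q > 0"
  shows "\<bar>corr q (\<lambda>m. step_fun y (2 * m)) - corr (2 * q) (step_fun y)\<bar> \<le> (if y \<le> 8 * real q + 1 then 1 / (2 * real q) else 0)"
proof -
  let ?F = "step_fun y"
  define J where "J m = (if \<bar>2 * m - y\<bar> \<le> 1 then 1 else 0 :: real)" for m
  define h where "h a x z = a * real q + (real z - real x)" for a and x z :: nat
  have two: "corr (2 * q) ?F = (1 / (64 * (real q)\<^sup>2)) * (\<Sum>x<q. \<Sum>z<q. \<Sum>e<2. \<Sum>e'<2.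
      3 * ?F (2 * h 1 x z + (real e' - real e)) - ?F (2 * h 3 x z + (real e' - real e)))"
  proof -
    have "(\<Sum>x<q * 2. \<Sum>z<q * 2. 3 * ?F (real (q * 2) + (real z - real x)) - ?F (3 * real (q * 2) + (real z - real x)))
      = (\<Sum>x<q. \<Sum>e<2. \<Sum>z<q. \<Sum>e'<2. 3 * ?F (real (q * 2) + (real (z * 2 + e') - real (x * 2 + e)))
           - ?F (3 * real (q * 2) + (real (z * 2 + e') - real (x * 2 + e))))"
      by (simp only: sum_split_mult)
    also have "\<dots> = (\<Sum>x<q. \<Sum>z<q. \<Sum>e<2. \<Sum>e'<2. 3 * ?F (real (q * 2) + (real (z * 2 + e') - real (x * 2 + e)))
           - ?F (3 * real (q * 2) + (real (z * 2 + e') - real (x * 2 + e))))"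
      by (intro sum.cong refl sum.swap)
    also have "\<dots> = (\<Sum>x<q. \<Sum>z<q. \<Sum>e<2. \<Sum>e'<2.
      3 * ?F (2 * h 1 x z + (real e' - real e)) - ?F (2 * h 3 x z + (real e' - real e)))"
      by (intro sum.cong refl arg_cong2[where f="(-)"] arg_cong2[where f="(*)"] arg_cong[where f="?F"])
         (auto simp: h_def)
    finally show ?thesis by (simp add: corr_def mult.commute power_mult_distrib)
  qed
  have one: "corr q (\<lambda>m. ?F (2 * m)) = (1 / (64 * (real q)\<^sup>2)) * (\<Sum>x<q. \<Sum>z<q. \<Sum>e<(2::nat). \<Sum>e'<(2::nat).
      3 * ?F (2 * h 1 x z) - ?F (2 * h 3 x z))"
    by (simp add: corr_def h_def sum_distrib_left sum_divide_distrib diff_divide_distrib algebra_simps)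
  have J: "\<bar>?F (2 * m) - ?F (2 * m + (real e' - real e))\<bar> \<le> J m" if "e < 2" "e' < 2" for m and e e' :: nat
  proof -
    have "real e' - real e \<le> 1" "real e - real e' \<le> 1" using that by auto
    then show ?thesis by (auto simp: step_fun_def J_def)
  qed
  have Jsum: "(\<Sum>x<q. \<Sum>z<q. J (h a x z)) \<le> 2 * real q" for a
  proof -
    have "(\<Sum>z<q. J (h a x z)) \<le> 2" for x
      unfolding J_def h_def by (rule count_close_le_2) (auto simp: abs_le_iff)
    then have "(\<Sum>x<q. \<Sum>z<q. J (h a x z)) \<le> (\<Sum>x<q. 2)" by (intro sum_mono)
    then show ?thesis by simp
  qed
  have "\<bar>corr q (\<lambda>m. ?F (2 * m)) - corr (2 * q) ?F\<bar> = (1 / (64 * (real q)\<^sup>2)) *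
     \<bar>\<Sum>x<q. \<Sum>z<q. \<Sum>e<(2::nat). \<Sum>e'<(2::nat). 3 * (?F (2 * h 1 x z) - ?F (2 * h 1 x z + (real e' - real e)))
        - (?F (2 * h 3 x z) - ?F (2 * h 3 x z + (real e' - real e)))\<bar>"
    unfolding one two right_diff_distrib[symmetric] abs_mult sum_subtractf[symmetric]
    by (simp add: algebra_simps)
  also have "\<dots> \<le> (1 / (64 * (real q)\<^sup>2)) * (\<Sum>x<q. \<Sum>z<q. \<Sum>e<(2::nat). \<Sum>e'<(2::nat). 3 * J (h 1 x z) + J (h 3 x z))"
  proof (rule mult_left_mono)
    show "\<bar>\<Sum>x<q. \<Sum>z<q. \<Sum>e<(2::nat). \<Sum>e'<(2::nat). 3 * (?F (2 * h 1 x z) - ?F (2 * h 1 x z + (real e' - real e)))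
        - (?F (2 * h 3 x z) - ?F (2 * h 3 x z + (real e' - real e)))\<bar>
       \<le> (\<Sum>x<q. \<Sum>z<q. \<Sum>e<(2::nat). \<Sum>e'<(2::nat). 3 * J (h 1 x z) + J (h 3 x z))"
    proof (intro order_trans[OF sum_abs] sum_mono)
      fix x z e e' assume "e \<in> {..<(2::nat)}" "e' \<in> {..<(2::nat)}"
      then show "\<bar>3 * (?F (2 * h 1 x z) - ?F (2 * h 1 x z + (real e' - real e)))
        - (?F (2 * h 3 x z) - ?F (2 * h 3 x z + (real e' - real e)))\<bar> \<le> 3 * J (h 1 x z) + J (h 3 x z)"
        using J[of e e' "h 1 x z"] J[of e e' "h 3 x z"] by auto
    qed
  qed simp
  also have "\<dots> = (1 / (16 * (real q)\<^sup>2)) * (3 * (\<Sum>x<q. \<Sum>z<q. J (h 1 x z)) + (\<Sum>x<q. \<Sum>z<q. J (h 3 x z)))"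
    by (simp add: sum.distrib sum_distrib_left[symmetric]) (use q in \<open>simp add: field_simps\<close>)
  finally have bd: "\<bar>corr q (\<lambda>m. ?F (2 * m)) - corr (2 * q) ?F\<bar>
     \<le> (1 / (16 * (real q)\<^sup>2)) * (3 * (\<Sum>x<q. \<Sum>z<q. J (h 1 x z)) + (\<Sum>x<q. \<Sum>z<q. J (h 3 x z)))" .
  show ?thesis
  proof (cases "y \<le> 8 * real q + 1")
    case True
    have "(1 / (16 * (real q)\<^sup>2)) * (3 * (\<Sum>x<q. \<Sum>z<q. J (h 1 x z)) + (\<Sum>x<q. \<Sum>z<q. J (h 3 x z)))
      \<le> (1 / (16 * (real q)\<^sup>2)) * (3 * (2 * real q) + 2 * real q)"
      using Jsum[of 1] Jsum[of 3] by (intro mult_left_mono) auto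
    also have "\<dots> = 1 / (2 * real q)" using q by (simp add: power2_eq_square field_simps)
    finally show ?thesis using bd True by simp
  next
    case False
    \<comment> \<open>Since z - x < q and the largest multiple of q is 3 q, every doubled lag is
      below 8 q, out of reach of y.\<close>
    have "J (h a x z) = 0" if "x < q" "z < q" "a \<le> 3" for a x z
    proof -
      have "a * real q \<le> 3 * real q" using that by (intro mult_right_mono) auto
      moreover have "real z \<le> real q" "0 \<le> real x" using that by auto
      ultimately have "2 * h a x z + 1 < y" using False unfolding h_def by argo
      then show ?thesis by (simp add: J_def)
    qed
    then have "(\<Sum>x<q. \<Sum>z<q. J (h a x z)) = 0" if "a \<le> 3" for a
      using that by (intro sum.neutral ballI) auto
    then show ?thesis using bd False by simp
  qed
qed

lemma geometric_tail:
  assumes a: "a > (0::real)"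
  shows "(\<Sum>k<m. if a \<le> 2 ^ k then 1 / 2 ^ k else 0 :: real) \<le> 2 / a"
proof -
  \<comment> \<open>The bound is strengthened by 2 / 2^m, the sum of all later terms, so that the
    induction closes.\<close>
  have "(a \<le> 2 ^ m \<longrightarrow> (\<Sum>k<m. if a \<le> 2 ^ k then 1 / 2 ^ k else 0 :: real) \<le> 2 / a - 2 / 2 ^ m) \<and>
    (2 ^ m < a \<longrightarrow> (\<Sum>k<m. if a \<le> 2 ^ k then 1 / 2 ^ k else 0 :: real) = 0)"
  proof (induction m)
    case 0
    then show ?case using a by (auto simp: field_simps)
  next
    case (Suc m)
    have p: "(2::real) ^ m \<le> 2 ^ Suc m" "(2::real) ^ m > 0" by simp_all
    have e: "2 / 2 ^ Suc m = 1 / (2::real) ^ m" by simp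
    show ?case
    proof (cases "a \<le> 2 ^ m")
      case True
      let ?S = "\<Sum>k<m. if a \<le> 2 ^ k then 1 / 2 ^ k else 0 :: real"
      have "?S \<le> 2 / a - 2 * (1 / 2 ^ m)" using Suc True by simp
      moreover have "(\<Sum>k<Suc m. if a \<le> 2 ^ k then 1 / 2 ^ k else 0 :: real) = ?S + 1 / 2 ^ m"
        using True by simp
      ultimately have "(\<Sum>k<Suc m. if a \<le> 2 ^ k then 1 / 2 ^ k else 0 :: real) \<le> 2 / a - 2 / 2 ^ Suc m"
        unfolding e by linarith
      then show ?thesis using True p by linarith
    next
      case False
      have "2 / 2 ^ Suc m \<le> 2 / a" if "a \<le> 2 ^ Suc m" using that a by (intro divide_left_mono) auto
      then show ?thesis using Suc False p by auto
    qed
  qed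
  moreover have "0 \<le> 2 / (2::real) ^ m" "0 \<le> 2 / a" using a by auto
  ultimately show ?thesis by linarith
qed

text \<open>For positive m the octave is a step at 2 m minus the step at m. Up to refinement errors
  the sum over the scales therefore telescopes to the correlation at the top scale Q, nearly the
  full mass 1 / 8, minus that at scale 1. The refinement errors add up to 9 / y, scale 1 costs 1 /
  y, and the lags that are below y even at scale Q cost y / 2^n.\<close>

lemma dyadic_kernel_approx:
  assumes y: "y \<ge> 1" and n: "n \<ge> 1"
  shows "\<bar>dyadic_kernel n y - 1 / 8\<bar> \<le> 10 / y + y / 2 ^ n"
proof -
  let ?F = "step_fun y"
  define Q :: nat where "Q = 2 ^ (n - 1)"
  have Q: "Q > 0" "2 * real Q = 2 ^ n"
    using n by (auto simp: Q_def simp flip: power_Suc)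
  have oct: "corr q (octave y) = corr q (\<lambda>m. ?F (2 * m)) - corr q ?F" for q
  proof -
    have "corr q (octave y) = corr q (\<lambda>m. ?F (2 * m) - ?F m)"
      by (intro corr_cong) (auto simp: octave_def step_fun_def)
    then show ?thesis by (simp add: corr_diff)
  qed
  have "dyadic_kernel n y = (\<Sum>k<n - 1. (corr (2 ^ k) (\<lambda>m. ?F (2 * m)) - corr (2 * 2 ^ k) ?F) + (corr (2 ^ Suc k) ?F - corr (2 ^ k) ?F))"
    unfolding dyadic_kernel_def by (intro sum.cong) (auto simp: oct)
  also have "\<dots> = (\<Sum>k<n - 1. corr (2 ^ k) (\<lambda>m. ?F (2 * m)) - corr (2 * 2 ^ k) ?F) + (corr Q ?F - corr 1 ?F)"
    unfolding sum.distrib by (subst sum_lessThan_telescope[where f="\<lambda>k. corr (2 ^ k) ?F"]) (simp add: Q_def)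
  finally have main: "dyadic_kernel n y = \<dots>" .
  have "\<bar>\<Sum>k<n - 1. corr (2 ^ k) (\<lambda>m. ?F (2 * m)) - corr (2 * 2 ^ k) ?F\<bar>
     \<le> (\<Sum>k<n - 1. (1 / 2) * (if y / 9 \<le> 2 ^ k then 1 / 2 ^ k else 0))"
  proof (intro order_trans[OF sum_abs] sum_mono)
    fix k
    \<comment> \<open>The refinement error vanishes unless y \<le> 8 * 2^k + 1, which is at most 9 *
      2^k; this is the origin of 9.\<close>
    have "(1::real) \<le> 2 ^ k" by simp
    then have "y / 9 \<le> 2 ^ k" if "y \<le> 8 * 2 ^ k + 1" using that by linarith
    moreover have "\<bar>corr (2 ^ k) (\<lambda>m. ?F (2 * m)) - corr (2 * 2 ^ k) ?F\<bar> \<le> (if y \<le> 8 * 2 ^ k + 1 then 1 / (2 * 2 ^ k) else 0)"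
      using corr_refine[of "2 ^ k" y] by (auto split: if_splits)
    ultimately show "\<bar>corr (2 ^ k) (\<lambda>m. ?F (2 * m)) - corr (2 * 2 ^ k) ?F\<bar> \<le> (1 / 2) * (if y / 9 \<le> 2 ^ k then 1 / 2 ^ k else 0)"
      by (cases "y \<le> 8 * 2 ^ k + 1") auto
  qed
  also have "\<dots> \<le> (1 / 2) * (2 / (y / 9))"
    unfolding sum_distrib_left[symmetric] using y by (intro mult_left_mono geometric_tail) auto
  finally have e1: "\<bar>\<Sum>k<n - 1. corr (2 ^ k) (\<lambda>m. ?F (2 * m)) - corr (2 * 2 ^ k) ?F\<bar> \<le> 9 / y" by simp
  have e2: "\<bar>corr 1 ?F\<bar> \<le> 1 / y"
    using y by (auto simp: corr_def step_fun_def field_simps)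
  have e3: "\<bar>corr Q ?F - 1 / 8\<bar> \<le> y / 2 ^ n"
  proof -
    define H where "H m = (if m < y then 1 else 0 :: real)" for m
    have "1 / 8 - corr Q ?F = corr Q (\<lambda>m. 1 - ?F m)"
      using Q by (simp add: corr_diff corr_const)
    also have "(\<lambda>m. 1 - ?F m) = H" by (auto simp: H_def step_fun_def)
    finally have eq: "1 / 8 - corr Q ?F = corr Q H" .
    \<comment> \<open>Because x < Q, the lag exceeds z, so only the z below y are counted.\<close>
    have cnt: "(\<Sum>z<Q. H (a * real Q + (real z - real x))) \<le> y + 1" if "x < Q" "a \<ge> 1" for x a
    proof -
      have "real Q \<le> a * real Q" using that by simp
      then have "(\<Sum>z<Q. H (a * real Q + (real z - real x))) \<le> (\<Sum>z<Q. if z < nat \<lceil>y\<rceil> then 1 else 0)"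
      proof (intro sum_mono)
        fix z
        have "z < nat \<lceil>y\<rceil>" if "a * real Q + (real z - real x) < y"
        proof -
          have "real z < y" using that \<open>real Q \<le> a * real Q\<close> \<open>x < Q\<close> by linarith
          then show ?thesis by linarith
        qed
        then show "H (a * real Q + (real z - real x)) \<le> (if z < nat \<lceil>y\<rceil> then 1 else 0)"
          by (auto simp: H_def)
      qed
      also have "\<dots> = real (card {z. z < Q \<and> z < nat \<lceil>y\<rceil>})"
        by (simp add: sum.If_cases Int_def)
      also have "card {z. z < Q \<and> z < nat \<lceil>y\<rceil>} \<le> card {..<nat \<lceil>y\<rceil>}" by (intro card_mono) auto
      also have "real (card {..<nat \<lceil>y\<rceil>}) \<le> y + 1" using y by simp
      finally show ?thesis by simp
    qed
    have "\<bar>corr Q H\<bar> \<le> (1 / (16 * (real Q)\<^sup>2)) * (\<Sum>x<Q. \<Sum>z<Q. 3 * H (1 * real Q + (real z - real x)) + H (3 * real Q + (real z - real x)))"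
      unfolding corr_def abs_mult
      by (intro mult_mono order_trans[OF sum_abs] sum_mono sum_nonneg) (auto simp: H_def)
    also have "\<dots> \<le> (1 / (16 * (real Q)\<^sup>2)) * (\<Sum>x<Q. 4 * (y + 1))"
    proof (intro mult_left_mono sum_mono)
      fix x assume "x \<in> {..<Q}"
      then show "(\<Sum>z<Q. 3 * H (1 * real Q + (real z - real x)) + H (3 * real Q + (real z - real x))) \<le> 4 * (y + 1)"
        using cnt[of x 1] cnt[of x 3] by (simp add: sum.distrib sum_distrib_left[symmetric])
    qed auto
    also have "\<dots> = (y + 1) / (4 * real Q)" using Q(1) by (simp add: power2_eq_square field_simps)
    also have "\<dots> \<le> (2 * y) / (4 * real Q)" using y by (intro divide_right_mono) auto
    also have "\<dots> = y / 2 ^ n" unfolding Q(2)[symmetric] by simp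
    finally show ?thesis using eq by linarith
  qed
  have "10 / y = 9 / y + 1 / y" by (simp add: field_simps)
  then show ?thesis unfolding main using e1 e2 e3 by linarith
qed


section \<open>Averaging over dilations of the grid\<close>

definition averaged_conv :: "nat \<Rightarrow> (real \<Rightarrow> 'a::banach) \<Rightarrow> real \<Rightarrow> 'a" where
  "averaged_conv n g \<tau> = integral {1..2} (\<lambda>r. (1 / r) *\<^sub>R dyadic_conv n (r / 2 ^ n) g \<tau>)"

lemma continuous_on_dyadic_conv:
  fixes g :: "real \<Rightarrow> 'a::real_normed_vector"
  assumes g: "continuous_on UNIV g" and "continuous_on S p" "continuous_on S q"
  shows "continuous_on S (\<lambda>u. dyadic_conv n (p u) g (q u))"
  unfolding dyadic_conv_def odd_part_def
  by (intro continuous_intros continuous_on_compose2[OF g] assms(2,3)) auto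

text \<open>With mesh r / 2^n a whole grid has length r \<le> 2, which is the enlargement of the
  interval. The rest is Cauchy-Schwarz in r and an exchange of integrals.\<close>

lemma averaged_conv_bounded:
  assumes "UMD TYPE('a::banach)"
  obtains D where "D \<ge> 0" "\<And>n (g :: real \<Rightarrow> 'a) a b. continuous_on UNIV g \<Longrightarrow>
     continuous_on UNIV (averaged_conv n g) \<and>
     integral {a..b} (\<lambda>\<tau>. (norm (averaged_conv n g \<tau>))\<^sup>2)
       \<le> D * integral {a - 2..b + 2} (\<lambda>\<tau>. (norm (g \<tau>))\<^sup>2)"
proof -
  obtain D where D0: "D \<ge> 0" and D: "\<And>n \<delta> (g :: real \<Rightarrow> 'a) a b.
     continuous_on UNIV g \<Longrightarrow> \<delta> \<ge> 0 \<Longrightarrow>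
     integral {a..b} (\<lambda>\<tau>. (norm (dyadic_conv n \<delta> g \<tau>))\<^sup>2)
       \<le> D * integral {a - 2 ^ n * \<delta>..b + 2 ^ n * \<delta>} (\<lambda>\<tau>. (norm (g \<tau>))\<^sup>2)"
    using dyadic_conv_bounded[OF assms] by blast
  have "continuous_on UNIV (averaged_conv n g) \<and>
     integral {a..b} (\<lambda>\<tau>. (norm (averaged_conv n g \<tau>))\<^sup>2)
       \<le> D * integral {a - 2..b + 2} (\<lambda>\<tau>. (norm (g \<tau>))\<^sup>2)"
    if g: "continuous_on UNIV g" for n and g :: "real \<Rightarrow> 'a" and a b
  proof
    let ?Q = "\<lambda>r \<tau>. dyadic_conv n (r / 2 ^ n) g \<tau>"
    show cont: "continuous_on UNIV (averaged_conv n g)"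
      unfolding averaged_conv_def box_real(2)[symmetric]
      by (rule integral_continuous_on_param)
         (auto simp: case_prod_beta intro!: continuous_intros continuous_on_dyadic_conv[OF g])
    have Qc: "continuous_on S (\<lambda>r. ?Q r \<tau>)" "continuous_on S (\<lambda>\<tau>. ?Q r \<tau>)" for S \<tau> r
      by (intro continuous_on_dyadic_conv[OF g] continuous_intros; simp)+
    have Qc2: "continuous_on S (\<lambda>(\<tau>, r). (norm (?Q r \<tau>))\<^sup>2)" for S
      unfolding case_prod_beta by (intro continuous_intros continuous_on_dyadic_conv[OF g]) auto
    have pt: "(norm (averaged_conv n g \<tau>))\<^sup>2 \<le> integral {1..2} (\<lambda>r. (norm (?Q r \<tau>))\<^sup>2)" for \<tau>
    proof -
      have "norm (averaged_conv n g \<tau>) \<le> integral {1..2} (\<lambda>r. 1 * norm (?Q r \<tau>))"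
        unfolding averaged_conv_def
      proof (intro integral_norm_bound_integral integrable_continuous_real continuous_intros Qc)
        fix r :: real assume "r \<in> {1..2}"
        then show "norm ((1 / r) *\<^sub>R ?Q r \<tau>) \<le> 1 * norm (?Q r \<tau>)"
          by (auto simp: divide_le_eq mult_le_cancel_left1 intro!: mult_right_mono)
      qed auto
      then have "(norm (averaged_conv n g \<tau>))\<^sup>2 \<le> (integral {1..2} (\<lambda>r. 1 * norm (?Q r \<tau>)))\<^sup>2"
        by (intro power_mono) auto
      also have "\<dots> \<le> integral {1..2::real} (\<lambda>_. 1) * integral {1..2} (\<lambda>r. 1 * (norm (?Q r \<tau>))\<^sup>2)"
        by (intro integral_Cauchy_Schwarz_weighted continuous_intros Qc) auto
      finally show ?thesis by simp
    qed
    have "integral {a..b} (\<lambda>\<tau>. (norm (averaged_conv n g \<tau>))\<^sup>2)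
       \<le> integral {a..b} (\<lambda>\<tau>. integral {1..2} (\<lambda>r. (norm (?Q r \<tau>))\<^sup>2))"
    proof (intro integral_le integrable_continuous_real pt)
      show "continuous_on {a..b} (\<lambda>\<tau>. (norm (averaged_conv n g \<tau>))\<^sup>2)"
        by (intro continuous_intros continuous_on_subset[OF cont]) auto
      show "continuous_on {a..b} (\<lambda>\<tau>. integral {1..2} (\<lambda>r. (norm (?Q r \<tau>))\<^sup>2))"
        unfolding box_real(2)[symmetric]
        by (rule integral_continuous_on_param) (rule Qc2)
    qed
    also have "\<dots> = integral {1..2} (\<lambda>r. integral {a..b} (\<lambda>\<tau>. (norm (?Q r \<tau>))\<^sup>2))"
      unfolding box_real(2)[symmetric] by (rule integral_swap_continuous) (rule Qc2)
    also have "\<dots> \<le> integral {1..2::real} (\<lambda>r. D * integral {a - 2..b + 2} (\<lambda>\<tau>. (norm (g \<tau>))\<^sup>2))"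
    proof (intro integral_le)
      have "continuous_on (cbox 1 2) (\<lambda>r. integral (cbox a b) (\<lambda>\<tau>. (norm (?Q r \<tau>))\<^sup>2))"
        by (rule integral_continuous_on_param)
          (auto simp: case_prod_beta intro!: continuous_intros continuous_on_dyadic_conv[OF g])
      then show "(\<lambda>r. integral {a..b} (\<lambda>\<tau>. (norm (?Q r \<tau>))\<^sup>2)) integrable_on {1..2}"
        by (intro integrable_continuous_real) simp
    next
      fix r :: real assume r: "r \<in> {1..2}"
      have "integral {a..b} (\<lambda>\<tau>. (norm (?Q r \<tau>))\<^sup>2)
        \<le> D * integral {a - 2 ^ n * (r / 2 ^ n)..b + 2 ^ n * (r / 2 ^ n)} (\<lambda>\<tau>. (norm (g \<tau>))\<^sup>2)"
        using r by (intro D g) auto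
      also have "\<dots> \<le> D * integral {a - 2..b + 2} (\<lambda>\<tau>. (norm (g \<tau>))\<^sup>2)"
        using r D0 by (intro mult_left_mono integral_mono_interval continuous_intros g) auto
      finally show "integral {a..b} (\<lambda>\<tau>. (norm (?Q r \<tau>))\<^sup>2) \<le> D * integral {a - 2..b + 2} (\<lambda>\<tau>. (norm (g \<tau>))\<^sup>2)" .
    qed auto
    finally show "integral {a..b} (\<lambda>\<tau>. (norm (averaged_conv n g \<tau>))\<^sup>2)
       \<le> D * integral {a - 2..b + 2} (\<lambda>\<tau>. (norm (g \<tau>))\<^sup>2)" by simp
  qed
  with D0 show ?thesis by (rule that)
qed

text \<open>The measure dr / r is invariant under dilations: for each lag m the substitution t = m r
  / 2^n turns the average over r into an integral against dt / t over the octave from m / 2^n to 2 m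
  / 2^n. Summed with the weights of the lags, the octaves make up
  \<open>dyadic_kernel\<close>.\<close>

lemma averaged_conv_has_integral:
  fixes g :: "real \<Rightarrow> 'a::banach"
  assumes g: "continuous_on UNIV g"
  shows "((\<lambda>t. (dyadic_kernel n (2 ^ n * t) / t) *\<^sub>R odd_part g \<tau> t) has_integral averaged_conv n g \<tau>) {1 / 2 ^ n..2}"
proof -
  let ?\<delta> = "1 / (2::real) ^ n"
  let ?f = "\<lambda>t. (1 / t) *\<^sub>R odd_part g \<tau> t"
  have oc: "continuous_on S (\<lambda>u. odd_part g \<tau> (h u))" if "continuous_on S h" for h and S :: "real set"
    unfolding odd_part_def using that by (intro continuous_intros continuous_on_compose2[OF g]) auto
  have oct: "((\<lambda>t. octave (2 ^ n * t) m *\<^sub>R ?f t) has_integral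
       integral {1..2} (\<lambda>r. (1 / r) *\<^sub>R odd_part g \<tau> (m * (r / 2 ^ n)))) {?\<delta>..2}"
    if m: "1 \<le> m" "m \<le> 2 ^ n" for m
  proof -
    let ?s = "m / 2 ^ n"
    have s: "?s > 0" "?\<delta> \<le> ?s" "2 * ?s \<le> 2" using m by (auto simp: field_simps)
    have "((\<lambda>r. (1 / r) *\<^sub>R odd_part g \<tau> (m * (r / 2 ^ n))) has_integral
       integral {1..2} (\<lambda>r. (1 / r) *\<^sub>R odd_part g \<tau> (m * (r / 2 ^ n)))) {1..2}" (is "(?h has_integral ?I) _")
      by (intro integrable_integral integrable_continuous_real continuous_intros oc) auto
    from has_integral_affinity[OF this[unfolded box_real(2)[symmetric]], of "1 / ?s" 0]
    have "((\<lambda>t. ?h (t / ?s)) has_integral ?s *\<^sub>R ?I) ((\<lambda>x. ?s * x) ` {1..2})"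
      using s by (simp add: divide_inverse mult.commute)
    moreover have "(\<lambda>x. ?s * x) ` {1..2} = {?s..2 * ?s}"
      using s by (subst image_mult_atLeastAtMost) (auto simp: mult.commute)
    ultimately have "((\<lambda>t. (1 / ?s) *\<^sub>R ?h (t / ?s)) has_integral (1 / ?s) *\<^sub>R ?s *\<^sub>R ?I) {?s..2 * ?s}"
      by (intro has_integral_cmul) simp
    moreover have "(1 / ?s) *\<^sub>R ?h (t / ?s) = ?f t" if "t \<in> {?s..2 * ?s}" for t
      using s that m by (simp add: field_simps)
    ultimately have "(?f has_integral ?I) {?s..2 * ?s}"
      using s m by (subst has_integral_cong[where g="\<lambda>t. (1 / ?s) *\<^sub>R ?h (t / ?s)"]) auto
    then have "((\<lambda>t. if t \<in> {?s..2 * ?s} then ?f t else 0) has_integral ?I) {?\<delta>..2}"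
      using s by (subst has_integral_restrict) auto
    then show ?thesis
      by (rule has_integral_spike_finite[of "{?s}", rotated 2])
         (use m in \<open>auto simp: octave_def field_simps\<close>)
  qed
  \<comment> \<open>All lags lie between 1 and 2^n, so every octave lies inside [2^-n, 2].\<close>
  have m1: "1 \<le> a * 2 ^ k + (real z - real x)" "a * 2 ^ k + (real z - real x) \<le> 2 ^ n"
    if "k < n - 1" "x < 2 ^ k" "z < 2 ^ k" "1 \<le> a" "a \<le> 3" for a k x z
  proof -
    have "real x + 1 \<le> 2 ^ k" "real z + 1 \<le> 2 ^ k" using that
      by (metis Suc_eq_plus1 Suc_leI of_nat_Suc of_nat_le_iff of_nat_numeral of_nat_power add.commute)+
    moreover have "2 ^ k \<le> a * 2 ^ k" "a * 2 ^ k \<le> 3 * 2 ^ k" using that by auto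
    moreover have "4 * 2 ^ k \<le> (2::real) ^ n"
    proof -
      have "(2::real) ^ (k + 2) \<le> 2 ^ n" using that by (intro power_increasing) auto
      then show ?thesis by simp
    qed
    ultimately show "1 \<le> a * 2 ^ k + (real z - real x)" "a * 2 ^ k + (real z - real x) \<le> 2 ^ n"
      by linarith+
  qed
  define W where "W m = integral {1..2} (\<lambda>r. (1 / r) *\<^sub>R odd_part g \<tau> (m * (r / 2 ^ n)))" for m :: real
  have "((\<lambda>t. \<Sum>k<n - 1. (1 / (16 * (2 ^ k)\<^sup>2)) *\<^sub>R (\<Sum>x<2 ^ k. \<Sum>z<2 ^ k.
     3 *\<^sub>R (octave (2 ^ n * t) (1 * 2 ^ k + (real z - real x)) *\<^sub>R ?f t)
       - octave (2 ^ n * t) (3 * 2 ^ k + (real z - real x)) *\<^sub>R ?f t))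
    has_integral (\<Sum>k<n - 1. (1 / (16 * (2 ^ k)\<^sup>2)) *\<^sub>R (\<Sum>x<2 ^ k. \<Sum>z<2 ^ k.
     3 *\<^sub>R W (1 * 2 ^ k + (real z - real x)) - W (3 * 2 ^ k + (real z - real x))))) {?\<delta>..2}"
    unfolding W_def
    by (intro has_integral_sum has_integral_cmul has_integral_diff oct m1) auto
  moreover have "(\<Sum>k<n - 1. (1 / (16 * (2 ^ k)\<^sup>2)) *\<^sub>R (\<Sum>x<2 ^ k. \<Sum>z<2 ^ k.
     3 *\<^sub>R (octave (2 ^ n * t) (1 * 2 ^ k + (real z - real x)) *\<^sub>R ?f t)
       - octave (2 ^ n * t) (3 * 2 ^ k + (real z - real x)) *\<^sub>R ?f t))
     = (dyadic_kernel n (2 ^ n * t) / t) *\<^sub>R odd_part g \<tau> t" for t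
  proof -
    have "(dyadic_kernel n (2 ^ n * t) / t) *\<^sub>R odd_part g \<tau> t = dyadic_kernel n (2 ^ n * t) *\<^sub>R ?f t"
      by simp
    also have "\<dots> = (\<Sum>k<n - 1. (1 / (16 * (2 ^ k)\<^sup>2)) *\<^sub>R (\<Sum>x<2 ^ k. \<Sum>z<2 ^ k.
     (3 * octave (2 ^ n * t) (1 * 2 ^ k + (real z - real x))
       - octave (2 ^ n * t) (3 * 2 ^ k + (real z - real x))) *\<^sub>R ?f t))"
      unfolding dyadic_kernel_def corr_def scaleR_sum_left
      by (simp only: scaleR_scaleR[symmetric] scaleR_sum_left of_nat_power of_nat_numeral mult_1)
    finally show ?thesis by (simp only: scaleR_left_diff_distrib scaleR_scaleR left_diff_distrib mult.assoc)
  qed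
  moreover have "(\<Sum>k<n - 1. (1 / (16 * (2 ^ k)\<^sup>2)) *\<^sub>R (\<Sum>x<2 ^ k. \<Sum>z<2 ^ k.
     3 *\<^sub>R W (1 * 2 ^ k + (real z - real x)) - W (3 * 2 ^ k + (real z - real x)))) = averaged_conv n g \<tau>"
  proof -
    have "((\<lambda>r. \<Sum>k<n - 1. (1 / (16 * (2 ^ k)\<^sup>2)) *\<^sub>R (\<Sum>x<2 ^ k. \<Sum>z<2 ^ k.
     3 *\<^sub>R ((1 / r) *\<^sub>R odd_part g \<tau> ((1 * 2 ^ k + (real z - real x)) * (r / 2 ^ n)))
       - (1 / r) *\<^sub>R odd_part g \<tau> ((3 * 2 ^ k + (real z - real x)) * (r / 2 ^ n))))
    has_integral (\<Sum>k<n - 1. (1 / (16 * (2 ^ k)\<^sup>2)) *\<^sub>R (\<Sum>x<2 ^ k. \<Sum>z<2 ^ k.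
     3 *\<^sub>R W (1 * 2 ^ k + (real z - real x)) - W (3 * 2 ^ k + (real z - real x))))) {1..2}"
      unfolding W_def
      by (intro has_integral_sum has_integral_cmul has_integral_diff integrable_integral
          integrable_continuous_real continuous_intros oc) auto
    moreover have "(\<Sum>k<n - 1. (1 / (16 * (2 ^ k)\<^sup>2)) *\<^sub>R (\<Sum>x<2 ^ k. \<Sum>z<2 ^ k.
     3 *\<^sub>R ((1 / r) *\<^sub>R odd_part g \<tau> ((1 * 2 ^ k + (real z - real x)) * (r / 2 ^ n)))
       - (1 / r) *\<^sub>R odd_part g \<tau> ((3 * 2 ^ k + (real z - real x)) * (r / 2 ^ n))))
      = (1 / r) *\<^sub>R dyadic_conv n (r / 2 ^ n) g \<tau>" for r
      unfolding dyadic_conv_def scaleR_sum_right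
      by (intro sum.cong refl) (simp add: scaleR_right_diff_distrib mult.commute)
    ultimately show ?thesis
      unfolding averaged_conv_def by (simp add: integral_unique)
  qed
  ultimately show ?thesis by simp
qed

section \<open>Exponentially decaying integrands\<close>

text \<open>Most integrals over the line below have integrands of this kind. They are limits of
  interval integrals with an explicit tail 2 C / a * exp (- a N), so exchanges of integrals and
  limits reduce to compact intervals and continuous functions.\<close>

definition exp_decay :: "real \<Rightarrow> real \<Rightarrow> (real \<Rightarrow> 'a::real_normed_vector) \<Rightarrow> bool" where
  "exp_decay C a f \<longleftrightarrow> a > 0 \<and> continuous_on UNIV f \<and> (\<forall>u. norm (f u) \<le> C * exp (- a * \<bar>u\<bar>))"

lemma exp_decayD:
  assumes "exp_decay C a f"
  shows "a > 0" "continuous_on S f" "norm (f u) \<le> C * exp (- a * \<bar>u\<bar>)" "C \<ge> 0"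
proof -
  show "norm (f u) \<le> C * exp (- a * \<bar>u\<bar>)" for u using assms by (simp add: exp_decay_def)
  from order_trans[OF norm_ge_zero this[of 0]] show "C \<ge> 0" by simp
qed (use assms in \<open>auto simp: exp_decay_def intro: continuous_on_subset\<close>)

lemma exp_decay_integrable_Icc: "exp_decay C a f \<Longrightarrow> f integrable_on {c..d}" for f :: "real \<Rightarrow> 'a::banach"
  by (intro integrable_continuous_real exp_decayD(2))

lemma integral_combine_Icc:
  fixes f :: "real \<Rightarrow> 'a::banach"
  assumes "c \<le> m" "m \<le> d" "f integrable_on {c..d}"
  shows "integral {c..d} f = integral {c..m} f + integral {m..d} f"
  using Henstock_Kurzweil_Integration.integral_combine[OF assms] by simp

lemma integral_reflect_Icc:
  fixes f :: "real \<Rightarrow> 'a::banach"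
  shows "integral {- d..- c} (\<lambda>x. f (- x)) = integral {c..d} f"
  unfolding integral_def integrable_on_def by simp

lemma has_integral_unboundedI:
  fixes f :: "real \<Rightarrow> 'a::banach"
  assumes S: "\<not> bounded S" and lim: "\<And>e. e > 0 \<Longrightarrow> \<exists>B>0. \<forall>c d. ball 0 B \<subseteq> {c..d} \<longrightarrow>
      (\<exists>z. ((\<lambda>x. if x \<in> S then f x else 0) has_integral z) {c..d} \<and> norm (z - L) < e)"
  shows "(f has_integral L) S"
proof -
  have "\<nexists>a b. S = cbox a b" using S by auto
  then show ?thesis by (subst has_integral_alt) (simp add: lim)
qed

lemma exp_has_integral_Icc:
  fixes a c d C :: real
  assumes "a > 0" "c \<le> d"
  shows "((\<lambda>u. C * exp (- a * u)) has_integral (C / a) * (exp (- a * c) - exp (- a * d))) {c..d}"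
proof -
  have "((\<lambda>u. C * exp (- a * u)) has_integral ((- C / a) * exp (- a * d) - (- C / a) * exp (- a * c))) {c..d}"
    using assms by (intro fundamental_theorem_of_calculus[OF assms(2)])
      (auto intro!: derivative_eq_intros simp: has_real_derivative_iff_has_vector_derivative[symmetric])
  then show ?thesis by (simp add: algebra_simps)
qed

lemma exp_decay_tail_right:
  fixes f :: "real \<Rightarrow> 'a::banach"
  assumes f: "exp_decay C a f" and c: "0 \<le> c" "c \<le> d"
  shows "norm (integral {c..d} f) \<le> (C / a) * exp (- a * c)"
proof -
  note [simp] = exp_decayD(1)[OF f] exp_decayD(4)[OF f]
  have I: "((\<lambda>u. C * exp (- a * u)) has_integral (C / a) * (exp (- a * c) - exp (- a * d))) {c..d}"
    using c by (intro exp_has_integral_Icc) auto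
  have "norm (integral {c..d} f) \<le> integral {c..d} (\<lambda>u. C * exp (- a * u))"
  proof (intro integral_norm_bound_integral exp_decay_integrable_Icc[OF f])
    show "norm (f u) \<le> C * exp (- a * u)" if "u \<in> {c..d}" for u
      using exp_decayD(3)[OF f, of u] that c by simp
  qed (use I in blast)
  also have "\<dots> = (C / a) * (exp (- a * c) - exp (- a * d))" using I by (rule integral_unique)
  also have "\<dots> \<le> (C / a) * exp (- a * c)" by (intro mult_left_mono) (auto intro: divide_nonneg_pos)
  finally show ?thesis .
qed

lemma exp_decay_reflect: "exp_decay C a f \<Longrightarrow> exp_decay C a (\<lambda>u. f (- u))"
  unfolding exp_decay_def
  by (auto intro!: continuous_on_compose2[of UNIV f UNIV uminus] continuous_intros) (metis abs_minus_cancel)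

lemma exp_decay_tail_left:
  fixes f :: "real \<Rightarrow> 'a::banach"
  assumes f: "exp_decay C a f" and c: "d \<le> 0" "c \<le> d"
  shows "norm (integral {c..d} f) \<le> (C / a) * exp (a * d)"
  using exp_decay_tail_right[OF exp_decay_reflect[OF f], of "- d" "- c"] c
    integral_reflect_Icc[of d c f] by simp

lemma exp_decay_integral_diff:
  fixes f :: "real \<Rightarrow> 'a::banach"
  assumes f: "exp_decay C a f" and c: "c \<le> - N" "0 \<le> N" "N \<le> d"
  shows "norm (integral {c..d} f - integral {- N..N} f) \<le> (2 * C / a) * exp (- a * N)"
proof -
  have "integral {c..d} f = integral {c..- N} f + integral {- N..N} f + integral {N..d} f"
    using c integral_combine_Icc[of c "- N" d f] integral_combine_Icc[of "- N" N d f] exp_decay_integrable_Icc[OF f]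
    by (simp add: add.assoc)
  then have "norm (integral {c..d} f - integral {- N..N} f) \<le> norm (integral {c..- N} f) + norm (integral {N..d} f)"
    by (simp add: norm_triangle_ineq)
  also have "\<dots> \<le> (C / a) * exp (a * (- N)) + (C / a) * exp (- a * N)"
    using c by (intro add_mono exp_decay_tail_left[OF f] exp_decay_tail_right[OF f]) auto
  finally show ?thesis by (simp add: algebra_simps)
qed

lemma exp_neg_mult_tendsto_0:
  fixes a C :: real
  assumes "a > 0"
  shows "(\<lambda>n. C * exp (- a * real n)) \<longlonglongrightarrow> 0"
proof -
  have "(\<lambda>n. exp (- a) ^ n) \<longlonglongrightarrow> 0" using assms by (intro LIMSEQ_power_zero) auto
  then have "(\<lambda>n. C * exp (- a) ^ n) \<longlonglongrightarrow> C * 0" by (intro tendsto_mult tendsto_const)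
  moreover have "exp (- a * real n) = exp (- a) ^ n" for n
    by (simp add: exp_of_nat_mult[symmetric] mult.commute)
  ultimately show ?thesis by (simp only: mult_zero_right)
qed

text \<open>The integrals over [-n, n] form a Cauchy sequence by the tail bounds, and every interval
  containing [-N, N] is off the limit by at most the two tails beyond N.\<close>

lemma exp_decay_integrable:
  fixes f :: "real \<Rightarrow> 'a::banach"
  assumes f: "exp_decay C a f"
  shows "f integrable_on UNIV"
    and "\<And>c d N. c \<le> - N \<Longrightarrow> 0 \<le> N \<Longrightarrow> N \<le> d \<Longrightarrow> norm (integral {c..d} f - integral UNIV f) \<le> (2 * C / a) * exp (- a * N)"
proof -
  note a = exp_decayD(1)[OF f]
  let ?I = "\<lambda>n. integral {- real n..real n} f"
  have lim0: "(\<lambda>n. (2 * C / a) * exp (- a * real n)) \<longlonglongrightarrow> 0" by (rule exp_neg_mult_tendsto_0[OF a])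
  have "Cauchy ?I"
  proof (rule metric_CauchyI)
    fix e :: real assume "e > 0"
    then have "\<forall>\<^sub>F n in sequentially. (2 * C / a) * exp (- a * real n) < e / 2"
      using order_tendstoD(2)[OF lim0, of "e / 2"] by simp
    then obtain M where M: "(2 * C / a) * exp (- a * real M) < e / 2" by (auto simp: eventually_sequentially)
    have "dist (?I m) (?I M) < e / 2" if "m \<ge> M" for m
      using exp_decay_integral_diff[OF f, of "- real m" "real M" "real m"] M that by (simp add: dist_norm)
    then have "dist (?I m) (?I n) < e" if "m \<ge> M" "n \<ge> M" for m n
      using dist_triangle_half_l[of "?I m" "?I M" e "?I n"] that by blast
    then show "\<exists>M. \<forall>m\<ge>M. \<forall>n\<ge>M. dist (?I m) (?I n) < e" by blast
  qed
  then obtain L where L: "?I \<longlonglongrightarrow> L" by (auto simp: Cauchy_convergent_iff convergent_def)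
  have bd: "norm (integral {c..d} f - L) \<le> (2 * C / a) * exp (- a * N)" if N: "c \<le> - N" "0 \<le> N" "N \<le> d" for c d N
  proof -
    have "norm (integral {- real n..real n} f - integral {-N..N} f) \<le> (2 * C / a) * exp (- a * N)" if "N \<le> real n" for n
      using exp_decay_integral_diff[OF f, of "- real n" N "real n"] N that by simp
    have "(\<lambda>n. norm (integral {- real n..real n} f - integral {c..d} f)) \<longlonglongrightarrow> norm (L - integral {c..d} f)"
      by (intro tendsto_intros L)
    moreover have "\<forall>\<^sub>F n in sequentially. norm (integral {- real n..real n} f - integral {c..d} f) \<le> (2 * C / a) * exp (- a * N)"
    proof -
      obtain m :: nat where m: "\<bar>c\<bar> \<le> real m" "\<bar>d\<bar> \<le> real m" using real_arch_simple[of "max \<bar>c\<bar> \<bar>d\<bar>"] by auto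
      have "norm (integral {- real n..real n} f - integral {c..d} f) \<le> (2 * C / a) * exp (- a * N)" if "n \<ge> m" for n
      proof -
        have n: "- real n \<le> c" "d \<le> real n" "c \<le> d" using m that N by auto
        have "integral {- real n..real n} f = integral {- real n..c} f + integral {c..d} f + integral {d..real n} f"
          using n integral_combine_Icc[of "- real n" c "real n" f] integral_combine_Icc[of c d "real n" f] exp_decay_integrable_Icc[OF f]
          by (simp add: add.assoc)
        then have "norm (integral {- real n..real n} f - integral {c..d} f) \<le> norm (integral {- real n..c} f) + norm (integral {d..real n} f)"
          by (simp add: norm_triangle_ineq)
        also have "\<dots> \<le> (C / a) * exp (a * c) + (C / a) * exp (- a * d)"
          using N n by (intro add_mono exp_decay_tail_left[OF f] exp_decay_tail_right[OF f]) auto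
        also have "\<dots> \<le> (C / a) * exp (- a * N) + (C / a) * exp (- a * N)"
          using N a exp_decayD(4)[OF f] mult_left_mono[of c "- N" a]
          by (intro add_mono mult_left_mono) auto
        finally show ?thesis by (simp add: algebra_simps)
      qed
      then show ?thesis by (auto simp: eventually_sequentially)
    qed
    ultimately have "norm (L - integral {c..d} f) \<le> (2 * C / a) * exp (- a * N)"
      by (intro tendsto_upperbound[where F=sequentially]) auto
    then show ?thesis by (simp add: norm_minus_commute)
  qed
  have "(f has_integral L) UNIV"
  proof (rule has_integral_unboundedI)
    fix e :: real assume "e > 0"
    then have "\<forall>\<^sub>F n in sequentially. (2 * C / a) * exp (- a * real n) < e"
      using order_tendstoD(2)[OF lim0, of "e"] by simp
    then obtain M where M: "(2 * C / a) * exp (- a * real M) < e" by (auto simp: eventually_sequentially)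
    show "\<exists>B>0. \<forall>c d. ball 0 B \<subseteq> {c..d} \<longrightarrow>
      (\<exists>z. ((\<lambda>x. if x \<in> UNIV then f x else 0) has_integral z) {c..d} \<and> norm (z - L) < e)"
    proof (intro exI[of _ "real M + 1"] conjI allI impI)
      fix c d :: real assume cd: "ball 0 (real M + 1) \<subseteq> {c..d}"
      have "- real M \<in> {c..d}" "real M \<in> {c..d}" by (rule subsetD[OF cd], simp add: dist_norm)+
      then have "c \<le> - real M" "real M \<le> d" by auto
      then have "norm (integral {c..d} f - L) < e" using bd[of c "real M" d] M by simp
      then show "\<exists>z. ((\<lambda>x. if x \<in> UNIV then f x else 0) has_integral z) {c..d} \<and> norm (z - L) < e"
        using integrable_integral[OF exp_decay_integrable_Icc[OF f, of c d]] by auto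
    qed auto
  qed simp
  then show "f integrable_on UNIV" "\<And>c d N. c \<le> - N \<Longrightarrow> 0 \<le> N \<Longrightarrow> N \<le> d \<Longrightarrow> norm (integral {c..d} f - integral UNIV f) \<le> (2 * C / a) * exp (- a * N)"
    using bd by (auto simp: integral_unique)
qed

lemma exp_decay_integral_limit:
  fixes f :: "real \<Rightarrow> 'a::banach"
  assumes f: "exp_decay C a f" and c: "filterlim c at_bot F" and d: "filterlim d at_top F"
  shows "((\<lambda>n. integral {c n..d n} f) \<longlongrightarrow> integral UNIV f) F"
proof (rule tendstoI)
  fix e :: real assume e: "e > 0"
  have "\<forall>\<^sub>F n in sequentially. (2 * C / a) * exp (- a * real n) < e"
    using order_tendstoD(2)[OF exp_neg_mult_tendsto_0[OF exp_decayD(1)[OF f]], of e "2 * C / a"] e by simp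
  then obtain M where M: "(2 * C / a) * exp (- a * real M) < e" by (auto simp: eventually_sequentially)
  have "\<forall>\<^sub>F n in F. c n \<le> - real M \<and> real M \<le> d n"
    using c d by (auto simp: filterlim_at_bot filterlim_at_top eventually_conj_iff)
  then show "\<forall>\<^sub>F n in F. dist (integral {c n..d n} f) (integral UNIV f) < e"
  proof (rule eventually_mono)
    fix n assume "c n \<le> - real M \<and> real M \<le> d n"
    then show "dist (integral {c n..d n} f) (integral UNIV f) < e"
      using exp_decay_integrable(2)[OF f, of "c n" "real M" "d n"] M by (simp add: dist_norm)
  qed
qed

lemma exp_decay_integral_LIMSEQ:
  fixes f :: "real \<Rightarrow> 'a::banach"
  assumes f: "exp_decay C a f"
  shows "(\<lambda>n. integral {- real n..real n} f) \<longlonglongrightarrow> integral UNIV f"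
  by (rule exp_decay_integral_limit[OF f])
     (auto intro: filterlim_real_sequentially simp: filterlim_uminus_at_bot)

lemma exp_decay_norm_integral:
  fixes f :: "real \<Rightarrow> 'a::banach"
  assumes f: "exp_decay C a f"
  shows "norm (integral UNIV f) \<le> 2 * C / a"
  using exp_decay_integrable(2)[OF f, of 0 0 0] by simp

lemma exp_decay_norm_integral_Icc:
  fixes f :: "real \<Rightarrow> 'a::banach"
  assumes f: "exp_decay C a f" and "0 \<le> N"
  shows "norm (integral {- N..N} f) \<le> 2 * C / a"
  using exp_decay_integral_diff[OF f, of "- N" 0 N] assms(2) by simp

lemma exp_decay_integral_shift:
  fixes f :: "real \<Rightarrow> 'a::banach"
  assumes f: "exp_decay C a f" and g: "exp_decay C' a' (\<lambda>u. f (u + w))"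
  shows "integral UNIV (\<lambda>u. f (u + w)) = integral UNIV f"
proof (rule LIMSEQ_unique)
  show "(\<lambda>n. integral {- real n..real n} (\<lambda>u. f (u + w))) \<longlonglongrightarrow> integral UNIV (\<lambda>u. f (u + w))"
    by (rule exp_decay_integral_LIMSEQ[OF g])
  have "(\<lambda>n. integral {w - real n..w + real n} f) \<longlonglongrightarrow> integral UNIV f"
  proof (rule exp_decay_integral_limit[OF f])
    show "filterlim (\<lambda>n. w + real n) at_top sequentially"
      by (intro filterlim_tendsto_add_at_top[OF tendsto_const] filterlim_real_sequentially)
    have "filterlim (\<lambda>n. - w + real n) at_top sequentially"
      by (intro filterlim_tendsto_add_at_top[OF tendsto_const] filterlim_real_sequentially)
    then show "filterlim (\<lambda>n. w - real n) at_bot sequentially"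
      by (simp add: filterlim_uminus_at_bot)
  qed
  moreover have "integral {w - real n..w + real n} f = integral {- real n..real n} (\<lambda>u. f (u + w))" for n
    using integral_shift_real_ivl[of "w - real n" w "w + real n" f] by simp
  ultimately show "(\<lambda>n. integral {- real n..real n} (\<lambda>u. f (u + w))) \<longlonglongrightarrow> integral UNIV f" by simp
qed

lemma exp_decay_integral_FTC:
  fixes f :: "real \<Rightarrow> 'a::banach"
  assumes f: "exp_decay C a f" and F: "\<And>u. (F has_vector_derivative f u) (at u)"
    and "(F \<longlongrightarrow> p) at_bot" "(F \<longlongrightarrow> q) at_top"
  shows "integral UNIV f = q - p"
proof (rule LIMSEQ_unique)
  show "(\<lambda>n. integral {- real n..real n} f) \<longlonglongrightarrow> integral UNIV f"
    by (rule exp_decay_integral_LIMSEQ[OF f])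
  have "integral {- real n..real n} f = F (real n) - F (- real n)" for n
    by (intro integral_unique fundamental_theorem_of_calculus) (auto intro: F has_vector_derivative_at_within)
  moreover have "(\<lambda>n. F (real n) - F (- real n)) \<longlonglongrightarrow> q - p"
    by (intro tendsto_diff filterlim_compose[OF assms(4)] filterlim_compose[OF assms(3)] filterlim_real_sequentially)
       (simp add: filterlim_uminus_at_bot filterlim_real_sequentially)
  ultimately show "(\<lambda>n. integral {- real n..real n} f) \<longlonglongrightarrow> q - p" by simp
qed

lemma exp_decay_integral_param:
  fixes F :: "real \<Rightarrow> real \<Rightarrow> 'a::banach"
  assumes cont: "continuous_on UNIV (\<lambda>(w, u). F w u)" and F: "\<And>w. exp_decay C a (F w)"
  shows "continuous_on UNIV (\<lambda>w. integral UNIV (F w))"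
proof (rule uniform_limit_theorem)
  show "uniform_limit UNIV (\<lambda>n w. integral {- real n..real n} (F w)) (\<lambda>w. integral UNIV (F w)) sequentially"
  proof (rule uniform_limitI)
    fix e :: real assume e: "e > 0"
    have "\<forall>\<^sub>F n in sequentially. (2 * C / a) * exp (- a * real n) < e"
      using order_tendstoD(2)[OF exp_neg_mult_tendsto_0[OF exp_decayD(1)[OF F]], of e "2 * C / a"] e by simp
    then show "\<forall>\<^sub>F n in sequentially. \<forall>w\<in>UNIV. dist (integral {- real n..real n} (F w)) (integral UNIV (F w)) < e"
    proof (rule eventually_mono, intro ballI)
      fix n w assume "(2 * C / a) * exp (- a * real n) < e"
      then show "dist (integral {- real n..real n} (F w)) (integral UNIV (F w)) < e"
        using exp_decay_integrable(2)[OF F, of "- real n" "real n" "real n" w] by (simp add: dist_norm)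
    qed
  qed
  have "continuous_on UNIV (\<lambda>w. integral (cbox (- real n) (real n)) (F w))" for n
    by (rule integral_continuous_on_param) (rule continuous_on_subset[OF cont], auto)
  then show "\<forall>\<^sub>F n in sequentially. continuous_on UNIV (\<lambda>w. integral {- real n..real n} (F w))" by simp
qed simp

section \<open>Double integrals and changes of variable\<close>

lemma exp_decay_plane_aux:
  fixes F :: "real \<Rightarrow> real \<Rightarrow> 'a::banach"
  assumes cont: "continuous_on UNIV (\<lambda>(u, w). F u w)" and a: "a > 0"
    and F: "\<And>u w. norm (F u w) \<le> C * exp (- a * \<bar>u\<bar>) * exp (- a * \<bar>w\<bar>)"
  shows "exp_decay (2 * C / a) a (\<lambda>u. integral UNIV (F u))"
    and "(\<lambda>n. integral {- real n..real n} (\<lambda>u. integral {- real n..real n} (F u)))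
      \<longlonglongrightarrow> integral UNIV (\<lambda>u. integral UNIV (F u))"
proof -
  have contu: "continuous_on UNIV (F u)" for u
    using continuous_on_compose2[OF cont continuous_on_Pair[OF continuous_on_const[of _ u] continuous_on_id]] by auto
  have Fu: "exp_decay (C * exp (- a * \<bar>u\<bar>)) a (F u)" for u
    using a F contu by (auto simp: exp_decay_def)
  have C0: "C \<ge> 0" using exp_decayD(4)[OF Fu[of 0]] by simp
  have Fu': "exp_decay C a (F u)" for u
    unfolding exp_decay_def
  proof (intro conjI allI a contu)
    fix w
    have "C * exp (- a * \<bar>u\<bar>) * exp (- a * \<bar>w\<bar>) \<le> C * 1 * exp (- a * \<bar>w\<bar>)"
      using C0 a by (intro mult_right_mono mult_left_mono) auto
    then show "norm (F u w) \<le> C * exp (- a * \<bar>w\<bar>)" using F[of u w] by simp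
  qed
  let ?G = "\<lambda>u. integral UNIV (F u)"
  show G: "exp_decay (2 * C / a) a ?G"
    unfolding exp_decay_def
  proof (intro conjI allI a)
    show "continuous_on UNIV ?G" by (rule exp_decay_integral_param[OF cont Fu'])
    show "norm (?G u) \<le> 2 * C / a * exp (- a * \<bar>u\<bar>)" for u
      using exp_decay_norm_integral[OF Fu[of u]] by simp
  qed
  have "(\<lambda>n. integral {- real n..real n} ?G - integral {- real n..real n} (\<lambda>u. integral {- real n..real n} (F u))) \<longlonglongrightarrow> 0"
  proof (rule tendsto_0_le[OF exp_neg_mult_tendsto_0[OF a, of "(2 * (2 * C / a) / a)"], of _ 1], intro always_eventually allI)
    fix n
    have cn: "continuous_on S (\<lambda>u. integral {- real n..real n} (F u))" for S
    proof -
      have "continuous_on S (\<lambda>u. integral (cbox (- real n) (real n)) (F u))"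
        by (rule integral_continuous_on_param) (rule continuous_on_subset[OF cont], auto)
      then show ?thesis by simp
    qed
    have "exp_decay (2 * C / a * exp (- a * real n)) a (\<lambda>u. ?G u - integral {- real n..real n} (F u))"
      unfolding exp_decay_def
    proof (intro conjI allI a continuous_intros cn exp_decayD(2)[OF G])
      fix u
      show "norm (?G u - integral {- real n..real n} (F u)) \<le> 2 * C / a * exp (- a * real n) * exp (- a * \<bar>u\<bar>)"
        using exp_decay_integrable(2)[OF Fu[of u], of "- real n" "real n" "real n"]
        by (simp add: norm_minus_commute mult_ac)
    qed
    from exp_decay_norm_integral_Icc[OF this, of "real n"]
    have "norm (integral {- real n..real n} (\<lambda>u. ?G u - integral {- real n..real n} (F u))) \<le> 2 * (2 * C / a * exp (- a * real n)) / a"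
      by simp
    then show "norm (integral {- real n..real n} ?G - integral {- real n..real n} (\<lambda>u. integral {- real n..real n} (F u)))
      \<le> norm (2 * (2 * C / a) / a * exp (- a * real n)) * 1"
      using C0 a by (subst integral_diff[symmetric]) (auto intro!: integrable_continuous_real cn exp_decayD(2)[OF G])
  qed
  from tendsto_diff[OF exp_decay_integral_LIMSEQ[OF G] this]
  show "(\<lambda>n. integral {- real n..real n} (\<lambda>u. integral {- real n..real n} (F u)))
      \<longlonglongrightarrow> integral UNIV (\<lambda>u. integral UNIV (F u))" by simp
qed

text \<open>Both iterated integrals are limits of integrals over the squares [-n, n]^2, where
  continuity allows the exchange.\<close>

lemma exp_decay_integral_swap:
  fixes F :: "real \<Rightarrow> real \<Rightarrow> 'a::banach"
  assumes cont: "continuous_on UNIV (\<lambda>(u, w). F u w)" and a: "a > 0"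
    and F: "\<And>u w. norm (F u w) \<le> C * exp (- a * \<bar>u\<bar>) * exp (- a * \<bar>w\<bar>)"
  shows "integral UNIV (\<lambda>u. integral UNIV (\<lambda>w. F u w)) = integral UNIV (\<lambda>w. integral UNIV (\<lambda>u. F u w))"
proof (rule LIMSEQ_unique)
  show "(\<lambda>n. integral {- real n..real n} (\<lambda>u. integral {- real n..real n} (F u)))
      \<longlonglongrightarrow> integral UNIV (\<lambda>u. integral UNIV (\<lambda>w. F u w))"
    by (rule exp_decay_plane_aux[OF assms])
  have cont': "continuous_on UNIV (\<lambda>(w, u). F u w)"
    using continuous_on_compose2[OF cont, of UNIV prod.swap] by (auto simp: case_prod_beta intro!: continuous_intros)
  have "(\<lambda>n. integral {- real n..real n} (\<lambda>w. integral {- real n..real n} (\<lambda>u. F u w)))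
      \<longlonglongrightarrow> integral UNIV (\<lambda>w. integral UNIV (\<lambda>u. F u w))"
  proof (rule exp_decay_plane_aux(2)[OF cont' a, where C = C])
    show "norm (F w u) \<le> C * exp (- a * \<bar>u\<bar>) * exp (- a * \<bar>w\<bar>)" for u w
      using F[of w u] by (simp add: mult_ac)
  qed
  moreover have "integral {- real n..real n} (\<lambda>w. integral {- real n..real n} (\<lambda>u. F u w))
    = integral {- real n..real n} (\<lambda>u. integral {- real n..real n} (F u))" for n
    using integral_swap_continuous[of "- real n" "- real n" "real n" "real n" F]
      continuous_on_subset[OF cont] by simp
  ultimately show "(\<lambda>n. integral {- real n..real n} (\<lambda>u. integral {- real n..real n} (F u)))
      \<longlonglongrightarrow> integral UNIV (\<lambda>w. integral UNIV (\<lambda>u. F u w))" by simp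
qed

text \<open>The substitution v = u + w keeps joint decay at half the rate, because |u| + |u + w| is
  at least (|u| + |w|) / 2; then the order is exchanged. This change of variables underlies the
  composition of Mellin transforms and the product of Gamma values.\<close>

lemma exp_decay_integral_plane_shift:
  fixes F :: "real \<Rightarrow> real \<Rightarrow> 'a::banach"
  assumes cont: "continuous_on UNIV (\<lambda>(u, v). F u v)"
    and F: "\<And>u v. norm (F u v) \<le> C * exp (- \<bar>u\<bar>) * exp (- \<bar>v\<bar>)"
  shows "integral UNIV (\<lambda>u. integral UNIV (\<lambda>v. F u v)) = integral UNIV (\<lambda>w. integral UNIV (\<lambda>u. F u (u + w)))"
    and "exp_decay (4 * C) (1 / 2) (\<lambda>w. integral UNIV (\<lambda>u. F u (u + w)))"
    and "\<And>w. exp_decay C (1 / 2) (\<lambda>u. F u (u + w))"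
proof -
  have contu: "continuous_on UNIV (\<lambda>v. F u v)" for u
    using continuous_on_compose2[OF cont continuous_on_Pair[OF continuous_on_const[of _ u] continuous_on_id]] by auto
  have cont': "continuous_on S (\<lambda>p. F (h p) (k p))"
    if "continuous_on S h" "continuous_on S k" for S :: "'z::topological_space set" and h k
    using continuous_on_compose2[OF cont continuous_on_Pair[OF that]] by simp
  have cont2: "continuous_on UNIV (\<lambda>(u, w). F u (u + w))" and cont3: "continuous_on UNIV (\<lambda>(w, u). F u (u + w))"
    unfolding case_prod_beta by (intro cont' continuous_intros)+
  have C0: "C \<ge> 0" using order_trans[OF norm_ge_zero F[of 0 0]] by simp
  have F2: "norm (F u (u + w)) \<le> C * exp (- (1 / 2) * \<bar>u\<bar>) * exp (- (1 / 2) * \<bar>w\<bar>)" for u w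
  proof -
    have "norm (F u (u + w)) \<le> C * exp (- \<bar>u\<bar> - \<bar>u + w\<bar>)" using F[of u "u + w"] by (simp add: exp_diff exp_minus field_simps)
    also have "\<dots> \<le> C * exp (- (1 / 2) * \<bar>u\<bar> - (1 / 2) * \<bar>w\<bar>)" using C0 by (intro mult_left_mono) auto
    finally show ?thesis by (simp add: exp_add[symmetric] mult.assoc)
  qed
  have F3: "exp_decay (C * exp (- \<bar>u\<bar>)) 1 (\<lambda>v. F u v)" for u
    using F contu by (auto simp: exp_decay_def)
  have F4: "exp_decay (C * exp (- (1 / 2) * \<bar>u\<bar>)) (1 / 2) (\<lambda>v. F u (v + u))" for u
    unfolding exp_decay_def using F2[of u]
    by (auto intro!: continuous_intros cont' simp: add.commute)
  have "integral UNIV (\<lambda>u. integral UNIV (\<lambda>v. F u v)) = integral UNIV (\<lambda>u. integral UNIV (\<lambda>w. F u (u + w)))"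
    using exp_decay_integral_shift[OF F3 F4] by (simp add: add.commute)
  also have "\<dots> = integral UNIV (\<lambda>w. integral UNIV (\<lambda>u. F u (u + w)))"
    by (rule exp_decay_integral_swap[OF cont2 _ F2]) auto
  finally show "integral UNIV (\<lambda>u. integral UNIV (\<lambda>v. F u v)) = integral UNIV (\<lambda>w. integral UNIV (\<lambda>u. F u (u + w)))" .
  show "exp_decay (4 * C) (1 / 2) (\<lambda>w. integral UNIV (\<lambda>u. F u (u + w)))"
  proof -
    have "norm (F u (u + w)) \<le> C * exp (- (1 / 2) * \<bar>w\<bar>) * exp (- (1 / 2) * \<bar>u\<bar>)" for w u
      using F2[of u w] by (simp add: mult_ac)
    from exp_decay_plane_aux(1)[OF cont3 _ this] show ?thesis by simp
  qed
  show "exp_decay C (1 / 2) (\<lambda>u. F u (u + w))" for w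
    unfolding exp_decay_def
  proof (intro conjI allI)
    show "continuous_on UNIV (\<lambda>u. F u (u + w))"
      by (intro cont' continuous_intros)
    fix u
    have "C * exp (- (1 / 2) * \<bar>u\<bar>) * exp (- (1 / 2) * \<bar>w\<bar>) \<le> C * exp (- (1 / 2) * \<bar>u\<bar>) * 1"
      using C0 by (intro mult_left_mono) auto
    then show "norm (F u (u + w)) \<le> C * exp (- (1 / 2) * \<bar>u\<bar>)" using F2[of u w] by linarith
  qed simp
qed

text \<open>The substitution l = exp u, carried out with an antiderivative: \<Phi> has a limit A at
  minus infinity, and \<Phi> after ln, extended by A at 0, is continuous on every [0, d]. It
  connects \<open>mellin\<close> with the integral in \<open>imag_power\<close>, and Euler's
  integral with the line.\<close>

lemma exp_decay_has_integral_ln: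
  fixes g :: "real \<Rightarrow> 'a::banach"
  assumes g: "exp_decay C a g"
  shows "((\<lambda>l. (1 / l) *\<^sub>R g (ln l)) has_integral integral UNIV g) {0<..}"
proof -
  note a = exp_decayD(1)[OF g]
  let ?f = "\<lambda>l. (1 / l) *\<^sub>R g (ln l)" and ?I = "integral UNIV g"
  define \<Phi> where "\<Phi> u = (if u \<ge> 0 then integral {0..u} g else - integral {u..0} g)" for u
  have deriv: "(\<Phi> has_vector_derivative g u) (at u)" for u
  proof -
    define N where "N = \<bar>u\<bar> + 1"
    have eq: "\<Phi> v = integral {- N..v} g - integral {- N..0} g" if "v \<in> {- N<..<N}" for v
      using that integral_combine_Icc[of "- N" 0 v g] integral_combine_Icc[of "- N" v 0 g]
        exp_decay_integrable_Icc[OF g] by (auto simp: \<Phi>_def N_def)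
    have "((\<lambda>v. integral {- N..v} g - integral {- N..0} g) has_vector_derivative g u - 0) (at u within {- N..N})"
      by (intro has_vector_derivative_diff has_vector_derivative_const integral_has_vector_derivative exp_decayD(2)[OF g])
         (auto simp: N_def)
    then have "((\<lambda>v. integral {- N..v} g - integral {- N..0} g) has_vector_derivative g u) (at u)"
      by (subst (asm) at_within_interior) (auto simp: N_def)
    then show ?thesis
      by (rule has_vector_derivative_transform_within_open[of _ _ _ "{- N<..<N}"]) (auto simp: eq N_def)
  qed
  have incr: "\<Phi> v - \<Phi> u = integral {u..v} g" if "u \<le> v" for u v
    using fundamental_theorem_of_calculus[OF that, of \<Phi> g] has_vector_derivative_at_within[OF deriv]
    by (metis integral_unique)
  have "Cauchy (\<lambda>n. \<Phi> (- real n))"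
  proof (rule metric_CauchyI)
    fix e :: real assume "e > 0"
    then have "\<forall>\<^sub>F n in sequentially. (C / a) * exp (- a * real n) < e / 2"
      using order_tendstoD(2)[OF exp_neg_mult_tendsto_0[OF a, of "C / a"], of "e / 2"] by simp
    then obtain M where M: "(C / a) * exp (- a * real M) < e / 2" by (auto simp: eventually_sequentially)
    have "dist (\<Phi> (- real m)) (\<Phi> (- real M)) < e / 2" if "m \<ge> M" for m
    proof -
      have "norm (\<Phi> (- real M) - \<Phi> (- real m)) \<le> (C / a) * exp (- a * real M)"
        using incr[of "- real m" "- real M"] exp_decay_tail_left[OF g, of "- real M" "- real m"] that by simp
      then show ?thesis using M by (subst dist_commute, unfold dist_norm, linarith)
    qed
    then have "dist (\<Phi> (- real m)) (\<Phi> (- real n)) < e" if "m \<ge> M" "n \<ge> M" for m n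
      using dist_triangle_half_l[of "\<Phi> (- real m)" "\<Phi> (- real M)" e "\<Phi> (- real n)"] that by blast
    then show "\<exists>M. \<forall>m\<ge>M. \<forall>n\<ge>M. dist (\<Phi> (- real m)) (\<Phi> (- real n)) < e" by blast
  qed
  then obtain A where A: "(\<lambda>n. \<Phi> (- real n)) \<longlonglongrightarrow> A" by (auto simp: Cauchy_convergent_iff convergent_def)
  have left: "norm (\<Phi> u - A) \<le> (C / a) * exp (a * u)" if "u \<le> 0" for u
  proof (rule tendsto_upperbound)
    show "(\<lambda>n. norm (\<Phi> u - \<Phi> (- real n))) \<longlonglongrightarrow> norm (\<Phi> u - A)" by (intro tendsto_intros A)
    obtain m :: nat where m: "- u \<le> real m" using real_arch_simple by blast
    have "norm (\<Phi> u - \<Phi> (- real n)) \<le> (C / a) * exp (a * u)" if "n \<ge> m" for n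
      using incr[of "- real n" u] exp_decay_tail_left[OF g, of u "- real n"] m that \<open>u \<le> 0\<close> by simp
    then show "\<forall>\<^sub>F n in sequentially. norm (\<Phi> u - \<Phi> (- real n)) \<le> (C / a) * exp (a * u)"
      by (auto simp: eventually_sequentially)
  qed simp
  have right: "norm (\<Phi> u - A - ?I) \<le> (3 * C / a) * exp (- a * u)" if "u \<ge> 0" for u
  proof -
    have "integral {- u..u} g = \<Phi> u - \<Phi> (- u)" using incr[of "- u" u] that by simp
    then have "\<Phi> u - A - ?I = (integral {- u..u} g - ?I) + (\<Phi> (- u) - A)" by simp
    also have "norm \<dots> \<le> (2 * C / a) * exp (- a * u) + (C / a) * exp (a * (- u))"
      using that by (intro order_trans[OF norm_triangle_ineq] add_mono exp_decay_integrable(2)[OF g] left) auto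
    finally show ?thesis by (simp add: algebra_simps)
  qed
  define \<Psi> where "\<Psi> l = (if l \<le> 0 then A else \<Phi> (ln l))" for l
  have fin: "(?f has_integral \<Psi> d - A) {0..d}" if "d > 0" for d
  proof -
    have der: "(\<Psi> has_vector_derivative ?f l) (at l)" if "l > 0" for l
    proof -
      have "(ln has_vector_derivative 1 / l) (at l)"
        using that by (auto intro!: derivative_eq_intros simp: has_real_derivative_iff_has_vector_derivative[symmetric])
      from vector_diff_chain_at[OF this deriv] have "(\<Phi> \<circ> ln has_vector_derivative ?f l) (at l)" .
      then show ?thesis
        by (rule has_vector_derivative_transform_within_open[of _ _ _ "{0<..}"]) (use that in \<open>auto simp: \<Psi>_def\<close>)
    qed
    have "continuous_on {0..d} \<Psi>"
      unfolding continuous_on_def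
    proof
      fix l assume l: "l \<in> {0..d}"
      show "(\<Psi> \<longlongrightarrow> \<Psi> l) (at l within {0..d})"
      proof (cases "l = 0")
        case False
        then have "isCont \<Psi> l" using l der[of l] has_vector_derivative_continuous by auto
        then show ?thesis
          using continuous_at_imp_continuous_at_within[of l \<Psi> "{0..d}"] by (simp add: continuous_within)
      next
        case True
        have "((\<lambda>l. (C / a) * exp (a * ln l)) \<longlongrightarrow> 0) (at_right 0)"
        proof -
          have "filterlim (\<lambda>l. a * ln l) at_bot (at_right 0)"
            using a by (intro filterlim_tendsto_pos_mult_at_bot[OF tendsto_const] ln_at_0) auto
          from filterlim_compose[OF exp_at_bot this] have "((\<lambda>l. exp (a * ln l)) \<longlongrightarrow> 0) (at_right 0)" .
          from tendsto_mult_left[OF this, of "C / a"] show ?thesis by simp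
        qed
        moreover have "\<forall>\<^sub>F l in at_right 0. norm (\<Psi> l - A) \<le> norm ((C / a) * exp (a * ln l)) * 1"
          using eventually_at_right_less[of 0] eventually_at_right_real[of 0 1, OF zero_less_one]
        proof eventually_elim
          case (elim l)
          then show ?case using left[of "ln l"] a exp_decayD(4)[OF g] by (auto simp: \<Psi>_def)
        qed
        ultimately have "((\<lambda>l. \<Psi> l - A) \<longlongrightarrow> 0) (at_right 0)" by (rule tendsto_0_le)
        then have "(\<Psi> \<longlongrightarrow> A) (at_right 0)" by (simp add: LIM_zero_iff)
        moreover have "at 0 within {0..d} = at_right 0"
          using \<open>d > 0\<close> by (simp add: at_within_Icc_at_right)
        ultimately show ?thesis using True by (simp add: \<Psi>_def)
      qed
    qed
    from fundamental_theorem_of_calculus_interior[OF _ this, of ?f] der \<open>d > 0\<close>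
    show ?thesis by (auto simp: \<Psi>_def)
  qed
  show ?thesis
  proof (rule has_integral_unboundedI)
    show "\<not> bounded ({0<..} :: real set)"
    proof
      assume "bounded ({0<..} :: real set)"
      then obtain b where "\<forall>x\<in>({0<..} :: real set). norm x \<le> b" unfolding bounded_iff by blast
      then have "norm (\<bar>b\<bar> + 1) \<le> b" by (rule bspec) auto
      then show False by auto
    qed
    fix e :: real assume "e > 0"
    then have "\<forall>\<^sub>F n in sequentially. (3 * C / a) * exp (- a * real n) < e"
      using order_tendstoD(2)[OF exp_neg_mult_tendsto_0[OF a, of "3 * C / a"], of "e"] by simp
    then obtain M where M: "(3 * C / a) * exp (- a * real M) < e" by (auto simp: eventually_sequentially)
    show "\<exists>B>0. \<forall>c d. ball 0 B \<subseteq> {c..d} \<longrightarrow>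
      (\<exists>z. ((\<lambda>x. if x \<in> {0<..} then ?f x else 0) has_integral z) {c..d} \<and> norm (z - ?I) < e)"
    proof (intro exI[of _ "exp (real M) + 1"] conjI allI impI)
      fix c d :: real assume cd: "ball 0 (exp (real M) + 1) \<subseteq> {c..d}"
      have "0 \<in> {c..d}" "exp (real M) \<in> {c..d}"
        by (rule subsetD[OF cd], simp add: dist_norm add_pos_pos)+
      then have c: "c \<le> 0" "exp (real M) \<le> d" by auto
      then have d: "d > 0" "real M \<le> ln d" using less_le_trans[OF exp_gt_zero c(2)] by (auto simp: ln_ge_iff)
      have "((\<lambda>x. if x \<in> {0..d} then ?f x else 0) has_integral \<Psi> d - A) {c..d}"
        using c d by (subst has_integral_restrict) (auto intro: fin)
      then have "((\<lambda>x. if x \<in> {0<..} then ?f x else 0) has_integral \<Psi> d - A) {c..d}"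
        by (rule has_integral_spike_finite[of "{0}", rotated 2]) auto
      moreover have "norm (\<Psi> d - A - ?I) < e"
      proof -
        have "norm (\<Psi> d - A - ?I) \<le> (3 * C / a) * exp (- a * ln d)"
          using right[OF order_trans[OF of_nat_0_le_iff d(2)]] d by (simp add: \<Psi>_def)
        also have "\<dots> \<le> (3 * C / a) * exp (- a * real M)"
          using d a exp_decayD(4)[OF g] by (intro mult_left_mono) auto
        finally show ?thesis using M by simp
      qed
      ultimately show "\<exists>z. ((\<lambda>x. if x \<in> {0<..} then ?f x else 0) has_integral z) {c..d} \<and> norm (z - ?I) < e" by blast
    qed (auto intro: add_pos_pos)
  qed
qed

section \<open>Resolvents\<close>

lemma bounded_bilinear_scaleC: "bounded_bilinear (scaleC :: complex \<Rightarrow> 'a::complex_banach \<Rightarrow> 'a)"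
proof
  fix c d :: complex and x y :: 'a and r :: real
  show "(c + d) *\<^sub>C x = c *\<^sub>C x + d *\<^sub>C x" by (rule scaleC_add_left)
  show "c *\<^sub>C (x + y) = c *\<^sub>C x + c *\<^sub>C y" by (rule scaleC_add_right)
  show "(r *\<^sub>R c) *\<^sub>C x = r *\<^sub>R (c *\<^sub>C x)"
    by (simp add: scaleR_conv_of_real scaleC_scaleC flip: scaleC_of_real)
  show "c *\<^sub>C (r *\<^sub>R x) = r *\<^sub>R (c *\<^sub>C x)"
    by (simp add: scaleR_conv_of_real scaleC_scaleC mult.commute flip: scaleC_of_real)
  show "\<exists>K. \<forall>(a::complex) (b::'a). norm (a *\<^sub>C b) \<le> norm a * norm b * K"
    by (rule exI[of _ 1]) (simp add: norm_scaleC)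
qed

interpretation scaleC: bounded_bilinear "scaleC :: complex \<Rightarrow> 'a::complex_banach \<Rightarrow> 'a"
  by (rule bounded_bilinear_scaleC)

declare scaleC.continuous_on [continuous_intros]

lemma scaleC_one [simp]: "1 *\<^sub>C x = (x :: 'a::complex_banach)"
  using scaleC_of_real[of 1 x] by simp

lemma scaleR_scaleC: "r *\<^sub>R x = complex_of_real r *\<^sub>C (x :: 'a::complex_banach)"
  by (simp add: scaleC_of_real)

lemma bounded_operatorD:
  assumes "bounded_operator T"
  shows "bounded_linear (op_app T)" "op_app T (c *\<^sub>C x) = c *\<^sub>C op_app T x"
    "(x, y) \<in> T \<longleftrightarrow> y = op_app T x" "norm (op_app T x) \<le> op_norm T * norm x"
proof -
  obtain f where f: "bounded_linear f" "\<And>c x. f (c *\<^sub>C x) = c *\<^sub>C f x" "T = {(x, f x) |x. True}"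
    using assms unfolding bounded_operator_def by blast
  have "op_app T = f" by (auto simp: op_app_def f(3))
  with f show "bounded_linear (op_app T)" "op_app T (c *\<^sub>C x) = c *\<^sub>C op_app T x"
    "(x, y) \<in> T \<longleftrightarrow> y = op_app T x" by auto
  then show "norm (op_app T x) \<le> op_norm T * norm x"
    unfolding op_norm_def by (intro onorm)
qed

lemma bounded_operator_eqI:
  assumes "\<And>x y. (x, y) \<in> T \<longleftrightarrow> y = f x"
  shows "op_app T = f"
  using assms by (auto simp: op_app_def)

definition Res :: "'a::complex_banach operator \<Rightarrow> complex \<Rightarrow> 'a \<Rightarrow> 'a" where
  "Res A z = op_app ((op_shift A z)\<inverse>)"

text \<open>Invertibility of A + z, not of A - z, together with an explicit bound. The bound is
  carried along because the rotation argument rests on constants that do not deteriorate.\<close>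

definition resolves :: "'a::complex_banach operator \<Rightarrow> complex \<Rightarrow> real \<Rightarrow> bool" where
  "resolves A z k \<longleftrightarrow> bounded_operator ((op_shift A z)\<inverse>) \<and> (\<forall>v. norm (Res A z v) \<le> k * norm v)"

lemma op_shift_converse_iff: "(v, w) \<in> (op_shift A z)\<inverse> \<longleftrightarrow> (w, v - z *\<^sub>C w) \<in> A"
  by (force simp: op_shift_def)

lemma resolvesD:
  assumes "resolves A z k"
  shows "bounded_linear (Res A z)" "Res A z (c *\<^sub>C x) = c *\<^sub>C Res A z x"
    "(w, v - z *\<^sub>C w) \<in> A \<longleftrightarrow> w = Res A z v" "norm (Res A z v) \<le> k * norm v"
  using assms bounded_operatorD[of "(op_shift A z)\<inverse>"] unfolding resolves_def Res_def
  by (auto simp: op_shift_converse_iff[symmetric])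

lemma resolves_mono: "resolves A z k \<Longrightarrow> k \<le> k' \<Longrightarrow> resolves A z k'"
  unfolding resolves_def by (meson mult_right_mono norm_ge_zero order_trans)

lemma Res_apply: "resolves A z k \<Longrightarrow> (x, y) \<in> A \<Longrightarrow> Res A z (y + z *\<^sub>C x) = x"
  using resolvesD(3)[of A z k x "y + z *\<^sub>C x"] by simp

lemma Res_in: "resolves A z k \<Longrightarrow> (Res A z v, v - z *\<^sub>C Res A z v) \<in> A"
  using resolvesD(3) by blast

lemma Res_linear:
  assumes "resolves A z k"
  shows "Res A z (x + y) = Res A z x + Res A z y" "Res A z (x - y) = Res A z x - Res A z y"
    "Res A z (- x) = - Res A z x" "Res A z 0 = 0"
  using bounded_linear.linear[OF resolvesD(1)[OF assms]]
  by (simp_all add: linear_add linear_diff linear_neg linear_0)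

text \<open>If the graph condition determines w from v, then f is linear, because the graph of A is
  closed under sums and multiples; only the bound has to be supplied.\<close>

lemma resolvesI:
  assumes f: "\<And>v w. (w, v - z *\<^sub>C w) \<in> A \<longleftrightarrow> w = f v"
    and lin: "linear_operator A" and bound: "\<And>v. norm (f v) \<le> k * norm v"
  shows "resolves A z k" "Res A z = f"
proof -
  have add: "f (u + v) = f u + f v" for u v
  proof -
    have "(f u + f v, (u - z *\<^sub>C f u) + (v - z *\<^sub>C f v)) \<in> A"
      using f[of "f u" u] f[of "f v" v] lin unfolding linear_operator_def by blast
    then have "(f u + f v, (u + v) - z *\<^sub>C (f u + f v)) \<in> A" by (simp add: scaleC.add_right algebra_simps)
    then show ?thesis using f by simp
  qed
  have scale: "f (c *\<^sub>C v) = c *\<^sub>C f v" for c v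
  proof -
    have "(c *\<^sub>C f v, c *\<^sub>C (v - z *\<^sub>C f v)) \<in> A"
      using f[of "f v" v] lin unfolding linear_operator_def by blast
    then have "(c *\<^sub>C f v, c *\<^sub>C v - z *\<^sub>C (c *\<^sub>C f v)) \<in> A"
      by (simp add: scaleC.diff_right scaleC_scaleC mult.commute)
    then show ?thesis using f by simp
  qed
  have bl: "bounded_linear f"
    by (rule bounded_linear_intro[of f k]) (simp_all add: add scale scaleR_scaleC bound mult.commute)
  have mem: "(v, w) \<in> (op_shift A z)\<inverse> \<longleftrightarrow> w = f v" for v w
    by (simp only: op_shift_converse_iff f)
  then have eq: "(op_shift A z)\<inverse> = {(x, f x) |x. True}" by auto
  show Rf: "Res A z = f" unfolding Res_def by (rule bounded_operator_eqI) (rule mem)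
  show "resolves A z k"
    unfolding resolves_def Rf unfolding bounded_operator_def eq using bl scale bound by blast
qed

lemma resolvent_identity:
  assumes z: "resolves A z k" and w: "resolves A w k'"
  shows "Res A z v - Res A w v = (w - z) *\<^sub>C Res A z (Res A w v)"
proof -
  let ?x = "Res A w v"
  have "Res A z ((v - w *\<^sub>C ?x) + z *\<^sub>C ?x) = ?x" by (rule Res_apply[OF z Res_in[OF w]])
  then show ?thesis
    by (simp add: Res_linear[OF z] resolvesD(2)[OF z] scaleC.diff_left algebra_simps)
qed

lemma Res_commute:
  assumes z: "resolves A z k" and w: "resolves A w k'"
  shows "Res A z (Res A w v) = Res A w (Res A z v)"
proof (cases "z = w")
  case False
  have "(w - z) *\<^sub>C Res A z (Res A w v) = - ((z - w) *\<^sub>C Res A w (Res A z v))"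
    by (simp only: resolvent_identity[OF z w, symmetric] resolvent_identity[OF w z, symmetric] minus_diff_eq)
  then have "(w - z) *\<^sub>C Res A z (Res A w v) = (w - z) *\<^sub>C Res A w (Res A z v)"
    by (simp add: scaleC.diff_left)
  then have "(1 / (w - z)) *\<^sub>C (w - z) *\<^sub>C Res A z (Res A w v) = (1 / (w - z)) *\<^sub>C (w - z) *\<^sub>C Res A w (Res A z v)"
    by simp
  then show ?thesis using False by (simp add: scaleC_scaleC)
qed simp

lemma has_derivative_quadratic:
  fixes f :: "'b::real_normed_vector \<Rightarrow> 'c::real_normed_vector"
  assumes L: "bounded_linear L" and C: "\<And>y. y \<in> S \<Longrightarrow> norm (f y - f a - L (y - a)) \<le> C * (norm (y - a))\<^sup>2"
  shows "(f has_derivative L) (at a within S)"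
  unfolding has_derivative_within_alt
proof (intro conjI L allI impI)
  fix e :: real assume e: "e > 0"
  show "\<exists>d>0. \<forall>y\<in>S. norm (y - a) < d \<longrightarrow> norm (f y - f a - L (y - a)) \<le> e * norm (y - a)"
  proof (intro exI[of _ "e / (\<bar>C\<bar> + 1)"] conjI ballI impI)
    fix y assume y: "y \<in> S" "norm (y - a) < e / (\<bar>C\<bar> + 1)"
    have "norm (f y - f a - L (y - a)) \<le> C * (norm (y - a))\<^sup>2" by (rule C[OF y(1)])
    also have "\<dots> \<le> (\<bar>C\<bar> + 1) * (norm (y - a))\<^sup>2" by (intro mult_right_mono) auto
    also have "\<dots> = ((\<bar>C\<bar> + 1) * norm (y - a)) * norm (y - a)" by (simp add: power2_eq_square)
    also have "\<dots> \<le> e * norm (y - a)"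
      using y(2) by (intro mult_right_mono) (auto simp: field_simps)
    finally show "norm (f y - f a - L (y - a)) \<le> e * norm (y - a)" .
  qed (use e in auto)
qed

text \<open>Two applications of the resolvent identity make the remainder quadratic, with a constant
  depending on K and x only. The set S is arbitrary, so the derivative is available on sets without
  interior such as the half-line.\<close>

lemma Res_has_derivative:
  assumes S: "\<And>z. z \<in> S \<Longrightarrow> resolves A z K" and K: "K \<ge> 0" and z: "z \<in> S"
  shows "((\<lambda>p. Res A (fst p) (snd p)) has_derivative
     (\<lambda>p. Res A z (snd p) - fst p *\<^sub>C Res A z (Res A z x))) (at (z, x) within S \<times> UNIV)"
proof (rule has_derivative_quadratic)
  note R = resolvesD[OF S[OF z]] and lin = Res_linear[OF S[OF z]]
  show "bounded_linear (\<lambda>p. Res A z (snd p) - fst p *\<^sub>C Res A z (Res A z x))"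
    by (intro bounded_linear_sub bounded_linear_compose[OF R(1) bounded_linear_snd]
        bounded_linear_compose[OF scaleC.bounded_linear_left bounded_linear_fst])
  fix p assume "p \<in> S \<times> (UNIV :: 'a set)"
  then obtain z' x' where p: "p = (z', x')" and z': "z' \<in> S" by auto
  define d e where "d = z' - z" and "e = x' - x"
  note lin' = Res_linear[OF S[OF z']] and R' = resolvesD[OF S[OF z']]
  have id: "Res A z' v = Res A z v - d *\<^sub>C Res A z' (Res A z v)" for v
    using resolvent_identity[OF S[OF z'] S[OF z], of v] by (simp add: d_def scaleC.diff_left algebra_simps)
  have "Res A z' x' - Res A z x - (Res A z e - d *\<^sub>C Res A z (Res A z x))
     = (Res A z' x - Res A z x + d *\<^sub>C Res A z (Res A z x)) + (Res A z' e - Res A z e)"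
    unfolding e_def lin lin' by simp
  also have "\<dots> = d *\<^sub>C (Res A z (Res A z x) - Res A z' (Res A z x)) - d *\<^sub>C Res A z' (Res A z e)"
    by (simp only: id[of x] id[of e] scaleC.diff_right) simp
  also have "\<dots> = d *\<^sub>C d *\<^sub>C Res A z' (Res A z (Res A z x)) - d *\<^sub>C Res A z' (Res A z e)"
    using id[of "Res A z x"] by simp
  finally have eq: "Res A z' x' - Res A z x - (Res A z e - d *\<^sub>C Res A z (Res A z x))
     = d *\<^sub>C d *\<^sub>C Res A z' (Res A z (Res A z x)) - d *\<^sub>C Res A z' (Res A z e)" .
  have b1: "norm (Res A z' v) \<le> K * norm v" "norm (Res A z v) \<le> K * norm v" for v
    by (rule R'(4), rule R(4))
  have b2: "norm (Res A z' (Res A z v)) \<le> K * (K * norm v)" for v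
    using order_trans[OF b1(1) mult_left_mono[OF b1(2) K]] .
  have b3: "norm (Res A z' (Res A z (Res A z v))) \<le> K * (K * (K * norm v))" for v
    using order_trans[OF b2 mult_left_mono[OF mult_left_mono[OF b1(2) K] K]] .
  have dp: "norm d \<le> norm (p - (z, x))" "norm e \<le> norm (p - (z, x))"
    using norm_fst_le[of d e] norm_snd_le[of e d] by (auto simp: p d_def e_def)
  have "norm (Res A z' x' - Res A z x - (Res A z e - d *\<^sub>C Res A z (Res A z x)))
     \<le> norm d * (norm d * (K * (K * (K * norm x)))) + norm d * (K * (K * norm e))"
    unfolding eq using b3[of x] b2[of e]
    by (intro order_trans[OF norm_triangle_ineq4] add_mono) (auto simp: norm_scaleC intro!: mult_left_mono)
  also have "\<dots> \<le> norm (p - (z, x)) * (norm (p - (z, x)) * (K * (K * (K * norm x)))) + norm (p - (z, x)) * (K * (K * norm (p - (z, x))))"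
    using dp K by (intro add_mono mult_mono mult_nonneg_nonneg) auto
  also have "\<dots> = (K ^ 3 * norm x + K\<^sup>2) * (norm (p - (z, x)))\<^sup>2"
    by (simp add: power2_eq_square power3_eq_cube algebra_simps)
  finally show "norm (Res A (fst p) (snd p) - Res A (fst (z, x)) (snd (z, x)) -
      (Res A z (snd (p - (z, x))) - fst (p - (z, x)) *\<^sub>C Res A z (Res A z x)))
    \<le> (K ^ 3 * norm x + K\<^sup>2) * (norm (p - (z, x)))\<^sup>2"
    by (simp add: p d_def e_def)
qed

lemma Res_has_vector_derivative:
  assumes S: "\<And>s. s \<in> X \<Longrightarrow> resolves A (\<gamma> s) K" and K: "K \<ge> 0" and s: "s \<in> X"
    and g: "(\<gamma> has_vector_derivative \<gamma>') (at s within X)" and w: "(w has_vector_derivative w') (at s within X)"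
  shows "((\<lambda>s. Res A (\<gamma> s) (w s)) has_vector_derivative
     Res A (\<gamma> s) w' - \<gamma>' *\<^sub>C Res A (\<gamma> s) (Res A (\<gamma> s) (w s))) (at s within X)"
proof -
  have p: "((\<lambda>s. (\<gamma> s, w s)) has_derivative (\<lambda>d. d *\<^sub>R (\<gamma>', w'))) (at s within X)"
    using has_vector_derivative_Pair[OF g w] by (simp add: has_vector_derivative_def)
  have "((\<lambda>p. Res A (fst p) (snd p)) has_derivative
     (\<lambda>p. Res A (\<gamma> s) (snd p) - fst p *\<^sub>C Res A (\<gamma> s) (Res A (\<gamma> s) (w s)))) (at (\<gamma> s, w s) within \<gamma> ` X \<times> UNIV)"
    using S s by (intro Res_has_derivative[OF _ K]) auto
  then have "((\<lambda>p. Res A (fst p) (snd p)) has_derivative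
     (\<lambda>p. Res A (\<gamma> s) (snd p) - fst p *\<^sub>C Res A (\<gamma> s) (Res A (\<gamma> s) (w s)))) (at (\<gamma> s, w s) within (\<lambda>s. (\<gamma> s, w s)) ` X)"
    by (rule has_derivative_subset) auto
  from diff_chain_within[OF p this]
  show ?thesis
    by (simp add: has_vector_derivative_def o_def linear_scale[OF bounded_linear.linear[OF resolvesD(1)[OF S[OF s]]]]
        scaleC.scaleR_left scaleR_right_diff_distrib)
qed

lemma continuous_on_Res:
  fixes A :: "'a::complex_banach operator" and f :: "'t::topological_space \<Rightarrow> complex"
  assumes S: "\<And>s. s \<in> X \<Longrightarrow> resolves A (f s) K" and f: "continuous_on X f" and g: "continuous_on X g"
  shows "continuous_on X (\<lambda>s. Res A (f s) (g s))"
proof -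
  have S': "\<And>s. s \<in> X \<Longrightarrow> resolves A (f s) \<bar>K\<bar>" using S by (rule resolves_mono) auto
  have "continuous_on (f ` X \<times> UNIV) (\<lambda>p. Res A (fst p) (snd p))"
    unfolding continuous_on_eq_continuous_within
  proof
    fix p assume "p \<in> f ` X \<times> (UNIV :: 'a set)"
    then obtain z x where p: "p = (z, x)" "z \<in> f ` X" by auto
    show "continuous (at p within f ` X \<times> UNIV) (\<lambda>p. Res A (fst p) (snd p))"
      unfolding p(1) by (rule has_derivative_continuous[OF Res_has_derivative[of _ _ "\<bar>K\<bar>"]]) (use S' p in auto)
  qed
  from continuous_on_compose2[OF this continuous_on_Pair[OF f g]] show ?thesis by auto
qed

section \<open>Mellin transform of the resolvent\<close>

definition yosida :: "'a::complex_banach operator \<Rightarrow> complex \<Rightarrow> 'a \<Rightarrow> 'a" where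
  "yosida A \<zeta> v = exp \<zeta> *\<^sub>C Res A (exp \<zeta>) v"

text \<open>For y = A x this is the derivative of \<open>yosida A \<zeta> x\<close> in \<zeta>. On
  the real axis, with l = exp u and du = dl / l, it is the part (A + l)^-2 y of the integrand of the
  imaginary powers, multiplied by the Jacobian l.\<close>

definition rho :: "'a::complex_banach operator \<Rightarrow> complex \<Rightarrow> 'a \<Rightarrow> 'a" where
  "rho A \<zeta> y = exp \<zeta> *\<^sub>C Res A (exp \<zeta>) (Res A (exp \<zeta>) y)"

definition mellin :: "'a::complex_banach operator \<Rightarrow> real \<Rightarrow> 'a \<Rightarrow> 'a" where
  "mellin A t y = integral UNIV (\<lambda>u. cis (t * u) *\<^sub>C rho A (of_real u) y)"

text \<open>Logarithmic coordinates: for h < \<pi> the strip of half-width h in \<zeta> is the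
  sector of half-angle h around the positive half-line in z = exp \<zeta>. With h = 0 only the
  half-line itself is required.\<close>

locale strip =
  fixes A :: "'a::complex_banach operator" and K h :: real
  assumes lin: "linear_operator A" and h: "h \<ge> 0" and K: "K \<ge> 1"
    and res0: "resolves A 0 K"
    and res: "\<And>\<zeta>. \<bar>Im \<zeta>\<bar> \<le> h \<Longrightarrow> resolves A (exp \<zeta>) (K / (1 + exp (Re \<zeta>)))"
begin

lemma resK:
  assumes "\<bar>Im \<zeta>\<bar> \<le> h"
  shows "resolves A (exp \<zeta>) K"
proof (rule resolves_mono[OF res[OF assms]])
  have "K * 1 \<le> K * (1 + exp (Re \<zeta>))" using K by (intro mult_left_mono) auto
  then show "K / (1 + exp (Re \<zeta>)) \<le> K"
    using exp_gt_zero[of "Re \<zeta>"] by (subst divide_le_eq) (auto simp: add_pos_pos)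
qed

lemmas [simp] = h

lemma Im_real: "\<bar>Im (of_real u)\<bar> \<le> h"
  by simp

lemma norm_Res:
  assumes "\<bar>Im \<zeta>\<bar> \<le> h"
  shows "norm (Res A (exp \<zeta>) v) \<le> K * norm v" "norm (Res A (exp \<zeta>) v) \<le> K * exp (- Re \<zeta>) * norm v"
proof -
  show "norm (Res A (exp \<zeta>) v) \<le> K * norm v" using resolvesD(4)[OF resK[OF assms]] .
  have "K / (1 + exp (Re \<zeta>)) \<le> K / exp (Re \<zeta>)"
    using K by (intro divide_left_mono mult_pos_pos) (auto simp: add_pos_pos)
  also have "\<dots> = K * exp (- Re \<zeta>)" by (simp add: exp_minus divide_inverse)
  finally show "norm (Res A (exp \<zeta>) v) \<le> K * exp (- Re \<zeta>) * norm v"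
    by (rule resolvesD(4)[OF resolves_mono[OF res[OF assms]]])
qed

lemma norm_yosida:
  assumes "\<bar>Im \<zeta>\<bar> \<le> h"
  shows "norm (yosida A \<zeta> v) \<le> K * norm v" "norm (yosida A \<zeta> v) \<le> K * exp (Re \<zeta>) * norm v"
proof -
  have "norm (yosida A \<zeta> v) \<le> exp (Re \<zeta>) * (K * exp (- Re \<zeta>) * norm v)"
    unfolding yosida_def norm_scaleC norm_exp_eq_Re
    by (intro mult_left_mono norm_Res assms) auto
  also have "\<dots> = K * norm v" by (simp add: exp_minus)
  finally show "norm (yosida A \<zeta> v) \<le> K * norm v" .
  have "norm (yosida A \<zeta> v) \<le> exp (Re \<zeta>) * (K * norm v)"
    unfolding yosida_def norm_scaleC norm_exp_eq_Re
    by (intro mult_left_mono norm_Res assms) auto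
  then show "norm (yosida A \<zeta> v) \<le> K * exp (Re \<zeta>) * norm v" by (simp add: mult_ac)
qed

text \<open>For large |exp \<zeta>| both resolvents decay and one of them compensates the factor exp
  \<zeta>; for small |exp \<zeta>| the factor itself decays.\<close>

lemma norm_rho:
  assumes "\<bar>Im \<zeta>\<bar> \<le> h"
  shows "norm (rho A \<zeta> y) \<le> K\<^sup>2 * norm y * exp (- \<bar>Re \<zeta>\<bar>)"
proof (cases "Re \<zeta> \<ge> 0")
  case True
  have "norm (rho A \<zeta> y) \<le> exp (Re \<zeta>) * (K * exp (- Re \<zeta>) * (K * exp (- Re \<zeta>) * norm y))"
    unfolding rho_def norm_scaleC norm_exp_eq_Re using K
    by (intro mult_left_mono order_trans[OF norm_Res(2)[OF assms]] norm_Res(2)[OF assms]) auto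
  also have "\<dots> = K\<^sup>2 * norm y * exp (- Re \<zeta>)" by (simp add: exp_minus power2_eq_square)
  finally show ?thesis using True by simp
next
  case False
  have "norm (rho A \<zeta> y) \<le> exp (Re \<zeta>) * (K * (K * norm y))"
    unfolding rho_def norm_scaleC norm_exp_eq_Re using K
    by (intro mult_left_mono order_trans[OF norm_Res(1)[OF assms]] norm_Res(1)[OF assms]) auto
  also have "\<dots> = K\<^sup>2 * norm y * exp (Re \<zeta>)" by (simp add: power2_eq_square)
  finally show ?thesis using False by simp
qed

lemma bounded_linear_rho: "\<bar>Im \<zeta>\<bar> \<le> h \<Longrightarrow> bounded_linear (rho A \<zeta>)"
  unfolding rho_def
  by (intro bounded_linear_compose[OF scaleC.bounded_linear_right]
      bounded_linear_compose[OF resolvesD(1)[OF resK]] resolvesD(1)[OF resK])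

lemma rho_scaleC: "\<bar>Im \<zeta>\<bar> \<le> h \<Longrightarrow> rho A \<zeta> (c *\<^sub>C y) = c *\<^sub>C rho A \<zeta> y"
  by (simp add: rho_def resolvesD(2)[OF resK] scaleC_scaleC mult.commute)

lemma rho_Res_commute:
  assumes "\<bar>Im \<zeta>\<bar> \<le> h" "resolves A w k"
  shows "rho A \<zeta> (Res A w y) = Res A w (rho A \<zeta> y)"
  using assms by (simp add: rho_def resolvesD(2)[OF assms(2)] Res_commute[OF assms(2) resK])

lemma continuous_on_rho [continuous_intros]:
  assumes "\<And>s. s \<in> X \<Longrightarrow> \<bar>Im (f s)\<bar> \<le> h" "continuous_on X f" "continuous_on X g"
  shows "continuous_on X (\<lambda>s. rho A (f s) (g s))"
  unfolding rho_def
  by (intro continuous_intros continuous_on_Res[where K = K] resK assms continuous_on_compose2[OF continuous_on_exp[OF continuous_on_id, of UNIV]])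
     (auto intro: assms)

lemma mellin_decay: "exp_decay (K\<^sup>2 * norm y) 1 (\<lambda>u. cis (t * u) *\<^sub>C rho A (of_real u) y)"
  unfolding exp_decay_def
proof (intro conjI allI)
  show "continuous_on UNIV (\<lambda>u. cis (t * u) *\<^sub>C rho A (complex_of_real u) y)"
    by (intro continuous_intros) auto
  show "norm (cis (t * u) *\<^sub>C rho A (complex_of_real u) y) \<le> K\<^sup>2 * norm y * exp (- 1 * \<bar>u\<bar>)" for u
    using norm_rho[of "of_real u" y] by (simp add: norm_scaleC)
qed simp

lemma mellin_scaleC: "mellin A t (c *\<^sub>C y) = c *\<^sub>C mellin A t y"
proof -
  have "mellin A t (c *\<^sub>C y) = integral UNIV ((\<lambda>v. c *\<^sub>C v) \<circ> (\<lambda>u. cis (t * u) *\<^sub>C rho A (of_real u) y))"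
    unfolding mellin_def by (simp add: o_def rho_scaleC scaleC_scaleC mult.commute)
  also have "\<dots> = c *\<^sub>C mellin A t y"
    unfolding mellin_def
    by (rule integral_linear[OF exp_decay_integrable(1)[OF mellin_decay] scaleC.bounded_linear_right])
  finally show ?thesis .
qed

lemma mellin_commute:
  assumes f: "bounded_linear f" "\<And>c v. f (c *\<^sub>C v) = c *\<^sub>C f v" "\<And>u v. f (rho A (of_real u) v) = rho A (of_real u) (f v)"
  shows "f (mellin A t y) = mellin A t (f y)"
  unfolding mellin_def
  by (subst integral_linear[OF exp_decay_integrable(1)[OF mellin_decay] f(1), symmetric]) (simp add: o_def f)

lemma mellin_Res: "resolves A w k \<Longrightarrow> mellin A t (Res A w y) = Res A w (mellin A t y)"
  using mellin_commute[of "Res A w" t y] rho_Res_commute[OF Im_real, of w k]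
  by (simp add: resolvesD(1,2))

lemma mellin_continuous: "continuous_on UNIV (\<lambda>t. mellin A t y)"
  unfolding mellin_def
proof (rule exp_decay_integral_param)
  show "continuous_on UNIV (\<lambda>(t, u). cis (t * u) *\<^sub>C rho A (complex_of_real u) y)"
    unfolding case_prod_beta by (intro continuous_intros) auto
qed (rule mellin_decay)

lemma yosida_residual: "\<bar>Im \<zeta>\<bar> \<le> h \<Longrightarrow> (x, y) \<in> A \<Longrightarrow> x - yosida A \<zeta> x = Res A (exp \<zeta>) y"
  using Res_apply[OF resK, of \<zeta> x y]
  by (simp add: yosida_def Res_linear[OF resK] resolvesD(2)[OF resK] algebra_simps)

text \<open>Since (A + l)^-1 A is I - T with T = \<open>yosida\<close>, this vector is T (I - T) x.
  Products of such terms thereby become polynomials in values of T.\<close>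

lemma rho_eq: "\<bar>Im \<zeta>\<bar> \<le> h \<Longrightarrow> (x, y) \<in> A \<Longrightarrow> rho A \<zeta> y = yosida A \<zeta> x - yosida A \<zeta> (yosida A \<zeta> x)"
  by (simp only: rho_def yosida_residual[symmetric] Res_linear[OF resK] scaleC.diff_right yosida_def[symmetric])

text \<open>Derivatives are taken along lines \<zeta>0 + s c, so that one set of formulas serves
  both the real axis (c = 1) and the direction across the strip (c imaginary).\<close>

lemma exp_line_deriv:
  fixes \<zeta>0 c :: complex
  shows "((\<lambda>s. exp (\<zeta>0 + of_real s * c)) has_vector_derivative c * exp (\<zeta>0 + of_real s * c)) (at s within X)"
proof -
  have "((\<lambda>z. exp (\<zeta>0 + z * c)) has_field_derivative c * exp (\<zeta>0 + of_real s * c)) (at (of_real s))"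
    by (auto intro!: derivative_eq_intros)
  from has_vector_derivative_real_field[OF this] show ?thesis .
qed

lemma Res_line_deriv:
  assumes X: "\<And>s. s \<in> X \<Longrightarrow> \<bar>Im (\<zeta>0 + of_real s * c)\<bar> \<le> h" and s: "s \<in> X"
    and w: "(w has_vector_derivative w') (at s within X)"
  shows "((\<lambda>s. Res A (exp (\<zeta>0 + of_real s * c)) (w s)) has_vector_derivative
    Res A (exp (\<zeta>0 + of_real s * c)) w' - (c * exp (\<zeta>0 + of_real s * c)) *\<^sub>C
      Res A (exp (\<zeta>0 + of_real s * c)) (Res A (exp (\<zeta>0 + of_real s * c)) (w s))) (at s within X)"
  using K by (intro Res_has_vector_derivative[where K = K] resK X s exp_line_deriv w) auto

lemma yosida_deriv:
  assumes X: "\<And>s. s \<in> X \<Longrightarrow> \<bar>Im (\<zeta>0 + of_real s * c)\<bar> \<le> h" and s: "s \<in> X" and xy: "(x, y) \<in> A"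
  shows "((\<lambda>s. yosida A (\<zeta>0 + of_real s * c) x) has_vector_derivative c *\<^sub>C rho A (\<zeta>0 + of_real s * c) y) (at s within X)"
proof -
  let ?\<zeta> = "\<lambda>s. \<zeta>0 + of_real s * c"
  have "((\<lambda>s. yosida A (?\<zeta> s) x) has_vector_derivative
      exp (?\<zeta> s) *\<^sub>C (Res A (exp (?\<zeta> s)) 0 - (c * exp (?\<zeta> s)) *\<^sub>C Res A (exp (?\<zeta> s)) (Res A (exp (?\<zeta> s)) x))
      + (c * exp (?\<zeta> s)) *\<^sub>C Res A (exp (?\<zeta> s)) x) (at s within X)"
    unfolding yosida_def
    by (intro scaleC.has_vector_derivative exp_line_deriv Res_line_deriv X s has_vector_derivative_const)
  moreover have "exp \<zeta> *\<^sub>C (Res A (exp \<zeta>) 0 - (c * exp \<zeta>) *\<^sub>C Res A (exp \<zeta>) (Res A (exp \<zeta>) x))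
      + (c * exp \<zeta>) *\<^sub>C Res A (exp \<zeta>) x = c *\<^sub>C rho A \<zeta> y" if \<zeta>: "\<bar>Im \<zeta>\<bar> \<le> h" for \<zeta>
    unfolding rho_eq[OF \<zeta> xy] yosida_def
    by (simp add: Res_linear[OF resK[OF \<zeta>]] resolvesD(2)[OF resK[OF \<zeta>]] scaleC_scaleC scaleC.diff_right
        scaleC.minus_right scaleC.zero_right mult_ac)
  ultimately show ?thesis using X[OF s] by simp
qed

text \<open>As T' = T - T^2, the derivative of T - T^2 is (1 - 2 T) (T - T^2).\<close>

definition rho' where
  "rho' \<zeta> y = rho A \<zeta> y - 2 *\<^sub>R yosida A \<zeta> (rho A \<zeta> y)"

lemma rho_deriv:
  assumes X: "\<And>s. s \<in> X \<Longrightarrow> \<bar>Im (\<zeta>0 + of_real s * c)\<bar> \<le> h" and s: "s \<in> X"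
  shows "((\<lambda>s. rho A (\<zeta>0 + of_real s * c) y) has_vector_derivative c *\<^sub>C rho' (\<zeta>0 + of_real s * c) y) (at s within X)"
proof -
  let ?\<zeta> = "\<lambda>s. \<zeta>0 + of_real s * c"
  let ?R = "\<lambda>\<zeta>. Res A (exp \<zeta>)"
  have "((\<lambda>s. rho A (?\<zeta> s) y) has_vector_derivative
      exp (?\<zeta> s) *\<^sub>C (?R (?\<zeta> s) (?R (?\<zeta> s) 0 - (c * exp (?\<zeta> s)) *\<^sub>C ?R (?\<zeta> s) (?R (?\<zeta> s) y)) - (c * exp (?\<zeta> s)) *\<^sub>C ?R (?\<zeta> s) (?R (?\<zeta> s) (?R (?\<zeta> s) y)))
      + (c * exp (?\<zeta> s)) *\<^sub>C ?R (?\<zeta> s) (?R (?\<zeta> s) y)) (at s within X)"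
    unfolding rho_def
    by (intro scaleC.has_vector_derivative exp_line_deriv Res_line_deriv X s has_vector_derivative_const)
  moreover have "exp \<zeta> *\<^sub>C (?R \<zeta> (?R \<zeta> 0 - (c * exp \<zeta>) *\<^sub>C ?R \<zeta> (?R \<zeta> y)) - (c * exp \<zeta>) *\<^sub>C ?R \<zeta> (?R \<zeta> (?R \<zeta> y)))
      + (c * exp \<zeta>) *\<^sub>C ?R \<zeta> (?R \<zeta> y) = c *\<^sub>C rho' \<zeta> y" if \<zeta>: "\<bar>Im \<zeta>\<bar> \<le> h" for \<zeta>
    unfolding rho'_def rho_def yosida_def
    by (simp add: Res_linear[OF resK[OF \<zeta>]] resolvesD(2)[OF resK[OF \<zeta>]] scaleC_scaleC scaleC.diff_right
        scaleC.minus_right scaleC.zero_right mult_ac scaleR_2 scaleC.add_right)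
  ultimately show ?thesis using X[OF s] by simp
qed

lemma yosida_at_top:
  assumes xy: "(x, y) \<in> A"
  shows "((\<lambda>u. yosida A (of_real u) x) \<longlongrightarrow> x) at_top"
proof -
  have "((\<lambda>u. x - yosida A (of_real u) x) \<longlongrightarrow> 0) at_top"
  proof (rule tendsto_0_le[where K = 1])
    show "((\<lambda>u. K * exp (- u) * norm y) \<longlongrightarrow> 0) at_top"
      by (intro tendsto_mult_left_zero tendsto_mult_right_zero filterlim_compose[OF exp_at_bot filterlim_uminus_at_bot_at_top])
    show "\<forall>\<^sub>F u in at_top. norm (x - yosida A (of_real u) x) \<le> norm (K * exp (- u) * norm y) * 1"
      using yosida_residual[OF Im_real xy] norm_Res(2)[OF Im_real, of _ y] K by (simp add: abs_mult)
  qed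
  from tendsto_diff[OF tendsto_const[of x] this] show ?thesis by simp
qed

lemma yosida_at_bot: "((\<lambda>u. yosida A (of_real u) x) \<longlongrightarrow> 0) at_bot"
proof (rule tendsto_0_le[where K = 1])
  show "((\<lambda>u. K * exp u * norm x) \<longlongrightarrow> 0) at_bot"
    by (intro tendsto_mult_left_zero tendsto_mult_right_zero exp_at_bot)
  show "\<forall>\<^sub>F u in at_bot. norm (yosida A (of_real u) x) \<le> norm (K * exp u * norm x) * 1"
    using norm_yosida(2)[OF Im_real, of _ x] K by (simp add: abs_mult)
qed

lemma yosida_real_deriv:
  "(x, y) \<in> A \<Longrightarrow> ((\<lambda>u. yosida A (of_real u) x) has_vector_derivative rho A (of_real u) y) (at u)"
  using yosida_deriv[of UNIV 0 1 u x y] h by simp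

end

section \<open>Composition of Mellin transforms\<close>

lemma exp_decay_shift:
  assumes f: "exp_decay C a f"
  shows "exp_decay (C * exp (a * \<bar>w\<bar>)) a (\<lambda>u. f (u + w))"
  unfolding exp_decay_def
proof (intro conjI allI)
  show "a > 0" by (rule exp_decayD[OF f])
  show "continuous_on UNIV (\<lambda>u. f (u + w))"
    by (rule continuous_on_compose2[OF exp_decayD(2)[OF f, of UNIV]]) (auto intro!: continuous_intros)
  fix u
  have "a * \<bar>u\<bar> \<le> a * (\<bar>w\<bar> + \<bar>u + w\<bar>)" using exp_decayD(1)[OF f] by (intro mult_left_mono) auto
  then have "exp (- a * \<bar>u + w\<bar>) \<le> exp (a * \<bar>w\<bar> + - a * \<bar>u\<bar>)" by (simp add: algebra_simps)
  then have "C * exp (- a * \<bar>u + w\<bar>) \<le> C * exp (a * \<bar>w\<bar> + - a * \<bar>u\<bar>)"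
    using exp_decayD(4)[OF f] by (intro mult_left_mono)
  then show "norm (f (u + w)) \<le> C * exp (a * \<bar>w\<bar>) * exp (- a * \<bar>u\<bar>)"
    using exp_decayD(3)[OF f, of "u + w"] by (simp add: mult.assoc exp_add[symmetric])
qed

text \<open>The scalar factor in \<open>mellin_conv_eq\<close>; q comes from partial fractions of
  two resolvents at the points exp u and exp (u + w). It depends on \<sigma> and w but not on the
  operator, which makes the comparison in \<open>mellin_mult\<close> possible.\<close>

definition pair_kernel :: "real \<Rightarrow> real \<Rightarrow> complex" where
  "pair_kernel \<sigma> w = (let q = exp w / (exp w - 1) in
     of_real (q * (q - 1)) * (of_real (2 * q - 1) * ((1 - cis (- \<sigma> * w)) / (\<i> * \<sigma>)) - 1 - cis (- \<sigma> * w)))"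

context strip
begin

lemma Res0_in: "(Res A 0 y, y) \<in> A"
  using Res_in[OF res0, of y] by (simp add: scaleC.zero_left)

lemma mellin_shift:
  "integral UNIV (\<lambda>u. cis (t * u) *\<^sub>C rho A (of_real (u + w)) y) = cis (- t * w) *\<^sub>C mellin A t y"
    and mellin_shift_decay: "exp_decay (K\<^sup>2 * norm y * exp \<bar>w\<bar>) 1 (\<lambda>u. cis (t * u) *\<^sub>C rho A (of_real (u + w)) y)"
proof -
  let ?f = "\<lambda>u. cis (t * u) *\<^sub>C rho A (of_real u) y"
  have d: "exp_decay (K\<^sup>2 * norm y * exp \<bar>w\<bar>) 1 (\<lambda>u. ?f (u + w))"
    using exp_decay_shift[OF mellin_decay[of y t], of w] by simp
  have "cis (- t * w) * cis (t * (u + w)) = cis (t * u)" for u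
    by (simp add: cis_mult algebra_simps)
  then have eq: "cis (t * u) *\<^sub>C rho A (of_real (u + w)) y = cis (- t * w) *\<^sub>C ?f (u + w)" for u
    by (simp add: scaleC_scaleC)
  show "exp_decay (K\<^sup>2 * norm y * exp \<bar>w\<bar>) 1 (\<lambda>u. cis (t * u) *\<^sub>C rho A (of_real (u + w)) y)"
    unfolding eq using d by (auto simp: exp_decay_def norm_scaleC intro!: continuous_intros)
  have "integral UNIV (\<lambda>u. cis (t * u) *\<^sub>C rho A (of_real (u + w)) y)
     = cis (- t * w) *\<^sub>C integral UNIV (\<lambda>u. ?f (u + w))"
    unfolding eq using integral_linear[OF exp_decay_integrable(1)[OF d] scaleC.bounded_linear_right] by (simp add: o_def)
  also have "integral UNIV (\<lambda>u. ?f (u + w)) = mellin A t y"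
    unfolding mellin_def by (rule exp_decay_integral_shift[OF mellin_decay d])
  finally show "integral UNIV (\<lambda>u. cis (t * u) *\<^sub>C rho A (of_real (u + w)) y) = cis (- t * w) *\<^sub>C mellin A t y" .
qed

lemma yosida_shift_decay:
  assumes xy: "(x, y) \<in> A"
  shows "\<exists>C. exp_decay C 1 (\<lambda>u. cis (t * u) *\<^sub>C (yosida A (of_real (u + w)) x - yosida A (of_real u) x))"
proof (intro exI)
  let ?D = "\<lambda>u. yosida A (of_real (u + w)) x - yosida A (of_real u) x"
  let ?C = "K * (2 + exp w + exp (- w)) * (norm x + norm y)"
  show "exp_decay ?C 1 (\<lambda>u. cis (t * u) *\<^sub>C ?D u)"
    unfolding exp_decay_def
  proof (intro conjI allI)
    have "continuous_on UNIV (\<lambda>u. yosida A (of_real u) x)"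
      using yosida_real_deriv[OF xy]
      by (meson continuous_at_imp_continuous_on has_vector_derivative_continuous)
    then have yc: "continuous_on UNIV (\<lambda>u. yosida A (of_real (f u)) x)" if "continuous_on UNIV f" for f :: "real \<Rightarrow> real"
      using that continuous_on_compose2 by fastforce
    then show "continuous_on UNIV (\<lambda>u. cis (t * u) *\<^sub>C ?D u)" by (intro continuous_intros yc)
    fix u
    have "norm (?D u) \<le> ?C * exp (- \<bar>u\<bar>)"
    proof (cases "u \<ge> 0")
      case True
      have "?D u = (x - yosida A (of_real u) x) - (x - yosida A (of_real (u + w)) x)" by simp
      also have "norm \<dots> \<le> norm (Res A (exp (of_real u)) y) + norm (Res A (exp (of_real (u + w))) y)"
        unfolding yosida_residual[OF Im_real xy] by (rule norm_triangle_ineq4)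
      also have "\<dots> \<le> K * exp (- u) * norm y + K * exp (- (u + w)) * norm y"
        using norm_Res(2)[OF Im_real, of u y] norm_Res(2)[OF Im_real, of "u + w" y] by simp
      also have "\<dots> = K * (1 + exp (- w)) * norm y * exp (- u)" by (simp add: exp_diff exp_minus field_simps)
      also have "\<dots> \<le> ?C * exp (- u)"
        using K by (intro mult_right_mono mult_mono) (auto intro: add_nonneg_nonneg)
      finally show ?thesis using True by simp
    next
      case False
      have "norm (?D u) \<le> K * exp (u + w) * norm x + K * exp u * norm x"
        using norm_yosida(2)[OF Im_real, of u x] norm_yosida(2)[OF Im_real, of "u + w" x]
        by (intro order_trans[OF norm_triangle_ineq4]) simp
      also have "\<dots> = K * (1 + exp w) * norm x * exp u" by (simp add: exp_add field_simps)
      also have "\<dots> \<le> ?C * exp u"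
        using K by (intro mult_right_mono mult_mono) (auto intro: add_nonneg_nonneg)
      finally show ?thesis using False by simp
    qed
    then show "norm (cis (t * u) *\<^sub>C ?D u) \<le> ?C * exp (- 1 * \<bar>u\<bar>)" by (simp add: norm_scaleC)
  qed simp
qed

text \<open>Integration by parts. A single \<open>yosida\<close> term tends to x at plus infinity,
  but the difference of two vanishes at both ends, and its derivative is a difference of two
  integrands of \<open>mellin\<close>.\<close>

lemma yosida_shift_integral:
  assumes xy: "(x, y) \<in> A" and t: "t \<noteq> 0"
  shows "integral UNIV (\<lambda>u. cis (t * u) *\<^sub>C (yosida A (of_real (u + w)) x - yosida A (of_real u) x))
    = ((1 - cis (- t * w)) / (\<i> * t)) *\<^sub>C mellin A t y"
proof -
  let ?D = "\<lambda>u. yosida A (of_real (u + w)) x - yosida A (of_real u) x"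
  let ?X = "integral UNIV (\<lambda>u. cis (t * u) *\<^sub>C ?D u)"
  let ?f = "\<lambda>u. \<i> * t * cis (t * u)" and ?g = "\<lambda>u. rho A (of_real (u + w)) y - rho A (of_real u) y"
  obtain C where C: "exp_decay C 1 (\<lambda>u. cis (t * u) *\<^sub>C ?D u)" using yosida_shift_decay[OF xy] by blast
  have cis_d: "((\<lambda>u. cis (t * u)) has_vector_derivative ?f u) (at u)" for u
  proof -
    have "((\<lambda>z. exp (\<i> * (t * z))) has_field_derivative \<i> * t * exp (\<i> * (t * of_real u))) (at (of_real u))"
      by (auto intro!: derivative_eq_intros)
    from has_vector_derivative_real_field[OF this] show ?thesis by (simp add: cis_conv_exp)
  qed
  have sh: "((\<lambda>u. yosida A (of_real (u + w)) x) has_vector_derivative rho A (of_real (u + w)) y) (at u)" for u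
    using yosida_deriv[of UNIV "of_real w" 1 u x y] xy by (simp add: add.commute)
  have Fd: "((\<lambda>u. cis (t * u) *\<^sub>C ?D u) has_vector_derivative (\<i> * t) *\<^sub>C (cis (t * u) *\<^sub>C ?D u)
      + (cis (t * u) *\<^sub>C rho A (of_real (u + w)) y - cis (t * u) *\<^sub>C rho A (of_real u) y)) (at u)" for u
  proof -
    have "((\<lambda>u. cis (t * u) *\<^sub>C ?D u) has_vector_derivative cis (t * u) *\<^sub>C ?g u + ?f u *\<^sub>C ?D u) (at u)"
      by (intro scaleC.has_vector_derivative cis_d has_vector_derivative_diff sh yosida_real_deriv xy)
    then show ?thesis by (simp add: scaleC.diff_right scaleC_scaleC add.commute)
  qed
  have lim: "((\<lambda>u. cis (t * u) *\<^sub>C ?D u) \<longlongrightarrow> 0) F" if "filterlim abs at_top F" for F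
  proof (rule tendsto_0_le[where K = 1])
    have "filterlim (\<lambda>u. - 1 * \<bar>u\<bar>) at_bot F" using that by (simp add: filterlim_uminus_at_bot)
    from filterlim_compose[OF exp_at_bot this] have "((\<lambda>u. C * exp (- 1 * \<bar>u\<bar>)) \<longlongrightarrow> C * 0) F" by (intro tendsto_intros)
    then show "((\<lambda>u. C * exp (- 1 * \<bar>u\<bar>)) \<longlongrightarrow> 0) F" by simp
    show "\<forall>\<^sub>F u in F. norm (cis (t * u) *\<^sub>C ?D u) \<le> norm (C * exp (- 1 * \<bar>u\<bar>)) * 1"
      using exp_decayD(3)[OF C] exp_decayD(4)[OF C] by (intro always_eventually allI) (simp add: abs_mult)
  qed
  have dec: "exp_decay (C * \<bar>t\<bar> + (K\<^sup>2 * norm y * exp \<bar>w\<bar> + K\<^sup>2 * norm y)) 1 (\<lambda>u. (\<i> * t) *\<^sub>C (cis (t * u) *\<^sub>C ?D u)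
      + (cis (t * u) *\<^sub>C rho A (of_real (u + w)) y - cis (t * u) *\<^sub>C rho A (of_real u) y))"
    unfolding exp_decay_def
  proof (intro conjI allI continuous_on_add continuous_on_diff scaleC.continuous_on[OF continuous_on_const]
      exp_decayD(2)[OF C] exp_decayD(2)[OF mellin_decay] exp_decayD(2)[OF mellin_shift_decay])
    fix u
    show "norm ((\<i> * t) *\<^sub>C (cis (t * u) *\<^sub>C ?D u)
      + (cis (t * u) *\<^sub>C rho A (of_real (u + w)) y - cis (t * u) *\<^sub>C rho A (of_real u) y))
      \<le> (C * \<bar>t\<bar> + (K\<^sup>2 * norm y * exp \<bar>w\<bar> + K\<^sup>2 * norm y)) * exp (- 1 * \<bar>u\<bar>)"
      unfolding distrib_right
    proof (intro order_trans[OF norm_triangle_ineq] order_trans[OF norm_triangle_ineq4] add_mono)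
      have "\<bar>t\<bar> * norm (cis (t * u) *\<^sub>C ?D u) \<le> \<bar>t\<bar> * (C * exp (- 1 * \<bar>u\<bar>))"
        by (intro mult_left_mono exp_decayD(3)[OF C]) auto
      then show "norm ((\<i> * t) *\<^sub>C (cis (t * u) *\<^sub>C ?D u)) \<le> C * \<bar>t\<bar> * exp (- 1 * \<bar>u\<bar>)"
        by (simp add: norm_scaleC norm_mult mult_ac)
    qed (rule exp_decayD(3)[OF mellin_shift_decay] exp_decayD(3)[OF mellin_decay])+
  qed simp
  have "integral UNIV (\<lambda>u. (\<i> * t) *\<^sub>C (cis (t * u) *\<^sub>C ?D u)
      + (cis (t * u) *\<^sub>C rho A (of_real (u + w)) y - cis (t * u) *\<^sub>C rho A (of_real u) y)) = 0 - 0"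
    by (rule exp_decay_integral_FTC[OF dec Fd]; rule lim)
       (auto intro: filterlim_abs_real filterlim_at_infinity_imp_filterlim_at_top simp: filterlim_abs_real filterlim_at_bot_mirror)
  moreover have "integral UNIV (\<lambda>u. (\<i> * t) *\<^sub>C (cis (t * u) *\<^sub>C ?D u)
      + (cis (t * u) *\<^sub>C rho A (of_real (u + w)) y - cis (t * u) *\<^sub>C rho A (of_real u) y))
    = (\<i> * t) *\<^sub>C ?X + (cis (- t * w) *\<^sub>C mellin A t y - mellin A t y)"
  proof (rule integral_unique, intro has_integral_add has_integral_diff)
    show "((\<lambda>u. (\<i> * t) *\<^sub>C (cis (t * u) *\<^sub>C ?D u)) has_integral (\<i> * t) *\<^sub>C ?X) UNIV"
      using has_integral_linear[OF integrable_integral[OF exp_decay_integrable(1)[OF C]] scaleC.bounded_linear_right]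
      by (simp only: o_def)
    show "((\<lambda>u. cis (t * u) *\<^sub>C rho A (of_real (u + w)) y) has_integral cis (- t * w) *\<^sub>C mellin A t y) UNIV"
      unfolding mellin_shift[symmetric] by (rule integrable_integral[OF exp_decay_integrable(1)[OF mellin_shift_decay]])
    show "((\<lambda>u. cis (t * u) *\<^sub>C rho A (of_real u) y) has_integral mellin A t y) UNIV"
      unfolding mellin_def by (rule integrable_integral[OF exp_decay_integrable(1)[OF mellin_decay]])
  qed
  ultimately have "(\<i> * t) *\<^sub>C ?X = mellin A t y - cis (- t * w) *\<^sub>C mellin A t y"
    by (simp add: algebra_simps eq_neg_iff_add_eq_0)
  then have "(1 / (\<i> * t)) *\<^sub>C (\<i> * t) *\<^sub>C ?X = (1 / (\<i> * t)) *\<^sub>C (1 - cis (- t * w)) *\<^sub>C mellin A t y"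
    by (simp add: scaleC.diff_left)
  then show ?thesis using t by (simp add: scaleC_scaleC)
qed

lemma bounded_linear_yosida: "\<bar>Im \<zeta>\<bar> \<le> h \<Longrightarrow> bounded_linear (yosida A \<zeta>)"
  unfolding yosida_def
  by (intro bounded_linear_compose[OF scaleC.bounded_linear_right] resolvesD(1)[OF resK])

text \<open>The resolvent identity yields the partial fractions T(u) T(v) = q T(u) - (q - 1) T(v).
  With each \<open>rho\<close> written as T - T^2 after A^-1, reducing the mixed products in this
  way leaves terms in one variable only, which can be integrated.\<close>

lemma rho_rho:
  fixes u v :: real and y :: 'a
  assumes uv: "u \<noteq> v"
  defines "q \<equiv> exp v / (exp v - exp u)" and "x \<equiv> Res A 0 (Res A 0 y)"
  shows "rho A (of_real u) (rho A (of_real v) y) = (q * (q - 1)) *\<^sub>R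
    ((2 * q - 1) *\<^sub>R (yosida A (of_real v) x - yosida A (of_real u) x)
      - rho A (of_real u) (Res A 0 y) - rho A (of_real v) (Res A 0 y))"
proof -
  let ?a = "yosida A (of_real u)" and ?b = "yosida A (of_real v)"
  have lin: "linear ?a" "linear ?b" using bounded_linear_yosida[OF Im_real] bounded_linear.linear by blast+
  have ne: "exp v - exp u \<noteq> (0::real)" using uv by simp
  have ab: "?a (?b z) = q *\<^sub>R ?a z - (q - 1) *\<^sub>R ?b z" for z
  proof -
    let ?l = "exp (of_real u) :: complex" and ?m = "exp (of_real v) :: complex"
    have lm: "?m - ?l = of_real (exp v - exp u)" by (simp add: exp_of_real)
    have ne': "?m - ?l \<noteq> 0" unfolding lm using ne by (metis of_real_eq_0_iff)
    have "(?m - ?l) *\<^sub>C ?a (?b z) = (?l * ?m) *\<^sub>C (?m - ?l) *\<^sub>C Res A ?l (Res A ?m z)"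
      by (simp add: yosida_def resolvesD(2)[OF resK] scaleC_scaleC mult_ac)
    also have "\<dots> = ?m *\<^sub>C ?a z - ?l *\<^sub>C ?b z"
      unfolding resolvent_identity[OF resK[OF Im_real] resK[OF Im_real], symmetric]
      by (simp add: yosida_def scaleC_scaleC scaleC.diff_right mult_ac)
    finally have "(1 / (?m - ?l)) *\<^sub>C (?m - ?l) *\<^sub>C ?a (?b z) = (1 / (?m - ?l)) *\<^sub>C (?m *\<^sub>C ?a z - ?l *\<^sub>C ?b z)" by simp
    then have "?a (?b z) = (?m / (?m - ?l)) *\<^sub>C ?a z - (?l / (?m - ?l)) *\<^sub>C ?b z"
      using ne' by (simp add: scaleC_scaleC scaleC.diff_right)
    moreover have "?m / (?m - ?l) = of_real q" by (simp add: q_def exp_of_real)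
    moreover have "?l / (?m - ?l) = of_real (q - 1)"
    proof -
      have "q - 1 = exp u / (exp v - exp u)" using ne by (simp add: q_def field_simps)
      then show ?thesis by (simp add: exp_of_real)
    qed
    ultimately show ?thesis by (simp only: scaleR_scaleC)
  qed
  have two: "(c * (d * (e * 2))) *\<^sub>R z = (c * (d * e)) *\<^sub>R z + (c * (d * e)) *\<^sub>R z" for c d e :: real and z :: 'a
    by (metis mult.assoc mult_2_right scaleR_left_distrib)
  have Rrho: "rho A (of_real c) z = yosida A (of_real c) (Res A 0 z) - yosida A (of_real c) (yosida A (of_real c) (Res A 0 z))" for c z
    by (rule rho_eq[OF Im_real Res0_in])
  have "rho A (of_real u) (rho A (of_real v) y) = ?a (Res A 0 (rho A (of_real v) y)) - ?a (?a (Res A 0 (rho A (of_real v) y)))"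
    by (rule Rrho)
  also have "Res A 0 (rho A (of_real v) y) = rho A (of_real v) (Res A 0 y)" by (rule rho_Res_commute[OF Im_real res0, symmetric])
  also have "\<dots> = ?b x - ?b (?b x)" unfolding x_def by (rule Rrho)
  finally have main: "rho A (of_real u) (rho A (of_real v) y) = ?a (?b x - ?b (?b x)) - ?a (?a (?b x - ?b (?b x)))" .
  have "?a (?b x - ?b (?b x)) = (q - q * q) *\<^sub>R ?a x + (q * (q - 1) - (q - 1)) *\<^sub>R ?b x + (q - 1) *\<^sub>R ?b (?b x)"
    by (simp add: linear_diff[OF lin(1)] ab algebra_simps) (metis mult_2_right scaleR_left_distrib)
  then have "?a (?b x - ?b (?b x)) - ?a (?a (?b x - ?b (?b x))) =
     (q - q * q) *\<^sub>R ?a x + (q * (q - 1) - (q - 1)) *\<^sub>R ?b x + (q - 1) *\<^sub>R ?b (?b x)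
     - ((q - q * q) *\<^sub>R ?a (?a x) + (q * (q - 1) - (q - 1)) *\<^sub>R ?a (?b x) + (q - 1) *\<^sub>R ?a (?b (?b x)))"
    by (simp add: linear_add[OF lin(1)] linear_scale[OF lin(1)])
  also have "\<dots> = (q * (q - 1)) *\<^sub>R
    ((2 * q - 1) *\<^sub>R (?b x - ?a x) - (?a x - ?a (?a x)) - (?b x - ?b (?b x)))"
    by (simp add: ab algebra_simps) (simp add: two add_ac)
  finally show ?thesis unfolding main Rrho[of _ "Res A 0 y"] x_def .
qed

lemma rho_rho_continuous:
  "continuous_on UNIV (\<lambda>(u, v). cis (s * u) *\<^sub>C cis (t * v) *\<^sub>C rho A (complex_of_real u) (rho A (complex_of_real v) y))"
  unfolding case_prod_beta by (intro continuous_intros) auto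

lemma rho_rho_norm:
  "norm (cis (s * u) *\<^sub>C cis (t * v) *\<^sub>C rho A (complex_of_real u) (rho A (complex_of_real v) y))
    \<le> (K ^ 4 * norm y) * exp (- \<bar>u\<bar>) * exp (- \<bar>v\<bar>)"
proof -
  have "norm (cis (s * u) *\<^sub>C cis (t * v) *\<^sub>C rho A (complex_of_real u) (rho A (complex_of_real v) y))
      = norm (rho A (complex_of_real u) (rho A (complex_of_real v) y))"
    by (simp add: norm_scaleC)
  also have "\<dots> \<le> K\<^sup>2 * (K\<^sup>2 * norm y * exp (- \<bar>v\<bar>)) * exp (- \<bar>u\<bar>)"
    using norm_rho[OF Im_real, of u "rho A (complex_of_real v) y"] norm_rho[OF Im_real, of v y] K
    by (elim order_trans) (auto intro!: mult_right_mono mult_left_mono)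
  finally show ?thesis by (simp add: mult_ac power2_eq_square power4_eq_xxxx)
qed

definition mellin_conv :: "real \<Rightarrow> real \<Rightarrow> 'a \<Rightarrow> 'a" where
  "mellin_conv \<sigma> w y = integral UNIV (\<lambda>u. cis (\<sigma> * u) *\<^sub>C rho A (of_real u) (rho A (of_real (u + w)) y))"

text \<open>After the substitution v = u + w the phases combine to cis ((s + t) u) cis (t w), so the
  inner integral depends on s and t through s + t alone.\<close>

lemma mellin_mellin:
  shows "mellin A s (mellin A t y) = integral UNIV (\<lambda>w. cis (t * w) *\<^sub>C mellin_conv (s + t) w y)"
    and "(\<lambda>w. cis (t * w) *\<^sub>C mellin_conv (s + t) w y) integrable_on UNIV"
proof -
  let ?F = "\<lambda>u v. cis (s * u) *\<^sub>C cis (t * v) *\<^sub>C rho A (complex_of_real u) (rho A (complex_of_real v) y)"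
  have "mellin A s (mellin A t y) = integral UNIV (\<lambda>u. integral UNIV (\<lambda>v. ?F u v))"
    unfolding mellin_def[of A s]
  proof (rule arg_cong[where f = "integral UNIV"], rule ext)
    fix u
    have "integral UNIV ((\<lambda>z. cis (s * u) *\<^sub>C rho A (of_real u) z) \<circ> (\<lambda>v. cis (t * v) *\<^sub>C rho A (of_real v) y))
      = cis (s * u) *\<^sub>C rho A (of_real u) (mellin A t y)"
      unfolding mellin_def[of A t]
      by (rule integral_linear[OF exp_decay_integrable(1)[OF mellin_decay]])
         (intro bounded_linear_compose[OF scaleC.bounded_linear_right] bounded_linear_rho Im_real)
    then show "cis (s * u) *\<^sub>C rho A (of_real u) (mellin A t y) = integral UNIV (\<lambda>v. ?F u v)"
      by (simp add: o_def rho_scaleC)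
  qed
  also have "\<dots> = integral UNIV (\<lambda>w. integral UNIV (\<lambda>u. ?F u (u + w)))"
    by (rule exp_decay_integral_plane_shift(1)[OF rho_rho_continuous rho_rho_norm])
  finally have 1: "mellin A s (mellin A t y) = integral UNIV (\<lambda>w. integral UNIV (\<lambda>u. ?F u (u + w)))" .
  have 2: "integral UNIV (\<lambda>u. ?F u (u + w)) = cis (t * w) *\<^sub>C mellin_conv (s + t) w y" for w
  proof -
    have "(\<lambda>u. cis ((s + t) * u) *\<^sub>C rho A (of_real u) (rho A (of_real (u + w)) y)) integrable_on UNIV"
      using exp_decay_integrable(1)[OF exp_decay_integral_plane_shift(3)[OF rho_rho_continuous[of "s + t" 0 y] rho_rho_norm, of w]] by simp
    from integral_linear[OF this scaleC.bounded_linear_right[of "cis (t * w)"]]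
    show ?thesis unfolding mellin_conv_def
      by (simp add: o_def scaleC_scaleC cis_mult algebra_simps)
  qed
  show "mellin A s (mellin A t y) = integral UNIV (\<lambda>w. cis (t * w) *\<^sub>C mellin_conv (s + t) w y)"
    using 1 unfolding 2 .
  show "(\<lambda>w. cis (t * w) *\<^sub>C mellin_conv (s + t) w y) integrable_on UNIV"
    using exp_decay_integrable(1)[OF exp_decay_integral_plane_shift(2)[OF rho_rho_continuous[of s t y] rho_rho_norm]] unfolding 2 .
qed

lemma mellin_conv_eq:
  assumes w: "w \<noteq> 0" and \<sigma>: "\<sigma> \<noteq> 0"
  shows "mellin_conv \<sigma> w y = pair_kernel \<sigma> w *\<^sub>C mellin A \<sigma> (Res A 0 y)"
proof -
  define q where "q = exp w / (exp w - 1)"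
  let ?x = "Res A 0 (Res A 0 y)" and ?y = "Res A 0 y"
  let ?P = "mellin A \<sigma> ?y"
  have q: "exp (u + w) / (exp (u + w) - exp u) = q" for u
  proof -
    have "exp (u + w) - exp u = exp u * (exp w - 1)" by (simp add: exp_add algebra_simps)
    then show ?thesis by (simp add: q_def exp_add)
  qed
  have xy: "(?x, ?y) \<in> A" by (rule Res0_in)
  obtain C where C: "exp_decay C 1 (\<lambda>u. cis (\<sigma> * u) *\<^sub>C (yosida A (of_real (u + w)) ?x - yosida A (of_real u) ?x))"
    using yosida_shift_decay[OF xy] by blast
  have "((\<lambda>u. (q * (q - 1)) *\<^sub>R ((2 * q - 1) *\<^sub>R (cis (\<sigma> * u) *\<^sub>C (yosida A (of_real (u + w)) ?x - yosida A (of_real u) ?x))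
      - cis (\<sigma> * u) *\<^sub>C rho A (of_real u) ?y - cis (\<sigma> * u) *\<^sub>C rho A (of_real (u + w)) ?y))
    has_integral (q * (q - 1)) *\<^sub>R ((2 * q - 1) *\<^sub>R (((1 - cis (- \<sigma> * w)) / (\<i> * \<sigma>)) *\<^sub>C ?P) - ?P - cis (- \<sigma> * w) *\<^sub>C ?P)) UNIV"
    unfolding yosida_shift_integral[OF xy \<sigma>, of w, symmetric] mellin_shift[symmetric]
    by (intro has_integral_cmul has_integral_diff integrable_integral exp_decay_integrable(1)[OF C]
        exp_decay_integrable(1)[OF mellin_shift_decay])
       (unfold mellin_def, intro integrable_integral exp_decay_integrable(1)[OF mellin_decay])
  moreover have "(q * (q - 1)) *\<^sub>R ((2 * q - 1) *\<^sub>R (cis (\<sigma> * u) *\<^sub>C (yosida A (of_real (u + w)) ?x - yosida A (of_real u) ?x))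
      - cis (\<sigma> * u) *\<^sub>C rho A (of_real u) ?y - cis (\<sigma> * u) *\<^sub>C rho A (of_real (u + w)) ?y)
    = cis (\<sigma> * u) *\<^sub>C rho A (of_real u) (rho A (of_real (u + w)) y)" for u
    using rho_rho[of u "u + w" y] w unfolding q
    by (simp add: scaleC.scaleR_right scaleC.diff_right)
  ultimately have "mellin_conv \<sigma> w y = (q * (q - 1)) *\<^sub>R ((2 * q - 1) *\<^sub>R (((1 - cis (- \<sigma> * w)) / (\<i> * \<sigma>)) *\<^sub>C ?P) - ?P - cis (- \<sigma> * w) *\<^sub>C ?P)"
    unfolding mellin_conv_def by (simp add: integral_unique)
  then show ?thesis
    unfolding pair_kernel_def Let_def q_def[symmetric]
    by (simp only: scaleR_scaleC scaleC_scaleC[symmetric] scaleC.diff_left scaleC_one)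
qed

end

section \<open>The scalar model and its Mellin transform\<close>

definition id_op :: "complex operator" where
  "id_op = {(x, x) |x. True}"

lemma id_op_resolves:
  assumes "1 + z \<noteq> 0" "1 / cmod (1 + z) \<le> k"
  shows "resolves id_op z k" "Res id_op z = (\<lambda>v. v / (1 + z))"
proof -
  have iff: "(w, v - z *\<^sub>C w) \<in> id_op \<longleftrightarrow> w = v / (1 + z)" for v w
    using assms(1) by (auto simp: id_op_def scaleC_complex_def field_simps eq_diff_eq)
  have lin: "linear_operator id_op"
    by (auto simp: linear_operator_def id_op_def single_valued_def)
  have bd: "norm (v / (1 + z)) \<le> k * norm v" for v
    using mult_right_mono[OF assms(2), of "norm v"] by (simp add: norm_divide)
  show "resolves id_op z k" "Res id_op z = (\<lambda>v. v / (1 + z))"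
    using resolvesI[OF iff lin bd] by auto
qed

lemma exp_real_nonneg:
  assumes "\<bar>Im \<zeta>\<bar> \<le> 0"
  shows "exp \<zeta> = of_real (exp (Re \<zeta>))"
proof -
  have "\<zeta> = of_real (Re \<zeta>)" using assms by (intro complex_eqI) auto
  then show ?thesis by (metis exp_of_real)
qed

lemma cmod_one_plus_of_real: "x > 0 \<Longrightarrow> cmod (1 + of_real x) = 1 + x"
proof -
  assume "x > 0"
  have "1 + complex_of_real x = of_real (1 + x)" by simp
  then show ?thesis using \<open>x > 0\<close> by (simp only: norm_of_real)
qed

lemma one_plus_exp_real_neq_0: "1 + complex_of_real (exp u) \<noteq> 0"
proof -
  have "1 + complex_of_real (exp u) = of_real (1 + exp u)" by simp
  moreover have "1 + exp u \<noteq> (0::real)" using exp_gt_zero[of u] by linarith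
  ultimately show ?thesis by (metis of_real_eq_0_iff)
qed

interpretation id_op: strip id_op 1 0
proof
  show "linear_operator id_op"
    by (auto simp: linear_operator_def id_op_def single_valued_def)
  show "resolves id_op 0 1" by (rule id_op_resolves) auto
  fix \<zeta> :: complex assume z: "\<bar>Im \<zeta>\<bar> \<le> 0"
  show "resolves id_op (exp \<zeta>) (1 / (1 + exp (Re \<zeta>)))"
    unfolding exp_real_nonneg[OF z]
    by (rule id_op_resolves) (simp_all only: cmod_one_plus_of_real exp_gt_zero one_plus_exp_real_neq_0 not_False_eq_True order_refl)
qed auto

lemma rho_id_op: "rho id_op (of_real u) y = of_real (exp u / (1 + exp u)\<^sup>2) * y"
proof -
  have "Res id_op (exp (of_real u)) v = v / (1 + of_real (exp u))" for v
    using id_op_resolves(2)[of "of_real (exp u)" 1] one_plus_exp_real_neq_0[of u] cmod_one_plus_of_real[of "exp u"]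
    by (simp add: exp_of_real add_pos_pos)
  then show ?thesis
    by (simp add: rho_def scaleC_complex_def exp_of_real power2_eq_square)
qed

text \<open>All imaginary powers of the identity are 1, so its transform is the normalising factor
  between \<open>mellin A t (A x)\<close> and A^it x.\<close>

definition mellin_id :: "real \<Rightarrow> complex" where
  "mellin_id t = mellin id_op t 1"

lemma mellin_id_op: "mellin id_op t c = mellin_id t * c"
  using id_op.mellin_scaleC[of t c 1] by (simp add: mellin_id_def scaleC_complex_def mult.commute)

lemma mellin_id_eq: "mellin_id t = integral UNIV (\<lambda>u. cis (t * u) * of_real (exp u / (1 + exp u)\<^sup>2))"
  by (simp add: mellin_id_def mellin_def rho_id_op scaleC_complex_def)

text \<open>The compositions for A and for \<open>id_op\<close> are integrals over w of the same
  \<open>pair_kernel\<close>, so one is expressed through the other without evaluating the integral.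
  This becomes the group law. The formula for the kernel fails at w = 0, a null set.\<close>

lemma (in strip) mellin_mult:
  assumes "s + t \<noteq> 0"
  shows "mellin_id (s + t) *\<^sub>C mellin A s (mellin A t y) = (mellin_id s * mellin_id t) *\<^sub>C mellin A (s + t) (Res A 0 y)"
proof -
  let ?\<sigma> = "s + t" and ?P = "mellin A (s + t) (Res A 0 y)"
  have id0: "Res id_op 0 v = v" for v
    using id_op_resolves(2)[of 0 1] by simp
  have conv: "mellin_id ?\<sigma> *\<^sub>C (cis (t * w) *\<^sub>C mellin_conv ?\<sigma> w y)
     = (cis (t * w) *\<^sub>C id_op.mellin_conv ?\<sigma> w 1) *\<^sub>C ?P" if "w \<noteq> 0" for w
    using mellin_conv_eq[OF that assms] id_op.mellin_conv_eq[OF that assms, of 1]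
    by (simp add: id0 mellin_id_op scaleC_scaleC scaleC_complex_def mult_ac)
  have "((\<lambda>w. mellin_id ?\<sigma> *\<^sub>C (cis (t * w) *\<^sub>C mellin_conv ?\<sigma> w y)) has_integral
      mellin_id ?\<sigma> *\<^sub>C mellin A s (mellin A t y)) UNIV"
    using has_integral_linear[OF integrable_integral[OF mellin_mellin(2)] scaleC.bounded_linear_right]
    unfolding mellin_mellin(1) by (simp only: o_def)
  then have 1: "((\<lambda>w. (cis (t * w) *\<^sub>C id_op.mellin_conv ?\<sigma> w 1) *\<^sub>C ?P) has_integral
      mellin_id ?\<sigma> *\<^sub>C mellin A s (mellin A t y)) UNIV"
    by (rule has_integral_spike_finite[of "{0}", rotated 2]) (auto simp: conv)
  have "((\<lambda>w. (cis (t * w) *\<^sub>C id_op.mellin_conv ?\<sigma> w 1) *\<^sub>C ?P) has_integral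
      (mellin id_op s (mellin id_op t 1)) *\<^sub>C ?P) UNIV"
    using has_integral_linear[OF integrable_integral[OF id_op.mellin_mellin(2)] scaleC.bounded_linear_left]
    unfolding id_op.mellin_mellin(1) by (simp only: o_def)
  with 1 show ?thesis
    by (simp add: mellin_id_op has_integral_unique mult.commute)
qed

lemma exp_minus_exp_decay:
  "exp_decay 1 1 (\<lambda>u. complex_of_real (exp u * exp (- exp u)))"
  unfolding exp_decay_def
proof (intro conjI allI)
  fix u :: real
  have "exp u * exp (- exp u) \<le> exp (- \<bar>u\<bar>)"
  proof (cases "u \<ge> 0")
    case True
    have "1 + u + u\<^sup>2 / 2 \<le> exp u" by (rule exp_lower_Taylor_quadratic[OF True])
    moreover have "2 * u \<le> 1 + u + u\<^sup>2 / 2"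
      using zero_le_power2[of "u - 1"] by (simp add: power2_eq_square algebra_simps)
    ultimately show ?thesis using True by (simp add: exp_add[symmetric])
  next
    case False
    then have "exp u * exp (- exp u) \<le> exp u * 1" by (intro mult_left_mono) auto
    then show ?thesis using False by simp
  qed
  then show "norm (complex_of_real (exp u * exp (- exp u))) \<le> 1 * exp (- 1 * \<bar>u\<bar>)"
    by (simp add: norm_mult)
qed (auto intro!: continuous_intros)

lemma Gamma_exp_integral:
  "Gamma (1 + \<i> * t) = integral UNIV (\<lambda>u. cis (t * u) * of_real (exp u * exp (- exp u)))"
    and Gamma_exp_decay: "exp_decay 1 1 (\<lambda>u. cis (t * u) * of_real (exp u * exp (- exp u)))"
proof -
  show d: "exp_decay 1 1 (\<lambda>u. cis (t * u) * of_real (exp u * exp (- exp u)))"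
    using exp_minus_exp_decay unfolding exp_decay_def
    by (auto simp: norm_mult intro!: continuous_intros)
  have "((\<lambda>l. (1 / l) *\<^sub>R (cis (t * ln l) * of_real (exp (ln l) * exp (- exp (ln l))))) has_integral
     integral UNIV (\<lambda>u. cis (t * u) * of_real (exp u * exp (- exp u)))) {0<..}"
    by (rule exp_decay_has_integral_ln[OF d])
  moreover have "(1 / l) *\<^sub>R (cis (t * ln l) * of_real (exp (ln l) * exp (- exp (ln l)))) =
     of_real l powr ((1 + \<i> * t) - 1) / of_real (exp l)" if "l \<in> {0<..}" for l
    using that by (simp add: powr_def Ln_of_real cis_conv_exp exp_minus scaleR_conv_of_real divide_simps mult_ac)
  ultimately have "((\<lambda>l. of_real l powr ((1 + \<i> * t) - 1) / of_real (exp l)) has_integral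
     integral UNIV (\<lambda>u. cis (t * u) * of_real (exp u * exp (- exp u)))) {0<..}"
    by (rule has_integral_eq[rotated])
  with Gamma_integral_complex'[of "1 + \<i> * t"]
  show "Gamma (1 + \<i> * t) = integral UNIV (\<lambda>u. cis (t * u) * of_real (exp u * exp (- exp u)))"
    by (auto intro: has_integral_unique)
qed

text \<open>With v = u + w the product of the two Gamma integrals has the inner integrand exp (2 u)
  exp (- c exp u), up to a factor exp w, where c = 1 + exp w. Its integral over u is 1 / c^2, and
  exp w / c^2 is the integrand of \<open>mellin_id\<close>.\<close>

lemma mellin_id_Gamma: "mellin_id t = Gamma (1 + \<i> * t) * Gamma (1 - \<i> * t)"
proof -
  let ?b = "\<lambda>u. exp u * exp (- exp u) :: real"
  let ?F = "\<lambda>u v. (cis (- t * u) * of_real (?b u)) * (cis (t * v) * of_real (?b v))"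
  have bb: "norm (complex_of_real (?b u)) \<le> exp (- \<bar>u\<bar>)" for u
    using exp_decayD(3)[OF exp_minus_exp_decay, of u] by simp
  have cont: "continuous_on UNIV (\<lambda>(u, v). ?F u v)"
    unfolding case_prod_beta by (intro continuous_intros)
  have dec: "norm (?F u v) \<le> 1 * exp (- \<bar>u\<bar>) * exp (- \<bar>v\<bar>)" for u v
    using mult_mono[OF bb[of u] bb[of v]] by (simp add: norm_mult)
  have g1: "Gamma (1 + \<i> * t) = integral UNIV (\<lambda>v. cis (t * v) * of_real (?b v))"
    and g2: "Gamma (1 - \<i> * t) = integral UNIV (\<lambda>u. cis (- t * u) * of_real (?b u))"
    using Gamma_exp_integral[of t] Gamma_exp_integral[of "- t"] by simp_all
  have "Gamma (1 + \<i> * t) * Gamma (1 - \<i> * t) = integral UNIV (\<lambda>u. integral UNIV (\<lambda>v. ?F u v))"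
    unfolding g1 g2 by (simp add: mult.commute)
  also have "\<dots> = integral UNIV (\<lambda>w. integral UNIV (\<lambda>u. ?F u (u + w)))"
    by (rule exp_decay_integral_plane_shift(1)[OF cont dec])
  also have "\<dots> = mellin_id t"
    unfolding mellin_id_eq
  proof (rule arg_cong[where f = "integral UNIV"], rule ext)
    fix w :: real
    define c where "c = 1 + exp w"
    have c: "c > 0" using exp_gt_zero[of w] by (simp add: c_def add_pos_pos)
    let ?G = "\<lambda>u. - ((exp u / c + 1 / c\<^sup>2) * exp (- (c * exp u))) :: real"
    have Fe: "?F u (u + w) = cis (t * w) * of_real (exp w * (exp u * exp u * exp (- (c * exp u))))" for u
    proof -
      have "cis (- t * u) * cis (t * (u + w)) = cis (t * w)" by (simp add: cis_mult algebra_simps)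
      moreover have "?b u * ?b (u + w) = exp w * (exp u * exp u * exp (- (c * exp u)))"
        by (simp add: exp_add[symmetric] c_def) (simp add: exp_add algebra_simps)
      ultimately show ?thesis
        by (metis (no_types, lifting) mult.assoc mult.left_commute of_real_mult)
    qed
    have Gd: "((\<lambda>u. cis (t * w) * of_real (exp w * ?G u)) has_vector_derivative ?F u (u + w)) (at u)" for u
    proof -
      have "(?G has_real_derivative exp u * exp u * exp (- (c * exp u))) (at u)"
        using c by (auto intro!: derivative_eq_intros simp: field_simps power2_eq_square)
      then have "((\<lambda>u. of_real (?G u)) has_vector_derivative complex_of_real (exp u * exp u * exp (- (c * exp u)))) (at u)"
        by (intro has_vector_derivative_of_real) (simp add: has_real_derivative_iff_has_vector_derivative[symmetric])
      from has_vector_derivative_mult_right[OF this, of "cis (t * w) * of_real (exp w)"]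
      show ?thesis unfolding Fe by (simp add: mult_ac)
    qed
    have top: "(?G \<longlongrightarrow> 0) at_top" using c by real_asymp
    have bot: "(?G \<longlongrightarrow> - (1 / c\<^sup>2)) at_bot"
    proof -
      have "(?G \<longlongrightarrow> - ((0 / c + 1 / c\<^sup>2) * exp (- (c * 0)))) at_bot"
        by (intro tendsto_intros exp_at_bot) (use c in auto)
      then show ?thesis by simp
    qed
    have "integral UNIV (\<lambda>u. ?F u (u + w)) = cis (t * w) * of_real (exp w * 0) - cis (t * w) * of_real (exp w * (- (1 / c\<^sup>2)))"
      by (rule exp_decay_integral_FTC[OF exp_decay_integral_plane_shift(3)[OF cont dec] Gd])
         (intro tendsto_intros top bot)+
    then show "integral UNIV (\<lambda>u. ?F u (u + w)) = cis (t * w) * of_real (exp w / (1 + exp w)\<^sup>2)"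
      by (simp add: c_def)
  qed
  finally show ?thesis by simp
qed

text \<open>Functional equation and reflection formula of the Gamma function. The first form cancels
  against the sine factor in \<open>imag_power\<close>; the second shows that the factor is real and
  even.\<close>

lemma mellin_id_sinh:
  assumes "t \<noteq> 0"
  shows "mellin_id t = (\<i> * pi * t) / sin (\<i> * pi * t)" "mellin_id t = of_real (pi * t / sinh (pi * t))"
proof -
  have "\<i> * t \<noteq> 0" using assms by simp
  then have "Gamma (1 + \<i> * t) = \<i> * t * Gamma (\<i> * t)"
    by (subst add.commute, intro Gamma_plus1) (auto elim!: nonpos_Ints_cases simp: complex_eq_iff)
  then have "mellin_id t = \<i> * t * (Gamma (\<i> * t) * Gamma (1 - \<i> * t))"
    by (simp add: mellin_id_Gamma)
  also have "\<dots> = (\<i> * pi * t) / sin (\<i> * pi * t)"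
    by (subst Gamma_reflection_complex) (simp add: mult_ac)
  finally show 1: "mellin_id t = (\<i> * pi * t) / sin (\<i> * pi * t)" .
  have "sin (\<i> * pi * t) = \<i> * of_real (sinh (pi * t))"
    by (simp add: sin_exp_eq sinh_field_def exp_of_real[symmetric] field_simps) (simp add: algebra_simps)?
  then show "mellin_id t = of_real (pi * t / sinh (pi * t))"
    unfolding 1 by simp
qed

lemma mellin_id_0: "mellin_id 0 = 1"
  by (simp add: mellin_id_Gamma)

lemma exp_decay_integral_swap_Icc:
  fixes F :: "real \<Rightarrow> real \<Rightarrow> 'a::banach"
  assumes cont: "continuous_on UNIV (\<lambda>(t, v). F t v)" and F: "\<And>t. exp_decay C a (F t)" and cd: "c \<le> d"
  shows "integral {c..d} (\<lambda>t. integral UNIV (F t)) = integral UNIV (\<lambda>v. integral {c..d} (\<lambda>t. F t v))"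
proof -
  note a = exp_decayD(1)[OF F[of 0]] and C0 = exp_decayD(4)[OF F[of 0]]
  have cont': "continuous_on S (\<lambda>p. F (h p) (k p))"
    if "continuous_on S h" "continuous_on S k" for S :: "'z::topological_space set" and h k
    using continuous_on_compose2[OF cont continuous_on_Pair[OF that]] by simp
  let ?G = "\<lambda>v. integral {c..d} (\<lambda>t. F t v)"
  have G: "exp_decay (C * (d - c)) a ?G"
    unfolding exp_decay_def
  proof (intro conjI allI a)
    have "continuous_on UNIV (\<lambda>v. integral (cbox c d) (\<lambda>t. F t v))"
      by (rule integral_continuous_on_param) (auto simp: case_prod_beta intro!: cont' continuous_intros)
    then show "continuous_on UNIV ?G" by simp
    fix v
    have "norm (?G v) \<le> C * exp (- a * \<bar>v\<bar>) * (d - c)"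
      using exp_decayD(3)[OF F] by (intro integral_bound[OF cd] cont' continuous_intros) auto
    then show "norm (?G v) \<le> C * (d - c) * exp (- a * \<bar>v\<bar>)" by (simp add: mult_ac)
  qed
  have cI: "continuous_on {c..d} (\<lambda>t. integral UNIV (F t))"
    using exp_decay_integral_param[OF cont F] continuous_on_subset by blast
  have cIn: "continuous_on {c..d} (\<lambda>t. integral {- real n..real n} (F t))" for n
  proof -
    have "continuous_on {c..d} (\<lambda>t. integral (cbox (- real n) (real n)) (F t))"
      by (rule integral_continuous_on_param) (auto simp: case_prod_beta intro!: cont' continuous_intros)
    then show ?thesis by simp
  qed
  have swap: "integral {- real n..real n} ?G = integral {c..d} (\<lambda>t. integral {- real n..real n} (F t))" for n
    using integral_swap_continuous[of c "- real n" d "real n" F] continuous_on_subset[OF cont] by simp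
  have "(\<lambda>n. integral {- real n..real n} ?G - integral {c..d} (\<lambda>t. integral UNIV (F t))) \<longlonglongrightarrow> 0"
  proof (rule tendsto_0_le[OF exp_neg_mult_tendsto_0[OF a, of "(2 * C / a) * (d - c)"], of _ 1], intro always_eventually allI)
    fix n
    have "norm (integral {c..d} (\<lambda>t. integral {- real n..real n} (F t) - integral UNIV (F t)))
       \<le> (2 * C / a) * exp (- a * real n) * (d - c)"
      using exp_decay_integrable(2)[OF F, of "- real n" "real n" "real n"]
      by (intro integral_bound[OF cd] continuous_on_diff cI cIn) auto
    then have "norm (integral {- real n..real n} ?G - integral {c..d} (\<lambda>t. integral UNIV (F t))) \<le> (2 * C / a) * exp (- a * real n) * (d - c)"
      unfolding swap by (subst integral_diff[symmetric]) (auto intro!: integrable_continuous_real cI cIn)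
    also have "\<dots> \<le> norm ((2 * C / a) * (d - c) * exp (- a * real n)) * 1"
      unfolding real_norm_def mult_1_right by (rule order_trans[OF _ abs_ge_self]) (simp only: mult_ac order_refl)
    finally show "norm (integral {- real n..real n} ?G - integral {c..d} (\<lambda>t. integral UNIV (F t)))
      \<le> norm ((2 * C / a) * (d - c) * exp (- a * real n)) * 1" .
  qed
  then have "(\<lambda>n. integral {- real n..real n} ?G) \<longlonglongrightarrow> integral {c..d} (\<lambda>t. integral UNIV (F t))"
    by (simp add: LIM_zero_iff)
  from LIMSEQ_unique[OF this exp_decay_integral_LIMSEQ[OF G]] show ?thesis .
qed

section \<open>The sine integral and Mellin inversion\<close>

lemma Si_minus: "Si (- x) = - Si x"
  using Si_neg[of x] Si_neg[of "- x"] by (cases "x \<ge> 0") auto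

lemma isCont_Si: "isCont Si x"
  using DERIV_Si by (rule DERIV_isCont)

lemma Si_bounded: obtains B where "B \<ge> 0" "\<And>x. \<bar>Si x\<bar> \<le> B"
proof -
  have "\<forall>\<^sub>F x in at_top. Si x \<in> ball (pi / 2) 1"
    using Si_at_top by (rule topological_tendstoD) auto
  then obtain X where "\<And>x. x \<ge> X \<Longrightarrow> Si x \<in> ball (pi / 2) 1"
    unfolding eventually_at_top_linorder by blast
  then have X: "\<bar>Si x\<bar> \<le> pi / 2 + 1" if "x \<ge> X" for x
    using \<open>\<And>x. x \<ge> X \<Longrightarrow> Si x \<in> ball (pi / 2) 1\<close>[OF that] pi_gt_zero
    unfolding mem_ball dist_real_def by linarith
  have "compact (Si ` {0..\<bar>X\<bar>})"
    by (intro compact_continuous_image continuous_at_imp_continuous_on ballI isCont_Si) auto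
  then have "bounded (Si ` {0..\<bar>X\<bar>})" by (rule compact_imp_bounded)
  then obtain B where "\<forall>s\<in>Si ` {0..\<bar>X\<bar>}. norm s \<le> B" unfolding bounded_iff by blast
  then have B: "\<And>x. x \<in> {0..\<bar>X\<bar>} \<Longrightarrow> \<bar>Si x\<bar> \<le> B" by auto
  have pos: "\<bar>Si x\<bar> \<le> max \<bar>B\<bar> (pi / 2 + 1)" if "x \<ge> 0" for x
    using X[of x] B[of x] that by (cases "x \<ge> X") (force simp: max_def)+
  have "\<bar>Si x\<bar> \<le> max \<bar>B\<bar> (pi / 2 + 1)" for x
    using pos[of x] pos[of "- x"] by (cases "x \<ge> 0") (auto simp: Si_minus)
  then show ?thesis by (intro that[of "max \<bar>B\<bar> (pi / 2 + 1)"]) auto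
qed

lemma sin_has_integral_Si:
  assumes "0 < \<delta>" "\<delta> \<le> L"
  shows "((\<lambda>t. sin (t * w) / t) has_integral Si (L * w) - Si (\<delta> * w)) {\<delta>..L}"
proof (rule fundamental_theorem_of_calculus[OF assms(2)])
  fix t assume "t \<in> {\<delta>..L}"
  then have t: "t \<noteq> 0" using assms by auto
  have "((\<lambda>t. Si (t * w)) has_real_derivative sinc (t * w) * w) (at t)"
    by (rule DERIV_chain'[OF _ DERIV_Si]) (auto intro!: derivative_eq_intros)
  moreover have "sinc (t * w) * w = sin (t * w) / t" using t by (cases "w = 0") auto
  ultimately show "((\<lambda>t. Si (t * w)) has_vector_derivative sin (t * w) / t) (at t within {\<delta>..L})"
    by (simp add: has_real_derivative_iff_has_vector_derivative has_vector_derivative_at_within)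
qed

lemma cis_diff_sin: "cis x - cis (- x) = 2 * \<i> * of_real (sin x)"
  by (simp add: complex_eq_iff)

text \<open>The integral of sin (t w) / t over [2^-n, n], a truncated Dirichlet integral: odd in w,
  with limit \<pi> / 2 for w > 0.\<close>

definition Si_diff :: "nat \<Rightarrow> real \<Rightarrow> real" where
  "Si_diff n w = Si (real n * w) - Si (1 / 2 ^ n * w)"

lemma continuous_on_Si_diff: "continuous_on S f \<Longrightarrow> continuous_on S (\<lambda>v. Si_diff n (f v))"
proof -
  assume f: "continuous_on S f"
  have Si: "continuous_on UNIV Si" by (simp add: continuous_at_imp_continuous_on isCont_Si)
  show ?thesis
    unfolding Si_diff_def by (intro continuous_on_diff continuous_on_compose2[OF Si] continuous_on_mult continuous_on_const f) auto
qed

lemma Si_diff_minus: "Si_diff n (- w) = - Si_diff n w"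
  using Si_minus[of "real n * w"] Si_minus[of "1 / 2 ^ n * w"] by (simp add: Si_diff_def)

lemma Si_0: "Si 0 = 0"
  using Si_minus[of 0] by simp

lemma Si_diff_limit:
  assumes "w > 0"
  shows "(\<lambda>n. Si_diff n w) \<longlonglongrightarrow> pi / 2"
proof -
  have "filterlim (\<lambda>n. real n * w) at_top sequentially"
    using assms by (intro filterlim_at_top_mult_tendsto_pos[OF tendsto_const _ filterlim_real_sequentially])
  then have "(\<lambda>n. Si (real n * w)) \<longlonglongrightarrow> pi / 2" by (rule filterlim_compose[OF Si_at_top])
  moreover have "(\<lambda>n. Si (1 / 2 ^ n * w)) \<longlonglongrightarrow> Si 0"
  proof (rule isCont_tendsto_compose[OF isCont_Si])
    have "(\<lambda>n. (1 / 2) ^ n * w) \<longlonglongrightarrow> 0 * w" by (intro tendsto_intros LIMSEQ_power_zero) auto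
    then show "(\<lambda>n. 1 / 2 ^ n * w) \<longlonglongrightarrow> 0" by (simp add: power_one_over)
  qed
  ultimately have "(\<lambda>n. Si (real n * w) - Si (1 / 2 ^ n * w)) \<longlonglongrightarrow> pi / 2 - Si 0" by (rule tendsto_diff)
  then show ?thesis by (simp add: Si_diff_def Si_0)
qed

lemma Si_diff_le:
  assumes "\<And>x. \<bar>Si x\<bar> \<le> B"
  shows "\<bar>2 * Si_diff n w\<bar> \<le> 4 * B"
proof -
  have "\<bar>2 * (a - b)\<bar> \<le> 4 * B" if "\<bar>a\<bar> \<le> B" "\<bar>b\<bar> \<le> B" for a b :: real
    using that by (auto simp: abs_le_iff)
  then show ?thesis unfolding Si_diff_def using assms by blast
qed

text \<open>Distance of the doubled Dirichlet integral from its limit \<pi>, weighted with the decay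
  of \<open>rho\<close>. It reduces a limit of vector-valued integrals to dominated convergence for
  real functions.\<close>

definition Si_error :: "real \<Rightarrow> nat \<Rightarrow> real \<Rightarrow> real" where
  "Si_error u n v = \<bar>2 * Si_diff n \<bar>v - u\<bar> - pi\<bar> * exp (- \<bar>v\<bar>)"

lemma Si_error_decay: obtains C where "\<And>u n. exp_decay C 1 (Si_error u n)"
proof -
  obtain B where B: "B \<ge> 0" "\<And>x. \<bar>Si x\<bar> \<le> B" using Si_bounded by blast
  have "exp_decay (4 * B + pi) 1 (Si_error u n)" for u n
    unfolding exp_decay_def
  proof (intro conjI allI)
    show "continuous_on UNIV (Si_error u n)"
      unfolding Si_error_def by (intro continuous_intros continuous_on_Si_diff)
    fix v
    have "\<bar>2 * Si_diff n \<bar>v - u\<bar> - pi\<bar> \<le> 4 * B + pi"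
      by (rule order_trans[OF abs_triangle_ineq4]) (simp only: add_mono Si_diff_le[OF B(2)] abs_of_pos[OF pi_gt_zero] order_refl)
    then show "norm (Si_error u n v) \<le> (4 * B + pi) * exp (- 1 * \<bar>v\<bar>)"
      by (simp add: Si_error_def abs_mult mult_right_mono)
  qed simp
  then show ?thesis by (rule that)
qed

lemma Si_error_limit: "(\<lambda>n. integral UNIV (Si_error u n)) \<longlonglongrightarrow> 0"
proof -
  obtain C where C: "\<And>u n. exp_decay C 1 (Si_error u n)" using Si_error_decay by blast
  \<comment> \<open>At v = u the Dirichlet integral is 0 for every n, so the pointwise limit is
    nonzero there, on a null set.\<close>
  let ?g = "\<lambda>v. if v = u then pi * exp (- \<bar>u\<bar>) else 0"
  have h: "exp_decay C 1 (\<lambda>v. C * exp (- \<bar>v\<bar>))"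
    using exp_decayD(4)[OF C] by (auto simp: exp_decay_def abs_mult intro!: continuous_intros)
  have "(\<lambda>n. integral UNIV (Si_error u n)) \<longlonglongrightarrow> integral UNIV ?g"
  proof (rule dominated_convergence(2)[OF exp_decay_integrable(1)[OF C] exp_decay_integrable(1)[OF h]])
    show "norm (Si_error u n v) \<le> C * exp (- \<bar>v\<bar>)" for n v
      using exp_decayD(3)[OF C, of u n v] by simp
    show "(\<lambda>n. Si_error u n v) \<longlonglongrightarrow> ?g v" for v
    proof (cases "v = u")
      case False
      then have "(\<lambda>n. \<bar>2 * Si_diff n \<bar>v - u\<bar> - pi\<bar> * exp (- \<bar>v\<bar>)) \<longlonglongrightarrow> \<bar>2 * (pi / 2) - pi\<bar> * exp (- \<bar>v\<bar>)"
        by (intro tendsto_intros Si_diff_limit) auto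
      then show ?thesis using False by (simp add: Si_error_def)
    qed (simp add: Si_error_def Si_diff_def Si_0)
  qed
  moreover have "(?g has_integral 0) UNIV"
    by (rule has_integral_spike_finite[of "{u}" _ _ "\<lambda>_. 0"]) auto
  ultimately show ?thesis by (simp add: integral_unique)
qed

context strip
begin

lemma Si_diff_rho_decay: obtains C where "\<And>n u. exp_decay C 1 (\<lambda>v. (2 * Si_diff n (v - u)) *\<^sub>R rho A (of_real v) y)"
proof -
  obtain B where B: "B \<ge> 0" "\<And>x. \<bar>Si x\<bar> \<le> B" using Si_bounded by blast
  have "exp_decay (4 * B * (K\<^sup>2 * norm y)) 1 (\<lambda>v. (2 * Si_diff n (v - u)) *\<^sub>R rho A (of_real v) y)" for n u
    unfolding exp_decay_def
  proof (intro conjI allI)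
    show "continuous_on UNIV (\<lambda>v. (2 * Si_diff n (v - u)) *\<^sub>R rho A (of_real v) y)"
      by (intro continuous_intros continuous_on_Si_diff) auto
    fix v
    have "\<bar>2 * Si_diff n (v - u)\<bar> \<le> 4 * B"
      by (rule Si_diff_le[OF B(2)])
    then have "\<bar>2 * Si_diff n (v - u)\<bar> * norm (rho A (of_real v) y) \<le> 4 * B * (K\<^sup>2 * norm y * exp (- \<bar>v\<bar>))"
      using norm_rho[OF Im_real, of v y] by (intro mult_mono) auto
    then show "norm ((2 * Si_diff n (v - u)) *\<^sub>R rho A (of_real v) y) \<le> 4 * B * (K\<^sup>2 * norm y) * exp (- 1 * \<bar>v\<bar>)"
      by (simp add: mult_ac)
  qed simp
  then show ?thesis by (rule that)
qed

text \<open>In the limit the factor is \<pi> times the sign of v - u. As \<open>rho\<close> is the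
  derivative of T = \<open>yosida\<close>, the part to the right of u contributes x - T(u) x and the
  part to the left - T(u) x.\<close>

lemma Si_diff_rho_limit:
  assumes xy: "(x, y) \<in> A"
  shows "(\<lambda>n. integral UNIV (\<lambda>v. (2 * Si_diff n (v - u)) *\<^sub>R rho A (of_real v) y)) \<longlonglongrightarrow> pi *\<^sub>R (x - 2 *\<^sub>R yosida A (of_real u) x)"
proof -
  let ?T = "\<lambda>v. yosida A (of_real v) x"
  let ?f = "\<lambda>n v. (2 * Si_diff n (v - u)) *\<^sub>R rho A (of_real v) y"
  obtain C where C: "\<And>n u. exp_decay C 1 (\<lambda>v. (2 * Si_diff n (v - u)) *\<^sub>R rho A (of_real v) y)"
    using Si_diff_rho_decay by blast
  obtain C' where C': "\<And>u n. exp_decay C' 1 (Si_error u n)" using Si_error_decay by blast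
  have rint: "(\<lambda>v. rho A (of_real v) y) integrable_on {c..d}" for c d
    by (intro integrable_continuous_real continuous_intros) auto
  have rval: "integral {c..d} (\<lambda>v. rho A (of_real v) y) = ?T d - ?T c" if "c \<le> d" for c d
    by (intro integral_unique fundamental_theorem_of_calculus that)
       (auto intro: has_vector_derivative_at_within yosida_real_deriv xy)
  \<comment> \<open>One side of u at a time, s being the sign of v - u on that side; there \<pi> s
    is the limit of the factor.\<close>
  have piece: "norm (integral {c..d} (?f n) - (s * pi) *\<^sub>R (?T d - ?T c)) \<le> (K\<^sup>2 * norm y) * integral {c..d} (Si_error u n)"
    if cd: "c \<le> d" and s: "s \<in> {-1, 1}" "\<And>v. v \<in> {c..d} \<Longrightarrow> s * (v - u) \<ge> 0" for c d s n
  proof -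
    have eq: "integral {c..d} (?f n) - (s * pi) *\<^sub>R (?T d - ?T c)
      = integral {c..d} (\<lambda>v. (2 * Si_diff n (v - u) - s * pi) *\<^sub>R rho A (of_real v) y)"
      unfolding rval[OF cd, symmetric] scaleR_left_diff_distrib
      by (subst integral_diff) (auto intro: exp_decay_integrable_Icc[OF C] integrable_cmul rint)
    also have "norm \<dots> \<le> integral {c..d} (\<lambda>v. (K\<^sup>2 * norm y) * Si_error u n v)"
    proof (intro integral_norm_bound_integral)
      show "(\<lambda>v. (2 * Si_diff n (v - u) - s * pi) *\<^sub>R rho A (of_real v) y) integrable_on {c..d}"
        by (intro integrable_continuous_real continuous_intros continuous_on_Si_diff) auto
      show "(\<lambda>v. (K\<^sup>2 * norm y) * Si_error u n v) integrable_on {c..d}"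
        by (intro integrable_continuous_real continuous_intros exp_decayD(2)[OF C'])
      fix v assume v: "v \<in> {c..d}"
      have "\<bar>2 * Si_diff n (v - u) - s * pi\<bar> = \<bar>2 * Si_diff n \<bar>v - u\<bar> - pi\<bar>"
      proof (cases "s = 1")
        case False
        then have "s = -1" "\<bar>v - u\<bar> = - (v - u)" using s(1) s(2)[OF v] by auto
        then show ?thesis using Si_diff_minus[of n "v - u"] by simp
      qed (use s(2)[OF v] in simp)
      then show "norm ((2 * Si_diff n (v - u) - s * pi) *\<^sub>R rho A (of_real v) y) \<le> (K\<^sup>2 * norm y) * Si_error u n v"
        using mult_left_mono[OF norm_rho[OF Im_real, of v y], of "\<bar>2 * Si_diff n \<bar>v - u\<bar> - pi\<bar>"]
        by (simp add: Si_error_def mult_ac)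
    qed
    finally show ?thesis by simp
  qed
  have fin: "norm (integral {- real m..real m} (?f n) - pi *\<^sub>R (?T (real m) + ?T (- real m) - 2 *\<^sub>R ?T u))
     \<le> (K\<^sup>2 * norm y) * integral {- real m..real m} (Si_error u n)" if m: "\<bar>u\<bar> \<le> real m" for m n
  proof -
    have "integral {- real m..real m} (?f n) - pi *\<^sub>R (?T (real m) + ?T (- real m) - 2 *\<^sub>R ?T u)
      = (integral {- real m..u} (?f n) - ((-1) * pi) *\<^sub>R (?T u - ?T (- real m))) + (integral {u..real m} (?f n) - (1 * pi) *\<^sub>R (?T (real m) - ?T u))"
      using m integral_combine_Icc[of "- real m" u "real m" "?f n"] exp_decay_integrable_Icc[OF C]
      by (simp add: scaleR_right_diff_distrib scaleR_right_distrib algebra_simps scaleR_2)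
    also have "norm \<dots> \<le> (K\<^sup>2 * norm y) * integral {- real m..u} (Si_error u n) + (K\<^sup>2 * norm y) * integral {u..real m} (Si_error u n)"
      using m by (intro order_trans[OF norm_triangle_ineq] add_mono piece) auto
    also have "\<dots> = (K\<^sup>2 * norm y) * integral {- real m..real m} (Si_error u n)"
      using m integral_combine_Icc[of "- real m" u "real m" "Si_error u n"] exp_decay_integrable_Icc[OF C']
      by (simp add: distrib_left)
    finally show ?thesis .
  qed
  have bd: "norm (integral UNIV (?f n) - pi *\<^sub>R (x + 0 - 2 *\<^sub>R ?T u)) \<le> (K\<^sup>2 * norm y) * integral UNIV (Si_error u n)" for n
  proof (rule tendsto_le[OF sequentially_bot])
    show "(\<lambda>m. norm (integral {- real m..real m} (?f n) - pi *\<^sub>R (?T (real m) + ?T (- real m) - 2 *\<^sub>R ?T u)))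
      \<longlonglongrightarrow> norm (integral UNIV (?f n) - pi *\<^sub>R (x + 0 - 2 *\<^sub>R ?T u))"
      by (intro tendsto_intros exp_decay_integral_LIMSEQ[OF C] filterlim_compose[OF yosida_at_top[OF xy]]
          filterlim_compose[OF yosida_at_bot] filterlim_real_sequentially)
         (simp add: filterlim_uminus_at_bot filterlim_real_sequentially)
    show "(\<lambda>m. (K\<^sup>2 * norm y) * integral {- real m..real m} (Si_error u n)) \<longlonglongrightarrow> (K\<^sup>2 * norm y) * integral UNIV (Si_error u n)"
      by (intro tendsto_intros exp_decay_integral_LIMSEQ[OF C'])
    obtain M where "\<bar>u\<bar> \<le> real M" using real_arch_simple by blast
    then show "\<forall>\<^sub>F m in sequentially. norm (integral {- real m..real m} (?f n) - pi *\<^sub>R (?T (real m) + ?T (- real m) - 2 *\<^sub>R ?T u))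
      \<le> (K\<^sup>2 * norm y) * integral {- real m..real m} (Si_error u n)"
      using fin by (auto simp: eventually_sequentially intro!: exI[of _ M])
  qed
  have "(\<lambda>n. integral UNIV (?f n) - pi *\<^sub>R (x - 2 *\<^sub>R ?T u)) \<longlonglongrightarrow> 0"
  proof (rule tendsto_0_le[where K = 1])
    show "(\<lambda>n. (K\<^sup>2 * norm y) * integral UNIV (Si_error u n)) \<longlonglongrightarrow> 0"
      by (rule tendsto_mult_right_zero[OF Si_error_limit])
    have "norm (integral UNIV (?f n) - pi *\<^sub>R (x - 2 *\<^sub>R ?T u)) \<le> norm ((K\<^sup>2 * norm y) * integral UNIV (Si_error u n)) * 1" for n
    proof -
      have "norm (integral UNIV (?f n) - pi *\<^sub>R (x - 2 *\<^sub>R ?T u)) \<le> (K\<^sup>2 * norm y) * integral UNIV (Si_error u n)"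
        using bd[of n] by (simp only: add_0_right)
      also have "\<dots> \<le> norm ((K\<^sup>2 * norm y) * integral UNIV (Si_error u n)) * 1"
        unfolding real_norm_def mult_1_right by (rule abs_ge_self)
      finally show ?thesis .
    qed
    then show "\<forall>\<^sub>F n in sequentially. norm (integral UNIV (?f n) - pi *\<^sub>R (x - 2 *\<^sub>R ?T u)) \<le> norm ((K\<^sup>2 * norm y) * integral UNIV (Si_error u n)) * 1"
      by (intro always_eventually allI)
  qed
  then show ?thesis by (simp add: LIM_zero_iff)
qed

text \<open>Exchanging the integrals, the t-integral becomes a Dirichlet integral in v - u, that is
  a smoothed sign function acting on the derivative \<open>rho\<close> of
  \<open>yosida\<close>.\<close>

lemma yosida_principal_value:
  assumes xy: "(x, y) \<in> A"
  shows "(\<lambda>n. integral {1 / 2 ^ n..real n} (\<lambda>t. (1 / t) *\<^sub>R (cis (- t * u) *\<^sub>C mellin A t y - cis (t * u) *\<^sub>C mellin A (- t) y)))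
    \<longlonglongrightarrow> (\<i> * pi) *\<^sub>C (x - 2 *\<^sub>R yosida A (of_real u) x)"
proof -
  have eq: "integral {1 / 2 ^ n..real n} (\<lambda>t. (1 / t) *\<^sub>R (cis (- t * u) *\<^sub>C mellin A t y - cis (t * u) *\<^sub>C mellin A (- t) y))
    = \<i> *\<^sub>C integral UNIV (\<lambda>v. (2 * Si_diff n (v - u)) *\<^sub>R rho A (of_real v) y)" if n: "n \<ge> 1" for n
  proof -
    define \<delta> where "\<delta> = 1 / (2::real) ^ n"
    \<comment> \<open>\<open>max \<delta> t\<close> agrees with t on the range of integration and
      keeps \<open>F\<close> continuous and uniformly decaying on the whole plane, as the exchange
      of integrals requires.\<close>
    define F where "F t v = (1 / max \<delta> t) *\<^sub>R ((cis (t * (v - u)) - cis (- (t * (v - u)))) *\<^sub>C rho A (of_real v) y)" for t v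
    have \<delta>: "\<delta> > 0" "\<delta> \<le> real n"
    proof -
      have "\<delta> \<le> 1" by (simp add: \<delta>_def)
      then show "\<delta> \<le> real n" using n by linarith
    qed (simp add: \<delta>_def)
    have F: "exp_decay ((1 / \<delta>) * (2 * (K\<^sup>2 * norm y))) 1 (F t)" for t
      unfolding exp_decay_def
    proof (intro conjI allI)
      show "continuous_on UNIV (F t)"
        unfolding F_def by (intro continuous_intros) auto
      fix v
      have "norm (cis (t * (v - u)) - cis (- (t * (v - u)))) \<le> 2"
        by (rule order_trans[OF norm_triangle_ineq4]) simp
      then have "norm ((cis (t * (v - u)) - cis (- (t * (v - u)))) *\<^sub>C rho A (of_real v) y) \<le> 2 * (K\<^sup>2 * norm y * exp (- \<bar>v\<bar>))"
        unfolding norm_scaleC using norm_rho[OF Im_real, of v y] by (intro mult_mono) auto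
      moreover have "\<bar>1 / max \<delta> t\<bar> \<le> 1 / \<delta>" using \<delta> by (simp add: frac_le)
      ultimately have "norm (F t v) \<le> (1 / \<delta>) * (2 * (K\<^sup>2 * norm y * exp (- \<bar>v\<bar>)))"
        unfolding F_def norm_scaleR using \<delta> by (intro mult_mono) auto
      then show "norm (F t v) \<le> (1 / \<delta>) * (2 * (K\<^sup>2 * norm y)) * exp (- 1 * \<bar>v\<bar>)" by (simp add: mult_ac)
    qed simp
    have cont: "continuous_on UNIV (\<lambda>(t, v). F t v)"
      unfolding F_def case_prod_beta using \<delta> by (intro continuous_intros) auto
    have inner: "(1 / t) *\<^sub>R (cis (- t * u) *\<^sub>C mellin A t y - cis (t * u) *\<^sub>C mellin A (- t) y) = integral UNIV (F t)"
      if "t \<in> {\<delta>..real n}" for t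
    proof (rule integral_unique[symmetric])
      have m: "((\<lambda>v. cis (s * v) *\<^sub>C rho A (of_real v) y) has_integral mellin A s y) UNIV" for s
        unfolding mellin_def by (rule integrable_integral[OF exp_decay_integrable(1)[OF mellin_decay]])
      have m': "((\<lambda>v. c *\<^sub>C cis (s * v) *\<^sub>C rho A (of_real v) y) has_integral c *\<^sub>C mellin A s y) UNIV" for c s
        using has_integral_linear[OF m scaleC.bounded_linear_right] by (simp only: o_def)
      have "((\<lambda>v. (1 / t) *\<^sub>R (cis (- t * u) *\<^sub>C cis (t * v) *\<^sub>C rho A (of_real v) y - cis (t * u) *\<^sub>C cis (- t * v) *\<^sub>C rho A (of_real v) y))
        has_integral (1 / t) *\<^sub>R (cis (- t * u) *\<^sub>C mellin A t y - cis (t * u) *\<^sub>C mellin A (- t) y)) UNIV"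
        by (intro has_integral_cmul has_integral_diff m')
      moreover have "cis (- t * u) *\<^sub>C cis (t * v) *\<^sub>C z - cis (t * u) *\<^sub>C cis (- t * v) *\<^sub>C z
          = (cis (t * (v - u)) - cis (- (t * (v - u)))) *\<^sub>C z" for v and z :: 'a
        unfolding scaleC.diff_left scaleC_scaleC cis_mult by (simp add: algebra_simps)
      moreover have "max \<delta> t = t" using that by auto
      ultimately show "(F t has_integral (1 / t) *\<^sub>R (cis (- t * u) *\<^sub>C mellin A t y - cis (t * u) *\<^sub>C mellin A (- t) y)) UNIV"
        by (simp add: F_def[abs_def])
    qed
    have outer: "integral {\<delta>..real n} (\<lambda>t. F t v) = \<i> *\<^sub>C ((2 * Si_diff n (v - u)) *\<^sub>R rho A (of_real v) y)" for v
    proof -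
      have "((\<lambda>r. \<i> *\<^sub>C ((2 * r) *\<^sub>R rho A (of_real v) y)) \<circ> (\<lambda>t. sin (t * (v - u)) / t)
         has_integral \<i> *\<^sub>C ((2 * (Si (real n * (v - u)) - Si (\<delta> * (v - u)))) *\<^sub>R rho A (of_real v) y)) {\<delta>..real n}"
        by (rule has_integral_linear[OF sin_has_integral_Si[OF \<delta>]])
           (intro bounded_linear_compose[OF scaleC.bounded_linear_right]
             bounded_linear_compose[OF bounded_linear_scaleR_left] bounded_linear_mult_right)
      then have "((\<lambda>t. F t v) has_integral \<i> *\<^sub>C ((2 * (Si (real n * (v - u)) - Si (\<delta> * (v - u)))) *\<^sub>R rho A (of_real v) y)) {\<delta>..real n}"
      proof (rule has_integral_eq[rotated])
        fix t assume "t \<in> {\<delta>..real n}"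
        then have "max \<delta> t = t" by auto
        then show "((\<lambda>r. \<i> *\<^sub>C ((2 * r) *\<^sub>R rho A (of_real v) y)) \<circ> (\<lambda>t. sin (t * (v - u)) / t)) t = F t v"
          by (simp add: F_def cis_diff_sin scaleR_scaleC scaleC_scaleC mult_ac)
      qed
      then show ?thesis by (simp add: integral_unique Si_diff_def \<delta>_def)
    qed
    obtain C where C: "\<And>n u. exp_decay C 1 (\<lambda>v. (2 * Si_diff n (v - u)) *\<^sub>R rho A (of_real v) y)"
      using Si_diff_rho_decay by blast
    have "integral {\<delta>..real n} (\<lambda>t. (1 / t) *\<^sub>R (cis (- t * u) *\<^sub>C mellin A t y - cis (t * u) *\<^sub>C mellin A (- t) y))
      = integral {\<delta>..real n} (\<lambda>t. integral UNIV (F t))"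
      by (intro integral_cong inner)
    also have "\<dots> = integral UNIV (\<lambda>v. integral {\<delta>..real n} (\<lambda>t. F t v))"
      by (rule exp_decay_integral_swap_Icc[OF cont F \<delta>(2)])
    also have "\<dots> = \<i> *\<^sub>C integral UNIV (\<lambda>v. (2 * Si_diff n (v - u)) *\<^sub>R rho A (of_real v) y)"
      unfolding outer using integral_linear[OF exp_decay_integrable(1)[OF C] scaleC.bounded_linear_right] by (simp only: o_def)
    finally show ?thesis unfolding \<delta>_def .
  qed
  have "(\<lambda>n. \<i> *\<^sub>C integral UNIV (\<lambda>v. (2 * Si_diff n (v - u)) *\<^sub>R rho A (of_real v) y))
     \<longlonglongrightarrow> \<i> *\<^sub>C (pi *\<^sub>R (x - 2 *\<^sub>R yosida A (of_real u) x))"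
    by (intro scaleC.tendsto tendsto_const Si_diff_rho_limit xy)
  then have "(\<lambda>n. integral {1 / 2 ^ n..real n} (\<lambda>t. (1 / t) *\<^sub>R (cis (- t * u) *\<^sub>C mellin A t y - cis (t * u) *\<^sub>C mellin A (- t) y)))
     \<longlonglongrightarrow> \<i> *\<^sub>C (pi *\<^sub>R (x - 2 *\<^sub>R yosida A (of_real u) x))"
    by (rule Lim_transform_eventually) (use eq in \<open>auto simp: eventually_sequentially intro!: exI[of _ 1]\<close>)
  moreover have "\<i> *\<^sub>C (pi *\<^sub>R z) = (\<i> * pi) *\<^sub>C z" for z :: 'a
    by (simp add: scaleR_scaleC[of pi] scaleC_scaleC)
  ultimately show ?thesis by simp
qed

end

section \<open>Rotating the operator\<close>

context strip
begin

lemma continuous_on_yosida: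
  assumes "\<And>s. s \<in> X \<Longrightarrow> \<bar>Im (f s)\<bar> \<le> h" "continuous_on X f" "continuous_on X g"
  shows "continuous_on X (\<lambda>s. yosida A (f s) (g s))"
proof -
  have "continuous_on X (\<lambda>s. exp (f s))" using assms(2) by (rule continuous_on_exp)
  moreover from this have "continuous_on X (\<lambda>s. Res A (exp (f s)) (g s))"
    using resK[OF assms(1)] assms(3) by (intro continuous_on_Res[where K = K])
  ultimately show ?thesis unfolding yosida_def by (rule scaleC.continuous_on)
qed

text \<open>Shifting the line of integration: along \<open>\<zeta> = u - \<i> s \<eta>\<close> the derivatives of the integrand in \<open>s\<close>
  and in \<open>u\<close> are proportional, so the \<open>s\<close>-derivative of the integral is a boundary term.\<close>

lemma mellin_rotate:
  assumes \<eta>: "\<bar>\<eta>\<bar> \<le> h"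
  shows "((\<lambda>u. cis (t * u) *\<^sub>C rho A (of_real u - \<i> * \<eta>) y) has_integral exp (- t * \<eta>) *\<^sub>R mellin A t y) UNIV"
proof -
  \<comment> \<open>The parameter s deforms the real line (s = 0) into the line with imaginary part
    - \<eta> (s = 1).\<close>
  define \<zeta> where "\<zeta> u s = complex_of_real u - \<i> * of_real (s * \<eta>)" for u s
  define \<Phi> where "\<Phi> u s = exp (\<i> * t * \<zeta> u s) *\<^sub>C rho A (\<zeta> u s) y" for u s
  define D where "D u s = exp (\<i> * t * \<zeta> u s) *\<^sub>C rho' (\<zeta> u s) y + (\<i> * t * exp (\<i> * t * \<zeta> u s)) *\<^sub>C rho A (\<zeta> u s) y" for u s
  have Im: "\<bar>Im (\<zeta> u s)\<bar> \<le> h" if "s \<in> {0..1}" for u s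
  proof -
    have "\<bar>s * \<eta>\<bar> \<le> 1 * h" unfolding abs_mult using that \<eta> by (intro mult_mono) auto
    then show ?thesis by (simp add: \<zeta>_def)
  qed
  have Re: "Re (\<zeta> u s) = u" for u s by (simp add: \<zeta>_def)
  have deriv: "((\<lambda>r. exp (\<i> * t * (z0 + of_real r * c)) *\<^sub>C rho A (z0 + of_real r * c) y) has_vector_derivative
     c *\<^sub>C (exp (\<i> * t * (z0 + of_real r * c)) *\<^sub>C rho' (z0 + of_real r * c) y
       + (\<i> * t * exp (\<i> * t * (z0 + of_real r * c))) *\<^sub>C rho A (z0 + of_real r * c) y)) (at r within X)"
    if "\<And>r. r \<in> X \<Longrightarrow> \<bar>Im (z0 + of_real r * c)\<bar> \<le> h" "r \<in> X" for z0 c r and X :: "real set"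
  proof -
    have "((\<lambda>z. exp (\<i> * t * (z0 + z * c))) has_field_derivative \<i> * t * c * exp (\<i> * t * (z0 + of_real r * c))) (at (of_real r))"
      by (auto intro!: derivative_eq_intros)
    from scaleC.has_vector_derivative[OF has_vector_derivative_real_field[OF this, of X] rho_deriv[OF that]]
    show ?thesis by (simp add: scaleC_scaleC scaleC.add_right mult_ac add.commute)
  qed
  have du: "((\<lambda>u. \<Phi> u s) has_vector_derivative D u s) (at u within X)" if "s \<in> {0..1}" for u s X
  proof (rule has_vector_derivative_within_subset[OF _ subset_UNIV])
    show "((\<lambda>u. \<Phi> u s) has_vector_derivative D u s) (at u)"
      using deriv[of UNIV "- \<i> * of_real (s * \<eta>)" 1 u] Im[OF that] by (simp add: \<Phi>_def D_def \<zeta>_def)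
  qed
  have ds: "((\<lambda>s. \<Phi> u s) has_vector_derivative (- \<i> * \<eta>) *\<^sub>C D u s) (at s within {0..1})" if "s \<in> {0..1}" for u s
    using deriv[of "{0..1}" "of_real u" "- \<i> * \<eta>" s] Im that by (simp add: \<Phi>_def D_def \<zeta>_def mult_ac)
  have cont\<zeta>: "continuous_on S (\<lambda>p. \<zeta> (f p) (g p))" if "continuous_on S f" "continuous_on S g" for f g and S :: "'z::topological_space set"
    unfolding \<zeta>_def by (intro continuous_intros that)
  have contrho: "continuous_on S (\<lambda>p. rho A (\<zeta> (f p) (g p)) y)"
    if "continuous_on S f" "continuous_on S g" "\<And>p. p \<in> S \<Longrightarrow> g p \<in> {0..1}" for f g and S :: "'z::topological_space set"
  proof -
    have Im': "\<bar>Im (\<zeta> (f p) (g p))\<bar> \<le> h" if "p \<in> S" for p using Im that \<open>\<And>p. p \<in> S \<Longrightarrow> g p \<in> {0..1}\<close> by blast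
    have c: "continuous_on S (\<lambda>p. exp (\<zeta> (f p) (g p)))" by (intro continuous_on_exp cont\<zeta> that)
    have R: "\<And>p. p \<in> S \<Longrightarrow> resolves A (exp (\<zeta> (f p) (g p))) K" using Im' by (rule resK)
    have c1: "continuous_on S (\<lambda>p. Res A (exp (\<zeta> (f p) (g p))) y)"
      by (rule continuous_on_Res[OF R c continuous_on_const])
    show ?thesis unfolding rho_def
      by (rule scaleC.continuous_on[OF c continuous_on_Res[OF R c c1]])
  qed
  have contexp: "continuous_on S (\<lambda>p. exp (\<i> * t * \<zeta> (f p) (g p)))"
    if "continuous_on S f" "continuous_on S g" for f g and S :: "'z::topological_space set"
    by (intro continuous_on_exp continuous_on_mult continuous_on_const cont\<zeta> that)
  have contD: "continuous_on S (\<lambda>p. D (f p) (g p))"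
    if "continuous_on S f" "continuous_on S g" "\<And>p. p \<in> S \<Longrightarrow> g p \<in> {0..1}" for f g and S :: "'z::topological_space set"
  proof -
    have Im': "\<bar>Im (\<zeta> (f p) (g p))\<bar> \<le> h" if "p \<in> S" for p using Im that \<open>\<And>p. p \<in> S \<Longrightarrow> g p \<in> {0..1}\<close> by blast
    have "continuous_on S (\<lambda>p. yosida A (\<zeta> (f p) (g p)) (rho A (\<zeta> (f p) (g p)) y))"
      by (rule continuous_on_yosida[OF Im' cont\<zeta> contrho]) (use that in auto)
    then show ?thesis unfolding D_def rho'_def
      by (intro scaleC.continuous_on continuous_on_add continuous_on_diff continuous_on_scaleR continuous_on_mult
           continuous_on_const contexp contrho that)
  qed
  have cont\<Phi>: "continuous_on S (\<lambda>u. \<Phi> u s)" if "s \<in> {0..1}" for S s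
    unfolding \<Phi>_def
    by (intro scaleC.continuous_on contexp contrho continuous_on_const continuous_on_id that)
  define C where "C = exp (\<bar>t * \<eta>\<bar>) * (K\<^sup>2 * norm y)"
  have \<Phi>_decay: "exp_decay C 1 (\<lambda>u. \<Phi> u s)" if s: "s \<in> {0..1}" for s
    unfolding exp_decay_def
  proof (intro conjI allI cont\<Phi> s)
    fix u
    have "t * (s * \<eta>) \<le> \<bar>t * \<eta>\<bar>"
    proof -
      have "t * (s * \<eta>) = s * (t * \<eta>)" by simp
      also have "\<dots> \<le> s * \<bar>t * \<eta>\<bar>" using s by (intro mult_left_mono abs_ge_self) auto
      also have "\<dots> \<le> 1 * \<bar>t * \<eta>\<bar>" using s by (intro mult_right_mono) auto
      finally show ?thesis by simp
    qed
    then have "norm (exp (\<i> * t * \<zeta> u s)) \<le> exp (\<bar>t * \<eta>\<bar>)" by (simp add: \<zeta>_def)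
    then have "norm (\<Phi> u s) \<le> exp (\<bar>t * \<eta>\<bar>) * (K\<^sup>2 * norm y * exp (- \<bar>u\<bar>))"
      unfolding \<Phi>_def norm_scaleC using norm_rho[OF Im[OF s], of u y] by (intro mult_mono) (auto simp: Re)
    then show "norm (\<Phi> u s) \<le> C * exp (- 1 * \<bar>u\<bar>)" by (simp add: C_def mult.assoc)
  qed simp
  \<comment> \<open>Fundamental theorem in s, exchange of integrals, fundamental theorem in u: only
    the values at u = m and u = - m remain, and these decay exponentially.\<close>
  have diff: "norm (integral {- real m..real m} (\<lambda>u. \<Phi> u 1) - integral {- real m..real m} (\<lambda>u. \<Phi> u 0)) \<le> (2 * \<bar>\<eta>\<bar> * C) * exp (- 1 * real m)" for m
  proof -
    have "integral {- real m..real m} (\<lambda>u. \<Phi> u 1) - integral {- real m..real m} (\<lambda>u. \<Phi> u 0)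
      = integral {- real m..real m} (\<lambda>u. \<Phi> u 1 - \<Phi> u 0)"
      by (rule integral_diff[symmetric]) (intro integrable_continuous_real cont\<Phi>; simp)+
    also have "\<dots> = integral {- real m..real m} (\<lambda>u. integral {0..1} (\<lambda>s. (- \<i> * \<eta>) *\<^sub>C D u s))"
      by (intro integral_cong integral_unique[symmetric] fundamental_theorem_of_calculus ds) auto
    also have "\<dots> = integral {0..1} (\<lambda>s. integral {- real m..real m} (\<lambda>u. (- \<i> * \<eta>) *\<^sub>C D u s))"
    proof -
      have "continuous_on (cbox (- real m, 0) (real m, 1)) (\<lambda>(u, s). (- \<i> * \<eta>) *\<^sub>C D u s)"
        unfolding case_prod_beta by (intro continuous_intros contD) auto
      from integral_swap_continuous[OF this] show ?thesis by simp
    qed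
    also have "\<dots> = integral {0..1} (\<lambda>s. (- \<i> * \<eta>) *\<^sub>C (\<Phi> (real m) s - \<Phi> (- real m) s))"
    proof (intro integral_cong)
      fix s :: real assume s: "s \<in> {0..1}"
      have "((\<lambda>u. D u s) has_integral \<Phi> (real m) s - \<Phi> (- real m) s) {- real m..real m}"
        by (intro fundamental_theorem_of_calculus du s) auto
      from integral_unique[OF has_integral_linear[OF this scaleC.bounded_linear_right]]
      show "integral {- real m..real m} (\<lambda>u. (- \<i> * \<eta>) *\<^sub>C D u s) = (- \<i> * \<eta>) *\<^sub>C (\<Phi> (real m) s - \<Phi> (- real m) s)"
        by (simp only: o_def)
    qed
    also have "norm \<dots> \<le> (2 * \<bar>\<eta>\<bar> * C) * exp (- 1 * real m) * (1 - 0)"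
    proof (rule integral_bound)
      have "((\<lambda>s. \<Phi> u s)) differentiable (at s within {0..1})" if "s \<in> {0..1}" for u s
        using ds[OF that] vector_derivative_works has_vector_derivative_def differentiable_def by blast
      then have "continuous_on {0..1} (\<Phi> u)" for u
        by (simp add: differentiable_imp_continuous_on differentiable_on_def)
      then show "continuous_on {0..1} (\<lambda>s. (- \<i> * \<eta>) *\<^sub>C (\<Phi> (real m) s - \<Phi> (- real m) s))"
        by (intro continuous_intros)
      fix s :: real assume s: "s \<in> {0..1}"
      have "norm (\<Phi> (real m) s - \<Phi> (- real m) s) \<le> C * exp (- 1 * real m) + C * exp (- 1 * real m)"
        using exp_decayD(3)[OF \<Phi>_decay[OF s], of "real m"] exp_decayD(3)[OF \<Phi>_decay[OF s], of "- real m"]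
        by (intro order_trans[OF norm_triangle_ineq4] add_mono) auto
      from mult_left_mono[OF this, of "\<bar>\<eta>\<bar>"]
      show "norm ((- \<i> * \<eta>) *\<^sub>C (\<Phi> (real m) s - \<Phi> (- real m) s)) \<le> (2 * \<bar>\<eta>\<bar> * C) * exp (- 1 * real m)"
        by (simp add: norm_scaleC norm_mult mult_ac)
    qed simp
    finally show ?thesis by simp
  qed
  have "(\<lambda>m. integral {- real m..real m} (\<lambda>u. \<Phi> u 1) - integral {- real m..real m} (\<lambda>u. \<Phi> u 0)) \<longlonglongrightarrow> 0"
  proof (rule tendsto_0_le[OF exp_neg_mult_tendsto_0[of 1 "2 * \<bar>\<eta>\<bar> * C"], of _ 1], simp, intro always_eventually allI)
    show "norm (integral {- real m..real m} (\<lambda>u. \<Phi> u 1) - integral {- real m..real m} (\<lambda>u. \<Phi> u 0))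
      \<le> norm ((2 * \<bar>\<eta>\<bar> * C) * exp (- 1 * real m)) * 1" for m
      unfolding real_norm_def mult_1_right by (rule order_trans[OF diff abs_ge_self])
  qed
  moreover have "(\<lambda>m. integral {- real m..real m} (\<lambda>u. \<Phi> u 1) - integral {- real m..real m} (\<lambda>u. \<Phi> u 0))
     \<longlonglongrightarrow> integral UNIV (\<lambda>u. \<Phi> u 1) - integral UNIV (\<lambda>u. \<Phi> u 0)"
    by (intro tendsto_diff exp_decay_integral_LIMSEQ[OF \<Phi>_decay]) auto
  ultimately have "integral UNIV (\<lambda>u. \<Phi> u 1) = integral UNIV (\<lambda>u. \<Phi> u 0)"
    using LIMSEQ_unique by fastforce
  also have "\<dots> = mellin A t y"
    by (simp add: mellin_def \<Phi>_def \<zeta>_def cis_conv_exp mult_ac)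
  finally have "((\<lambda>u. \<Phi> u 1) has_integral mellin A t y) UNIV"
    using integrable_integral[OF exp_decay_integrable(1)[OF \<Phi>_decay[of 1]]] by simp
  from has_integral_cmul[OF this, of "exp (- t * \<eta>)"]
  have "((\<lambda>u. exp (- t * \<eta>) *\<^sub>R \<Phi> u 1) has_integral exp (- t * \<eta>) *\<^sub>R mellin A t y) UNIV" .
  moreover have "exp (- t * \<eta>) *\<^sub>R \<Phi> u 1 = cis (t * u) *\<^sub>C rho A (of_real u - \<i> * \<eta>) y" for u
  proof -
    have "complex_of_real (exp (- t * \<eta>)) * exp (\<i> * t * \<zeta> u 1) = cis (t * u)"
      by (simp add: \<zeta>_def cis_conv_exp exp_of_real[symmetric] exp_add[symmetric] algebra_simps)
    then show ?thesis by (simp add: \<Phi>_def scaleR_scaleC scaleC_scaleC \<zeta>_def)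
  qed
  ultimately show ?thesis by simp
qed

end

section \<open>Resolvents of rotated and perturbed operators\<close>

lemma op_scale_iff: "c \<noteq> 0 \<Longrightarrow> (x, y) \<in> op_scale c A \<longleftrightarrow> (x, (1 / c) *\<^sub>C y) \<in> A"
  by (auto simp: op_scale_def scaleC_scaleC intro!: exI[of _ "(1 / c) *\<^sub>C y"])

lemma op_scale_op_scale: "op_scale c (op_scale d A) = op_scale (c * d) A"
proof -
  have "op_scale c A = (\<lambda>(x, y). (x, c *\<^sub>C y)) ` A" for c and A :: "'a operator"
    by (force simp: op_scale_def)
  then show ?thesis by (simp add: image_image case_prod_beta scaleC_scaleC)
qed

lemma op_scale_1: "op_scale 1 A = A"
  by (auto simp: op_scale_def)

lemma linear_op_scale:
  assumes A: "linear_operator A" and c: "c \<noteq> 0"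
  shows "linear_operator (op_scale c A)"
  unfolding linear_operator_def
proof (intro conjI allI impI)
  show "single_valued (op_scale c A)"
    using A by (auto simp: linear_operator_def single_valued_def op_scale_def)
  show "(0, 0) \<in> op_scale c A"
    using A by (simp add: op_scale_iff[OF c] scaleC.zero_right linear_operator_def)
  show "(x + y, u + v) \<in> op_scale c A" if "(x, u) \<in> op_scale c A" "(y, v) \<in> op_scale c A" for x y u v
    using A that by (simp add: op_scale_iff[OF c] scaleC.add_right linear_operator_def)
  show "(d *\<^sub>C x, d *\<^sub>C u) \<in> op_scale c A" if "(x, u) \<in> op_scale c A" for d x u
  proof -
    have "(d *\<^sub>C x, d *\<^sub>C ((1 / c) *\<^sub>C u)) \<in> A"
      using A that unfolding op_scale_iff[OF c] linear_operator_def by blast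
    then show ?thesis by (simp add: op_scale_iff[OF c] scaleC_scaleC)
  qed
qed

lemma op_scale_resolves:
  assumes A: "linear_operator A" and c: "c \<noteq> 0" and R: "resolves A (z / c) k" and k: "k / cmod c \<le> k'"
  shows "resolves (op_scale c A) z k'" "Res (op_scale c A) z = (\<lambda>v. Res A (z / c) ((1 / c) *\<^sub>C v))"
proof -
  have iff: "(w, v - z *\<^sub>C w) \<in> op_scale c A \<longleftrightarrow> w = Res A (z / c) ((1 / c) *\<^sub>C v)" for v w
    using resolvesD(3)[OF R, of w "(1 / c) *\<^sub>C v"]
    by (simp add: op_scale_iff[OF c] scaleC.diff_right scaleC_scaleC)
  have bd: "norm (Res A (z / c) ((1 / c) *\<^sub>C v)) \<le> k' * norm v" for v
  proof -
    have "norm (Res A (z / c) ((1 / c) *\<^sub>C v)) \<le> k * norm ((1 / c) *\<^sub>C v)" by (rule resolvesD(4)[OF R])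
    also have "\<dots> = (k / cmod c) * norm v" by (simp add: norm_scaleC norm_divide)
    also have "\<dots> \<le> k' * norm v" using k by (intro mult_right_mono) auto
    finally show ?thesis .
  qed
  show "resolves (op_scale c A) z k'" "Res (op_scale c A) z = (\<lambda>v. Res A (z / c) ((1 / c) *\<^sub>C v))"
    using resolvesI[OF iff linear_op_scale[OF A c] bd] by auto
qed

text \<open>Since cis \<eta> A + exp \<zeta> is cis \<eta> times A + exp (\<zeta> - i \<eta>),
  resolvents of the rotated operator on the half-line are resolvents of A on a line inside the
  strip. The factor exp (- t \<eta>) is the power i t of cis \<eta>.\<close>

lemma (in strip) strip_rotate:
  assumes \<eta>: "\<bar>\<eta>\<bar> \<le> h"
  shows "strip (op_scale (cis \<eta>) A) K 0"
    and "mellin (op_scale (cis \<eta>) A) t (cis \<eta> *\<^sub>C y) = exp (- t * \<eta>) *\<^sub>R mellin A t y"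
proof -
  have c: "cis \<eta> \<noteq> 0" "cmod (cis \<eta>) = 1" "1 / cis \<eta> = cis (- \<eta>)" by (simp_all add: cis_divide[of 0, symmetric] divide_inverse)
  have e: "exp \<zeta> / cis \<eta> = exp (\<zeta> - \<i> * \<eta>)" for \<zeta> by (simp add: cis_conv_exp exp_diff)
  have res': "resolves A (exp \<zeta> / cis \<eta>) (K / (1 + exp (Re \<zeta>)))" if "\<bar>Im \<zeta>\<bar> \<le> 0" for \<zeta>
    using res[of "\<zeta> - \<i> * \<eta>"] that \<eta> unfolding e by simp
  show "strip (op_scale (cis \<eta>) A) K 0"
  proof
    show "linear_operator (op_scale (cis \<eta>) A)" by (rule linear_op_scale[OF lin c(1)])
    show "resolves (op_scale (cis \<eta>) A) 0 K" by (rule op_scale_resolves[OF lin c(1)]) (use res0 in auto)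
    show "resolves (op_scale (cis \<eta>) A) (exp \<zeta>) (K / (1 + exp (Re \<zeta>)))" if "\<bar>Im \<zeta>\<bar> \<le> 0" for \<zeta>
      by (rule op_scale_resolves[OF lin c(1) res'[OF that]]) simp
  qed (use K in auto)
  have "rho (op_scale (cis \<eta>) A) (of_real u) (cis \<eta> *\<^sub>C y) = rho A (of_real u - \<i> * \<eta>) y" for u
  proof -
    have "Res (op_scale (cis \<eta>) A) (exp (of_real u)) = (\<lambda>v. Res A (exp (of_real u - \<i> * \<eta>)) (cis (- \<eta>) *\<^sub>C v))"
      using op_scale_resolves(2)[OF lin c(1) res'[of "of_real u"], of "K / (1 + exp u)"] by (simp add: e c(3))
    then show ?thesis
      using resolvesD(2)[OF resK[of "of_real u - \<i> * \<eta>"]] \<eta>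
      by (simp add: rho_def scaleC_scaleC cis_mult exp_diff cis_conv_exp[symmetric] divide_inverse mult_ac)
  qed
  then show "mellin (op_scale (cis \<eta>) A) t (cis \<eta> *\<^sub>C y) = exp (- t * \<eta>) *\<^sub>R mellin A t y"
    unfolding mellin_def[of "op_scale (cis \<eta>) A"] using mellin_rotate[OF \<eta>, of t y] by (simp add: integral_unique)
qed

text \<open>Neumann series in the form of a fixed point: (A + w) x = v means x = Res A z v + (z - w)
  Res A z x, and the right-hand side contracts with factor 1 / 2, whence the bound 2 k.\<close>

lemma resolves_perturb:
  assumes A: "linear_operator A" and R: "resolves A z k" and w: "cmod (z - w) * k \<le> 1 / 2"
  shows "resolves A w (2 * k)"
proof -
  let ?g = "\<lambda>v x. Res A z v + (z - w) *\<^sub>C Res A z x"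
  have iff: "(x, v - w *\<^sub>C x) \<in> A \<longleftrightarrow> ?g v x = x" for v x
  proof -
    have "v - w *\<^sub>C x = (v + (z - w) *\<^sub>C x) - z *\<^sub>C x" by (simp add: scaleC.diff_left)
    then have "(x, v - w *\<^sub>C x) \<in> A \<longleftrightarrow> x = Res A z (v + (z - w) *\<^sub>C x)"
      by (simp only: resolvesD(3)[OF R])
    then show ?thesis by (auto simp: Res_linear[OF R] resolvesD(2)[OF R])
  qed
  have contr: "norm ((z - w) *\<^sub>C Res A z x) \<le> (1 / 2) * norm x" for x
  proof -
    have "norm ((z - w) *\<^sub>C Res A z x) \<le> cmod (z - w) * (k * norm x)"
      unfolding norm_scaleC by (intro mult_left_mono resolvesD(4)[OF R]) auto
    also have "\<dots> \<le> (1 / 2) * norm x" using mult_right_mono[OF w norm_ge_zero[of x]] by (simp add: mult.assoc)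
    finally show ?thesis .
  qed
  have ex1: "\<exists>!x. ?g v x = x" for v
  proof -
    show ?thesis
    proof (rule banach_fix_type[of "1 / 2"])
      show "\<forall>x y. dist (?g v x) (?g v y) \<le> 1 / 2 * dist x y"
      proof (intro allI)
        fix x y
        show "dist (?g v x) (?g v y) \<le> 1 / 2 * dist x y"
          using contr[of "x - y"] by (simp add: dist_norm Res_linear[OF R] scaleC.diff_right)
      qed
    qed auto
  qed
  define f where "f v = (THE x. ?g v x = x)" for v
  have f: "?g v (f v) = f v" for v unfolding f_def by (rule theI'[OF ex1])
  have fiff: "(x, v - w *\<^sub>C x) \<in> A \<longleftrightarrow> x = f v" for v x
    unfolding iff using ex1[of v] f[of v] by blast
  have bd: "norm (f v) \<le> (2 * k) * norm v" for v
  proof -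
    have "norm (f v) \<le> norm (Res A z v) + norm ((z - w) *\<^sub>C Res A z (f v))"
      using norm_triangle_ineq[of "Res A z v" "(z - w) *\<^sub>C Res A z (f v)"] by (simp add: f)
    then show ?thesis using contr[of "f v"] resolvesD(4)[OF R, of v] by simp
  qed
  show ?thesis by (rule resolvesI(1)[OF fiff A bd])
qed

text \<open>The point exp \<zeta> is within |Im \<zeta>| exp (Re \<zeta>) of the half-line, so the
  resolvent bound allows an opening that depends on K alone. This fixes the step length of the
  rotation.\<close>

lemma strip_widen:
  assumes "strip A K 0"
  shows "strip A (2 * K) (1 / (2 * K))"
proof -
  interpret strip A K 0 by fact
  show ?thesis
  proof
    show "linear_operator A" by (rule lin)
    show "resolves A 0 (2 * K)" using res0 by (rule resolves_mono) (use K in simp)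
    fix \<zeta> :: complex assume z: "\<bar>Im \<zeta>\<bar> \<le> 1 / (2 * K)"
    let ?r = "exp (Re \<zeta>)"
    have "exp \<zeta> = of_real ?r * cis (Im \<zeta>)" by (simp add: exp_eq_polar exp_of_real)
    then have "exp (of_real (Re \<zeta>)) - exp \<zeta> = of_real ?r * (1 - cis (Im \<zeta>))"
      by (simp add: exp_of_real algebra_simps)
    then have "cmod (exp (of_real (Re \<zeta>)) - exp \<zeta>) = ?r * cmod (cis (Im \<zeta>) - cis 0)"
      by (simp add: norm_mult norm_minus_commute)
    also have "cmod (cis (Im \<zeta>) - cis 0) \<le> \<bar>Im \<zeta> - 0\<bar>"
    proof -
      have "cmod (exp (\<i> * of_real (Im \<zeta>)) - 1) \<le> \<bar>Im \<zeta>\<bar>" using iexp_approx1[of "Im \<zeta>" 0] by simp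
      then show ?thesis by (simp add: cis_conv_exp)
    qed
    finally have d: "cmod (exp (of_real (Re \<zeta>)) - exp \<zeta>) \<le> ?r * \<bar>Im \<zeta>\<bar>" by (simp add: mult_left_mono)
    have "cmod (exp (of_real (Re \<zeta>)) - exp \<zeta>) * (K / (1 + ?r)) \<le> (?r * (1 / (2 * K))) * (K / (1 + ?r))"
      using z K by (intro mult_right_mono order_trans[OF d] mult_left_mono) (auto simp: add_nonneg_nonneg)
    also have "\<dots> = (1 / 2) * (?r / (1 + ?r))"
    proof -
      have "(?r * (1 / (2 * k))) * (k / m) = (1 / 2) * (?r / m)" if "k \<noteq> 0" for k m :: real
        using that by simp
      then show ?thesis using K by simp
    qed
    also have "\<dots> \<le> (1 / 2) * 1" by (intro mult_left_mono) (auto simp: divide_le_eq add_pos_pos)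
    finally show "resolves A (exp \<zeta>) (2 * K / (1 + exp (Re \<zeta>)))"
      using resolves_perturb[OF lin res[of "of_real (Re \<zeta>)"], of "exp \<zeta>"] by simp
  qed (use K in auto)
qed

section \<open>The group of imaginary powers\<close>

text \<open>With x = \<pi> |t| the claim amounts to (1 + 2 x) exp (- 2 x) \<le> 1. The linear factor
  makes the bound hold down to t = 0.\<close>

lemma norm_mellin_id: "cmod (mellin_id t) \<le> (1 + 2 * pi * \<bar>t\<bar>) * exp (- pi * \<bar>t\<bar>)"
proof (cases "t = 0")
  case False
  define x where "x = pi * \<bar>t\<bar>"
  have x: "x > 0" using False by (simp add: x_def)
  have sx: "sinh x > 0" using x by simp
  have "(1 + 2 * x) * exp (- 2 * x) \<le> exp (2 * x) * exp (- 2 * x)"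
    by (intro mult_right_mono exp_ge_add_one_self) auto
  then have e: "(1 + 2 * x) * exp (- 2 * x) \<le> 1" by (simp add: exp_minus)
  have "(1 + 2 * x) * exp (- x) * sinh x = (1 + 2 * x) * (exp (- x) * exp x - exp (- x) * exp (- x)) / 2"
    unfolding sinh_field_def by (simp add: right_diff_distrib diff_divide_distrib mult.assoc)
  also have "\<dots> = (1 + 2 * x - (1 + 2 * x) * exp (- 2 * x)) / 2"
    by (simp add: exp_add[symmetric] algebra_simps)
  finally have "x \<le> (1 + 2 * x) * exp (- x) * sinh x" using e by simp
  then have "x / sinh x \<le> (1 + 2 * x) * exp (- x)" using sx by (simp add: divide_le_eq)
  moreover have "cmod (mellin_id t) = x / sinh x"
  proof -
    have "\<bar>sinh (pi * t)\<bar> = sinh x" by (simp add: x_def abs_mult flip: sinh_real_abs)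
    then show ?thesis unfolding mellin_id_sinh(2)[OF False] norm_of_real by (simp add: abs_mult x_def)
  qed
  ultimately show ?thesis by (simp add: x_def mult_ac)
qed (simp add: mellin_id_0)

text \<open>Half of the exponential rate absorbs the linear factor.\<close>

lemma poly_exp_bound:
  assumes "\<alpha> > 0" "t \<ge> 0"
  shows "(1 + 2 * pi * t) * exp (- \<alpha> * t) \<le> (1 + 4 * pi / \<alpha>) * exp (- (\<alpha> / 2) * t)"
proof -
  have "1 + 2 * pi * t \<le> (1 + 4 * pi / \<alpha>) * (1 + \<alpha> / 2 * t)"
    using assms by (simp add: field_simps)
  also have "\<dots> \<le> (1 + 4 * pi / \<alpha>) * exp (\<alpha> / 2 * t)"
    using assms by (intro mult_left_mono exp_ge_add_one_self) auto
  finally have "(1 + 2 * pi * t) * exp (- \<alpha> * t) \<le> (1 + 4 * pi / \<alpha>) * exp (\<alpha> / 2 * t) * exp (- \<alpha> * t)"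
    by (intro mult_right_mono) auto
  also have "\<dots> = (1 + 4 * pi / \<alpha>) * exp (- (\<alpha> / 2) * t)"
    by (simp add: mult.assoc exp_add[symmetric])
  finally show ?thesis .
qed

lemma abs_exp_minus_1_le: "\<bar>exp a - 1\<bar> \<le> \<bar>a\<bar> * exp \<bar>a\<bar>" for a :: real
proof (cases "a \<ge> 0")
  case True
  have "(1 - a) * exp a \<le> exp (- a) * exp a"
    using exp_ge_add_one_self[of "- a"] by (intro mult_right_mono) auto
  then show ?thesis using True by (simp add: exp_minus algebra_simps)
next
  case False
  have "1 - exp a \<le> - a" using exp_ge_add_one_self[of a] by linarith
  also have "\<dots> \<le> - a * exp \<bar>a\<bar>" using False by simp
  finally show ?thesis using False by simp
qed

lemma norm_bound_dense:
  assumes f: "bounded_linear f" and S: "closure S = UNIV" and bd: "\<And>x. x \<in> S \<Longrightarrow> norm (f x) \<le> c * norm x"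
  shows "norm (f x) \<le> c * norm x"
proof -
  have cf: "continuous_on UNIV f" using f by (rule linear_continuous_on)
  have "closed {x. norm (f x) \<le> c * norm x}"
    by (intro closed_Collect_le continuous_intros cf)
  then have "closure S \<subseteq> {x. norm (f x) \<le> c * norm x}"
    using bd by (intro closure_minimal) auto
  then show ?thesis using S by auto
qed

lemma eq_dense:
  fixes f g :: "'a::real_normed_vector \<Rightarrow> 'b::real_normed_vector"
  assumes f: "bounded_linear f" and g: "bounded_linear g" and S: "closure S = UNIV" and eq: "\<And>x. x \<in> S \<Longrightarrow> f x = g x"
  shows "f x = g x"
  using norm_bound_dense[of "\<lambda>x. f x - g x" S 0 x] bounded_linear_sub[OF f g] S eq by simp

text \<open>The family U is kept abstract instead of being \<open>imag_power\<close>, so that the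
  locale passes to the rotated operator with exp (- t \<psi>) U t in place of U t. Neither the group
  law nor continuity is assumed; both follow from \<open>U_mellin\<close>.\<close>

locale bip = strip A K 0 for A :: "'a::complex_banach operator" and K :: real +
  fixes U :: "real \<Rightarrow> 'a \<Rightarrow> 'a" and M \<phi> :: real
  assumes dense: "closure (Domain A) = UNIV" and \<phi>: "\<phi> \<ge> 0" "\<phi> < pi" and M: "M \<ge> 1"
    and U_lin: "bounded_linear (U t)" and U_scaleC: "U t (c *\<^sub>C x) = c *\<^sub>C U t x"
    and U_0: "U 0 x = x"
    and U_bound: "norm (U t x) \<le> M * exp (\<phi> * \<bar>t\<bar>) * norm x"
    and U_mellin: "(x, y) \<in> A \<Longrightarrow> mellin A t y = mellin_id t *\<^sub>C U t x"
begin

lemma norm_mellin: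
  assumes "(x, y) \<in> A"
  shows "norm (mellin A t y) \<le> M * (1 + 2 * pi * \<bar>t\<bar>) * exp (- (pi - \<phi>) * \<bar>t\<bar>) * norm x"
proof -
  have "norm (mellin A t y) \<le> ((1 + 2 * pi * \<bar>t\<bar>) * exp (- pi * \<bar>t\<bar>)) * (M * exp (\<phi> * \<bar>t\<bar>) * norm x)"
    unfolding U_mellin[OF assms] norm_scaleC by (intro mult_mono norm_mellin_id U_bound) (auto intro: add_nonneg_nonneg)
  also have "\<dots> = M * (1 + 2 * pi * \<bar>t\<bar>) * (exp (- pi * \<bar>t\<bar>) * exp (\<phi> * \<bar>t\<bar>)) * norm x" by (simp add: mult_ac)
  also have "exp (- pi * \<bar>t\<bar>) * exp (\<phi> * \<bar>t\<bar>) = exp (- (pi - \<phi>) * \<bar>t\<bar>)" by (simp add: exp_add[symmetric] algebra_simps)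
  finally show ?thesis .
qed

text \<open>The singularity of the kernel at \<open>0\<close> cancels in the difference between the resolvents of
  the rotated and of the original operator, so the bound is uniform in the constant \<open>K'\<close>.\<close>

lemma yosida_rotated_bound:
  assumes \<theta>: "0 \<le> \<theta>" "\<theta> < pi - \<phi>"
  obtains C where "C \<ge> 0" "\<And>\<psi> K' u x. \<bar>\<psi>\<bar> \<le> \<theta> \<Longrightarrow> strip (op_scale (cis \<psi>) A) K' 0 \<Longrightarrow>
     (\<And>t y. mellin (op_scale (cis \<psi>) A) t (cis \<psi> *\<^sub>C y) = exp (- t * \<psi>) *\<^sub>R mellin A t y) \<Longrightarrow>
     norm (yosida (op_scale (cis \<psi>) A) (of_real u) x) \<le> C * norm x"
proof -
  \<comment> \<open>The decay that is left of exp (- \<pi> t) after the growth exp (\<phi> t) of the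
    imaginary powers and exp (\<theta> t) of the rotation.\<close>
  define \<alpha> where "\<alpha> = pi - \<phi> - \<theta>"
  have \<alpha>: "\<alpha> > 0" using \<theta> by (simp add: \<alpha>_def)
  define c where "c = 2 * \<theta> * M * (1 + 4 * pi / \<alpha>)"
  have c0: "c \<ge> 0" using \<theta> M \<alpha> by (simp add: c_def)
  define D where "D = c / (\<alpha> / 2)"
  have D0: "D \<ge> 0" using c0 \<alpha> by (simp add: D_def)
  have key: "norm (yosida (op_scale (cis \<psi>) A) (of_real u) x) \<le> (K + D / (2 * pi)) * norm x"
    if \<psi>: "\<bar>\<psi>\<bar> \<le> \<theta>" and B: "strip (op_scale (cis \<psi>) A) K' 0"
      and mB: "\<And>t y. mellin (op_scale (cis \<psi>) A) t (cis \<psi> *\<^sub>C y) = exp (- t * \<psi>) *\<^sub>R mellin A t y" for \<psi> K' u x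
  proof (rule norm_bound_dense[OF _ dense])
    let ?B = "op_scale (cis \<psi>) A"
    interpret B: strip ?B K' 0 by fact
    show "bounded_linear (yosida ?B (of_real u))" by (rule B.bounded_linear_yosida) simp
    fix x assume "x \<in> Domain A"
    then obtain y where xy: "(x, y) \<in> A" by auto
    then have xyB: "(x, cis \<psi> *\<^sub>C y) \<in> ?B" by (auto simp: op_scale_def)
    let ?m = "\<lambda>t. mellin A t y"
    let ?TA = "yosida A (of_real u) x" and ?TB = "yosida ?B (of_real u) x"
    let ?f = "\<lambda>t. (1 / t) *\<^sub>R (cis (- t * u) *\<^sub>C mellin ?B t (cis \<psi> *\<^sub>C y) - cis (t * u) *\<^sub>C mellin ?B (- t) (cis \<psi> *\<^sub>C y))"
    let ?g = "\<lambda>t. (1 / t) *\<^sub>R (cis (- t * u) *\<^sub>C mellin A t y - cis (t * u) *\<^sub>C mellin A (- t) y)"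
    have mc: "continuous_on S (\<lambda>t. mellin A (k t) y)" if "continuous_on S k" for S :: "real set" and k
      by (rule continuous_on_compose2[OF mellin_continuous that]) auto
    have bd: "norm (integral {1 / 2 ^ n..real n} ?f - integral {1 / 2 ^ n..real n} ?g) \<le> D * norm x" if n: "n \<ge> 1" for n
    proof -
      define \<delta> where "\<delta> = 1 / (2::real) ^ n"
      have \<delta>: "\<delta> > 0" "\<delta> \<le> real n"
      proof -
        have "\<delta> \<le> 1" by (simp add: \<delta>_def)
        then show "\<delta> \<le> real n" using n by linarith
      qed (simp add: \<delta>_def)
      have cf: "continuous_on {\<delta>..real n} ?f" and cg: "continuous_on {\<delta>..real n} ?g"
        unfolding mB using \<delta> by (intro continuous_intros mc; auto)+
      have pt: "norm (?f t - ?g t) \<le> c * norm x * exp (- (\<alpha> / 2) * t)" if "t \<in> {\<delta>..real n}" for t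
      proof -
        have t: "t > 0" using that \<delta> by auto
        define b where "b = M * (1 + 2 * pi * t) * exp (- (pi - \<phi>) * t) * norm x"
        have b0: "b \<ge> 0" using M t by (simp add: b_def add_nonneg_nonneg)
        have m1: "norm (?m t) \<le> b" "norm (?m (- t)) \<le> b"
          using norm_mellin[OF xy, of t] norm_mellin[OF xy, of "- t"] t by (simp_all add: b_def)
        \<comment> \<open>The factor t cancels the singularity 1 / t of the principal value.\<close>
        have e1: "\<bar>exp (- t * \<psi>) - 1\<bar> \<le> t * \<theta> * exp (t * \<theta>)" "\<bar>exp (- (- t) * \<psi>) - 1\<bar> \<le> t * \<theta> * exp (t * \<theta>)"
        proof -
          have *: "\<bar>s\<bar> * exp \<bar>s\<bar> \<le> t * \<theta> * exp (t * \<theta>)" if "\<bar>s\<bar> = t * \<bar>\<psi>\<bar>" for s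
            unfolding that using \<psi> t by (intro mult_mono) auto
          show "\<bar>exp (- t * \<psi>) - 1\<bar> \<le> t * \<theta> * exp (t * \<theta>)" "\<bar>exp (- (- t) * \<psi>) - 1\<bar> \<le> t * \<theta> * exp (t * \<theta>)"
            using t by (intro order_trans[OF abs_exp_minus_1_le] *; simp add: abs_mult)+
        qed
        have "?f t - ?g t = (1 / t) *\<^sub>R (cis (- t * u) *\<^sub>C ((exp (- t * \<psi>) - 1) *\<^sub>R ?m t) - cis (t * u) *\<^sub>C ((exp (- (- t) * \<psi>) - 1) *\<^sub>R ?m (- t)))"
          unfolding mB by (simp add: scaleR_left_diff_distrib scaleC.diff_right scaleR_right_diff_distrib)
        also have "norm \<dots> \<le> (1 / t) * (\<bar>exp (- t * \<psi>) - 1\<bar> * norm (?m t) + \<bar>exp (- (- t) * \<psi>) - 1\<bar> * norm (?m (- t)))"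
          unfolding norm_scaleR using t
          by (intro mult_mono order_trans[OF norm_triangle_ineq4]) (auto simp: norm_scaleC)
        also have "\<dots> \<le> (1 / t) * (t * \<theta> * exp (t * \<theta>) * b + t * \<theta> * exp (t * \<theta>) * b)"
          using t \<theta> by (intro mult_left_mono add_mono mult_mono e1 m1) auto
        also have "\<dots> = 2 * \<theta> * (exp (t * \<theta>) * b)" using t by simp
        also have "exp (t * \<theta>) * b = M * norm x * ((1 + 2 * pi * t) * exp (- \<alpha> * t))"
          by (simp add: b_def \<alpha>_def mult_ac exp_add[symmetric] algebra_simps)
            (simp add: exp_add[symmetric] mult_ac algebra_simps)?
        also have "\<dots> \<le> M * norm x * ((1 + 4 * pi / \<alpha>) * exp (- (\<alpha> / 2) * t))"
          using M t by (intro mult_left_mono poly_exp_bound \<alpha>) auto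
        finally have "norm (?f t - ?g t) \<le> 2 * \<theta> * (M * norm x * ((1 + 4 * pi / \<alpha>) * exp (- (\<alpha> / 2) * t)))"
          using \<theta> by (simp add: mult_left_mono)
        also have "\<dots> = c * norm x * exp (- (\<alpha> / 2) * t)" by (simp only: c_def mult_ac)
        finally show ?thesis .
      qed
      have I: "((\<lambda>t. c * norm x * exp (- (\<alpha> / 2) * t)) has_integral (c * norm x) / (\<alpha> / 2) * (exp (- (\<alpha> / 2) * \<delta>) - exp (- (\<alpha> / 2) * real n))) {\<delta>..real n}"
        using \<alpha> \<delta> by (intro exp_has_integral_Icc) auto
      have "norm (integral {\<delta>..real n} (\<lambda>t. ?f t - ?g t)) \<le> integral {\<delta>..real n} (\<lambda>t. c * norm x * exp (- (\<alpha> / 2) * t))"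
        using I by (intro integral_norm_bound_integral pt integrable_continuous_real continuous_on_diff cf cg has_integral_integrable[OF I])
      also have "\<dots> = (c * norm x) / (\<alpha> / 2) * (exp (- (\<alpha> / 2) * \<delta>) - exp (- (\<alpha> / 2) * real n))" using I by (rule integral_unique)
      also have "\<dots> \<le> (c * norm x) / (\<alpha> / 2) * 1"
      proof (intro mult_left_mono)
        have "exp (- (\<alpha> / 2) * \<delta>) \<le> 1" using \<alpha> \<delta> by simp
        then show "exp (- (\<alpha> / 2) * \<delta>) - exp (- (\<alpha> / 2) * real n) \<le> 1" using exp_gt_zero[of "- (\<alpha> / 2) * real n"] by linarith
      qed (use c0 \<alpha> in auto)
      also have "\<dots> = D * norm x" by (simp add: D_def)
      finally show ?thesis
        unfolding \<delta>_def[symmetric] using integral_diff[OF integrable_continuous_real[OF cf] integrable_continuous_real[OF cg]] by simp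
    qed
    \<comment> \<open>Both principal values converge to expressions i \<pi> (x - 2 T x); subtracting
      them leaves 2 \<pi> times the difference of the two \<open>yosida\<close> operators in
      norm.\<close>
    have "norm ((\<i> * pi) *\<^sub>C (x - 2 *\<^sub>R ?TB) - (\<i> * pi) *\<^sub>C (x - 2 *\<^sub>R ?TA)) \<le> D * norm x"
    proof (rule tendsto_upperbound)
      show "(\<lambda>n. norm (integral {1 / 2 ^ n..real n} ?f - integral {1 / 2 ^ n..real n} ?g))
        \<longlonglongrightarrow> norm ((\<i> * pi) *\<^sub>C (x - 2 *\<^sub>R ?TB) - (\<i> * pi) *\<^sub>C (x - 2 *\<^sub>R ?TA))"
        by (intro tendsto_norm tendsto_diff B.yosida_principal_value[OF xyB] yosida_principal_value[OF xy])
      show "\<forall>\<^sub>F n in sequentially. norm (integral {1 / 2 ^ n..real n} ?f - integral {1 / 2 ^ n..real n} ?g) \<le> D * norm x"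
        using bd by (auto simp: eventually_sequentially intro!: exI[of _ 1])
    qed simp
    also have "(\<i> * pi) *\<^sub>C (x - 2 *\<^sub>R ?TB) - (\<i> * pi) *\<^sub>C (x - 2 *\<^sub>R ?TA) = (- 2 * \<i> * pi) *\<^sub>C (?TB - ?TA)"
      by (simp add: scaleR_scaleC[of 2] scaleC.diff_right scaleC_scaleC scaleC.minus_left mult_ac)
    also have "norm \<dots> = 2 * pi * norm (?TB - ?TA)" by (simp add: norm_scaleC norm_mult)
    finally have "norm (?TB - ?TA) \<le> D / (2 * pi) * norm x" using pi_gt_zero by (simp add: field_simps)
    moreover have "norm ?TA \<le> K * norm x" by (rule norm_yosida(1)) simp
    ultimately show "norm ?TB \<le> (K + D / (2 * pi)) * norm x"
      using norm_triangle_sub[of ?TB ?TA] by (simp add: distrib_right)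
  qed
  have "K + D / (2 * pi) \<ge> 0" using K D0 by (simp add: add_nonneg_nonneg)
  then show ?thesis by (rule that) (rule key)
qed

text \<open>Continuation in the angle. The half-line of one angle opens into a sector
  (\<open>strip_widen\<close>) and permits a small rotation at the price of a worse constant;
  \<open>yosida_rotated_bound\<close>, which is uniform in that constant, restores L. Steps of the
  fixed length 1 / (2 L) therefore reach every angle up to \<theta>.\<close>

lemma sector_extension:
  assumes \<theta>: "0 \<le> \<theta>" "\<theta> < pi - \<phi>"
  obtains L where "L \<ge> 1" "\<And>\<psi>. \<bar>\<psi>\<bar> \<le> \<theta> \<Longrightarrow> strip (op_scale (cis \<psi>) A) L 0"
     "\<And>\<psi> t y. \<bar>\<psi>\<bar> \<le> \<theta> \<Longrightarrow> mellin (op_scale (cis \<psi>) A) t (cis \<psi> *\<^sub>C y) = exp (- t * \<psi>) *\<^sub>R mellin A t y"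
proof -
  obtain C where C0: "C \<ge> 0" and C: "\<And>\<psi> K' u x. \<bar>\<psi>\<bar> \<le> \<theta> \<Longrightarrow> strip (op_scale (cis \<psi>) A) K' 0 \<Longrightarrow>
     (\<And>t y. mellin (op_scale (cis \<psi>) A) t (cis \<psi> *\<^sub>C y) = exp (- t * \<psi>) *\<^sub>R mellin A t y) \<Longrightarrow>
     norm (yosida (op_scale (cis \<psi>) A) (of_real u) x) \<le> C * norm x"
    using yosida_rotated_bound[OF \<theta>] by blast
  \<comment> \<open>K (1 + C) will bound the resolvent, and C will bound exp (Re \<zeta>) times the
    resolvent.\<close>
  define L where "L = K * (1 + C) + C"
  have LK: "L \<ge> K" using K C0 by (simp add: L_def distrib_left)
  then have L: "L \<ge> K" "L \<ge> 1" using K by linarith+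
  define good where "good \<psi> \<longleftrightarrow> strip (op_scale (cis \<psi>) A) L 0 \<and>
     (\<forall>t y. mellin (op_scale (cis \<psi>) A) t (cis \<psi> *\<^sub>C y) = exp (- t * \<psi>) *\<^sub>R mellin A t y)" for \<psi>
  have improve: "good \<psi>" if \<psi>: "\<bar>\<psi>\<bar> \<le> \<theta>" and B: "strip (op_scale (cis \<psi>) A) K' 0"
      and mB: "\<And>t y. mellin (op_scale (cis \<psi>) A) t (cis \<psi> *\<^sub>C y) = exp (- t * \<psi>) *\<^sub>R mellin A t y" for \<psi> K'
  proof -
    let ?B = "op_scale (cis \<psi>) A"
    interpret B: strip ?B K' 0 by fact
    \<comment> \<open>The bound at the point 0 is invariant under rotation, so the original K may be
      used at every angle.\<close>
    have B0: "resolves ?B 0 K" by (rule op_scale_resolves(1)[OF lin]) (use res0 in auto)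
    have "strip ?B L 0"
    proof
      show "linear_operator ?B" by (rule B.lin)
      show "resolves ?B 0 L" using B0 L(1) by (rule resolves_mono)
      fix \<zeta> :: complex assume z: "\<bar>Im \<zeta>\<bar> \<le> 0"
      let ?r = "exp (Re \<zeta>)"
      have \<zeta>: "\<zeta> = of_real (Re \<zeta>)" using z by (intro complex_eqI) auto
      note R = B.resK[OF z]
      show "resolves ?B (exp \<zeta>) (L / (1 + ?r))"
        unfolding resolves_def
      proof (intro conjI allI)
        show "bounded_operator ((op_shift ?B (exp \<zeta>))\<inverse>)" using R by (simp add: resolves_def)
        fix v
        have y: "norm (yosida ?B \<zeta> v) \<le> C * norm v" using C[OF \<psi> B mB, of "Re \<zeta>" v] \<zeta> by simp
        then have 1: "?r * norm (Res ?B (exp \<zeta>) v) \<le> C * norm v" by (simp add: yosida_def norm_scaleC)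
        have "Res ?B (exp \<zeta>) v = Res ?B 0 (v - yosida ?B \<zeta> v)"
          using resolvent_identity[OF B0 R, of v] by (simp add: Res_linear[OF B0] resolvesD(2)[OF B0] yosida_def algebra_simps)
        also have "norm \<dots> \<le> K * norm (v - yosida ?B \<zeta> v)" by (rule resolvesD(4)[OF B0])
        also have "\<dots> \<le> K * (norm v + C * norm v)"
          using K y by (intro mult_left_mono order_trans[OF norm_triangle_ineq4] add_left_mono) auto
        finally have "(1 + ?r) * norm (Res ?B (exp \<zeta>) v) \<le> L * norm v"
          using 1 by (simp add: L_def algebra_simps)
        then show "norm (Res ?B (exp \<zeta>) v) \<le> L / (1 + ?r) * norm v"
          using exp_gt_zero[of "Re \<zeta>"] by (simp add: pos_le_divide_eq add_pos_pos mult.commute)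
      qed
    qed (use L in auto)
    then show ?thesis using mB by (simp add: good_def)
  qed
  define \<eta>0 where "\<eta>0 = 1 / (2 * L)"
  have \<eta>0: "\<eta>0 > 0" using L by (simp add: \<eta>0_def)
  have step: "good (\<psi>0 + \<eta>)" if g: "good \<psi>0" and \<eta>: "\<bar>\<eta>\<bar> \<le> \<eta>0" "\<bar>\<psi>0 + \<eta>\<bar> \<le> \<theta>" for \<psi>0 \<eta>
  proof -
    let ?B = "op_scale (cis \<psi>0) A"
    interpret W: strip ?B "2 * L" "1 / (2 * L)" by (rule strip_widen) (use g in \<open>simp add: good_def\<close>)
    have eq: "op_scale (cis \<eta>) ?B = op_scale (cis (\<psi>0 + \<eta>)) A"
      by (simp add: op_scale_op_scale cis_mult add.commute)
    show ?thesis
    proof (rule improve[OF \<eta>(2)])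
      show "strip (op_scale (cis (\<psi>0 + \<eta>)) A) (2 * L) 0"
        using W.strip_rotate(1)[of \<eta>] \<eta>(1) unfolding eq \<eta>0_def .
      fix t y
      have "mellin (op_scale (cis (\<psi>0 + \<eta>)) A) t (cis \<eta> *\<^sub>C cis \<psi>0 *\<^sub>C y) = exp (- t * \<eta>) *\<^sub>R mellin ?B t (cis \<psi>0 *\<^sub>C y)"
        using W.strip_rotate(2)[of \<eta>] \<eta>(1) unfolding eq \<eta>0_def .
      also have "\<dots> = exp (- t * (\<psi>0 + \<eta>)) *\<^sub>R mellin A t y"
        using g by (simp add: good_def exp_add[symmetric] algebra_simps)
      finally show "mellin (op_scale (cis (\<psi>0 + \<eta>)) A) t (cis (\<psi>0 + \<eta>) *\<^sub>C y) = exp (- t * (\<psi>0 + \<eta>)) *\<^sub>R mellin A t y"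
        by (simp add: scaleC_scaleC cis_mult add.commute)
    qed
  qed
  have all: "\<bar>\<psi>\<bar> \<le> \<theta> \<Longrightarrow> \<bar>\<psi>\<bar> \<le> real n * \<eta>0 \<Longrightarrow> good \<psi>" for n \<psi>
  proof (induction n arbitrary: \<psi>)
    case 0
    then have "\<psi> = 0" by simp
    moreover have "strip A K 0" by unfold_locales
    ultimately show ?case using improve[of 0 K] \<theta> by (simp add: op_scale_1)
  next
    case (Suc n)
    \<comment> \<open>The angle nearest to \<psi> among those already reached in n steps.\<close>
    define \<psi>0 where "\<psi>0 = max (- (real n * \<eta>0)) (min (real n * \<eta>0) \<psi>)"
    have n0: "0 \<le> real n * \<eta>0" using \<eta>0 by simp
    have S: "\<bar>\<psi>\<bar> \<le> real n * \<eta>0 + \<eta>0" using Suc.prems(2) by (simp add: algebra_simps)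
    have "\<bar>\<psi>0\<bar> \<le> \<bar>\<psi>\<bar>" "\<bar>\<psi>0\<bar> \<le> real n * \<eta>0" "\<bar>\<psi> - \<psi>0\<bar> \<le> \<eta>0"
      unfolding \<psi>0_def using n0 S \<eta>0 by linarith+
    then show ?case using step[of \<psi>0 "\<psi> - \<psi>0"] Suc.IH[of \<psi>0] Suc.prems(1) by simp
  qed
  have "good \<psi>" if "\<bar>\<psi>\<bar> \<le> \<theta>" for \<psi>
  proof -
    obtain n where "\<bar>\<psi>\<bar> / \<eta>0 \<le> real n" using real_arch_simple by blast
    then show ?thesis using all[OF that, of n] \<eta>0 by (simp add: divide_le_eq)
  qed
  then show ?thesis by (intro that[of L] L) (auto simp: good_def)
qed

text \<open>Rotation multiplies A^it by exp (- t \<psi>), which adds |\<psi>| to the power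
  angle.\<close>

lemma bip_rotate:
  assumes "strip (op_scale (cis \<psi>) A) L 0" "\<phi> + \<bar>\<psi>\<bar> < pi"
    and m: "\<And>t y. mellin (op_scale (cis \<psi>) A) t (cis \<psi> *\<^sub>C y) = exp (- t * \<psi>) *\<^sub>R mellin A t y"
  shows "bip (op_scale (cis \<psi>) A) L (\<lambda>t x. exp (- t * \<psi>) *\<^sub>R U t x) M (\<phi> + \<bar>\<psi>\<bar>)"
proof -
  interpret B: strip "op_scale (cis \<psi>) A" L 0 by fact
  show ?thesis
  proof (intro bip.intro bip_axioms.intro B.strip_axioms)
    have "Domain (op_scale (cis \<psi>) A) = Domain A" by (auto simp: op_scale_def)
    then show "closure (Domain (op_scale (cis \<psi>) A)) = UNIV" using dense by simp
    show "\<phi> + \<bar>\<psi>\<bar> \<ge> 0" "\<phi> + \<bar>\<psi>\<bar> < pi" "M \<ge> 1" using \<phi> assms M by auto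
    show "bounded_linear (\<lambda>x. exp (- t * \<psi>) *\<^sub>R U t x)" for t
      by (rule bounded_linear_compose[OF bounded_linear_scaleR_right U_lin])
    show "exp (- t * \<psi>) *\<^sub>R U t (c *\<^sub>C x) = c *\<^sub>C (exp (- t * \<psi>) *\<^sub>R U t x)" for t c x
      by (simp add: U_scaleC scaleC.scaleR_right)
    show "exp (- 0 * \<psi>) *\<^sub>R U 0 x = x" for x by (simp add: U_0)
    show "norm (exp (- t * \<psi>) *\<^sub>R U t x) \<le> M * exp ((\<phi> + \<bar>\<psi>\<bar>) * \<bar>t\<bar>) * norm x" for t x
    proof -
      have "- t * \<psi> \<le> \<bar>\<psi>\<bar> * \<bar>t\<bar>" using abs_ge_self[of "- t * \<psi>"] by (simp add: abs_mult mult.commute)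
      then have "exp (- t * \<psi>) * norm (U t x) \<le> exp (\<bar>\<psi>\<bar> * \<bar>t\<bar>) * (M * exp (\<phi> * \<bar>t\<bar>) * norm x)"
        by (intro mult_mono U_bound) auto
      moreover have "exp ((\<phi> + \<bar>\<psi>\<bar>) * \<bar>t\<bar>) = exp (\<phi> * \<bar>t\<bar>) * exp (\<bar>\<psi>\<bar> * \<bar>t\<bar>)"
        by (simp only: distrib_right exp_add)
      ultimately show ?thesis by (simp add: mult_ac)
    qed
    show "mellin (op_scale (cis \<psi>) A) t y = mellin_id t *\<^sub>C (exp (- t * \<psi>) *\<^sub>R U t x)"
      if xy: "(x, y) \<in> op_scale (cis \<psi>) A" for t x y
    proof -
      obtain y' where y': "y = cis \<psi> *\<^sub>C y'" "(x, y') \<in> A" using xy by (auto simp: op_scale_def)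
      show ?thesis unfolding y'(1) m U_mellin[OF y'(2)] by (simp add: scaleC.scaleR_right)
    qed
  qed
qed

section \<open>The group law\<close>

lemma mellin_id_nonzero: "mellin_id t \<noteq> 0"
  by (cases "t = 0") (auto simp: mellin_id_0 mellin_id_sinh(2))

text \<open>On the domain U t x is the quotient of \<open>mellin A t (A x)\<close> by
  \<open>mellin_id t\<close>, both continuous in t, and the divisor has no zeros.\<close>

lemma U_continuous:
  assumes "x \<in> Domain A"
  shows "continuous_on S (\<lambda>t. U t x)"
proof -
  obtain y where xy: "(x, y) \<in> A" using assms by auto
  have "(\<lambda>t. U t x) = (\<lambda>t. (1 / mellin_id t) *\<^sub>C mellin A t y)"
    using mellin_id_nonzero by (simp add: U_mellin[OF xy] scaleC_scaleC)
  moreover have "continuous_on UNIV mellin_id"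
    unfolding mellin_id_def using id_op.mellin_continuous .
  then have "continuous_on UNIV (\<lambda>t. (1 / mellin_id t) *\<^sub>C mellin A t y)"
    using mellin_id_nonzero by (intro continuous_intros mellin_continuous) auto
  ultimately show ?thesis by (metis continuous_on_subset subset_UNIV)
qed

lemma U_R0: "mellin A t y = mellin_id t *\<^sub>C U t (Res A 0 y)"
  by (rule U_mellin[OF Res0_in])

text \<open>\<open>mellin_mult\<close> with every transform rewritten by \<open>U_mellin\<close>.
  Each of the two transforms uses up one factor A^-1, hence the vector A^-2 y.\<close>

lemma U_group_aux:
  assumes "s + t \<noteq> 0"
  shows "U s (U t (Res A 0 (Res A 0 y))) = U (s + t) (Res A 0 (Res A 0 y))"
proof -
  let ?x = "Res A 0 (Res A 0 y)"
  have "mellin A s (mellin A t y) = mellin_id s *\<^sub>C U s (Res A 0 (mellin A t y))" by (rule U_R0)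
  also have "Res A 0 (mellin A t y) = mellin_id t *\<^sub>C U t ?x"
    unfolding mellin_Res[OF res0, symmetric] by (rule U_R0)
  finally have "mellin_id (s + t) *\<^sub>C (mellin_id s * mellin_id t) *\<^sub>C U s (U t ?x) = (mellin_id s * mellin_id t) *\<^sub>C mellin_id (s + t) *\<^sub>C U (s + t) ?x"
    using mellin_mult[OF assms, of y] by (simp add: U_scaleC scaleC_scaleC U_R0 mult_ac)
  then have "(mellin_id (s + t) * (mellin_id s * mellin_id t)) *\<^sub>C U s (U t ?x) = (mellin_id (s + t) * (mellin_id s * mellin_id t)) *\<^sub>C U (s + t) ?x"
    by (simp add: scaleC_scaleC mult_ac)
  then have "(1 / (mellin_id (s + t) * (mellin_id s * mellin_id t))) *\<^sub>C (mellin_id (s + t) * (mellin_id s * mellin_id t)) *\<^sub>C U s (U t ?x) = (1 / (mellin_id (s + t) * (mellin_id s * mellin_id t))) *\<^sub>C (mellin_id (s + t) * (mellin_id s * mellin_id t)) *\<^sub>C U (s + t) ?x"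
    by simp
  then show ?thesis using mellin_id_nonzero by (simp add: scaleC_scaleC)
qed

lemma Res0_range: "x \<in> Domain A \<longleftrightarrow> (\<exists>y. x = Res A 0 y)"
  using Res0_in resolvesD(3)[OF res0] by (auto simp: scaleC.zero_left)

text \<open>For x = A^-1 y the approximants \<open>yosida A u x\<close> of x lie in the range of
  A^-2, because the resolvent maps y into the domain.\<close>

lemma dense_square: "closure (range (\<lambda>y. Res A 0 (Res A 0 y))) = UNIV"
proof -
  have "Domain A \<subseteq> closure (range (\<lambda>y. Res A 0 (Res A 0 y)))"
  proof
    fix x assume "x \<in> Domain A"
    then obtain y where x: "x = Res A 0 y" by (auto simp: Res0_range)
    have "yosida A (of_real u) x \<in> range (\<lambda>y. Res A 0 (Res A 0 y))" for u
    proof -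
      have "Res A (exp (of_real u)) y \<in> Domain A" using Res_in[OF resK[OF Im_real]] by auto
      then obtain z where "Res A (exp (of_real u)) y = Res A 0 z" by (auto simp: Res0_range)
      then have "yosida A (of_real u) x = Res A 0 (Res A 0 (exp (of_real u) *\<^sub>C z))"
        unfolding x yosida_def Res_commute[OF resK[OF Im_real] res0] by (simp add: resolvesD(2)[OF res0])
      then show ?thesis by blast
    qed
    then show "x \<in> closure (range (\<lambda>y. Res A 0 (Res A 0 y)))"
      using yosida_at_top[OF Res0_in, of y] unfolding x[symmetric]
      by (intro Lim_in_closed_set[of _ _ at_top, OF closed_closure]) (auto intro!: always_eventually subsetD[OF closure_subset])
  qed
  then have "closure (Domain A) \<subseteq> closure (range (\<lambda>y. Res A 0 (Res A 0 y)))" by (rule closure_minimal) simp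
  then show ?thesis using dense by auto
qed

text \<open>Both sides are bounded operators, so the dense range of A^-2 suffices. The case s + t =
  0, which \<open>mellin_mult\<close> excludes, is the limit of the others by continuity.\<close>

lemma U_group: "U s (U t x) = U (s + t) x"
proof (rule eq_dense[where f = "\<lambda>x. U s (U t x)" and g = "U (s + t)", OF _ _ dense_square])
  show "bounded_linear (\<lambda>x. U s (U t x))" by (rule bounded_linear_compose[OF U_lin U_lin])
  show "bounded_linear (U (s + t))" by (rule U_lin)
  fix x assume "x \<in> range (\<lambda>y. Res A 0 (Res A 0 y))"
  then obtain y where x: "x = Res A 0 (Res A 0 y)" by auto
  show "U s (U t x) = U (s + t) x"
  proof (cases "s + t = 0")
    case False
    then show ?thesis unfolding x by (rule U_group_aux)
  next
    case True
    have "x \<in> Domain A" unfolding x using Res0_in by auto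
    note Uc = U_continuous[OF this, of UNIV]
    have "continuous_on UNIV (\<lambda>r. U s (U r x) - U (s + r) x)"
      by (intro continuous_on_diff continuous_on_compose2[OF linear_continuous_on[OF U_lin, of UNIV] Uc] continuous_on_compose2[OF Uc]) (auto intro!: continuous_intros)
    then have "((\<lambda>r. U s (U r x) - U (s + r) x) \<longlongrightarrow> U s (U t x) - U (s + t) x) (at t)"
      by (simp add: continuous_on_def)
    moreover have "\<forall>\<^sub>F r in at t. U s (U r x) - U (s + r) x = 0"
    proof -
      have "U s (U r x) - U (s + r) x = 0" if "r \<noteq> t" for r
        using U_group_aux[of s r y] that True unfolding x by simp
      then show ?thesis by (auto simp: eventually_at_filter)
    qed
    then have "((\<lambda>r. U s (U r x) - U (s + r) x) \<longlongrightarrow> 0) (at t)" by (rule tendsto_eventually)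
    ultimately have "U s (U t x) - U (s + t) x = 0" using tendsto_unique trivial_limit_at by blast
    then show ?thesis by simp
  qed
qed

end

section \<open>Transference\<close>

text \<open>For an antiderivative F, the difference F (s + p) - F s has derivative f (s + p) - f s =
  0.\<close>

lemma integral_periodic:
  fixes f :: "real \<Rightarrow> real"
  assumes f: "continuous_on UNIV f" and per: "\<And>x. f (x + p) = f x" and p: "p \<ge> 0"
  shows "integral {t..t + p} f = integral {0..p} f" "integral {0..p} (\<lambda>x. f (x + t)) = integral {0..p} f"
proof -
  let ?I = "{- \<bar>t\<bar>..\<bar>t\<bar> + p}"
  obtain F where F: "\<And>x. x \<in> ?I \<Longrightarrow> (F has_vector_derivative f x) (at x within ?I)"
    using antiderivative_continuous[OF continuous_on_subset[OF f subset_UNIV]] by blast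
  have int: "integral {s..s + p} f = F (s + p) - F s" if "s \<in> {- \<bar>t\<bar>..\<bar>t\<bar>}" for s
    using that p by (intro integral_unique fundamental_theorem_of_calculus has_vector_derivative_within_subset[OF F]) auto
  have deriv: "((\<lambda>s. F (s + p) - F s) has_vector_derivative 0) (at s within {- \<bar>t\<bar>..\<bar>t\<bar>})"
    if s: "s \<in> {- \<bar>t\<bar>..\<bar>t\<bar>}" for s
  proof -
    have 1: "(F has_vector_derivative f s) (at s within {- \<bar>t\<bar>..\<bar>t\<bar>})"
      using s p by (intro has_vector_derivative_within_subset[OF F]) auto
    have "(F has_vector_derivative f (s + p)) (at (s + p) within (\<lambda>s. s + p) ` {- \<bar>t\<bar>..\<bar>t\<bar>})"
      using s p by (intro has_vector_derivative_within_subset[OF F]) auto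
    then have 2: "((\<lambda>s. F (s + p)) has_vector_derivative f (s + p)) (at s within {- \<bar>t\<bar>..\<bar>t\<bar>})"
      using vector_diff_chain_within[of "\<lambda>s. s + p" 1 s "{- \<bar>t\<bar>..\<bar>t\<bar>}" F "f (s + p)"]
        has_vector_derivative_add[OF has_vector_derivative_id has_vector_derivative_const]
      unfolding o_def by simp
    show ?thesis
      using has_vector_derivative_diff[OF 2 1] per[of s] by simp
  qed
  obtain c where c: "\<And>s. s \<in> {- \<bar>t\<bar>..\<bar>t\<bar>} \<Longrightarrow> F (s + p) - F s = c"
    using has_vector_derivative_zero_constant[OF _ deriv] by auto
  show *: "integral {t..t + p} f = integral {0..p} f"
  proof -
    have "t \<in> {- \<bar>t\<bar>..\<bar>t\<bar>}" "0 \<in> {- \<bar>t\<bar>..\<bar>t\<bar>}" unfolding atLeastAtMost_iff by linarith+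
    then show ?thesis using int[of t] int[of 0] c[of t] c[of 0] by simp
  qed
  show "integral {0..p} (\<lambda>x. f (x + t)) = integral {0..p} f"
    unfolding *[symmetric] using integral_shift_Icc_real[of 0 p f t] by (simp add: o_def add.commute)
qed

text \<open>Bound in L^2 for a nonnegative kernel of mass at most W, which will be the error of the
  kernel comparison. Cauchy-Schwarz with weight w costs one factor W and the t-integral after the
  exchange the other; 4 comes from (a + b)^2 \<le> 2 a^2 + 2 b^2 and the invariance of periodic
  integrals under translation.\<close>

lemma periodic_Minkowski:
  fixes N w :: "real \<Rightarrow> real"
  assumes N: "continuous_on UNIV N" and per: "\<And>x. N (x + 2 * pi) = N x"
    and w: "continuous_on {c..d} w" "\<And>t. t \<in> {c..d} \<Longrightarrow> w t \<ge> 0" and W: "integral {c..d} w \<le> W"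
  shows "integral {0..2 * pi} (\<lambda>\<tau>. (integral {c..d} (\<lambda>t. w t * (N (\<tau> + t) + N (\<tau> - t))))\<^sup>2)
    \<le> 4 * W\<^sup>2 * integral {0..2 * pi} (\<lambda>\<tau>. (N \<tau>)\<^sup>2)" (is "?L \<le> 4 * W\<^sup>2 * ?I")
    and "continuous_on S (\<lambda>\<tau>. integral {c..d} (\<lambda>t. w t * (N (\<tau> + t) + N (\<tau> - t))))"
proof -
  have cN: "continuous_on S (\<lambda>p. N (k p))" if "continuous_on S k" for S :: "'z::topological_space set" and k
    by (rule continuous_on_compose2[OF N that]) auto
  have cw: "continuous_on (X \<times> {c..d}) (\<lambda>p. w (snd p))" for X :: "real set"
    by (rule continuous_on_compose2[OF w(1)]) (auto intro!: continuous_intros)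
  have w0: "integral {c..d} w \<ge> 0" by (rule integral_nonneg[OF integrable_continuous_real[OF w(1)] w(2)])
  have "continuous_on UNIV (\<lambda>\<tau>. integral {c..d} (\<lambda>t. w t * (N (\<tau> + t) + N (\<tau> - t))))"
    using integral_continuous_on_param[of UNIV c d "\<lambda>\<tau> t. w t * (N (\<tau> + t) + N (\<tau> - t))"]
    by (simp add: case_prod_beta continuous_on_mult cw cN continuous_on_add continuous_on_diff continuous_on_fst continuous_on_snd)
  then show cont: "continuous_on S (\<lambda>\<tau>. integral {c..d} (\<lambda>t. w t * (N (\<tau> + t) + N (\<tau> - t))))" for S
    by (rule continuous_on_subset) simp
  let ?G = "\<lambda>\<tau> t. w t * (2 * (N (\<tau> + t))\<^sup>2 + 2 * (N (\<tau> - t))\<^sup>2)"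
  have cG: "continuous_on ({0..2 * pi} \<times> {c..d}) (\<lambda>p. ?G (fst p) (snd p))"
    by (intro continuous_intros cw cN)
  have cGt: "continuous_on {c..d} (?G \<tau>)" for \<tau>
    by (intro continuous_intros w(1) cN)
  have "?L \<le> integral {0..2 * pi} (\<lambda>\<tau>. W * integral {c..d} (?G \<tau>))"
  proof (intro integral_le integrable_continuous_real continuous_on_power continuous_on_mult continuous_on_const cont)
    show "continuous_on {0..2 * pi} (\<lambda>\<tau>. integral {c..d} (?G \<tau>))"
      using integral_continuous_on_param[of "{0..2 * pi}" c d ?G] cG by (simp add: case_prod_beta)
    fix \<tau>
    have "(integral {c..d} (\<lambda>t. w t * (N (\<tau> + t) + N (\<tau> - t))))\<^sup>2
      \<le> integral {c..d} w * integral {c..d} (\<lambda>t. w t * (N (\<tau> + t) + N (\<tau> - t))\<^sup>2)"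
      by (intro integral_Cauchy_Schwarz_weighted w continuous_intros cN)
    also have "\<dots> \<le> W * integral {c..d} (?G \<tau>)"
    proof (intro mult_mono W)
      show "integral {c..d} (\<lambda>t. w t * (N (\<tau> + t) + N (\<tau> - t))\<^sup>2) \<le> integral {c..d} (?G \<tau>)"
      proof (intro integral_le integrable_continuous_real cGt)
        show "continuous_on {c..d} (\<lambda>t. w t * (N (\<tau> + t) + N (\<tau> - t))\<^sup>2)"
          by (intro continuous_intros w(1) cN)
        show "w t * (N (\<tau> + t) + N (\<tau> - t))\<^sup>2 \<le> ?G \<tau> t" if "t \<in> {c..d}" for t
          using norm_add_square_le[of "N (\<tau> + t)" "N (\<tau> - t)"] w(2)[OF that] by (intro mult_left_mono) auto
      qed
      show "0 \<le> integral {c..d} (\<lambda>t. w t * (N (\<tau> + t) + N (\<tau> - t))\<^sup>2)"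
        by (intro integral_nonneg integrable_continuous_real continuous_intros w(1) cN) (simp add: w(2))
    qed (use w0 W in auto)
    finally show "(integral {c..d} (\<lambda>t. w t * (N (\<tau> + t) + N (\<tau> - t))))\<^sup>2 \<le> W * integral {c..d} (?G \<tau>)" .
  qed
  also have "\<dots> = W * integral {c..d} (\<lambda>t. integral {0..2 * pi} (\<lambda>\<tau>. ?G \<tau> t))"
  proof -
    have "continuous_on (cbox (0, c) (2 * pi, d)) (\<lambda>(\<tau>, t). ?G \<tau> t)"
      using cG by (simp add: case_prod_beta cbox_Pair_eq)
    from integral_swap_continuous[OF this] show ?thesis by simp
  qed
  also have "integral {c..d} (\<lambda>t. integral {0..2 * pi} (\<lambda>\<tau>. ?G \<tau> t)) = integral {c..d} (\<lambda>t. w t * (4 * ?I))"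
  proof (intro integral_cong)
    fix t
    have c2: "continuous_on UNIV (\<lambda>\<tau>. (N \<tau>)\<^sup>2)" by (intro continuous_intros N)
    have I: "(\<lambda>\<tau>. (N (\<tau> + s))\<^sup>2) integrable_on {0..2 * pi}" for s
      by (intro integrable_continuous_real continuous_intros cN)
    have e: "integral {0..2 * pi} (\<lambda>\<tau>. (N (\<tau> + s))\<^sup>2) = ?I" for s
      using integral_periodic(2)[OF c2, of "2 * pi" s] per by simp
    have "((\<lambda>\<tau>. w t * (2 * (N (\<tau> + t))\<^sup>2 + 2 * (N (\<tau> + - t))\<^sup>2)) has_integral w t * (2 * ?I + 2 * ?I)) {0..2 * pi}"
      using integrable_integral[OF I[of t]] integrable_integral[OF I[of "- t"]] unfolding e
      by (intro has_integral_mult_right has_integral_add)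
    then show "integral {0..2 * pi} (\<lambda>\<tau>. ?G \<tau> t) = w t * (4 * ?I)"
      by (intro integral_unique) simp
  qed
  also have "W * \<dots> = W * (integral {c..d} w * (4 * ?I))" by simp
  also have "\<dots> \<le> W * (W * (4 * ?I))"
  proof -
    have "?I \<ge> 0" by (intro integral_nonneg integrable_continuous_real continuous_intros cN) simp
    then show ?thesis using W w0 by (intro mult_left_mono mult_right_mono) auto
  qed
  finally show "?L \<le> 4 * W\<^sup>2 * ?I" by (simp add: power2_eq_square mult_ac)
qed

section \<open>The kernel \<pi> t / sinh (\<pi> t) and trigonometric polynomials\<close>

definition sinh_kernel :: "real \<Rightarrow> real" where
  "sinh_kernel t = Re (mellin_id t)"

lemma mellin_id_sinh_kernel: "mellin_id t = of_real (sinh_kernel t)" "mellin_id (- t) = of_real (sinh_kernel t)"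
  by (cases "t = 0"; simp add: sinh_kernel_def mellin_id_0 mellin_id_sinh(2))+

lemma abs_sinh_kernel_le: "\<bar>sinh_kernel t\<bar> \<le> (1 + 2 * pi * \<bar>t\<bar>) * exp (- pi * \<bar>t\<bar>)"
  using norm_mellin_id[of t] by (simp add: mellin_id_sinh_kernel)

text \<open>Divided by t, this says that the kernel of the principal value differs from 1 / t by at
  most \<pi>, so that only the singular part 1 / t has to be handled by UMD.\<close>

lemma sinh_kernel_near_1:
  assumes "t > 0"
  shows "\<bar>sinh_kernel t - 1\<bar> \<le> pi * t"
proof -
  define x where "x = pi * t"
  have x: "x > 0" using assms by (simp add: x_def)
  have s: "sinh x > 0" using x by simp
  have e: "sinh_kernel t = x / sinh x" using assms by (simp add: sinh_kernel_def mellin_id_sinh(2) x_def)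
  have 1: "x \<le> (1 + x) * sinh x"
  proof -
    have "(1 + x) * exp (- x) \<le> exp x * exp (- x)"
      by (intro mult_right_mono exp_ge_add_one_self) auto
    also have "\<dots> = 1" by (simp add: exp_minus)
    finally have a: "(1 + x) * exp (- x) \<le> 1" .
    have "(1 + x) * (1 + x) \<le> (1 + x) * exp x"
      using x by (intro mult_left_mono exp_ge_add_one_self) auto
    moreover have "(1 + x) * (1 + x) = 1 + 2 * x + x * x" by (simp add: algebra_simps)
    moreover have "x * x \<ge> 0" by simp
    ultimately have "2 * x \<le> (1 + x) * exp x - (1 + x) * exp (- x)" using a by linarith
    also have "\<dots> = 2 * ((1 + x) * sinh x)" unfolding sinh_field_def by (simp add: right_diff_distrib)
    finally show ?thesis by simp
  qed
  have "(1 - 2 * x) * exp x \<le> exp (- 2 * x) * exp x"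
    using exp_ge_add_one_self[of "- 2 * x"] by (intro mult_right_mono) auto
  then have "exp x - exp (- x) \<le> 2 * x * exp x" by (simp add: exp_add[symmetric] algebra_simps)
  then have 2: "sinh x \<le> x * exp x" by (simp add: sinh_field_def)
  have "(1 - x) * sinh x \<le> x"
  proof (cases "x \<le> 1")
    case True
    have "(1 - x) * sinh x \<le> exp (- x) * (x * exp x)"
      using exp_ge_add_one_self[of "- x"] True x s by (intro mult_mono 2) auto
    also have "\<dots> = x" by (simp add: exp_minus field_simps)
    finally show ?thesis .
  next
    case False
    then have "(1 - x) * sinh x \<le> 0" using s by (intro mult_nonpos_nonneg) auto
    then show ?thesis using x by simp
  qed
  then have "1 - x \<le> x / sinh x" using s by (simp add: pos_le_divide_eq)
  moreover have "x / sinh x \<le> 1 + x" using 1 s by (simp add: divide_le_eq)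
  ultimately show ?thesis unfolding e x_def[symmetric] by simp
qed

text \<open>The frequencies are real because r enters through \<mu> k = k - ln r. The common shift
  is a unimodular factor, so norms remain periodic with period 2 \<pi>.\<close>

definition trig :: "(nat \<Rightarrow> real) \<Rightarrow> nat \<Rightarrow> (nat \<Rightarrow> 'a::complex_banach) \<Rightarrow> real \<Rightarrow> 'a" where
  "trig \<mu> m x \<tau> = (\<Sum>k\<le>m. cis (\<mu> k * \<tau>) *\<^sub>C x k)"

lemma continuous_on_trig: "continuous_on S f \<Longrightarrow> continuous_on S (\<lambda>s. trig \<mu> m x (f s))"
  unfolding trig_def by (intro continuous_intros) auto

lemma trig_diff: "trig \<mu> m x \<tau> - trig \<mu> m y \<tau> = trig \<mu> m (\<lambda>k. x k - y k) \<tau>"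
  by (simp add: trig_def scaleC.diff_right sum_subtractf)

lemma norm_trig_le: "norm (trig \<mu> m x \<tau>) \<le> (\<Sum>k\<le>m. norm (x k))"
  unfolding trig_def by (rule order_trans[OF norm_sum]) (simp add: norm_scaleC)

lemma (in bip) U_trig: "U t (trig \<mu> m x \<tau>) = trig \<mu> m (\<lambda>k. U t (x k)) \<tau>"
  by (simp add: trig_def linear_sum[OF bounded_linear.linear[OF U_lin]] U_scaleC)

lemma trig_square_perturb:
  "integral {0..2 * pi} (\<lambda>\<tau>. (norm (trig \<mu> m q \<tau>))\<^sup>2)
    \<le> 2 * integral {0..2 * pi} (\<lambda>\<tau>. (norm (trig \<mu> m p \<tau>))\<^sup>2) + 2 * (\<Sum>k\<le>m. norm (q k - p k))\<^sup>2 * (2 * pi)"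
proof -
  let ?e = "\<Sum>k\<le>m. norm (q k - p k)"
  have "integral {0..2 * pi} (\<lambda>\<tau>. (norm (trig \<mu> m q \<tau>))\<^sup>2)
    \<le> integral {0..2 * pi} (\<lambda>\<tau>. 2 * (norm (trig \<mu> m p \<tau>))\<^sup>2 + 2 * ?e\<^sup>2)"
  proof (intro integral_le integrable_continuous_real continuous_intros continuous_on_trig)
    fix \<tau>
    have "norm (trig \<mu> m q \<tau> - trig \<mu> m p \<tau>) \<le> ?e"
      unfolding trig_diff by (rule norm_trig_le)
    then have "(norm (trig \<mu> m q \<tau> - trig \<mu> m p \<tau>))\<^sup>2 \<le> ?e\<^sup>2" by (intro power_mono) auto
    then show "(norm (trig \<mu> m q \<tau>))\<^sup>2 \<le> 2 * (norm (trig \<mu> m p \<tau>))\<^sup>2 + 2 * ?e\<^sup>2"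
      using norm_add_square_le[of "trig \<mu> m p \<tau>" "trig \<mu> m q \<tau> - trig \<mu> m p \<tau>"] by simp
  qed
  also have "\<dots> = 2 * integral {0..2 * pi} (\<lambda>\<tau>. (norm (trig \<mu> m p \<tau>))\<^sup>2) + 2 * ?e\<^sup>2 * (2 * pi)"
  proof -
    have "((\<lambda>\<tau>. 2 * (norm (trig \<mu> m p \<tau>))\<^sup>2 + 2 * ?e\<^sup>2) has_integral
      2 * integral {0..2 * pi} (\<lambda>\<tau>. (norm (trig \<mu> m p \<tau>))\<^sup>2) + (2 * pi - 0) *\<^sub>R (2 * ?e\<^sup>2)) {0..2 * pi}"
      by (intro has_integral_add has_integral_mult_right integrable_integral integrable_continuous_real continuous_intros
          continuous_on_trig has_integral_const_real[THEN has_integral_eq_rhs]) auto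
    from integral_unique[OF this] show ?thesis by (simp add: mult_ac)
  qed
  finally show ?thesis .
qed

text \<open>Convergence of the coefficients makes the polynomials converge uniformly; the factor 2
  stems from the square of a sum in \<open>trig_square_perturb\<close>.\<close>

lemma trig_limit_bound:
  assumes lim: "\<And>k. k \<le> m \<Longrightarrow> (\<lambda>n. p n k) \<longlonglongrightarrow> q k"
    and bd: "\<forall>\<^sub>F n in sequentially. integral {0..2 * pi} (\<lambda>\<tau>. (norm (trig \<mu> m (p n) \<tau>))\<^sup>2) \<le> c n" and c: "c \<longlonglongrightarrow> b"
  shows "integral {0..2 * pi} (\<lambda>\<tau>. (norm (trig \<mu> m q \<tau>))\<^sup>2) \<le> 2 * b"
proof (rule tendsto_lowerbound)
  let ?e = "\<lambda>n. \<Sum>k\<le>m. norm (q k - p n k)"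
  have "(\<lambda>n. q k - p n k) \<longlonglongrightarrow> 0" if "k \<le> m" for k
    using tendsto_diff[OF tendsto_const lim[OF that], of "q k"] by simp
  then have "?e \<longlonglongrightarrow> (\<Sum>k\<le>m. 0)"
    by (intro tendsto_sum tendsto_norm_zero) auto
  then have "(\<lambda>n. 2 * c n + 2 * (?e n)\<^sup>2 * (2 * pi)) \<longlonglongrightarrow> 2 * b + 2 * (\<Sum>k\<le>m. 0)\<^sup>2 * (2 * pi)"
    by (intro tendsto_add tendsto_mult tendsto_power tendsto_const c)
  then show "(\<lambda>n. 2 * c n + 2 * (?e n)\<^sup>2 * (2 * pi)) \<longlonglongrightarrow> 2 * b" by simp
  show "\<forall>\<^sub>F n in sequentially. integral {0..2 * pi} (\<lambda>\<tau>. (norm (trig \<mu> m q \<tau>))\<^sup>2) \<le> 2 * c n + 2 * (?e n)\<^sup>2 * (2 * pi)"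
    using bd
  proof eventually_elim
    case (elim n)
    then show ?case using trig_square_perturb[of \<mu> m q "p n"] by simp
  qed
qed simp

context bip
begin

text \<open>Comparison of kernels, weighted with the growth M exp (\<phi> t) of the group. On
  [2^-n, 2] the factor 8 normalises the limit 1 / 8 of \<open>dyadic_kernel\<close>; the errors
  \<pi> t and 8 (10 / (2^n t) + t), divided by t, give 80 * 2^-n / t^2 + \<pi> + 8. Beyond 2 the
  whole kernel decays. One majorant serves both ranges, so a single integral remains to be
  estimated.\<close>

lemma kernel_bounds:
  obtains a C where "a > 0" "C \<ge> 0"
    "\<And>n t. n \<ge> 1 \<Longrightarrow> 1 / 2 ^ n \<le> t \<Longrightarrow> t \<le> 2 \<Longrightarrow>
       \<bar>(sinh_kernel t - 8 * dyadic_kernel n (2 ^ n * t)) / t\<bar> * (M * exp (\<phi> * t)) \<le> C * (1 / 2 ^ n / t\<^sup>2 + exp (- a * t))"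
    "\<And>n t. 2 \<le> t \<Longrightarrow> \<bar>sinh_kernel t / t\<bar> * (M * exp (\<phi> * t)) \<le> C * (1 / 2 ^ n / t\<^sup>2 + exp (- a * t))"
proof -
  define \<alpha> where "\<alpha> = pi - \<phi>"
  have \<alpha>: "\<alpha> > 0" using \<phi> by (simp add: \<alpha>_def)
  define a where "a = \<alpha> / 2"
  have a: "a > 0" using \<alpha> by (simp add: a_def)
  define C1 where "C1 = M * exp (\<phi> * 2) * (80 + (pi + 8)) * exp (a * 2)"
  define C2 where "C2 = M * (1 + 4 * pi / \<alpha>)"
  have C: "C1 \<ge> 0" "C2 \<ge> 0" using M \<alpha> by (auto simp: C1_def C2_def)
  have near: "\<bar>(sinh_kernel t - 8 * dyadic_kernel n (2 ^ n * t)) / t\<bar> * (M * exp (\<phi> * t)) \<le> C1 * (1 / 2 ^ n / t\<^sup>2 + exp (- a * t))"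
    if n: "n \<ge> 1" and t1: "1 / 2 ^ n \<le> t" and t2: "t \<le> 2" for n t
  proof -
    have "0 < 1 / (2::real) ^ n" by simp
    then have t: "t > 0" using t1 by linarith
    have y: "2 ^ n * t \<ge> 1" using t1 by (simp add: divide_le_eq mult.commute)
    define \<epsilon> where "\<epsilon> = 1 / 2 ^ n / t\<^sup>2"
    have \<epsilon>: "\<epsilon> \<ge> 0" by (simp add: \<epsilon>_def)
    have "\<bar>dyadic_kernel n (2 ^ n * t) - 1 / 8\<bar> \<le> 10 / (2 ^ n * t) + t"
      using dyadic_kernel_approx[OF y n] by simp
    then have "\<bar>sinh_kernel t - 8 * dyadic_kernel n (2 ^ n * t)\<bar> \<le> pi * t + 8 * (10 / (2 ^ n * t) + t)"
      using sinh_kernel_near_1[OF t] by (auto simp: abs_le_iff)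
    then have "\<bar>sinh_kernel t - 8 * dyadic_kernel n (2 ^ n * t)\<bar> / t \<le> (pi * t + 8 * (10 / (2 ^ n * t) + t)) / t"
      using t by (intro divide_right_mono) auto
    also have "\<dots> = 80 * \<epsilon> + (pi + 8)"
      using t by (simp add: \<epsilon>_def add_divide_distrib distrib_left power2_eq_square)
    also have "\<dots> \<le> (80 + (pi + 8)) * exp (a * 2) * (\<epsilon> + exp (- a * t))"
    proof -
      \<comment> \<open>On t \<le> 2 the product exp (2 a) exp (- a t) is at least 1, so the
        exponential term absorbs the constants.\<close>
      have 1: "1 \<le> exp (a * 2)" using a by simp
      have "exp (a * 2) * exp (- a * t) = exp (a * (2 - t))" by (simp add: exp_add[symmetric] algebra_simps)
      then have 2: "1 \<le> exp (a * 2) * exp (- a * t)" using a t2 by simp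
      have "1 * \<epsilon> \<le> exp (a * 2) * \<epsilon>" using 1 \<epsilon> by (intro mult_right_mono)
      then have 3: "\<epsilon> + 1 \<le> exp (a * 2) * (\<epsilon> + exp (- a * t))" using 2 by (simp add: distrib_left)
      have "80 * \<epsilon> + (pi + 8) \<le> (80 + (pi + 8)) * (\<epsilon> + 1)"
        using \<epsilon> mult_nonneg_nonneg[of pi \<epsilon>] by (simp add: distrib_right distrib_left)
      also have "\<dots> \<le> (80 + (pi + 8)) * (exp (a * 2) * (\<epsilon> + exp (- a * t)))"
        using 3 by (intro mult_left_mono) auto
      finally show ?thesis by (simp only: mult.assoc)
    qed
    finally have 1: "\<bar>(sinh_kernel t - 8 * dyadic_kernel n (2 ^ n * t)) / t\<bar> \<le> (80 + (pi + 8)) * exp (a * 2) * (\<epsilon> + exp (- a * t))"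
      using t by simp
    have 2: "M * exp (\<phi> * t) \<le> M * exp (\<phi> * 2)" using M \<phi> t2 by (intro mult_left_mono) (auto intro: mult_left_mono)
    have "\<bar>(sinh_kernel t - 8 * dyadic_kernel n (2 ^ n * t)) / t\<bar> * (M * exp (\<phi> * t))
      \<le> ((80 + (pi + 8)) * exp (a * 2) * (\<epsilon> + exp (- a * t))) * (M * exp (\<phi> * 2))"
      using M \<epsilon> by (intro mult_mono 1 2) (auto intro!: mult_nonneg_nonneg add_nonneg_nonneg)
    then show ?thesis by (simp only: C1_def \<epsilon>_def mult_ac)
  qed
  have far: "\<bar>sinh_kernel t / t\<bar> * (M * exp (\<phi> * t)) \<le> C2 * (1 / 2 ^ n / t\<^sup>2 + exp (- a * t))" if t: "2 \<le> t" for n t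
  proof -
    have "\<bar>sinh_kernel t / t\<bar> \<le> \<bar>sinh_kernel t\<bar>" using t mult_left_mono[of 1 t "\<bar>sinh_kernel t\<bar>"] by (simp add: divide_le_eq)
    also have "\<dots> \<le> (1 + 2 * pi * t) * exp (- pi * t)" using abs_sinh_kernel_le[of t] t by simp
    finally have "\<bar>sinh_kernel t / t\<bar> * (M * exp (\<phi> * t)) \<le> ((1 + 2 * pi * t) * exp (- pi * t)) * (M * exp (\<phi> * t))"
      using M by (intro mult_right_mono) auto
    also have "\<dots> = M * ((1 + 2 * pi * t) * exp (- \<alpha> * t))"
    proof -
      have "exp (- \<alpha> * t) = exp (- pi * t) * exp (\<phi> * t)" by (simp add: \<alpha>_def exp_add[symmetric] algebra_simps)
      then show ?thesis by (simp only: mult_ac)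
    qed
    also have "\<dots> \<le> M * ((1 + 4 * pi / \<alpha>) * exp (- (\<alpha> / 2) * t))"
      using M t by (intro mult_left_mono poly_exp_bound \<alpha>) auto
    also have "\<dots> = C2 * exp (- a * t)" by (simp add: C2_def a_def)
    also have "\<dots> \<le> C2 * (1 / 2 ^ n / t\<^sup>2 + exp (- a * t))" using C by (intro mult_left_mono) auto
    finally show ?thesis .
  qed
  define w where "w n t = 1 / 2 ^ n / t\<^sup>2 + exp (- a * t)" for n and t :: real
  have w: "w n t \<ge> 0" for n t by (simp add: w_def add_nonneg_nonneg)
  show ?thesis
  proof (rule that[OF a])
    show "max C1 C2 \<ge> 0" using C by simp
    show "\<bar>(sinh_kernel t - 8 * dyadic_kernel n (2 ^ n * t)) / t\<bar> * (M * exp (\<phi> * t)) \<le> max C1 C2 * (1 / 2 ^ n / t\<^sup>2 + exp (- a * t))"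
      if "n \<ge> 1" "1 / 2 ^ n \<le> t" "t \<le> 2" for n t
      using order_trans[OF near[OF that, folded w_def] mult_right_mono[OF max.cobounded1[of C1 C2] w]] by (simp only: w_def)
    show "\<bar>sinh_kernel t / t\<bar> * (M * exp (\<phi> * t)) \<le> max C1 C2 * (1 / 2 ^ n / t\<^sup>2 + exp (- a * t))"
      if "2 \<le> t" for n t
      using order_trans[OF far[OF that, folded w_def] mult_right_mono[OF max.cobounded2[of C2 C1] w]] by (simp only: w_def)
  qed
qed

text \<open>The singular term 2^-n / t^2 is integrated from 2^-n on only, so its integral is at most
  1 whatever n is.\<close>

lemma kernel_integral:
  fixes a :: real
  assumes a: "a > 0" and n: "n \<ge> 1"
  shows "integral {1 / 2 ^ n..real n} (\<lambda>t. 1 / 2 ^ n / t\<^sup>2 + exp (- a * t)) \<le> 1 + 1 / a"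
proof -
  define \<delta> where "\<delta> = 1 / (2::real) ^ n"
  have \<delta>: "\<delta> > 0" "\<delta> \<le> real n"
  proof -
    have "\<delta> \<le> 1" by (simp add: \<delta>_def)
    then show "\<delta> \<le> real n" using n by linarith
  qed (simp add: \<delta>_def)
  have "((\<lambda>t. \<delta> / t\<^sup>2) has_integral (- \<delta> / real n) - (- \<delta> / \<delta>)) {\<delta>..real n}"
    using \<delta> by (intro fundamental_theorem_of_calculus)
      (auto intro!: derivative_eq_intros simp: has_real_derivative_iff_has_vector_derivative[symmetric] power2_eq_square)
  from has_integral_add[OF this exp_has_integral_Icc[OF a \<delta>(2), of 1]]
  have "integral {\<delta>..real n} (\<lambda>t. \<delta> / t\<^sup>2 + exp (- a * t)) = 1 - \<delta> / real n + (1 / a) * (exp (- a * \<delta>) - exp (- a * real n))"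
    using \<delta> by (intro integral_unique) simp
  also have "\<dots> \<le> 1 + (1 / a) * 1"
  proof (intro add_mono mult_left_mono)
    have "exp (- a * \<delta>) \<le> 1" using a \<delta> by simp
    then show "exp (- a * \<delta>) - exp (- a * real n) \<le> 1" using exp_gt_zero[of "- a * real n"] by linarith
  qed (use a \<delta> in auto)
  finally show ?thesis by (simp add: \<delta>_def)
qed

end

context bip
begin

text \<open>Coifman--Weiss transference: \<open>U\<^sub>t f (\<tau> - t) = U\<^sub>\<tau> g (\<tau> - t)\<close> with \<open>g \<tau> = U\<^sub>-\<^sub>\<tau> f \<tau>\<close> turns the singular
  part of the principal value into a truncated Hilbert transform of \<open>g\<close>.\<close>

definition twist :: "(nat \<Rightarrow> real) \<Rightarrow> nat \<Rightarrow> (nat \<Rightarrow> 'a) \<Rightarrow> real \<Rightarrow> 'a" where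
  "twist \<mu> m x \<tau> = U (- \<tau>) (trig \<mu> m x \<tau>)"

lemma continuous_on_twist:
  assumes x: "\<And>k. x k \<in> Domain A"
  shows "continuous_on UNIV (twist \<mu> m x)"
  unfolding twist_def U_trig unfolding trig_def
  by (intro continuous_intros continuous_on_compose2[OF U_continuous[OF x, of UNIV]]) auto

lemma odd_part_twist:
  "U \<tau> (odd_part (twist \<mu> m x) \<tau> t) = U (- t) (trig \<mu> m x (\<tau> + t)) - U t (trig \<mu> m x (\<tau> - t))"
  by (simp add: odd_part_def twist_def linear_diff[OF bounded_linear.linear[OF U_lin]] U_group)

lemma norm_odd_part_twist:
  assumes "t \<ge> 0"
  shows "norm (U \<tau> (odd_part (twist \<mu> m x) \<tau> t)) \<le> M * exp (\<phi> * t) * (norm (trig \<mu> m x (\<tau> + t)) + norm (trig \<mu> m x (\<tau> - t)))"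
  unfolding odd_part_twist distrib_left
  using U_bound[of "- t" "trig \<mu> m x (\<tau> + t)"] U_bound[of t "trig \<mu> m x (\<tau> - t)"] assms
  by (intro order_trans[OF norm_triangle_ineq4] add_mono) auto

text \<open>The truncated integral of \<open>yosida_principal_value\<close>; for y = A x it
  converges to i \<pi> (x - 2 T x) with T = \<open>yosida\<close> at u.\<close>

definition pv_coeff :: "nat \<Rightarrow> real \<Rightarrow> 'a \<Rightarrow> 'a" where
  "pv_coeff n u y = integral {1 / 2 ^ n..real n} (\<lambda>t. (1 / t) *\<^sub>R (cis (- t * u) *\<^sub>C mellin A t y - cis (t * u) *\<^sub>C mellin A (- t) y))"

text \<open>The even factor \<open>sinh_kernel\<close> comes out of both transforms, and
  \<open>odd_part_twist\<close> recognises the remaining difference. The minus sign appears because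
  the odd part subtracts the value at \<tau> - t.\<close>

lemma pv_has_integral:
  assumes xy: "\<And>k. (x k, y k) \<in> A" and n: "n \<ge> 1"
  shows "((\<lambda>t. - (sinh_kernel t / t) *\<^sub>R U \<tau> (odd_part (twist \<mu> m x) \<tau> t)) has_integral
    trig \<mu> m (\<lambda>k. pv_coeff n (\<mu> k) (y k)) \<tau>) {1 / 2 ^ n..real n}"
proof -
  have mc: "continuous_on S (\<lambda>t. mellin A (k t) y)" if "continuous_on S k" for S :: "real set" and k y
    by (rule continuous_on_compose2[OF mellin_continuous that]) auto
  have \<delta>: "0 < 1 / (2::real) ^ n" by simp
  have cont: "continuous_on {1 / 2 ^ n..real n} (\<lambda>t. (1 / t) *\<^sub>R (cis (- t * \<mu> k) *\<^sub>C mellin A t (y k) - cis (t * \<mu> k) *\<^sub>C mellin A (- t) (y k)))" for k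
    using \<delta> by (intro continuous_intros mc) (auto simp: not_le[symmetric])
  have "((\<lambda>t. \<Sum>k\<le>m. cis (\<mu> k * \<tau>) *\<^sub>C ((1 / t) *\<^sub>R (cis (- t * \<mu> k) *\<^sub>C mellin A t (y k) - cis (t * \<mu> k) *\<^sub>C mellin A (- t) (y k))))
     has_integral trig \<mu> m (\<lambda>k. pv_coeff n (\<mu> k) (y k)) \<tau>) {1 / 2 ^ n..real n}"
    unfolding trig_def pv_coeff_def
    by (intro has_integral_sum finite_atMost
        has_integral_linear[OF integrable_integral[OF integrable_continuous_real[OF cont]] scaleC.bounded_linear_right, unfolded o_def])
  moreover have "(\<Sum>k\<le>m. cis (\<mu> k * \<tau>) *\<^sub>C ((1 / t) *\<^sub>R (cis (- t * \<mu> k) *\<^sub>C mellin A t (y k) - cis (t * \<mu> k) *\<^sub>C mellin A (- t) (y k))))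
     = - (sinh_kernel t / t) *\<^sub>R U \<tau> (odd_part (twist \<mu> m x) \<tau> t)" for t
  proof -
    have "cis (\<mu> k * \<tau>) *\<^sub>C ((1 / t) *\<^sub>R (cis (- t * \<mu> k) *\<^sub>C mellin A t (y k) - cis (t * \<mu> k) *\<^sub>C mellin A (- t) (y k)))
      = - (sinh_kernel t / t) *\<^sub>R (cis (\<mu> k * (\<tau> + t)) *\<^sub>C U (- t) (x k) - cis (\<mu> k * (\<tau> - t)) *\<^sub>C U t (x k))" for k
    proof -
      have m: "mellin A t (y k) = of_real (sinh_kernel t) *\<^sub>C U t (x k)" "mellin A (- t) (y k) = of_real (sinh_kernel t) *\<^sub>C U (- t) (x k)"
        by (simp_all only: U_mellin[OF xy] mellin_id_sinh_kernel(1)[of t] mellin_id_sinh_kernel(2)[of t])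
      have c: "cis (\<mu> k * (\<tau> + t)) = cis (\<mu> k * \<tau>) * cis (t * \<mu> k)" "cis (\<mu> k * (\<tau> - t)) = cis (\<mu> k * \<tau>) * cis (- t * \<mu> k)"
        by (simp_all add: cis_mult algebra_simps)
      show ?thesis unfolding m c
        by (simp add: scaleR_scaleC scaleC_scaleC scaleC.diff_right scaleC.minus_left mult_ac)
    qed
    then show ?thesis
      unfolding odd_part_twist U_trig unfolding trig_def
      by (simp only: scaleR_right.sum[symmetric] sum_subtractf[symmetric])
  qed
  ultimately show ?thesis by simp
qed

text \<open>The sum on the left is an integral against a difference of kernels: on [2^-n, 2] the
  averaged Haar shift cancels the singularity, on [2, n] the kernel is estimated directly. The plus
  sign compensates the minus of \<open>pv_has_integral\<close>.\<close>

lemma pv_pointwise: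
  assumes xy: "\<And>k. (x k, y k) \<in> A" and n: "n \<ge> 2"
    and near: "\<And>t. 1 / 2 ^ n \<le> t \<Longrightarrow> t \<le> 2 \<Longrightarrow> \<bar>(sinh_kernel t - 8 * dyadic_kernel n (2 ^ n * t)) / t\<bar> * (M * exp (\<phi> * t)) \<le> w t"
    and far: "\<And>t. 2 \<le> t \<Longrightarrow> \<bar>sinh_kernel t / t\<bar> * (M * exp (\<phi> * t)) \<le> w t"
    and w: "continuous_on {1 / 2 ^ n..real n} w"
  shows "norm (trig \<mu> m (\<lambda>k. pv_coeff n (\<mu> k) (y k)) \<tau> + 8 *\<^sub>R U \<tau> (averaged_conv n (twist \<mu> m x) \<tau>))
    \<le> integral {1 / 2 ^ n..real n} (\<lambda>t. w t * (norm (trig \<mu> m x (\<tau> + t)) + norm (trig \<mu> m x (\<tau> - t))))"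
proof -
  have x: "x k \<in> Domain A" for k using xy by auto
  define \<delta> where "\<delta> = 1 / (2::real) ^ n"
  have "\<delta> \<le> 1" by (simp add: \<delta>_def)
  then have \<delta>: "\<delta> > 0" "\<delta> \<le> 2" "2 \<le> real n"
    using n by (simp add: \<delta>_def, linarith, simp)
  let ?H = "\<lambda>t. U \<tau> (odd_part (twist \<mu> m x) \<tau> t)"
  let ?s = "\<lambda>t. norm (trig \<mu> m x (\<tau> + t)) + norm (trig \<mu> m x (\<tau> - t))"
  note pv = pv_has_integral[where x = x and y = y and n = n and \<mu> = \<mu> and m = m and \<tau> = \<tau>, OF xy, folded \<delta>_def]
  have pv: "((\<lambda>t. - (sinh_kernel t / t) *\<^sub>R ?H t) has_integral trig \<mu> m (\<lambda>k. pv_coeff n (\<mu> k) (y k)) \<tau>) {\<delta>..real n}"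
    using n by (intro pv) auto
  have cs: "continuous_on S (\<lambda>t. w t * ?s t)" if "S \<subseteq> {\<delta>..real n}" for S
    by (intro continuous_intros continuous_on_trig continuous_on_subset[OF w] that[unfolded \<delta>_def])
  have bound: "norm (c *\<^sub>R ?H t) \<le> w t * ?s t" if "\<bar>c\<bar> * (M * exp (\<phi> * t)) \<le> w t" "t \<ge> 0" for c t
  proof -
    have "norm (c *\<^sub>R ?H t) \<le> \<bar>c\<bar> * (M * exp (\<phi> * t) * ?s t)"
      using norm_odd_part_twist[OF that(2), where \<tau> = \<tau> and \<mu> = \<mu> and m = m and x = x] by (simp add: mult_left_mono)
    also have "\<dots> = (\<bar>c\<bar> * (M * exp (\<phi> * t))) * ?s t" by (simp only: mult_ac)
    also have "\<dots> \<le> w t * ?s t" using that by (intro mult_right_mono) auto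
    finally show ?thesis .
  qed
  have Q: "((\<lambda>t. (8 * dyadic_kernel n (2 ^ n * t) / t) *\<^sub>R ?H t) has_integral 8 *\<^sub>R U \<tau> (averaged_conv n (twist \<mu> m x) \<tau>)) {\<delta>..2}"
    using has_integral_cmul[OF has_integral_linear[OF averaged_conv_has_integral[OF continuous_on_twist[where x = x and \<mu> = \<mu> and m = m, OF x], where n = n and \<tau> = \<tau>] U_lin[of \<tau>]], of 8]
    by (simp add: o_def linear_scale[OF bounded_linear.linear[OF U_lin]] \<delta>_def)
  have int: "(\<lambda>t. - (sinh_kernel t / t) *\<^sub>R ?H t) integrable_on {\<delta>..real n}" using pv by (rule has_integral_integrable)
  have P: "trig \<mu> m (\<lambda>k. pv_coeff n (\<mu> k) (y k)) \<tau> = integral {\<delta>..2} (\<lambda>t. - (sinh_kernel t / t) *\<^sub>R ?H t) + integral {2..real n} (\<lambda>t. - (sinh_kernel t / t) *\<^sub>R ?H t)"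
    unfolding integral_unique[OF pv, symmetric] by (rule integral_combine_Icc[OF \<delta>(2,3) int])
  have int1: "(\<lambda>t. - (sinh_kernel t / t) *\<^sub>R ?H t) integrable_on {\<delta>..2}"
    by (rule integrable_on_subinterval[OF int]) (use \<delta> in auto)
  have int2: "(\<lambda>t. - (sinh_kernel t / t) *\<^sub>R ?H t) integrable_on {2..real n}"
    by (rule integrable_on_subinterval[OF int]) (use \<delta> in auto)
  have "((\<lambda>t. (- (sinh_kernel t - 8 * dyadic_kernel n (2 ^ n * t)) / t) *\<^sub>R ?H t) has_integral
     integral {\<delta>..2} (\<lambda>t. - (sinh_kernel t / t) *\<^sub>R ?H t) + 8 *\<^sub>R U \<tau> (averaged_conv n (twist \<mu> m x) \<tau>)) {\<delta>..2}"
    using has_integral_add[OF integrable_integral[OF int1] Q]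
    by (simp add: scaleR_left_diff_distrib diff_divide_distrib)
  note I = this
  have I1: "norm (integral {\<delta>..2} (\<lambda>t. - (sinh_kernel t / t) *\<^sub>R ?H t) + 8 *\<^sub>R U \<tau> (averaged_conv n (twist \<mu> m x) \<tau>))
    \<le> integral {\<delta>..2} (\<lambda>t. w t * ?s t)"
    unfolding integral_unique[OF I, symmetric]
  proof (intro integral_norm_bound_integral has_integral_integrable[OF I] integrable_continuous_real cs)
    fix t assume t: "t \<in> {\<delta>..2}"
    show "norm ((- (sinh_kernel t - 8 * dyadic_kernel n (2 ^ n * t)) / t) *\<^sub>R ?H t) \<le> w t * ?s t"
    proof (rule bound)
      show "\<bar>- (sinh_kernel t - 8 * dyadic_kernel n (2 ^ n * t)) / t\<bar> * (M * exp (\<phi> * t)) \<le> w t"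
        unfolding minus_divide_left[symmetric] abs_minus_cancel using t \<delta> by (intro near) (auto simp: \<delta>_def)
    qed (use t \<delta> in auto)
  qed (use \<delta> in auto)
  have I2: "norm (integral {2..real n} (\<lambda>t. - (sinh_kernel t / t) *\<^sub>R ?H t)) \<le> integral {2..real n} (\<lambda>t. w t * ?s t)"
  proof (intro integral_norm_bound_integral int2 integrable_continuous_real cs)
    fix t assume t: "t \<in> {2..real n}"
    show "norm (- (sinh_kernel t / t) *\<^sub>R ?H t) \<le> w t * ?s t"
      using far[of t] t by (intro bound) auto
  qed (use \<delta> in auto)
  have "norm (trig \<mu> m (\<lambda>k. pv_coeff n (\<mu> k) (y k)) \<tau> + 8 *\<^sub>R U \<tau> (averaged_conv n (twist \<mu> m x) \<tau>))
    \<le> integral {\<delta>..2} (\<lambda>t. w t * ?s t) + integral {2..real n} (\<lambda>t. w t * ?s t)"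
    unfolding P using norm_triangle_mono[OF I1 I2] by (simp only: ac_simps)
  also have "\<dots> = integral {\<delta>..real n} (\<lambda>t. w t * ?s t)"
    by (intro integral_combine_Icc[symmetric] \<delta> integrable_continuous_real cs) simp
  finally show ?thesis by (simp add: \<delta>_def)
qed

text \<open>The error in \<open>pv_pointwise\<close> is bounded by \<open>periodic_Minkowski\<close>
  and the averaged Haar shift of \<open>twist\<close> by UMD; the group factors that pass between
  \<open>twist\<close> and \<open>trig\<close> are bounded because \<tau> stays in a bounded
  range.\<close>

lemma pv_square_bound:
  assumes "UMD TYPE('a)"
  obtains C where "C \<ge> 0" "\<And>\<mu> m x y n. (\<And>k. (x k, y k) \<in> A) \<Longrightarrow> n \<ge> 2 \<Longrightarrow>
     (\<And>\<tau>. norm (trig \<mu> m x (\<tau> + 2 * pi)) = norm (trig \<mu> m x \<tau>)) \<Longrightarrow>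
     integral {0..2 * pi} (\<lambda>\<tau>. (norm (trig \<mu> m (\<lambda>k. pv_coeff n (\<mu> k) (y k)) \<tau>))\<^sup>2)
       \<le> C * integral {0..2 * pi} (\<lambda>\<tau>. (norm (trig \<mu> m x \<tau>))\<^sup>2)"
proof -
  obtain D where D: "D \<ge> 0" "\<And>n (g :: real \<Rightarrow> 'a) a b. continuous_on UNIV g \<Longrightarrow>
     continuous_on UNIV (averaged_conv n g) \<and>
     integral {a..b} (\<lambda>\<tau>. (norm (averaged_conv n g \<tau>))\<^sup>2) \<le> D * integral {a - 2..b + 2} (\<lambda>\<tau>. (norm (g \<tau>))\<^sup>2)"
    using averaged_conv_bounded[OF assms] by blast
  obtain a C0 where a: "a > 0" and C0: "C0 \<ge> 0"
    and near: "\<And>n t. n \<ge> 1 \<Longrightarrow> 1 / 2 ^ n \<le> t \<Longrightarrow> t \<le> 2 \<Longrightarrow>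
       \<bar>(sinh_kernel t - 8 * dyadic_kernel n (2 ^ n * t)) / t\<bar> * (M * exp (\<phi> * t)) \<le> C0 * (1 / 2 ^ n / t\<^sup>2 + exp (- a * t))"
    and far: "\<And>n t. 2 \<le> t \<Longrightarrow> \<bar>sinh_kernel t / t\<bar> * (M * exp (\<phi> * t)) \<le> C0 * (1 / 2 ^ n / t\<^sup>2 + exp (- a * t))"
    using kernel_bounds by blast
  define W where "W = C0 * (1 + 1 / a)"
  \<comment> \<open>\<open>L1\<close> bounds the group on one period, \<open>L2\<close> on the
    period enlarged by 2 at both ends, as \<open>averaged_conv_bounded\<close> demands.\<close>
  define L1 where "L1 = M * exp (\<phi> * (2 * pi))"
  define L2 where "L2 = M * exp (\<phi> * (2 * pi + 2))"
  define C where "C = 2 * (4 * W\<^sup>2) + 128 * L1\<^sup>2 * (D * (L2\<^sup>2 * 3))"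
  have C: "C \<ge> 0" using D(1) by (simp add: C_def)
  have key: "integral {0..2 * pi} (\<lambda>\<tau>. (norm (trig \<mu> m (\<lambda>k. pv_coeff n (\<mu> k) (y k)) \<tau>))\<^sup>2)
       \<le> C * integral {0..2 * pi} (\<lambda>\<tau>. (norm (trig \<mu> m x \<tau>))\<^sup>2)"
    if xy: "\<And>k. (x k, y k) \<in> A" and n: "n \<ge> 2" and per: "\<And>\<tau>. norm (trig \<mu> m x (\<tau> + 2 * pi)) = norm (trig \<mu> m x \<tau>)"
    for \<mu> m x y n
  proof -
    have x: "x k \<in> Domain A" for k using xy by auto
    let ?I = "integral {0..2 * pi} (\<lambda>\<tau>. (norm (trig \<mu> m x \<tau>))\<^sup>2)"
    let ?g = "twist \<mu> m x" and ?N = "\<lambda>\<tau>. norm (trig \<mu> m x \<tau>)"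
    let ?P = "trig \<mu> m (\<lambda>k. pv_coeff n (\<mu> k) (y k))"
    define w where "w t = C0 * (1 / 2 ^ n / t\<^sup>2 + exp (- a * t))" for t
    let ?E = "\<lambda>\<tau>. integral {1 / 2 ^ n..real n} (\<lambda>t. w t * (?N (\<tau> + t) + ?N (\<tau> - t)))"
    have \<delta>: "0 < 1 / (2::real) ^ n" by simp
    have cw: "continuous_on {1 / 2 ^ n..real n} w" unfolding w_def
      using \<delta> by (intro continuous_intros) (auto simp: not_le[symmetric])
    have W: "integral {1 / 2 ^ n..real n} w \<le> W"
      using mult_left_mono[OF kernel_integral[OF a, of n] C0] n unfolding w_def W_def by simp
    have w0: "w t \<ge> 0" for t using C0 by (simp add: w_def add_nonneg_nonneg)
    have cN: "continuous_on S ?N" for S by (intro continuous_intros continuous_on_trig)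
    note E = periodic_Minkowski[of ?N "1 / 2 ^ n" "real n" w W, OF cN per cw w0 W]
    have cg: "continuous_on UNIV ?g" by (rule continuous_on_twist[OF x])
    have cQ: "continuous_on S (averaged_conv n ?g)" for S using D(2)[OF cg] continuous_on_subset by blast
    have g: "(norm (?g \<tau>))\<^sup>2 \<le> L2\<^sup>2 * (?N \<tau>)\<^sup>2" if "\<tau> \<in> {0 - 2..2 * pi + 2}" for \<tau>
    proof -
      have "\<bar>\<tau>\<bar> \<le> 2 * pi + 2" using that pi_gt_zero unfolding atLeastAtMost_iff by linarith
      then have L: "M * exp (\<phi> * \<bar>\<tau>\<bar>) \<le> L2" unfolding L2_def using M \<phi>(1) by (simp add: mult_left_mono)
      have "norm (?g \<tau>) \<le> M * exp (\<phi> * \<bar>\<tau>\<bar>) * ?N \<tau>"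
        unfolding twist_def using U_bound[of "- \<tau>" "trig \<mu> m x \<tau>"] by simp
      also have "\<dots> \<le> L2 * ?N \<tau>" using L by (rule mult_right_mono) simp
      finally have "(norm (?g \<tau>))\<^sup>2 \<le> (L2 * ?N \<tau>)\<^sup>2" by (intro power_mono) auto
      then show ?thesis by (simp add: power_mult_distrib)
    qed
    have cN2: "continuous_on S (\<lambda>\<tau>. (?N \<tau>)\<^sup>2)" for S by (intro continuous_intros cN)
    have "integral {0..2 * pi} (\<lambda>\<tau>. (norm (averaged_conv n ?g \<tau>))\<^sup>2) \<le> D * integral {0 - 2..2 * pi + 2} (\<lambda>\<tau>. (norm (?g \<tau>))\<^sup>2)"
      using D(2)[OF cg] by blast
    also have "\<dots> \<le> D * (L2\<^sup>2 * (3 * ?I))"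
    proof (intro mult_left_mono D(1))
      have "integral {0 - 2..2 * pi + 2} (\<lambda>\<tau>. (norm (?g \<tau>))\<^sup>2) \<le> integral {0 - 2..2 * pi + 2} (\<lambda>\<tau>. L2\<^sup>2 * (?N \<tau>)\<^sup>2)"
        by (intro integral_le integrable_continuous_real continuous_intros cN g continuous_on_subset[OF cg]) auto
      also have "\<dots> = L2\<^sup>2 * integral {0 - 2..2 * pi + 2} (\<lambda>\<tau>. (?N \<tau>)\<^sup>2)" by simp
      \<comment> \<open>The enlarged period fits into [- 2 \<pi>, 4 \<pi>], which is three periods;
        hence the factor 3.\<close>
      also have "\<dots> \<le> L2\<^sup>2 * integral {- (2 * pi)..2 * pi + 2 * pi} (\<lambda>\<tau>. (?N \<tau>)\<^sup>2)"
        using pi_ge_two by (intro mult_left_mono integral_mono_interval cN2) auto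
      also have "integral {- (2 * pi)..2 * pi + 2 * pi} (\<lambda>\<tau>. (?N \<tau>)\<^sup>2) = 3 * ?I"
      proof -
        have i: "(\<lambda>\<tau>. (?N \<tau>)\<^sup>2) integrable_on {c..d}" for c d by (intro integrable_continuous_real cN2)
        have p: "integral {t..t + 2 * pi} (\<lambda>\<tau>. (?N \<tau>)\<^sup>2) = ?I" for t
          by (rule integral_periodic(1)[OF cN2]) (simp_all add: per)
        show ?thesis
          using integral_combine_Icc[OF _ _ i, of "- (2 * pi)" 0 "2 * pi + 2 * pi"]
            integral_combine_Icc[OF _ _ i, of 0 "2 * pi" "2 * pi + 2 * pi"] p[of "- (2 * pi)"] p[of "2 * pi"] by simp
      qed
      finally show "integral {0 - 2..2 * pi + 2} (\<lambda>\<tau>. (norm (?g \<tau>))\<^sup>2) \<le> L2\<^sup>2 * (3 * ?I)" .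
    qed
    finally have Q: "integral {0..2 * pi} (\<lambda>\<tau>. (norm (averaged_conv n ?g \<tau>))\<^sup>2) \<le> D * (L2\<^sup>2 * 3) * ?I" by (simp only: mult_ac)
    have pt: "(norm (?P \<tau>))\<^sup>2 \<le> 2 * (?E \<tau>)\<^sup>2 + 128 * L1\<^sup>2 * (norm (averaged_conv n ?g \<tau>))\<^sup>2" if \<tau>: "\<tau> \<in> {0..2 * pi}" for \<tau>
    proof -
      let ?q = "averaged_conv n ?g \<tau>"
      have "norm (?P \<tau> + 8 *\<^sub>R U \<tau> ?q) \<le> ?E \<tau>"
      proof (rule pv_pointwise[OF xy n _ _ cw])
        show "\<bar>(sinh_kernel t - 8 * dyadic_kernel n (2 ^ n * t)) / t\<bar> * (M * exp (\<phi> * t)) \<le> w t" if "1 / 2 ^ n \<le> t" "t \<le> 2" for t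
          unfolding w_def using n that by (intro near) auto
        show "\<bar>sinh_kernel t / t\<bar> * (M * exp (\<phi> * t)) \<le> w t" if "2 \<le> t" for t
          unfolding w_def using that by (rule far)
      qed
      then have e: "(norm (?P \<tau> + 8 *\<^sub>R U \<tau> ?q))\<^sup>2 \<le> (?E \<tau>)\<^sup>2" by (intro power_mono) auto
      have "M * exp (\<phi> * \<bar>\<tau>\<bar>) \<le> L1" unfolding L1_def using M \<phi>(1) \<tau> by (simp add: mult_left_mono)
      then have L: "M * exp (\<phi> * \<bar>\<tau>\<bar>) * norm ?q \<le> L1 * norm ?q" by (rule mult_right_mono) simp
      have "norm (U \<tau> ?q) \<le> L1 * norm ?q" by (rule order_trans[OF U_bound L])
      then have "(norm (U \<tau> ?q))\<^sup>2 \<le> (L1 * norm ?q)\<^sup>2" by (intro power_mono) auto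
      then have "(norm (- (8 *\<^sub>R U \<tau> ?q)))\<^sup>2 \<le> 64 * (L1\<^sup>2 * (norm ?q)\<^sup>2)" by (simp add: power_mult_distrib)
      then show ?thesis
        using norm_add_square_le[of "?P \<tau> + 8 *\<^sub>R U \<tau> ?q" "- (8 *\<^sub>R U \<tau> ?q)"] e by simp
    qed
    have iE: "(\<lambda>\<tau>. (?E \<tau>)\<^sup>2) integrable_on {0..2 * pi}" by (intro integrable_continuous_real continuous_intros E(2))
    have iQ: "(\<lambda>\<tau>. (norm (averaged_conv n ?g \<tau>))\<^sup>2) integrable_on {0..2 * pi}"
      by (intro integrable_continuous_real continuous_intros cQ)
    have "((\<lambda>\<tau>. 2 * (?E \<tau>)\<^sup>2 + 128 * L1\<^sup>2 * (norm (averaged_conv n ?g \<tau>))\<^sup>2) has_integral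
      2 * integral {0..2 * pi} (\<lambda>\<tau>. (?E \<tau>)\<^sup>2) + 128 * L1\<^sup>2 * integral {0..2 * pi} (\<lambda>\<tau>. (norm (averaged_conv n ?g \<tau>))\<^sup>2)) {0..2 * pi}"
      by (intro has_integral_add has_integral_mult_right integrable_integral iE iQ)
    note R = this
    have "integral {0..2 * pi} (\<lambda>\<tau>. (norm (?P \<tau>))\<^sup>2) \<le> 2 * integral {0..2 * pi} (\<lambda>\<tau>. (?E \<tau>)\<^sup>2) + 128 * L1\<^sup>2 * integral {0..2 * pi} (\<lambda>\<tau>. (norm (averaged_conv n ?g \<tau>))\<^sup>2)"
      unfolding integral_unique[OF R, symmetric]
      by (intro integral_le integrable_continuous_real continuous_intros continuous_on_trig has_integral_integrable[OF R] pt)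
    also have "\<dots> \<le> 2 * (4 * W\<^sup>2 * ?I) + 128 * L1\<^sup>2 * (D * (L2\<^sup>2 * 3) * ?I)"
      using E(1) Q by (intro add_mono mult_left_mono) auto
    also have "\<dots> = C * ?I" by (simp add: C_def algebra_simps)
    finally show ?thesis .
  qed
  show ?thesis by (rule that[OF C]) (rule key)
qed

text \<open>As n tends to infinity the coefficients tend to i \<pi> (x - 2 T x), from which T x is
  recovered; density of the domain then admits arbitrary coefficients. The constant does not depend
  on the frequencies, hence neither on r nor on the number of terms.\<close>

lemma yosida_trig_bound:
  assumes "UMD TYPE('a)"
  obtains C where "C > 0" "\<And>\<mu> m x. 
     (\<And>x \<tau>. norm (trig \<mu> m x (\<tau> + 2 * pi)) = norm (trig \<mu> m (x :: nat \<Rightarrow> 'a) \<tau>)) \<Longrightarrow>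
     integral {0..2 * pi} (\<lambda>\<tau>. (norm (trig \<mu> m (\<lambda>k. yosida A (of_real (\<mu> k)) (x k)) \<tau>))\<^sup>2)
       \<le> C * integral {0..2 * pi} (\<lambda>\<tau>. (norm (trig \<mu> m x \<tau>))\<^sup>2)"
proof -
  obtain C where C0: "C \<ge> 0" and C: "\<And>\<mu> m x y n. (\<And>k. (x k, y k) \<in> A) \<Longrightarrow> n \<ge> 2 \<Longrightarrow>
     (\<And>\<tau>. norm (trig \<mu> m x (\<tau> + 2 * pi)) = norm (trig \<mu> m x \<tau>)) \<Longrightarrow>
     integral {0..2 * pi} (\<lambda>\<tau>. (norm (trig \<mu> m (\<lambda>k. pv_coeff n (\<mu> k) (y k)) \<tau>))\<^sup>2)
       \<le> C * integral {0..2 * pi} (\<lambda>\<tau>. (norm (trig \<mu> m x \<tau>))\<^sup>2)"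
    using pv_square_bound[OF assms] by blast
  let ?J = "\<lambda>\<mu> m x. integral {0..2 * pi} (\<lambda>\<tau>. (norm (trig \<mu> m x \<tau>))\<^sup>2)"
  let ?T = "\<lambda>\<mu> x k. yosida A (of_real (\<mu> k)) (x k)"
  have J0: "?J \<mu> m x \<ge> 0" for \<mu> m and x :: "nat \<Rightarrow> 'a"
    by (intro integral_nonneg integrable_continuous_real continuous_intros continuous_on_trig) simp
  have dom: "?J \<mu> m (?T \<mu> x) \<le> (C + 1) * ?J \<mu> m x"
    if x: "\<And>k. x k \<in> Domain A" and per: "\<And>\<tau>. norm (trig \<mu> m x (\<tau> + 2 * pi)) = norm (trig \<mu> m x \<tau>)" for \<mu> m x
  proof -
    obtain y where xy: "\<And>k. (x k, y k) \<in> A" using x unfolding Domain_iff by metis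
    let ?q = "\<lambda>k. (\<i> * pi) *\<^sub>C (x k - 2 *\<^sub>R yosida A (of_real (\<mu> k)) (x k))"
    have 1: "?J \<mu> m ?q \<le> 2 * (C * ?J \<mu> m x)"
    proof (rule trig_limit_bound[where p = "\<lambda>n k. pv_coeff n (\<mu> k) (y k)" and c = "\<lambda>_. C * ?J \<mu> m x"])
      show "(\<lambda>n. pv_coeff n (\<mu> k) (y k)) \<longlonglongrightarrow> ?q k" for k
        unfolding pv_coeff_def by (rule yosida_principal_value[OF xy])
      show "\<forall>\<^sub>F n in sequentially. ?J \<mu> m (\<lambda>k. pv_coeff n (\<mu> k) (y k)) \<le> C * ?J \<mu> m x"
        using C[OF xy _ per] by (auto simp: eventually_sequentially intro!: exI[of _ 2])
    qed simp
    have pt: "(norm (trig \<mu> m (?T \<mu> x) \<tau>))\<^sup>2 \<le> (1 / 2) * (norm (trig \<mu> m x \<tau>))\<^sup>2 + (1 / 2) * (norm (trig \<mu> m ?q \<tau>))\<^sup>2" for \<tau>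
    proof -
      have q: "trig \<mu> m ?q \<tau> = (\<i> * pi) *\<^sub>C (trig \<mu> m x \<tau> - 2 *\<^sub>R trig \<mu> m (?T \<mu> x) \<tau>)"
        by (simp add: trig_def scaleC.sum_right scaleC_scaleC scaleC.diff_right sum_subtractf scaleR_right.sum
            scaleR_scaleC mult_ac)
      define u where "u = trig \<mu> m x \<tau>"
      define v where "v = trig \<mu> m (?T \<mu> x) \<tau>"
      have "4 * (norm v)\<^sup>2 \<le> 2 * (norm u)\<^sup>2 + 2 * (norm (u - 2 *\<^sub>R v))\<^sup>2"
        using norm_add_square_le[of u "2 *\<^sub>R v - u"] by (simp add: norm_minus_commute power_mult_distrib)
      moreover have "(norm (u - 2 *\<^sub>R v))\<^sup>2 \<le> (norm (trig \<mu> m ?q \<tau>))\<^sup>2"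
      proof (rule power_mono)
        have "1 * norm (u - 2 *\<^sub>R v) \<le> pi * norm (u - 2 *\<^sub>R v)" using pi_ge_two by (intro mult_right_mono) auto
        then show "norm (u - 2 *\<^sub>R v) \<le> norm (trig \<mu> m ?q \<tau>)" unfolding q u_def[symmetric] v_def[symmetric] by (simp add: norm_scaleC norm_mult)
      qed simp
      ultimately have "4 * (norm v)\<^sup>2 \<le> 2 * (norm u)\<^sup>2 + 2 * (norm (trig \<mu> m ?q \<tau>))\<^sup>2" by linarith
      then show ?thesis by (simp add: u_def v_def)
    qed
    have i: "(\<lambda>\<tau>. (norm (trig \<mu> m z \<tau>))\<^sup>2) integrable_on {0..2 * pi}" for z :: "nat \<Rightarrow> 'a"
      by (intro integrable_continuous_real continuous_intros continuous_on_trig)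
    have R: "((\<lambda>\<tau>. (1 / 2) * (norm (trig \<mu> m x \<tau>))\<^sup>2 + (1 / 2) * (norm (trig \<mu> m ?q \<tau>))\<^sup>2) has_integral
       (1 / 2) * ?J \<mu> m x + (1 / 2) * ?J \<mu> m ?q) {0..2 * pi}"
      by (intro has_integral_add has_integral_mult_right integrable_integral i)
    have "?J \<mu> m (?T \<mu> x) \<le> (1 / 2) * ?J \<mu> m x + (1 / 2) * ?J \<mu> m ?q"
      unfolding integral_unique[OF R, symmetric] by (rule integral_le[OF i has_integral_integrable[OF R] pt])
    also have "\<dots> \<le> (C + 1) * ?J \<mu> m x" using 1 J0[of \<mu> m x] by (simp add: distrib_right)
    finally show ?thesis .
  qed
  have key: "?J \<mu> m (?T \<mu> x) \<le> (2 * ((C + 1) * 2) + 1) * ?J \<mu> m x"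
    if per: "\<And>x \<tau>. norm (trig \<mu> m x (\<tau> + 2 * pi)) = norm (trig \<mu> m (x :: nat \<Rightarrow> 'a) \<tau>)" for \<mu> m and x :: "nat \<Rightarrow> 'a"
  proof -
    have "\<exists>z. (\<forall>n. z n \<in> Domain A) \<and> z \<longlonglongrightarrow> x k" for k
      using dense closure_sequential[of "x k" "Domain A"] by auto
    then obtain z where z: "\<And>k n. z k n \<in> Domain A" "\<And>k. z k \<longlonglongrightarrow> x k" by metis
    let ?z = "\<lambda>n k. z k n"
    have zt: "(\<lambda>n. ?z n k) \<longlonglongrightarrow> x k" for k by (rule z(2))
    let ?e = "\<lambda>n. (\<Sum>k\<le>m. norm (?z n k - x k))"
    let ?c = "\<lambda>n. (C + 1) * (2 * ?J \<mu> m x + 2 * (?e n)\<^sup>2 * (2 * pi))"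
    have "?J \<mu> m (?T \<mu> x) \<le> 2 * ((C + 1) * (2 * ?J \<mu> m x + 2 * (\<Sum>k\<le>m. 0)\<^sup>2 * (2 * pi)))"
    proof (rule trig_limit_bound[where p = "\<lambda>n. ?T \<mu> (?z n)" and c = ?c])
      show "(\<lambda>n. ?T \<mu> (?z n) k) \<longlonglongrightarrow> ?T \<mu> x k" for k
        by (rule bounded_linear.tendsto[OF bounded_linear_yosida zt]) simp
      have "?J \<mu> m (?T \<mu> (?z n)) \<le> ?c n" for n
        by (rule order_trans[OF dom[OF z(1) per] mult_left_mono[OF trig_square_perturb]]) (use C0 in simp)
      then show "\<forall>\<^sub>F n in sequentially. ?J \<mu> m (?T \<mu> (?z n)) \<le> ?c n" by simp
      show "?c \<longlonglongrightarrow> (C + 1) * (2 * ?J \<mu> m x + 2 * (\<Sum>k\<le>m. 0)\<^sup>2 * (2 * pi))"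
        by (intro tendsto_add tendsto_mult tendsto_power tendsto_const tendsto_sum tendsto_norm_zero)
          (use zt in \<open>auto simp: LIM_zero\<close>)
    qed
    then show ?thesis using J0[of \<mu> m x] by (simp add: distrib_right)
  qed
  have "2 * ((C + 1) * 2) + 1 > 0" using C0 by simp
  then show ?thesis by (rule that) (rule key)
qed

end

section \<open>T-sectoriality\<close>

lemma resolves_iff:
  assumes "k \<ge> 0"
  shows "resolves A z k \<longleftrightarrow> bounded_operator ((op_shift A z)\<inverse>) \<and> op_norm ((op_shift A z)\<inverse>) \<le> k"
proof
  assume "resolves A z k"
  then show "bounded_operator ((op_shift A z)\<inverse>) \<and> op_norm ((op_shift A z)\<inverse>) \<le> k"
    unfolding resolves_def op_norm_def Res_def using assms by (auto intro: onorm_bound)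
next
  assume "bounded_operator ((op_shift A z)\<inverse>) \<and> op_norm ((op_shift A z)\<inverse>) \<le> k"
  then show "resolves A z k"
    unfolding resolves_def Res_def using bounded_operatorD(4)
    by (blast intro: order_trans[OF _ mult_right_mono[OF _ norm_ge_zero]])
qed

lemma bounded_operator_compose_minus: "bounded_operator {(v, w). (- v, w) \<in> T} \<longleftrightarrow> bounded_operator T"
proof -
  have *: "bounded_operator {(v, w). (- v, w) \<in> T}" if "bounded_operator T" for T :: "'a operator"
  proof -
    have "bounded_linear (\<lambda>v. op_app T (- v))"
      using bounded_linear_compose[OF bounded_operatorD(1)[OF that] bounded_linear_minus[OF bounded_linear_ident]] .
    moreover have "op_app T (- (c *\<^sub>C x)) = c *\<^sub>C op_app T (- x)" for c x
      by (simp add: bounded_operatorD(2)[OF that, symmetric] scaleC.minus_right)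
    moreover have "{(v, w). (- v, w) \<in> T} = {(x, op_app T (- x)) |x. True}"
      by (auto simp: bounded_operatorD(3)[OF that])
    ultimately show ?thesis unfolding bounded_operator_def by blast
  qed
  from *[of "{(v, w). (- v, w) \<in> T}"] *[of T] show ?thesis by auto
qed

text \<open>The operator - A - z is the negative of A + z, so the two inverses differ by the sign of
  the argument.\<close>

lemma resolvent_set_minus_iff: "z \<in> resolvent_set (op_scale (- 1) A) \<longleftrightarrow> bounded_operator ((op_shift A z)\<inverse>)"
proof -
  have "(v, w) \<in> (op_shift (op_scale (- 1) A) (- z))\<inverse> \<longleftrightarrow> (- v, w) \<in> (op_shift A z)\<inverse>" for v w
    unfolding op_shift_converse_iff
    by (simp add: op_scale_iff scaleC.minus_left scaleC.minus_right scaleC.add_right scaleC.diff_right algebra_simps)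
  then have "(op_shift (op_scale (- 1) A) (- z))\<inverse> = {(v, w). (- v, w) \<in> (op_shift A z)\<inverse>}" by auto
  then show ?thesis
    unfolding resolvent_set_def by (simp only: mem_Collect_eq bounded_operator_compose_minus)
qed

lemma sectorial_class_const_iff:
  assumes "K \<ge> 0"
  shows "A \<in> sectorial_class_const K \<theta> \<longleftrightarrow> linear_operator A \<and> closed A \<and> closure (Domain A) = UNIV \<and>
    (\<forall>z\<in>sector \<theta>. resolves A z (K / (1 + cmod z)))"
proof -
  have "resolves A z (K / (1 + cmod z)) \<longleftrightarrow> z \<in> resolvent_set (op_scale (- 1) A) \<and> (1 + cmod z) * op_norm ((op_shift A z)\<inverse>) \<le> K" for z
  proof -
    have "1 + cmod z > 0" by (simp add: add_pos_nonneg)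
    then show ?thesis using assms
      by (simp add: resolves_iff resolvent_set_minus_iff pos_le_divide_eq mult.commute)
  qed
  then show ?thesis unfolding sectorial_class_const_def by (auto simp: subset_iff)
qed

lemma sector_of_real: "\<theta> \<ge> 0 \<Longrightarrow> r \<ge> 0 \<Longrightarrow> of_real r \<in> sector \<theta>"
  by (auto simp: sector_def Arg_of_real)

text \<open>Only the positive half-line is retained from the given sector; wider sectors are
  regained from the imaginary powers.\<close>

lemma strip_of_sectorial:
  assumes "sectorial A"
  obtains K where "strip A K 0"
proof -
  obtain \<theta> K where \<theta>: "\<theta> \<ge> 0" and K: "K \<ge> 1" and A: "A \<in> sectorial_class_const K \<theta>"
    using assms by (auto simp: sectorial_def sectorial_class_def)
  then have lin: "linear_operator A" and res: "\<And>z. z \<in> sector \<theta> \<Longrightarrow> resolves A z (K / (1 + cmod z))"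
    by (auto simp: sectorial_class_const_iff)
  have "strip A K 0"
  proof
    show "resolves A 0 K" using res[of 0] by (simp add: sector_def)
    show "resolves A (exp \<zeta>) (K / (1 + exp (Re \<zeta>)))" if "\<bar>Im \<zeta>\<bar> \<le> 0" for \<zeta>
      unfolding exp_real_nonneg[OF that] using res[OF sector_of_real[OF \<theta>, of "exp (Re \<zeta>)"]] by simp
  qed (use lin K in auto)
  then show ?thesis by (rule that)
qed

lemma (in strip) mellin_0:
  assumes xy: "(x, y) \<in> A"
  shows "mellin A 0 y = x"
proof -
  have "integral UNIV (\<lambda>u. cis (0 * u) *\<^sub>C rho A (of_real u) y) = x - 0"
  proof (rule exp_decay_integral_FTC[OF mellin_decay])
    show "((\<lambda>u. yosida A (of_real u) x) has_vector_derivative cis (0 * u) *\<^sub>C rho A (of_real u) y) (at u)" for u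
      using yosida_real_deriv[OF xy] by simp
  qed (rule yosida_at_bot yosida_at_top[OF xy])+
  then show ?thesis by (simp add: mellin_def)
qed

text \<open>The substitution u = ln l in the integral of \<open>imag_power\<close>.\<close>

lemma (in strip) imag_power_integral:
  "integral {0<..} (\<lambda>l::real. (of_real l powr (\<i> * t)) *\<^sub>C (op_app ((op_shift A (of_real l))\<inverse>) ^^ 2) y) = mellin A t y"
proof -
  have "((\<lambda>l. (1 / l) *\<^sub>R (cis (t * ln l) *\<^sub>C rho A (of_real (ln l)) y)) has_integral mellin A t y) {0<..}"
    unfolding mellin_def by (rule exp_decay_has_integral_ln[OF mellin_decay])
  moreover have "(1 / l) *\<^sub>R (cis (t * ln l) *\<^sub>C rho A (of_real (ln l)) y)
     = (of_real l powr (\<i> * t)) *\<^sub>C (op_app ((op_shift A (of_real l))\<inverse>) ^^ 2) y" if "l \<in> {0<..}" for l :: real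
  proof -
    have l: "l > 0" using that by simp
    have "complex_of_real l powr (\<i> * t) = cis (t * ln l)"
      using l by (simp add: powr_def Ln_of_real cis_conv_exp mult_ac)
    moreover have "exp (complex_of_real (ln l)) = of_real l" using l by (simp add: exp_of_real)
    ultimately show ?thesis
      using l by (simp add: rho_def Res_def[symmetric] numeral_2_eq_2 scaleR_scaleC scaleC_scaleC)
  qed
  ultimately have "((\<lambda>l::real. (of_real l powr (\<i> * t)) *\<^sub>C (op_app ((op_shift A (of_real l))\<inverse>) ^^ 2) y) has_integral mellin A t y) {0<..}"
    by (rule has_integral_eq[rotated])
  then show ?thesis by (rule integral_unique)
qed

lemma bip_of_imaginary_powers:
  fixes A :: "'a::complex_banach operator"
  assumes A: "sectorial A" and P: "bounded_imaginary_powers_angle A \<phi>" and \<phi>: "\<phi> < pi"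
  obtains K M where "bip A K (\<lambda>t. op_app (imag_power A t)) M \<phi>"
proof -
  obtain K where "strip A K 0" using strip_of_sectorial[OF A] .
  then interpret strip A K 0 .
  obtain M where M: "M \<ge> 1" "\<phi> \<ge> 0" "\<And>t. bounded_operator (imag_power A t)" "\<And>t. op_norm (imag_power A t) \<le> M * exp (\<phi> * \<bar>t\<bar>)"
    using P unfolding bounded_imaginary_powers_angle_def by blast
  have U0: "op_app (imag_power A 0) x = x" for x
    by (simp add: imag_power_def op_app_def)
  have "bip A K (\<lambda>t. op_app (imag_power A t)) M \<phi>"
  proof (intro bip.intro bip_axioms.intro strip_axioms)
    show "closure (Domain A) = UNIV"
      using A by (auto simp: sectorial_def sectorial_class_def sectorial_class_const_def)
    show "bounded_linear (op_app (imag_power A t))" for t using M(3) by (rule bounded_operatorD)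
    show "op_app (imag_power A t) (c *\<^sub>C x) = c *\<^sub>C op_app (imag_power A t) x" for t c x
      using M(3) by (rule bounded_operatorD)
    show "norm (op_app (imag_power A t) x) \<le> M * exp (\<phi> * \<bar>t\<bar>) * norm x" for t x
      by (rule order_trans[OF bounded_operatorD(4)[OF M(3)] mult_right_mono[OF M(4) norm_ge_zero]])
    show "mellin A t y = mellin_id t *\<^sub>C op_app (imag_power A t) x" if xy: "(x, y) \<in> A" for t x y
    proof (cases "t = 0")
      case True
      then show ?thesis by (simp add: mellin_0[OF xy] mellin_id_0 U0)
    next
      case False
      have app: "op_app A x = y"
        unfolding op_app_def using lin xy
        by (intro the_equality) (auto simp: linear_operator_def single_valued_def)
      let ?c = "(sin (\<i> * pi * t) / (\<i> * pi * t))"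
      \<comment> \<open>A point of the original graph lies in its closure, and the closure is the
        graph of a bounded operator, so it determines the value at x.\<close>
      have "(x, ?c *\<^sub>C mellin A t y) \<in> imag_power A t"
      proof -
        have "(x, ?c *\<^sub>C mellin A t (op_app A x)) \<in> {(x, ?c *\<^sub>C
             integral {0<..} (\<lambda>l::real. (of_real l powr (\<i> * t)) *\<^sub>C
               (op_app ((op_shift A (of_real l))\<inverse>) ^^ 2) (op_app A x))) |x. x \<in> Domain A}"
          unfolding imag_power_integral using xy by blast
        from subsetD[OF closure_subset this] show ?thesis
          unfolding app imag_power_def if_not_P[OF False] .
      qed
      then have "op_app (imag_power A t) x = ?c *\<^sub>C mellin A t y"
        using bounded_operatorD(3)[OF M(3)] by simp
      moreover have "mellin_id t * ?c = 1"
      proof -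
        have "mellin_id t \<noteq> 0" using mellin_id_sinh(2)[OF False] False by simp
        then have "sin (\<i> * pi * t) \<noteq> 0" unfolding mellin_id_sinh(1)[OF False] by auto
        then show ?thesis unfolding mellin_id_sinh(1)[OF False] using False by simp
      qed
      ultimately show ?thesis by (simp add: scaleC_scaleC)
    qed
  qed (use M \<phi> U0 in auto)
  then show ?thesis by (rule that)
qed

text \<open>Rotating A by - Arg z moves z to the positive half-line, where
  \<open>sector_extension\<close> gives bounds that are uniform in the angle.\<close>

lemma (in bip) sectorial_class_extension:
  assumes cl: "closed A" and \<theta>: "0 \<le> \<theta>" "\<theta> < pi - \<phi>"
  shows "A \<in> sectorial_class \<theta>"
proof -
  obtain L where L: "L \<ge> 1" "\<And>\<psi>. \<bar>\<psi>\<bar> \<le> \<theta> \<Longrightarrow> strip (op_scale (cis \<psi>) A) L 0"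
    using sector_extension[OF \<theta>] by metis
  have "resolves A z (max K L / (1 + cmod z))" if z: "z \<in> sector \<theta>" for z
  proof (cases "z = 0")
    case True
    show ?thesis unfolding True by (rule resolves_mono[OF res0]) simp
  next
    case False
    define \<psi> where "\<psi> = - Arg z"
    have \<psi>: "\<bar>\<psi>\<bar> \<le> \<theta>" using z False by (auto simp: sector_def \<psi>_def)
    interpret B: strip "op_scale (cis \<psi>) A" L 0 by (rule L(2)[OF \<psi>])
    let ?r = "cmod z"
    have r: "exp (complex_of_real (ln ?r)) = of_real ?r" "exp (ln ?r) = ?r" using False by (simp_all add: exp_of_real)
    have "resolves (op_scale (cis \<psi>) A) (of_real ?r) (L / (1 + ?r))"
      using B.res[of "of_real (ln ?r)"] r by simp
    moreover have "z / cis (- \<psi>) = of_real ?r"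
      using rcis_cmod_Arg[of z] by (simp add: \<psi>_def rcis_def cis_neq_zero divide_eq_eq)
    ultimately have "resolves (op_scale (cis (- \<psi>)) (op_scale (cis \<psi>) A)) z (max K L / (1 + ?r))"
      by (intro op_scale_resolves(1)[OF B.lin, of _ _ "L / (1 + ?r)"]) (auto simp: divide_right_mono add_nonneg_nonneg)
    then show ?thesis by (simp add: op_scale_op_scale cis_mult op_scale_1)
  qed
  then have "A \<in> sectorial_class_const (max K L) \<theta>"
    using K cl lin dense by (simp add: sectorial_class_const_iff)
  then show ?thesis unfolding sectorial_class_def using K by (intro UN_I[of "max K L"]) auto
qed

lemma Lp_norm_continuous:
  fixes f :: "real \<Rightarrow> 'b::real_normed_vector"
  assumes f: "continuous_on UNIV f"
  shows "Lp_norm (lebesgue_on {0<..<b}) 2 f = sqrt (integral {0..b} (\<lambda>t. (norm (f t))\<^sup>2))"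
proof -
  let ?g = "\<lambda>t. (norm (f t))\<^sup>2"
  have c: "continuous_on {0..b} ?g" by (intro continuous_intros continuous_on_subset[OF f]) simp
  have "integrable (lebesgue_on {0<..<b}) ?g"
    by (intro absolutely_integrable_imp_integrable set_integrable_subset[OF absolutely_integrable_continuous_real[OF c]]) auto
  from lebesgue_integral_eq_integral[OF this]
  have "(\<integral>t. ?g t \<partial>lebesgue_on {0<..<b}) = integral {0..b} ?g"
    by (simp add: integral_open_interval_real)
  moreover have "norm (f t) powr 2 = ?g t" for t by simp
  moreover have "integral {0..b} ?g \<ge> 0" by (intro integral_nonneg integrable_continuous_real c) simp
  ultimately show ?thesis unfolding Lp_norm_def by (simp add: powr_half_sqrt)
qed

text \<open>This covers \<psi> = 0; a nonzero \<psi> leads to the same inequality for the rotated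
  operator, which is again an instance of the locale.\<close>

lemma (in bip) T_sectorial_bound:
  assumes "UMD TYPE('a)"
  shows "\<exists>C>0. \<forall>(n::nat). \<forall>r\<in>{exp (- 1)..1}. \<forall>x :: nat \<Rightarrow> 'a.
           \<exists>a :: nat \<Rightarrow> real \<Rightarrow> complex.
             (\<forall>k\<le>n. a k \<in> borel_measurable (lebesgue_on {0<..<2 * pi}) \<and>
                    (AE t in lebesgue_on {0<..<2 * pi}. cmod (a k t) \<le> 1)) \<and>
             Lp_norm (lebesgue_on {0<..<2 * pi}) 2
               (\<lambda>t. \<Sum>k\<le>n. exp (\<i> * of_nat k * of_real t) *\<^sub>C
                  op_app ((op_shift (op_scale (of_real r * exp (- of_nat k)) A) 1)\<inverse>) (x k))
             \<le> C * Lp_norm (lebesgue_on {0<..<2 * pi}) 2 (\<lambda>t. \<Sum>k\<le>n. a k t *\<^sub>C x k)"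
proof -
  obtain C where C0: "C > 0" and C: "\<And>\<mu> m x. 
     (\<And>x \<tau>. norm (trig \<mu> m x (\<tau> + 2 * pi)) = norm (trig \<mu> m (x :: nat \<Rightarrow> 'a) \<tau>)) \<Longrightarrow>
     integral {0..2 * pi} (\<lambda>\<tau>. (norm (trig \<mu> m (\<lambda>k. yosida A (of_real (\<mu> k)) (x k)) \<tau>))\<^sup>2)
       \<le> C * integral {0..2 * pi} (\<lambda>\<tau>. (norm (trig \<mu> m x \<tau>))\<^sup>2)"
    using yosida_trig_bound[OF assms] by blast
  define F :: "nat \<Rightarrow> (nat \<Rightarrow> 'a) \<Rightarrow> real \<Rightarrow> 'a"
    where "F n x t = (\<Sum>k\<le>n. exp (\<i> * of_nat k * of_real t) *\<^sub>C x k)" for n x t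
  have Fc: "continuous_on UNIV (F n x)" for n x
    unfolding F_def by (intro continuous_intros)
  have main: "Lp_norm (lebesgue_on {0<..<2 * pi}) 2 (F n (\<lambda>k. op_app ((op_shift (op_scale (of_real r * exp (- of_nat k)) A) 1)\<inverse>) (x k)))
    \<le> sqrt C * Lp_norm (lebesgue_on {0<..<2 * pi}) 2 (F n x)" if r: "r \<in> {exp (- 1)..1}" for n r x
  proof -
    have r0: "r > 0" using r by (auto intro: less_le_trans[OF exp_gt_zero])
    \<comment> \<open>Chosen so that exp (\<mu> k) = exp k / r is the reciprocal of the coefficient
      r exp (- k) of A.\<close>
    define \<mu> where "\<mu> k = real k - ln r" for k
    have T: "op_app ((op_shift (op_scale (of_real r * exp (- of_nat k)) A) 1)\<inverse>) v = yosida A (of_real (\<mu> k)) v" for k v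
    proof -
      let ?c = "complex_of_real r * exp (- of_nat k)"
      have c: "?c \<noteq> 0" using r0 by simp
      have inv: "1 / ?c = exp (of_real (\<mu> k))"
        using r0 by (simp add: \<mu>_def exp_diff exp_minus exp_of_real field_simps flip: exp_of_nat_mult)
      have "Res (op_scale ?c A) 1 = (\<lambda>v. Res A (1 / ?c) ((1 / ?c) *\<^sub>C v))"
        by (rule op_scale_resolves(2)[OF lin c, of _ K, OF _ order_refl]) (unfold inv, rule resK, simp)
      then show ?thesis unfolding Res_def[symmetric] inv yosida_def
        using resolvesD(2)[OF resK[of "of_real (\<mu> k)"]] by simp
    qed
    \<comment> \<open>All frequencies are shifted by the same - ln r, so norms agree with those of
      the polynomial with integer frequencies.\<close>
    have tr: "trig \<mu> n z t = cis (- ln r * t) *\<^sub>C F n z t" for z :: "nat \<Rightarrow> 'a" and t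
      unfolding trig_def F_def
      by (simp add: scaleC.sum_right scaleC_scaleC \<mu>_def cis_conv_exp exp_add[symmetric] algebra_simps)
    have ntr: "norm (trig \<mu> n z t) = norm (F n z t)" for z :: "nat \<Rightarrow> 'a" and t
      unfolding tr by (simp add: norm_scaleC)
    have per: "F n z (t + 2 * pi) = F n z t" for z :: "nat \<Rightarrow> 'a" and t
    proof -
      have "exp (\<i> * of_nat k * of_real (t + 2 * pi)) = exp (\<i> * of_nat k * of_real t)" for k
        using exp_plus_2pin[of "\<i> * of_nat k * of_real t" "int k"] by (simp add: algebra_simps)
      then show ?thesis by (simp add: F_def)
    qed
    have "integral {0..2 * pi} (\<lambda>t. (norm (F n (\<lambda>k. yosida A (of_real (\<mu> k)) (x k)) t))\<^sup>2)
      \<le> C * integral {0..2 * pi} (\<lambda>t. (norm (F n x t))\<^sup>2)"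
      using C[of \<mu> n x] unfolding ntr per by simp
    then show ?thesis unfolding T Lp_norm_continuous[OF Fc] by (simp flip: real_sqrt_mult)
  qed
  show ?thesis
  proof (intro exI[of _ "sqrt C"] conjI allI ballI)
    show "sqrt C > 0" using C0 by simp
    fix n r and x :: "nat \<Rightarrow> 'a" assume r: "r \<in> {exp (- 1::real)..1}"
    have "(\<lambda>t::real. exp (\<i> * of_nat k * of_real t)) \<in> borel_measurable (lebesgue_on {0<..<2 * pi})" for k
      by (intro continuous_imp_measurable_on_sets_lebesgue continuous_intros) auto
    then show "\<exists>a :: nat \<Rightarrow> real \<Rightarrow> complex.
             (\<forall>k\<le>n. a k \<in> borel_measurable (lebesgue_on {0<..<2 * pi}) \<and>
                    (AE t in lebesgue_on {0<..<2 * pi}. cmod (a k t) \<le> 1)) \<and>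
             Lp_norm (lebesgue_on {0<..<2 * pi}) 2
               (\<lambda>t. \<Sum>k\<le>n. exp (\<i> * of_nat k * of_real t) *\<^sub>C
                  op_app ((op_shift (op_scale (of_real r * exp (- of_nat k)) A) 1)\<inverse>) (x k))
             \<le> sqrt C * Lp_norm (lebesgue_on {0<..<2 * pi}) 2 (\<lambda>t. \<Sum>k\<le>n. a k t *\<^sub>C x k)"
      using main[OF r, of n x] unfolding F_def
      by (intro exI[of _ "\<lambda>k t. exp (\<i> * of_nat k * of_real t)"]) simp
  qed
qed

theorem theorem2p8:
  fixes A :: "'a::complex_banach operator" and \<phi> \<theta> :: real
  assumes "UMD TYPE('a)"
    and "sectorial A"
    and "bounded_imaginary_powers_angle A \<phi>"
    and "\<phi> < pi"
    and "\<theta> \<in> {0..<pi - \<phi>}"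
  shows "A \<in> T_sectorial_class \<theta>"
proof -
  obtain K M where "bip A K (\<lambda>t. op_app (imag_power A t)) M \<phi>"
    using bip_of_imaginary_powers[OF assms(2-4)] .
  then interpret bip A K "\<lambda>t. op_app (imag_power A t)" M \<phi> .
  have \<theta>: "0 \<le> \<theta>" "\<theta> < pi - \<phi>" using assms(5) by auto
  have "closed A" using assms(2) by (auto simp: sectorial_def sectorial_class_def sectorial_class_const_def)
  note sect = sectorial_class_extension[OF this \<theta>]
  obtain L where L: "\<And>\<psi>. \<bar>\<psi>\<bar> \<le> \<theta> \<Longrightarrow> strip (op_scale (cis \<psi>) A) L 0"
     "\<And>\<psi> t y. \<bar>\<psi>\<bar> \<le> \<theta> \<Longrightarrow> mellin (op_scale (cis \<psi>) A) t (cis \<psi> *\<^sub>C y) = exp (- t * \<psi>) *\<^sub>R mellin A t y"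
    using sector_extension[OF \<theta>] by metis
  have eq: "op_scale (of_real r * exp (- of_nat k + \<i> * of_real \<psi>)) A = op_scale (of_real r * exp (- of_nat k)) (op_scale (cis \<psi>) A)" for r k \<psi>
    by (simp only: op_scale_op_scale exp_add cis_conv_exp mult.assoc)
  have bound: "\<exists>C>0. \<forall>(n::nat). \<forall>r\<in>{exp (- 1)..1}. \<forall>x :: nat \<Rightarrow> 'a.
           \<exists>a :: nat \<Rightarrow> real \<Rightarrow> complex.
             (\<forall>k\<le>n. a k \<in> borel_measurable (lebesgue_on {0<..<2 * pi}) \<and>
                    (AE t in lebesgue_on {0<..<2 * pi}. cmod (a k t) \<le> 1)) \<and>
             Lp_norm (lebesgue_on {0<..<2 * pi}) 2
               (\<lambda>t. \<Sum>k\<le>n. exp (\<i> * of_nat k * of_real t) *\<^sub>C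
                  op_app ((op_shift (op_scale (of_real r * exp (- of_nat k + \<i> * of_real \<psi>)) A) 1)\<inverse>) (x k))
             \<le> C * Lp_norm (lebesgue_on {0<..<2 * pi}) 2 (\<lambda>t. \<Sum>k\<le>n. a k t *\<^sub>C x k)"
    if "\<psi> \<in> {- \<theta>..\<theta>}" for \<psi>
  proof -
    from that have \<psi>: "\<bar>\<psi>\<bar> \<le> \<theta>" by auto
    \<comment> \<open>From |\<psi>| \<le> \<theta> < \<pi> - \<phi> the power angle \<phi> +
      |\<psi>| of the rotated operator is still below \<pi>.\<close>
    interpret B: bip "op_scale (cis \<psi>) A" L "\<lambda>t x. exp (- t * \<psi>) *\<^sub>R op_app (imag_power A t) x" M "\<phi> + \<bar>\<psi>\<bar>"
      using \<psi> \<theta> by (intro bip_rotate L) auto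
    show ?thesis unfolding eq by (rule B.T_sectorial_bound[OF assms(1)])
  qed
  show ?thesis
    unfolding T_sectorial_class_def using sect bound by (intro CollectI conjI exI[of _ "2::real"]) auto
qed

end
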